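(* Let $A$ be a regular weak multiplier bialgebra over a field $k$ with right full comultiplication, with base algebra $R$, let $\varepsilon_R:R\to k$ be the counit of $R$ and $F\in\mathbb M(A\otimes A)$ the canonical multiplier. Then the assignments $$\Psi\mapsto \varepsilon_R\Psi \qquad\text{and}\qquad \psi\mapsto \big[a\mapsto (\psi\otimes R)((a\otimes 1)F)\big]$$ establish (as mutually inverse maps) a vector space isomorphism between the space of homomorphisms of right $A$-comodules $\Psi$ from the comodule $(A,T_1,T_3)$ to the comodule $(R,\lambda_R,\varrho_R)$ on the one hand, and the space of right integrals $\psi$ on $A$ on the other hand. Here $\lambda_R(r\otimes a)=E(1\otimes ra)$ and $\varrho_R(r\otimes a)=(1\otimes ar)E$.
   Context: Conventions. All vector spaces are over a field $k$; $\otimes$ is $\otimes_k$; the identity map of a space $V$ is also denoted by $V$; composition is juxtaposition; $\mathsf{Lin}(V,W)$ is the space of linear maps; $\mathsf{tw}$ is the flip; $\langle\ldots\rangle$ denotes linear span. For a linear map $f:V\otimes W\to V'\otimes W'$ put $f^{21}=\mathsf{tw} f\mathsf{tw}$ and $f^{13}=(V'\otimes\mathsf{tw})(f\otimes Z)(V\otimes\mathsf{tw}):V\otimes Z\otimes W\to V'\otimes Z\otimes W'$ for any space $Z$. An associative, possibly non-unital algebra $A$ with multiplication $\mu$ is idempotent if $\mu:A\otimes A\to A$ is surjective, and non-degenerate if each of ($ab=0\ \forall b\in A$) and ($ba=0\ \forall b\in A$) implies $a=0$. For such $A$, $\mathbb M(A)$ is the multiplier algebra of pairs $(\lambda,\varrho)$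 of linear maps $A\to A$ with $a\lambda(b)=\varrho(a)b$; it is unital and contains $A$ as a two-sided ideal via $(\lambda,\varrho)a=\lambda(a)$, $a(\lambda,\varrho)=\varrho(a)$. A regular weak multiplier bialgebra is an idempotent non-degenerate $k$-algebra $A$ with linear maps $E_1,E_2,T_1,T_2,T_3,T_4:A\otimes A\to A\otimes A$ and $\epsilon:A\to k$ such that for all $a,b,c,d\in A$: (i) $(a\otimes b)E_1(c\otimes d)=E_2(a\otimes b)(c\otimes d)$; (ii) $E_1^2=E_1$; (iii) $(T_2\otimes A)(A\otimes T_1)=(A\otimes T_1)(T_2\otimes A)$; (iv) $(\epsilon\otimes A)T_1=\mu=(A\otimes\epsilon)T_2$; (v) $(\mu\otimes A)T_1^{13}(A\otimes T_1)=T_1(\mu\otimes A)$; (vi) $\langle T_1(a\otimes c)(b\otimes 1)\mid a,b,c\in A\rangle=\langle E_1(b\otimes c)\mid b,c\in A\rangle$ and $\langle(1\otimes c)T_2(b\otimes a)\mid a,b,c\in A\rangle=\langle E_2(b\otimes c)\mid b,c\in A\rangle$; (vii) $(E_1\otimes A)(A\otimes T_1)=(A\otimes T_1)(E_1\otimes A)$ and $(E_2\otimes A)(A\otimes T_2)=(A\otimes T_2)E_2^{13}$; (viii) $(\epsilon\otimes A)((1\otimes a)E_1(b\otimes c))=(\epsilon\otimes A)(T_1(a\otimes c)(b\otimes1))$ and $(\epsilon\otimes A)(E_2(a\otimes b)(1\otimes c))=(\epsilon\otimes A)((1\otimes b)T_2(a\otimes c))$; (ix) $(1\otimes a)T_1(c\otimes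 b)=T_3(c\otimes a)(1\otimes b)$ and $T_2(a\otimes c)(b\otimes1)=(a\otimes1)T_4(b\otimes c)$. Then $E=(E_1,E_2)\in\mathbb M(A\otimes A)$ is idempotent and there is a multiplicative comultiplication $\Delta:A\to\mathbb M(A\otimes A)$ with $T_1(c\otimes b)=\Delta(c)(1\otimes b)$, $T_2(a\otimes c)=(a\otimes1)\Delta(c)$, $T_3(c\otimes b)=(1\otimes b)\Delta(c)$, $T_4(a\otimes c)=\Delta(c)(a\otimes1)$. The maps $\overline\sqcap^R,\sqcap^R:A\to\mathbb M(A)$ are given by $\overline\sqcap^R(a)b=(A\otimes\epsilon)E_1(b\otimes a)$, $b\overline\sqcap^R(a)=(A\otimes\epsilon)T_1(b\otimes a)$, $\sqcap^R(a)b=(A\otimes\epsilon)T_3(b\otimes a)$, $b\sqcap^R(a)=(A\otimes\epsilon)E_2(b\otimes a)$. The comultiplication is right full if $A=\langle(A\otimes\omega)T_1(a\otimes b)\mid a,b\in A,\ \omega\in\mathsf{Lin}(A,k)\rangle$. In that case the ranges of $\sqcap^R$ and $\overline\sqcap^R$ coincide; this common range $R\subseteq\mathbb M(A)$ is a (non-unital) subalgebra with local units, called the base algebra. There is a multiplier $F$ on $A\otimes A$ with $F(a\otimes bc)=((\overline\sqcap^R\otimes A)\mathsf{tw}T_4(c\otimes b))(a\otimes1)$ and $(ab\otimes c)F=(1\otimes c)((A\otimes\sqcap^R)T_2(a\otimes b))$; thus $(a\otimes 1)F\in A\otimes R$ for $a\in A$. $R$ is a coalgebra with comultiplication $\delta(\sqcap^R(a))=(\sqcap^R(a)\otimes1)F$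 and counit $\varepsilon_R(\sqcap^R(a))=\epsilon(a)$. The elements $E(1\otimes a)$ and $(1\otimes a)E$ lie in $R\otimes A$. A right $A$-comodule is a vector space $V$ with linear maps $\lambda,\varrho:V\otimes A\to V\otimes A$ such that $(1\otimes a)\lambda(v\otimes b)=\varrho(v\otimes a)(1\otimes b)$, $(\lambda\otimes A)\lambda^{13}(V\otimes E_1)=(\lambda\otimes A)\lambda^{13}$ and $(\lambda\otimes A)\lambda^{13}(V\otimes T_1)=(V\otimes T_1)(\lambda\otimes A)$. A homomorphism $f:V\to V'$ of comodules is a linear map with $\lambda'(f\otimes A)=(f\otimes A)\lambda$ (equivalently $\varrho'(f\otimes A)=(f\otimes A)\varrho$). Both $(A,T_1,T_3)$ and $(R,\lambda_R,\varrho_R)$ are right $A$-comodules. For $\psi\in\mathsf{Lin}(A,k)$ and $a\in A$, let $a\leftharpoonup\psi\in\mathbb M(A)$ be given by $(a\leftharpoonup\psi)b=(\psi\otimes A)T_1(a\otimes b)$, $b(a\leftharpoonup\psi)=(\psi\otimes A)T_3(a\otimes b)$. A right integral on $A$ is a $\psi\in\mathsf{Lin}(A,k)$ with $a\leftharpoonup\psi\in\sqcap^R(A)$ for all $a\in A$. *)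

theory Defs
  imports Complex_Main "HOL-Library.Function_Algebras" "HOL-Library.Product_Plus"
begin

section \<open>Vector spaces and linear maps\<close>

text \<open>
  A vector space is a subspace of an ambient type that carries a vector space structure.
  A linear map defined on \<open>V\<close> is represented by a total function vanishing outside the carrier
  of \<open>V\<close>, so that equality of linear maps is equality of functions.
\<close>

record ('k, 'v) vspace =
  vcar :: "'v set"
  vscale :: "'k \<Rightarrow> 'v \<Rightarrow> 'v"

definition is_vspace :: "('k::field, 'v::ab_group_add) vspace \<Rightarrow> bool" where
  "is_vspace V \<longleftrightarrow> vector_space (vscale V) \<and> module.subspace (vscale V) (vcar V)"

definition ground :: "('k::field, 'k) vspace" where
  "ground = \<lparr>vcar = UNIV, vscale = (*)\<rparr>"

definition linear_on ::
  "('k::field, 'v::ab_group_add) vspace \<Rightarrow> ('k, 'w::ab_group_add) vspace \<Rightarrow> ('v \<Rightarrow> 'w) \<Rightarrow> bool" where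
  "linear_on V W f \<longleftrightarrow>
     (\<forall>x\<in>vcar V. f x \<in> vcar W) \<and>
     (\<forall>x\<in>vcar V. \<forall>y\<in>vcar V. f (x + y) = f x + f y) \<and>
     (\<forall>c. \<forall>x\<in>vcar V. f (vscale V c x) = vscale W c (f x))"

definition Lin ::
  "('k::field, 'v::ab_group_add) vspace \<Rightarrow> ('k, 'w::ab_group_add) vspace \<Rightarrow> ('v \<Rightarrow> 'w) set" where
  "Lin V W = {f. linear_on V W f \<and> (\<forall>x. x \<notin> vcar V \<longrightarrow> f x = 0)}"

definition idm :: "('k, 'v::zero) vspace \<Rightarrow> 'v \<Rightarrow> 'v" where
  "idm V v = (if v \<in> vcar V then v else 0)"

definition bilinear_on ::
  "('k::field, 'v::ab_group_add) vspace \<Rightarrow> ('k, 'w::ab_group_add) vspace \<Rightarrow>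
   ('k, 'u::ab_group_add) vspace \<Rightarrow> ('v \<Rightarrow> 'w \<Rightarrow> 'u) \<Rightarrow> bool" where
  "bilinear_on V W U b \<longleftrightarrow>
     (\<forall>w\<in>vcar W. linear_on V U (\<lambda>v. b v w)) \<and> (\<forall>v\<in>vcar V. linear_on W U (b v))"


section \<open>Tensor products\<close>

text \<open>
  The library has no tensor product of vector spaces. Over a field, \<open>V \<otimes> W\<close> embeds in the dual of
  the space of bilinear forms on \<open>V \<times> W\<close>, the tensor \<open>v \<otimes> w\<close> being evaluation at \<open>(v, w)\<close>; we take
  the span of these evaluations as the tensor product. The universal property is proved as
  \<open>tensor_universal\<close> below, and all maps between tensor products are defined through it.
\<close>

type_synonym ('k, 'v, 'w) tensor = "('v \<Rightarrow> 'w \<Rightarrow> 'k) \<Rightarrow> 'k"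

definition tens ::
  "('k::field, 'v::ab_group_add) vspace \<Rightarrow> ('k, 'w::ab_group_add) vspace \<Rightarrow>
   'v \<Rightarrow> 'w \<Rightarrow> ('k, 'v, 'w) tensor" where
  "tens V W v w = (\<lambda>b. if bilinear_on V W ground b then b v w else 0)"

definition tscale :: "'k::field \<Rightarrow> ('k, 'v, 'w) tensor \<Rightarrow> ('k, 'v, 'w) tensor" where
  "tscale c t = (\<lambda>b. c * t b)"

abbreviation tspan :: "('k::field, 'v, 'w) tensor set \<Rightarrow> ('k, 'v, 'w) tensor set" where
  "tspan \<equiv> module.span tscale"

definition tensor_space ::
  "('k::field, 'v::ab_group_add) vspace \<Rightarrow> ('k, 'w::ab_group_add) vspace \<Rightarrow>
   ('k, ('k, 'v, 'w) tensor) vspace" (infixl "\<Otimes>" 70) where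
  "V \<Otimes> W = \<lparr>vcar = tspan {tens V W v w | v w. v \<in> vcar V \<and> w \<in> vcar W}, vscale = tscale\<rparr>"

text \<open>\<open>tlift V W U b\<close> is the linear map \<open>V \<otimes> W \<rightarrow> U\<close> corresponding to the bilinear map \<open>b\<close>.\<close>

definition tlift ::
  "('k::field, 'v::ab_group_add) vspace \<Rightarrow> ('k, 'w::ab_group_add) vspace \<Rightarrow>
   ('k, 'u::ab_group_add) vspace \<Rightarrow> ('v \<Rightarrow> 'w \<Rightarrow> 'u) \<Rightarrow> ('k, 'v, 'w) tensor \<Rightarrow> 'u" where
  "tlift V W U b = (THE f. f \<in> Lin (V \<Otimes> W) U \<and>
     (\<forall>v\<in>vcar V. \<forall>w\<in>vcar W. f (tens V W v w) = b v w))"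

lemma vector_space_tscale: "vector_space (tscale :: 'k::field \<Rightarrow> ('k, 'v, 'w) tensor \<Rightarrow> _)"
  by unfold_locales (auto simp: tscale_def fun_eq_iff algebra_simps)

lemma is_vspace_tensor: "is_vspace (V \<Otimes> W)"
proof -
  interpret vector_space "tscale :: 'a \<Rightarrow> ('a, 'b, 'c) tensor \<Rightarrow> _" by (rule vector_space_tscale)
  show ?thesis by (simp add: is_vspace_def tensor_space_def vector_space_axioms)
qed

theorem tensor_universal:
  fixes V :: "('k::field, 'v::ab_group_add) vspace" and W :: "('k, 'w::ab_group_add) vspace"
    and U :: "('k, 'u::ab_group_add) vspace"
  assumes U: "is_vspace U" and b: "bilinear_on V W U b"
  shows "\<exists>!f. f \<in> Lin (V \<Otimes> W) U \<and> (\<forall>v\<in>vcar V. \<forall>w\<in>vcar W. f (tens V W v w) = b v w)"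
proof -
  interpret T: vector_space "tscale :: 'k \<Rightarrow> ('k, 'v, 'w) tensor \<Rightarrow> _" by (rule vector_space_tscale)
  interpret U: vector_space "vscale U" using U by (simp add: is_vspace_def)
  have subU: "U.subspace (vcar U)" using U by (simp add: is_vspace_def)
  define B where "B = U.extend_basis {}"
  have B: "U.independent B" "U.span B = UNIV"
    by (auto simp: B_def U.independent_extend_basis U.independent_empty)
  define R where "R = U.representation B"
  have R_add: "R (x + y) e = R x e + R y e" and R_scale: "R (vscale U c x) e = c * R x e" for x y c e
    using B by (simp_all add: R_def U.representation_add U.representation_scale)
  define be where "be = (\<lambda>e v w. R (b v w) e)"
  have bil: "bilinear_on V W ground (be e)" for e
    using b by (auto simp: bilinear_on_def linear_on_def be_def ground_def R_add R_scale)
  define S where "S = {tens V W v w | v w. v \<in> vcar V \<and> w \<in> vcar W}"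
  have car: "vcar (V \<Otimes> W) = T.span S" and sc: "vscale (V \<Otimes> W) = tscale"
    by (simp_all add: tensor_space_def S_def)
  define supp where "supp = (\<lambda>t :: ('k, 'v, 'w) tensor. {e. t (be e) \<noteq> 0})"
  define g where "g = (\<lambda>t. \<Sum>e\<in>supp t. vscale U (t (be e)) e)"
  have tensv: "tens V W v w (be e) = R (b v w) e" for v w e
    using bil[of e] by (simp add: tens_def be_def)
  have fin0: "finite (supp (tens V W v w))" for v w
    unfolding supp_def tensv R_def by (rule U.finite_representation)
  have g_tens: "g (tens V W v w) = b v w" for v w
    unfolding g_def supp_def tensv R_def
    by (rule U.sum_nonzero_representation_eq) (use B in auto)
  have fin: "finite (supp t)" if "t \<in> T.span S" for t
    using that
  proof (induction rule: T.span_induct_alt)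
    case base show ?case by (simp add: supp_def)
  next
    case (step c x y)
    have "supp (tscale c x + y) \<subseteq> supp x \<union> supp y" by (auto simp: supp_def tscale_def)
    moreover have "finite (supp x)" using step fin0 by (auto simp: S_def)
    ultimately show ?case using step finite_subset by blast
  qed
  have g_sup: "g t = (\<Sum>e\<in>A. vscale U (t (be e)) e)" if "supp t \<subseteq> A" "finite A" for t A
    unfolding g_def by (rule sum.mono_neutral_left) (use that in \<open>auto simp: supp_def\<close>)
  have g_add: "g (x + y) = g x + g y" if "x \<in> T.span S" "y \<in> T.span S" for x y
  proof -
    let ?A = "supp x \<union> supp y"
    have "finite ?A" using fin that by simp
    moreover have "supp (x + y) \<subseteq> ?A" by (auto simp: supp_def)
    ultimately show ?thesis
      by (simp add: g_sup[of _ ?A] sum.distrib U.scale_left_distrib)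
  qed
  have g_scale: "g (tscale c x) = vscale U c (g x)" if "x \<in> T.span S" for c x
  proof -
    have "supp (tscale c x) \<subseteq> supp x" by (auto simp: supp_def tscale_def)
    then show ?thesis using fin[OF that]
      by (simp add: g_sup[of _ "supp x"] U.scale_sum_right tscale_def)
  qed
  have g_U': "t \<in> T.span S \<and> g t \<in> vcar U" if "t \<in> T.span S" for t
    using that
  proof (induction rule: T.span_induct_alt)
    case base
    have "0 \<in> T.span S \<and> g 0 \<in> vcar U"
      using U.subspace_0[OF subU] T.span_zero[of S] by (simp add: g_def supp_def)
    then show ?case .
  next
    case (step c x y)
    then obtain v w where "x = tens V W v w" "v \<in> vcar V" "w \<in> vcar W" by (auto simp: S_def)
    then have "g x \<in> vcar U" using b by (auto simp: g_tens bilinear_on_def linear_on_def)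
    moreover have "y \<in> T.span S" "x \<in> T.span S" using step T.span_base by auto
    ultimately have "tscale c x + y \<in> T.span S \<and> g (tscale c x + y) \<in> vcar U"
      using step subU
      by (simp add: g_add g_scale T.span_scale T.span_add U.subspace_add U.subspace_scale)
    then show ?case .
  qed
  then have g_U: "g t \<in> vcar U" if "t \<in> T.span S" for t
    using that by blast
  define f where "f = (\<lambda>t. if t \<in> T.span S then g t else 0)"
  show ?thesis
  proof (rule ex1I[of _ f])
    have "tens V W v w \<in> T.span S" if "v \<in> vcar V" "w \<in> vcar W" for v w
      using that by (auto intro!: T.span_base simp: S_def)
    then show "f \<in> Lin (V \<Otimes> W) U \<and> (\<forall>v\<in>vcar V. \<forall>w\<in>vcar W. f (tens V W v w) = b v w)"
      by (auto simp: Lin_def linear_on_def car sc f_def g_U g_add g_scale g_tens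
          T.span_add T.span_scale)
    fix h assume h: "h \<in> Lin (V \<Otimes> W) U \<and> (\<forall>v\<in>vcar V. \<forall>w\<in>vcar W. h (tens V W v w) = b v w)"
    have hl: "h (x + y) = h x + h y" "h (tscale c x) = vscale U c (h x)"
      if "x \<in> T.span S" "y \<in> T.span S" for x y c
      using h that by (auto simp: Lin_def linear_on_def car sc)
    have "t \<in> T.span S \<and> h t = g t" if "t \<in> T.span S" for t
      using that
    proof (induction rule: T.span_induct_alt)
      case base
      have "h 0 = 0" using hl(1)[of 0 0] T.span_zero by simp
      then have "0 \<in> T.span S \<and> h 0 = g 0"
        using T.span_zero[of S] by (simp add: g_def supp_def)
      then show ?case .
    next
      case (step c x y)
      then have "h x = g x" using h by (auto simp: S_def g_tens)
      moreover have "y \<in> T.span S" "x \<in> T.span S" using step T.span_base by auto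
      ultimately have "tscale c x + y \<in> T.span S \<and> h (tscale c x + y) = g (tscale c x + y)"
        using step by (simp add: hl g_add g_scale T.span_scale T.span_add)
      then show ?case .
    qed
    then show "h = f" using h by (auto simp: f_def Lin_def car fun_eq_iff)
  qed
qed

corollary
  fixes U :: "('k::field, 'u::ab_group_add) vspace"
  assumes "is_vspace U" "bilinear_on V W U b"
  shows tlift_Lin: "tlift V W U b \<in> Lin (V \<Otimes> W) U"
    and tlift_tens: "v \<in> vcar V \<Longrightarrow> w \<in> vcar W \<Longrightarrow> tlift V W U b (tens V W v w) = b v w"
  using theI'[OF tensor_universal[OF assms]] unfolding tlift_def by auto

text \<open>\<open>f \<otimes> g : V \<otimes> W \<rightarrow> V' \<otimes> W'\<close>\<close>

definition tmap ::
  "('k::field, 'v::ab_group_add) vspace \<Rightarrow> ('k, 'w::ab_group_add) vspace \<Rightarrow>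
   ('k, 'v1::ab_group_add) vspace \<Rightarrow> ('k, 'w1::ab_group_add) vspace \<Rightarrow>
   ('v \<Rightarrow> 'v1) \<Rightarrow> ('w \<Rightarrow> 'w1) \<Rightarrow> ('k, 'v, 'w) tensor \<Rightarrow> ('k, 'v1, 'w1) tensor" where
  "tmap V W V' W' f g = tlift V W (V' \<Otimes> W') (\<lambda>v w. tens V' W' (f v) (g w))"

definition tw ::
  "('k::field, 'v::ab_group_add) vspace \<Rightarrow> ('k, 'w::ab_group_add) vspace \<Rightarrow>
   ('k, 'v, 'w) tensor \<Rightarrow> ('k, 'w, 'v) tensor" where
  "tw V W = tlift V W (W \<Otimes> V) (\<lambda>v w. tens W V w v)"

text \<open>The maps \<open>\<omega> \<otimes> W : V \<otimes> W \<rightarrow> W\<close> and \<open>V \<otimes> \<omega> : V \<otimes> W \<rightarrow> V\<close>, where \<open>k \<otimes> W = W\<close>, \<open>V \<otimes> k = V\<close>.\<close>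

definition slice_left ::
  "('k::field, 'v::ab_group_add) vspace \<Rightarrow> ('k, 'w::ab_group_add) vspace \<Rightarrow>
   ('v \<Rightarrow> 'k) \<Rightarrow> ('k, 'v, 'w) tensor \<Rightarrow> 'w" where
  "slice_left V W \<omega> = tlift V W W (\<lambda>v w. vscale W (\<omega> v) w)"

definition slice_right ::
  "('k::field, 'v::ab_group_add) vspace \<Rightarrow> ('k, 'w::ab_group_add) vspace \<Rightarrow>
   ('w \<Rightarrow> 'k) \<Rightarrow> ('k, 'v, 'w) tensor \<Rightarrow> 'v" where
  "slice_right V W \<omega> = tlift V W V (\<lambda>v w. vscale V (\<omega> w) v)"

text \<open>Triple tensor products are bracketed to the left; the associativity isomorphisms are explicit.\<close>

definition assoc ::
  "('k::field, 'u::ab_group_add) vspace \<Rightarrow> ('k, 'v::ab_group_add) vspace \<Rightarrow>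
   ('k, 'w::ab_group_add) vspace \<Rightarrow>
   ('k, ('k, 'u, 'v) tensor, 'w) tensor \<Rightarrow> ('k, 'u, ('k, 'v, 'w) tensor) tensor" where
  "assoc U V W = tlift (U \<Otimes> V) W (U \<Otimes> (V \<Otimes> W))
     (\<lambda>x w. tlift U V (U \<Otimes> (V \<Otimes> W)) (\<lambda>u v. tens U (V \<Otimes> W) u (tens V W v w)) x)"

definition assoc_inv ::
  "('k::field, 'u::ab_group_add) vspace \<Rightarrow> ('k, 'v::ab_group_add) vspace \<Rightarrow>
   ('k, 'w::ab_group_add) vspace \<Rightarrow>
   ('k, 'u, ('k, 'v, 'w) tensor) tensor \<Rightarrow> ('k, ('k, 'u, 'v) tensor, 'w) tensor" where
  "assoc_inv U V W = tlift U (V \<Otimes> W) (U \<Otimes> V \<Otimes> W)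
     (\<lambda>u y. tlift V W (U \<Otimes> V \<Otimes> W) (\<lambda>v w. tens (U \<Otimes> V) W (tens U V u v) w) y)"

text \<open>
  For endomorphisms \<open>f\<close> of a twofold tensor product: \<open>f \<otimes> W\<close> for \<open>f\<close> on \<open>U \<otimes> V\<close>, \<open>U \<otimes> f\<close> for \<open>f\<close> on
  \<open>V \<otimes> W\<close>, and \<open>f\<^sup>1\<^sup>3\<close> for \<open>f\<close> on \<open>U \<otimes> W\<close>, all acting on \<open>U \<otimes> V \<otimes> W\<close>.
\<close>

definition leg12 where
  "leg12 U V W f = tmap (U \<Otimes> V) W (U \<Otimes> V) W f (idm W)"

definition leg23 where
  "leg23 U V W f = assoc_inv U V W \<circ> tmap U (V \<Otimes> W) U (V \<Otimes> W) (idm U) f \<circ> assoc U V W"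

definition leg13 where
  "leg13 U V W f =
     (assoc_inv U V W \<circ> tmap U (W \<Otimes> V) U (V \<Otimes> W) (idm U) (tw W V) \<circ> assoc U W V) \<circ>
     tmap (U \<Otimes> W) V (U \<Otimes> W) V f (idm V) \<circ>
     (assoc_inv U W V \<circ> tmap U (V \<Otimes> W) U (W \<Otimes> V) (idm U) (tw V W) \<circ> assoc U V W)"


section \<open>Algebras and multipliers\<close>

definition is_algebra ::
  "('k::field, 'v::ab_group_add) vspace \<Rightarrow> ('v \<Rightarrow> 'v \<Rightarrow> 'v) \<Rightarrow> bool" where
  "is_algebra V m \<longleftrightarrow> is_vspace V \<and> bilinear_on V V V m \<and>
     (\<forall>a\<in>vcar V. \<forall>b\<in>vcar V. \<forall>c\<in>vcar V. m (m a b) c = m a (m b c))"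

definition mult_map ::
  "('k::field, 'v::ab_group_add) vspace \<Rightarrow> ('v \<Rightarrow> 'v \<Rightarrow> 'v) \<Rightarrow> ('k, 'v, 'v) tensor \<Rightarrow> 'v" where
  "mult_map V m = tlift V V V m"

definition idempotent_algebra ::
  "('k::field, 'v::ab_group_add) vspace \<Rightarrow> ('v \<Rightarrow> 'v \<Rightarrow> 'v) \<Rightarrow> bool" where
  "idempotent_algebra V m \<longleftrightarrow> mult_map V m ` vcar (V \<Otimes> V) = vcar V"

definition nondegenerate_algebra ::
  "('k::field, 'v::ab_group_add) vspace \<Rightarrow> ('v \<Rightarrow> 'v \<Rightarrow> 'v) \<Rightarrow> bool" where
  "nondegenerate_algebra V m \<longleftrightarrow>
     (\<forall>a\<in>vcar V. (\<forall>b\<in>vcar V. m a b = 0) \<longrightarrow> a = 0) \<and>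
     (\<forall>a\<in>vcar V. (\<forall>b\<in>vcar V. m b a = 0) \<longrightarrow> a = 0)"

text \<open>The multiplication \<open>(a \<otimes> b)(c \<otimes> d) = ac \<otimes> bd\<close> of the tensor square.\<close>

definition tmult ::
  "('k::field, 'v::ab_group_add) vspace \<Rightarrow> ('v \<Rightarrow> 'v \<Rightarrow> 'v) \<Rightarrow>
   ('k, 'v, 'v) tensor \<Rightarrow> ('k, 'v, 'v) tensor \<Rightarrow> ('k, 'v, 'v) tensor" where
  "tmult V m x y = tlift V V (V \<Otimes> V)
     (\<lambda>a b. tlift V V (V \<Otimes> V) (\<lambda>c d. tens V V (m a c) (m b d)) y) x"

text \<open>
  Multipliers are pairs \<open>(\<lambda>, \<rho>)\<close> of left and right actions; thus \<open>fst x b\<close> is \<open>xb\<close> and \<open>snd x b\<close> is \<open>bx\<close>.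
\<close>

type_synonym 'v multiplier = "('v \<Rightarrow> 'v) \<times> ('v \<Rightarrow> 'v)"

definition multiplier_algebra ::
  "('k::field, 'v::ab_group_add) vspace \<Rightarrow> ('v \<Rightarrow> 'v \<Rightarrow> 'v) \<Rightarrow> ('k, 'v multiplier) vspace" where
  "multiplier_algebra V m =
     \<lparr>vcar = {(l, r). l \<in> Lin V V \<and> r \<in> Lin V V \<and>
                (\<forall>a\<in>vcar V. \<forall>b\<in>vcar V. m a (l b) = m (r a) b)},
      vscale = (\<lambda>c x. (\<lambda>b. vscale V c (fst x b), \<lambda>b. vscale V c (snd x b)))\<rparr>"

definition mmult :: "'v multiplier \<Rightarrow> 'v multiplier \<Rightarrow> 'v multiplier" (infixl "\<bullet>" 70) where
  "x \<bullet> y = (fst x \<circ> fst y, snd y \<circ> snd x)"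

definition mone :: "('k, 'v::zero) vspace \<Rightarrow> 'v multiplier" where
  "mone V = (idm V, idm V)"

text \<open>The inclusion of an algebra in its multiplier algebra.\<close>

definition minj ::
  "('k, 'v::zero) vspace \<Rightarrow> ('v \<Rightarrow> 'v \<Rightarrow> 'v) \<Rightarrow> 'v \<Rightarrow> 'v multiplier" where
  "minj V m a = (\<lambda>b. if b \<in> vcar V then m a b else 0, \<lambda>b. if b \<in> vcar V then m b a else 0)"

text \<open>The multiplier \<open>x \<otimes> y\<close> of the tensor square.\<close>

definition mtens ::
  "('k::field, 'v::ab_group_add) vspace \<Rightarrow> 'v multiplier \<Rightarrow> 'v multiplier \<Rightarrow>
   ('k, 'v, 'v) tensor multiplier" where
  "mtens V x y = (tmap V V V V (fst x) (fst y), tmap V V V V (snd x) (snd y))"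


section \<open>Regular weak multiplier bialgebras\<close>

record ('k, 'a) wmb =
  smult :: "'k \<Rightarrow> 'a \<Rightarrow> 'a"
  mult :: "'a \<Rightarrow> 'a \<Rightarrow> 'a"
  E\<^sub>1 :: "('k, 'a, 'a) tensor \<Rightarrow> ('k, 'a, 'a) tensor"
  E\<^sub>2 :: "('k, 'a, 'a) tensor \<Rightarrow> ('k, 'a, 'a) tensor"
  T\<^sub>1 :: "('k, 'a, 'a) tensor \<Rightarrow> ('k, 'a, 'a) tensor"
  T\<^sub>2 :: "('k, 'a, 'a) tensor \<Rightarrow> ('k, 'a, 'a) tensor"
  T\<^sub>3 :: "('k, 'a, 'a) tensor \<Rightarrow> ('k, 'a, 'a) tensor"
  T\<^sub>4 :: "('k, 'a, 'a) tensor \<Rightarrow> ('k, 'a, 'a) tensor"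
  counit :: "'a \<Rightarrow> 'k"

definition spc :: "('k::field, 'a::ab_group_add) wmb \<Rightarrow> ('k, 'a) vspace" where
  "spc H = \<lparr>vcar = UNIV, vscale = smult H\<rparr>"

abbreviation spc2 :: "('k::field, 'a::ab_group_add) wmb \<Rightarrow> ('k, ('k, 'a, 'a) tensor) vspace" where
  "spc2 H \<equiv> spc H \<Otimes> spc H"

abbreviation pure ::
  "('k::field, 'a::ab_group_add) wmb \<Rightarrow> 'a \<Rightarrow> 'a \<Rightarrow> ('k, 'a, 'a) tensor" where
  "pure H \<equiv> tens (spc H) (spc H)"

abbreviation mult2 ::
  "('k::field, 'a::ab_group_add) wmb \<Rightarrow>
   ('k, 'a, 'a) tensor \<Rightarrow> ('k, 'a, 'a) tensor \<Rightarrow> ('k, 'a, 'a) tensor" where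
  "mult2 H \<equiv> tmult (spc H) (mult H)"

text \<open>\<open>M(A)\<close>, \<open>M(A \<otimes> A)\<close> and the inclusions of \<open>A\<close> and \<open>A \<otimes> A\<close>.\<close>

abbreviation MA where "MA H \<equiv> multiplier_algebra (spc H) (mult H)"
abbreviation MAA where "MAA H \<equiv> multiplier_algebra (spc2 H) (mult2 H)"
abbreviation inj1 where "inj1 H \<equiv> minj (spc H) (mult H)"
abbreviation inj2 where "inj2 H \<equiv> minj (spc2 H) (mult2 H)"

text \<open>The multipliers \<open>a \<otimes> 1\<close> and \<open>1 \<otimes> a\<close> of \<open>A \<otimes> A\<close>.\<close>

definition lft where "lft H a = mtens (spc H) (inj1 H a) (mone (spc H))"
definition rgt where "rgt H a = mtens (spc H) (mone (spc H)) (inj1 H a)"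

text \<open>\<open>\<epsilon> \<otimes> A\<close> and \<open>A \<otimes> \<epsilon>\<close>\<close>

abbreviation eps_left where "eps_left H \<equiv> slice_left (spc H) (spc H) (counit H)"
abbreviation eps_right where "eps_right H \<equiv> slice_right (spc H) (spc H) (counit H)"

abbreviation on12 where "on12 H \<equiv> leg12 (spc H) (spc H) (spc H)"
abbreviation on23 where "on23 H \<equiv> leg23 (spc H) (spc H) (spc H)"
abbreviation on13 where "on13 H \<equiv> leg13 (spc H) (spc H) (spc H)"

abbreviation mu where "mu H \<equiv> mult_map (spc H) (mult H)"
abbreviation mu12 where "mu12 H \<equiv> tmap (spc2 H) (spc H) (spc H) (spc H) (mu H) (idm (spc H))"

locale regular_weak_multiplier_bialgebra =
  fixes H :: "('k::field, 'a::ab_group_add) wmb"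
  assumes algebra: "is_algebra (spc H) (mult H)"
    and idempotent: "idempotent_algebra (spc H) (mult H)"
    and nondegenerate: "nondegenerate_algebra (spc H) (mult H)"
    and linear:
      "E\<^sub>1 H \<in> Lin (spc2 H) (spc2 H)" "E\<^sub>2 H \<in> Lin (spc2 H) (spc2 H)"
      "T\<^sub>1 H \<in> Lin (spc2 H) (spc2 H)" "T\<^sub>2 H \<in> Lin (spc2 H) (spc2 H)"
      "T\<^sub>3 H \<in> Lin (spc2 H) (spc2 H)" "T\<^sub>4 H \<in> Lin (spc2 H) (spc2 H)"
      "counit H \<in> Lin (spc H) ground"
    and ax_i: "mult2 H (pure H a b) (E\<^sub>1 H (pure H c d)) = mult2 H (E\<^sub>2 H (pure H a b)) (pure H c d)"
    and ax_ii: "E\<^sub>1 H \<circ> E\<^sub>1 H = E\<^sub>1 H"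
    and ax_iii: "on12 H (T\<^sub>2 H) \<circ> on23 H (T\<^sub>1 H) = on23 H (T\<^sub>1 H) \<circ> on12 H (T\<^sub>2 H)"
    and ax_iv: "eps_left H \<circ> T\<^sub>1 H = mu H" "eps_right H \<circ> T\<^sub>2 H = mu H"
    and ax_v: "mu12 H \<circ> on13 H (T\<^sub>1 H) \<circ> on23 H (T\<^sub>1 H) = T\<^sub>1 H \<circ> mu12 H"
    and ax_vi:
      "tspan {snd (lft H b) (T\<^sub>1 H (pure H a c)) | a b c. True} =
       tspan {E\<^sub>1 H (pure H b c) | b c. True}"
      "tspan {fst (rgt H c) (T\<^sub>2 H (pure H b a)) | a b c. True} =
       tspan {E\<^sub>2 H (pure H b c) | b c. True}"
    and ax_vii:
      "on12 H (E\<^sub>1 H) \<circ> on23 H (T\<^sub>1 H) = on23 H (T\<^sub>1 H) \<circ> on12 H (E\<^sub>1 H)"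
      "on12 H (E\<^sub>2 H) \<circ> on23 H (T\<^sub>2 H) = on23 H (T\<^sub>2 H) \<circ> on13 H (E\<^sub>2 H)"
    and ax_viii:
      "eps_left H (fst (rgt H a) (E\<^sub>1 H (pure H b c))) =
       eps_left H (snd (lft H b) (T\<^sub>1 H (pure H a c)))"
      "eps_left H (snd (rgt H c) (E\<^sub>2 H (pure H a b))) =
       eps_left H (fst (rgt H b) (T\<^sub>2 H (pure H a c)))"
    and ax_ix:
      "fst (rgt H a) (T\<^sub>1 H (pure H c b)) = snd (rgt H b) (T\<^sub>3 H (pure H c a))"
      "snd (lft H b) (T\<^sub>2 H (pure H a c)) = fst (lft H a) (T\<^sub>4 H (pure H b c))"

definition right_full :: "('k::field, 'a::ab_group_add) wmb \<Rightarrow> bool" where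
  "right_full H \<longleftrightarrow>
     module.span (smult H)
       {slice_right (spc H) (spc H) \<omega> (T\<^sub>1 H (pure H a b)) | a b \<omega>. \<omega> \<in> Lin (spc H) ground} = UNIV"


section \<open>The base algebra\<close>

definition capR :: "('k::field, 'a::ab_group_add) wmb \<Rightarrow> 'a \<Rightarrow> 'a multiplier" where
  "capR H a = (\<lambda>b. eps_right H (T\<^sub>3 H (pure H b a)), \<lambda>b. eps_right H (E\<^sub>2 H (pure H b a)))"

definition capR_bar :: "('k::field, 'a::ab_group_add) wmb \<Rightarrow> 'a \<Rightarrow> 'a multiplier" where
  "capR_bar H a = (\<lambda>b. eps_right H (E\<^sub>1 H (pure H b a)), \<lambda>b. eps_right H (T\<^sub>1 H (pure H b a)))"

text \<open>If the comultiplication is right full, the range of \<open>capR_bar H\<close> is the same subspace.\<close>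

definition base :: "('k::field, 'a::ab_group_add) wmb \<Rightarrow> ('k, 'a multiplier) vspace" where
  "base H = \<lparr>vcar = range (capR H), vscale = vscale (MA H)\<rparr>"

definition base_counit :: "('k::field, 'a::ab_group_add) wmb \<Rightarrow> 'a multiplier \<Rightarrow> 'k" where
  "base_counit H r = (THE c. \<exists>a. capR H a = r \<and> counit H a = c)"

text \<open>
  For vector spaces \<open>V\<close>, \<open>W\<close> included in \<open>M(A)\<close> by \<open>i\<close> and \<open>j\<close>, \<open>embed H V W i j\<close> is the resulting
  (injective) map \<open>V \<otimes> W \<rightarrow> M(A \<otimes> A)\<close>.
\<close>

definition embed ::
  "('k::field, 'a::ab_group_add) wmb \<Rightarrow>
   ('k, 'v::ab_group_add) vspace \<Rightarrow> ('k, 'w::ab_group_add) vspace \<Rightarrow>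
   ('v \<Rightarrow> 'a multiplier) \<Rightarrow> ('w \<Rightarrow> 'a multiplier) \<Rightarrow>
   ('k, 'v, 'w) tensor \<Rightarrow> ('k, 'a, 'a) tensor multiplier" where
  "embed H V W i j = tlift V W (MAA H) (\<lambda>v w. mtens (spc H) (i v) (j w))"

definition canF :: "('k::field, 'a::ab_group_add) wmb \<Rightarrow> ('k, 'a, 'a) tensor multiplier" where
  "canF H = (THE F. F \<in> vcar (MAA H) \<and>
     (\<forall>a b c.
        F \<bullet> inj2 H (pure H a (mult H b c)) =
          embed H (MA H) (spc H) id (inj1 H)
            (tmap (spc H) (spc H) (MA H) (spc H) (capR_bar H) (idm (spc H))
               (tw (spc H) (spc H) (T\<^sub>4 H (pure H c b)))) \<bullet> lft H a \<and>
        inj2 H (pure H (mult H a b) c) \<bullet> F =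
          rgt H c \<bullet> embed H (spc H) (MA H) (inj1 H) id
            (tmap (spc H) (spc H) (spc H) (MA H) (idm (spc H)) (capR H)
               (T\<^sub>2 H (pure H a b)))))"

text \<open>The multiplier \<open>(a \<otimes> 1)F\<close>, regarded as an element of \<open>A \<otimes> R\<close>.\<close>

definition aF :: "('k::field, 'a::ab_group_add) wmb \<Rightarrow> 'a \<Rightarrow> ('k, 'a, 'a multiplier) tensor" where
  "aF H a = (THE t. t \<in> vcar (spc H \<Otimes> base H) \<and>
     embed H (spc H) (base H) (inj1 H) id t = lft H a \<bullet> canF H)"


section \<open>Comodules and integrals\<close>

record ('k, 'a, 'v) comod =
  cspc :: "('k, 'v) vspace"
  lam :: "('k, 'v, 'a) tensor \<Rightarrow> ('k, 'v, 'a) tensor"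
  rho :: "('k, 'v, 'a) tensor \<Rightarrow> ('k, 'v, 'a) tensor"

definition right_comodule ::
  "('k::field, 'a::ab_group_add) wmb \<Rightarrow> ('k, 'a, 'v::ab_group_add) comod \<Rightarrow> bool" where
  "right_comodule H M \<longleftrightarrow>
     (let V = cspc M; A = spc H in
      is_vspace V \<and> lam M \<in> Lin (V \<Otimes> A) (V \<Otimes> A) \<and> rho M \<in> Lin (V \<Otimes> A) (V \<Otimes> A) \<and>
      (\<forall>v\<in>vcar V. \<forall>a b.
         tmap V A V A (idm V) (fst (inj1 H a)) (lam M (tens V A v b)) =
         tmap V A V A (idm V) (snd (inj1 H b)) (rho M (tens V A v a))) \<and>
      leg12 V A A (lam M) \<circ> leg13 V A A (lam M) \<circ> leg23 V A A (E\<^sub>1 H) =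
        leg12 V A A (lam M) \<circ> leg13 V A A (lam M) \<and>
      leg12 V A A (lam M) \<circ> leg13 V A A (lam M) \<circ> leg23 V A A (T\<^sub>1 H) =
        leg23 V A A (T\<^sub>1 H) \<circ> leg12 V A A (lam M))"

text \<open>
  Homomorphisms are meant for \<open>M\<close> and \<open>N\<close> satisfying \<open>right_comodule H\<close>; as with
  homomorphisms in the library, that condition is not part of the set.
\<close>

definition comodule_homs ::
  "('k::field, 'a::ab_group_add) wmb \<Rightarrow> ('k, 'a, 'v::ab_group_add) comod \<Rightarrow>
   ('k, 'a, 'w::ab_group_add) comod \<Rightarrow> ('v \<Rightarrow> 'w) set" where
  "comodule_homs H M N =
     {f \<in> Lin (cspc M) (cspc N).
        lam N \<circ> tmap (cspc M) (spc H) (cspc N) (spc H) f (idm (spc H)) =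
        tmap (cspc M) (spc H) (cspc N) (spc H) f (idm (spc H)) \<circ> lam M}"

definition regular_comod :: "('k::field, 'a::ab_group_add) wmb \<Rightarrow> ('k, 'a, 'a) comod" where
  "regular_comod H = \<lparr>cspc = spc H, lam = T\<^sub>1 H, rho = T\<^sub>3 H\<rparr>"

text \<open>\<open>E(1 \<otimes> ra)\<close> and \<open>(1 \<otimes> ar)E\<close> are multipliers of \<open>A \<otimes> A\<close>, regarded as elements of \<open>R \<otimes> A\<close>.\<close>

definition in_base_A ::
  "('k::field, 'a::ab_group_add) wmb \<Rightarrow> ('k, 'a, 'a) tensor multiplier \<Rightarrow>
   ('k, 'a multiplier, 'a) tensor" where
  "in_base_A H x = (THE t. t \<in> vcar (base H \<Otimes> spc H) \<and>
     embed H (base H) (spc H) id (inj1 H) t = x)"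

definition base_comod :: "('k::field, 'a::ab_group_add) wmb \<Rightarrow> ('k, 'a, 'a multiplier) comod" where
  "base_comod H =
     \<lparr>cspc = base H,
      lam = tlift (base H) (spc H) (base H \<Otimes> spc H)
        (\<lambda>r a. in_base_A H ((E\<^sub>1 H, E\<^sub>2 H) \<bullet> rgt H (fst r a))),
      rho = tlift (base H) (spc H) (base H \<Otimes> spc H)
        (\<lambda>r a. in_base_A H (rgt H (snd r a) \<bullet> (E\<^sub>1 H, E\<^sub>2 H)))\<rparr>"

text \<open>The multiplier \<open>a \<leftharpoonup> \<psi>\<close>\<close>

definition harpoon ::
  "('k::field, 'a::ab_group_add) wmb \<Rightarrow> 'a \<Rightarrow> ('a \<Rightarrow> 'k) \<Rightarrow> 'a multiplier" where
  "harpoon H a \<psi> =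
     (\<lambda>b. slice_left (spc H) (spc H) \<psi> (T\<^sub>1 H (pure H a b)),
      \<lambda>b. slice_left (spc H) (spc H) \<psi> (T\<^sub>3 H (pure H a b)))"

definition right_integrals :: "('k::field, 'a::ab_group_add) wmb \<Rightarrow> ('a \<Rightarrow> 'k) set" where
  "right_integrals H = {\<psi> \<in> Lin (spc H) ground. \<forall>a. harpoon H a \<psi> \<in> range (capR H)}"

text \<open>Both sets of linear maps carry the pointwise vector space structure.\<close>

definition hom_space :: "('k::field, 'a::ab_group_add) wmb \<Rightarrow> ('k, 'a \<Rightarrow> 'a multiplier) vspace" where
  "hom_space H = \<lparr>vcar = comodule_homs H (regular_comod H) (base_comod H),
                  vscale = (\<lambda>c \<Psi> a. vscale (base H) c (\<Psi> a))\<rparr>"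

definition integral_space :: "('k::field, 'a::ab_group_add) wmb \<Rightarrow> ('k, 'a \<Rightarrow> 'k) vspace" where
  "integral_space H = \<lparr>vcar = right_integrals H, vscale = (\<lambda>c \<psi> a. c * \<psi> a)\<rparr>"

definition inverse_isomorphisms ::
  "('k::field, 'v::ab_group_add) vspace \<Rightarrow> ('k, 'w::ab_group_add) vspace \<Rightarrow>
   ('v \<Rightarrow> 'w) \<Rightarrow> ('w \<Rightarrow> 'v) \<Rightarrow> bool" where
  "inverse_isomorphisms V W f g \<longleftrightarrow>
     is_vspace V \<and> is_vspace W \<and> linear_on V W f \<and> linear_on W V g \<and>
     (\<forall>v\<in>vcar V. g (f v) = v) \<and> (\<forall>w\<in>vcar W. f (g w) = w)"

end

theory Submission
  imports Defs
begin

text \<open>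
Write \<open>A\<close> for the bialgebra, \<open>N = capR H\<close>, \<open>N' = capR_bar H\<close>, \<open>R\<close> for the base algebra and
\<open>\<epsilon>\<^sub>R\<close> for its counit; \<open>a\<^sub>1 \<otimes> a\<^sub>2\<close> is Sweedler notation for the coproduct \<open>\<Delta>(a)\<close>.

\<^bold>\<open>Why the two maps are mutually inverse.\<close> A comodule homomorphism \<open>\<Psi> : A \<rightarrow> R\<close> satisfies
\<open>E(1 \<otimes> \<Psi>(a)b) = \<Psi>(a\<^sub>1) \<otimes> a\<^sub>2 b\<close>. Since \<open>\<epsilon>\<^sub>R\<close> turns \<open>E(1 \<otimes> d)\<close> into \<open>d\<close> (\<open>coact_counit\<close>), the
functional \<open>\<psi> = \<epsilon>\<^sub>R \<Psi>\<close> satisfies \<open>\<Psi>(a)b = \<psi>(a\<^sub>1) a\<^sub>2 b\<close>. So \<open>\<Psi>(a)\<close> is the multiplier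
\<open>a \<leftharpoonup> \<psi>\<close>; in particular \<open>\<psi>\<close> is a right integral and determines \<open>\<Psi>\<close>.
Conversely let \<open>\<psi>\<close> be a right integral. The elements \<open>r = a \<leftharpoonup> \<psi>\<close> and \<open>s = (\<psi> \<otimes> R)((a \<otimes> 1)F)\<close> both lie
in \<open>R\<close>, and \<open>\<epsilon>(rc) = \<psi>(a N'(c)) = \<epsilon>(sc)\<close> for all \<open>c\<close>. The functionals \<open>\<epsilon>(- c)\<close> separate \<open>R\<close>
(\<open>base_eqI\<close>), so \<open>r = s\<close> (\<open>base_slice_eqI\<close>). That \<open>a \<mapsto> r\<close> is a homomorphism follows from
\<open>\<psi>(a\<^sub>1) \<Delta>(a\<^sub>2) \<Delta>(d) = \<Delta>(rd) = (1 \<otimes> r) \<Delta>(d)\<close>, which says \<open>\<psi>(a\<^sub>1) \<Delta>(a\<^sub>2) = (1 \<otimes> r)E\<close>, together with the fact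
that \<open>1 \<otimes> r\<close> commutes with \<open>E\<close> (\<open>integral_coproduct\<close>). Finally \<open>\<epsilon>\<^sub>R(s) = \<psi>(a)\<close> is the counit axiom.

\<^bold>\<open>The base algebra.\<close> These arguments need the structure of \<open>R\<close>, which has to be derived from the axioms.
The identity \<open>\<epsilon>(x y\<^sub>1) \<epsilon>(y\<^sub>2 a) = \<epsilon>(x y a)\<close> (\<open>counit_prod\<close>) and its mirror image show that \<open>N(a)\<close> and \<open>N'(a)\<close>
are multipliers. Applying the counit to the middle leg of the compatibility of \<open>E\<close> with \<open>\<Delta>\<close> expresses \<open>E\<close>
through \<open>N\<close> and \<open>N'\<close> (\<open>E_capR\<close>, \<open>E_capR_bar\<close>), and comparing the two expressions, fullness of \<open>\<Delta>\<close> identifies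
the ranges of \<open>N\<close> and \<open>N'\<close>. The decisive point is that \<open>R\<close> provides local units: every \<open>p \<in> A\<close> equals
\<open>p N'(c)\<close> for some \<open>c\<close> (\<open>local_unit\<close>). It makes \<open>\<epsilon>\<^sub>R(N(a)) = \<epsilon>(a)\<close> well defined.

\<^bold>\<open>The calculus.\<close> A tensor is by construction a functional on bilinear forms, and the number \<open>t \<beta>\<close> is the Sweedler
expression \<open>\<Sum> \<beta>(t\<^sub>1, t\<^sub>2)\<close>. All axioms are translated into identities between such numbers, composite
expressions are obtained by nesting, and the interchange of two evaluations (\<open>eval_commute\<close>) and the cancellation
of factors by nondegeneracy (\<open>cancel\<close>, \<open>cancel_vector\<close>) replace the usual manipulations of multipliers.
\<close>

section \<open>Linear maps and tensors\<close>

lemma vcar_ground [simp]: "vcar ground = UNIV" and vscale_ground [simp]: "vscale ground = (*)"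
  by (simp_all add: ground_def)

lemma vscale_tensor [simp]: "vscale (V \<Otimes> W) = tscale"
  by (simp add: tensor_space_def)

lemma is_vspaceD:
  assumes "is_vspace V"
  shows "vector_space (vscale V)" "0 \<in> vcar V"
    "x \<in> vcar V \<Longrightarrow> y \<in> vcar V \<Longrightarrow> x + y \<in> vcar V"
    "x \<in> vcar V \<Longrightarrow> y \<in> vcar V \<Longrightarrow> x - y \<in> vcar V"
    "x \<in> vcar V \<Longrightarrow> vscale V c x \<in> vcar V"
proof -
  show v: "vector_space (vscale V)" using assms by (simp add: is_vspace_def)
  interpret vector_space "vscale V" by (rule v)
  have "subspace (vcar V)" using assms by (simp add: is_vspace_def)
  then show "0 \<in> vcar V"
    "x \<in> vcar V \<Longrightarrow> y \<in> vcar V \<Longrightarrow> x + y \<in> vcar V"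
    "x \<in> vcar V \<Longrightarrow> y \<in> vcar V \<Longrightarrow> x - y \<in> vcar V"
    "x \<in> vcar V \<Longrightarrow> vscale V c x \<in> vcar V"
    by (auto intro: subspace_0 subspace_add subspace_diff subspace_scale)
qed

lemma is_vspaceI:
  assumes "vector_space (vscale V)" "0 \<in> vcar V"
    "\<And>x y. x \<in> vcar V \<Longrightarrow> y \<in> vcar V \<Longrightarrow> x + y \<in> vcar V"
    "\<And>c x. x \<in> vcar V \<Longrightarrow> vscale V c x \<in> vcar V"
  shows "is_vspace V"
proof -
  interpret vector_space "vscale V" by fact
  show ?thesis using assms by (simp add: is_vspace_def subspace_def)
qed

lemma linear_onD:
  assumes "linear_on V W f"
  shows "x \<in> vcar V \<Longrightarrow> f x \<in> vcar W"
    "x \<in> vcar V \<Longrightarrow> y \<in> vcar V \<Longrightarrow> f (x + y) = f x + f y"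
    "x \<in> vcar V \<Longrightarrow> f (vscale V c x) = vscale W c (f x)"
  using assms by (auto simp: linear_on_def)

lemma linear_on_zero:
  assumes "is_vspace V" "linear_on V W f"
  shows "f 0 = 0"
  using linear_onD(2)[OF assms(2), of 0 0] is_vspaceD(2)[OF assms(1)] by simp

lemma linear_on_diff:
  assumes "is_vspace V" "linear_on V W f" "x \<in> vcar V" "y \<in> vcar V"
  shows "f (x - y) = f x - f y"
  using linear_onD(2)[OF assms(2), of "x - y" y] assms is_vspaceD(4)[OF assms(1)]
  by (simp add: algebra_simps)

lemma linear_on_comp:
  "linear_on V W f \<Longrightarrow> linear_on W U g \<Longrightarrow> linear_on V U (\<lambda>x. g (f x))"
  by (simp add: linear_on_def)

lemma linear_on_cong:
  assumes "is_vspace V" "\<And>x. x \<in> vcar V \<Longrightarrow> f x = g x"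
  shows "linear_on V W f \<longleftrightarrow> linear_on V W g"
  using assms is_vspaceD(3,5)[OF assms(1)] by (auto simp: linear_on_def)

lemma bilinear_onD:
  assumes "bilinear_on V W U b"
  shows "w \<in> vcar W \<Longrightarrow> linear_on V U (\<lambda>v. b v w)" "v \<in> vcar V \<Longrightarrow> linear_on W U (b v)"
  using assms by (auto simp: bilinear_on_def)

lemma LinD: "f \<in> Lin V W \<Longrightarrow> linear_on V W f" "f \<in> Lin V W \<Longrightarrow> x \<notin> vcar V \<Longrightarrow> f x = 0"
  by (auto simp: Lin_def)

lemma tens_eval: "bilinear_on V W ground \<beta> \<Longrightarrow> tens V W v w \<beta> = \<beta> v w"
  by (simp add: tens_def)

lemma tens_in:
  fixes V :: "('k::field, 'v::ab_group_add) vspace" and W :: "('k, 'w::ab_group_add) vspace"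
  shows "v \<in> vcar V \<Longrightarrow> w \<in> vcar W \<Longrightarrow> tens V W v w \<in> vcar (V \<Otimes> W)"
proof -
  interpret vector_space "tscale :: 'k \<Rightarrow> ('k, 'v, 'w) tensor \<Rightarrow> _" by (rule vector_space_tscale)
  show "v \<in> vcar V \<Longrightarrow> w \<in> vcar W \<Longrightarrow> tens V W v w \<in> vcar (V \<Otimes> W)"
    by (auto simp: tensor_space_def intro!: span_base)
qed

lemma tens_bilinear:
  assumes "is_vspace V" "is_vspace W"
  shows "bilinear_on V W (V \<Otimes> W) (tens V W)"
  by (auto simp: bilinear_on_def linear_on_def tens_in)
    (auto simp: tens_def fun_eq_iff bilinear_on_def linear_on_def tscale_def)

lemma tensor_induct [consumes 2, case_names zero tens]:
  assumes V: "is_vspace V" and t: "t \<in> vcar (V \<Otimes> W)"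
    and "P 0"
    and step: "\<And>v w t. v \<in> vcar V \<Longrightarrow> w \<in> vcar W \<Longrightarrow> t \<in> vcar (V \<Otimes> W) \<Longrightarrow> P t \<Longrightarrow>
      P (tens V W v w + t)"
  shows "P t"
proof -
  interpret vector_space "tscale :: 'a \<Rightarrow> ('a, 'b, 'c) tensor \<Rightarrow> _" by (rule vector_space_tscale)
  have "t \<in> span {tens V W v w | v w. v \<in> vcar V \<and> w \<in> vcar W}"
    using t by (simp add: tensor_space_def)
  then have "P t \<and> t \<in> vcar (V \<Otimes> W)"
  proof (induction rule: span_induct_alt)
    case base
    then show ?case
      using assms(3) is_vspaceD(2)[OF is_vspace_tensor] by (simp add: zero_fun_def[symmetric])
  next
    case (step c x y)
    then obtain v w where x: "x = tens V W v w" "v \<in> vcar V" "w \<in> vcar W" by auto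
    have sc: "vscale V c v \<in> vcar V" using x is_vspaceD(5)[OF V] by simp
    have "tscale c x = tens V W (vscale V c v) w"
      using x by (auto simp: tens_def tscale_def fun_eq_iff bilinear_on_def linear_on_def)
    moreover have "P (tens V W (vscale V c v) w + y)" "tens V W (vscale V c v) w + y \<in> vcar (V \<Otimes> W)"
      using step assms(4)[OF sc x(3)] is_vspaceD(3)[OF is_vspace_tensor tens_in[OF sc x(3)]]
      by blast+
    ultimately show ?case unfolding x(1) by metis
  qed
  then show ?thesis by simp
qed

lemma eval_nonbilinear:
  assumes "is_vspace V" "t \<in> vcar (V \<Otimes> W)" "\<not> bilinear_on V W ground \<beta>"
  shows "t \<beta> = 0"
  using assms(1,2) by (induction rule: tensor_induct) (auto simp: tens_def assms(3))

lemma bilinear_cong: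
  assumes "is_vspace V" "is_vspace W"
    and "\<And>v w. v \<in> vcar V \<Longrightarrow> w \<in> vcar W \<Longrightarrow> b v w = b' v w"
  shows "bilinear_on V W U b \<longleftrightarrow> bilinear_on V W U b'"
proof -
  have "linear_on V U (\<lambda>v. b v w) \<longleftrightarrow> linear_on V U (\<lambda>v. b' v w)" if "w \<in> vcar W" for w
    by (rule linear_on_cong[OF assms(1)]) (simp add: assms(3) that)
  moreover have "linear_on W U (b v) \<longleftrightarrow> linear_on W U (b' v)" if "v \<in> vcar V" for v
    by (rule linear_on_cong[OF assms(2)]) (simp add: assms(3) that)
  ultimately show ?thesis by (simp add: bilinear_on_def)
qed

lemma eval_cong:
  assumes "is_vspace V" "is_vspace W" "t \<in> vcar (V \<Otimes> W)"
    and eq: "\<And>v w. v \<in> vcar V \<Longrightarrow> w \<in> vcar W \<Longrightarrow> \<beta> v w = \<beta>' v w"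
  shows "t \<beta> = t \<beta>'"
  using assms(1,3) bilinear_cong[OF assms(1,2) eq]
  by (induction rule: tensor_induct) (auto simp: tens_def eq)

lemma eval_add:
  assumes "is_vspace V" "t \<in> vcar (V \<Otimes> W)"
    "bilinear_on V W ground \<beta>" "bilinear_on V W ground \<beta>'"
  shows "t (\<lambda>v w. \<beta> v w + \<beta>' v w) = t \<beta> + t \<beta>'"
proof -
  have b: "bilinear_on V W ground (\<lambda>v w. \<beta> v w + \<beta>' v w)"
    using assms(3,4) by (simp add: bilinear_on_def linear_on_def algebra_simps)
  show ?thesis using assms(1,2)
    by (induction rule: tensor_induct) (auto simp: tens_eval b assms)
qed

lemma eval_scale:
  assumes "is_vspace V" "t \<in> vcar (V \<Otimes> W)" "bilinear_on V W ground \<beta>"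
  shows "t (\<lambda>v w. c * \<beta> v w) = c * t \<beta>"
proof -
  have b: "bilinear_on V W ground (\<lambda>v w. c * \<beta> v w)"
    using assms(3) by (simp add: bilinear_on_def linear_on_def algebra_simps)
  show ?thesis using assms(1,2)
    by (induction rule: tensor_induct) (auto simp: tens_eval b assms algebra_simps)
qed

text \<open>
  The key to computing with tensors: a linear functional on a tensor product is evaluation of
  the tensor at the corresponding bilinear form. Hence \<open>t \<beta>\<close> plays the role of the Sweedler
  expression \<open>\<Sum> \<beta>(t\<^sub>1, t\<^sub>2)\<close>.
\<close>

lemma functional_eval:
  assumes V: "is_vspace V" and W: "is_vspace W"
    and \<Phi>: "linear_on (V \<Otimes> W) ground \<Phi>" and t: "t \<in> vcar (V \<Otimes> W)"
  shows "\<Phi> t = t (\<lambda>v w. \<Phi> (tens V W v w))"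
    and "bilinear_on V W ground (\<lambda>v w. \<Phi> (tens V W v w))"
proof -
  show b: "bilinear_on V W ground (\<lambda>v w. \<Phi> (tens V W v w))"
    unfolding bilinear_on_def
    by (intro conjI ballI linear_on_comp[OF _ \<Phi>] bilinear_onD[OF tens_bilinear[OF V W]])
  show "\<Phi> t = t (\<lambda>v w. \<Phi> (tens V W v w))"
    using V t
  proof (induction rule: tensor_induct)
    case zero
    have "\<Phi> 0 = (0 :: ('a, 'b, 'c) tensor) (\<lambda>v w. \<Phi> (tens V W v w))"
      using linear_on_zero[OF is_vspace_tensor \<Phi>] by simp
    then show ?case .
  next
    case (tens v w t)
    then have "\<Phi> (tens V W v w + t) = (tens V W v w + t) (\<lambda>v w. \<Phi> (tens V W v w))"
      using linear_onD(2)[OF \<Phi> tens_in[OF tens(1,2)] tens(3)] by (simp add: tens_eval[OF b])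
    then show ?case .
  qed
qed

lemma eval_linear: "linear_on (V \<Otimes> W) ground (\<lambda>t. t \<beta>)"
  by (simp add: linear_on_def tscale_def)

lemma tlift_linear:
  "is_vspace U \<Longrightarrow> bilinear_on V W U b \<Longrightarrow> linear_on (V \<Otimes> W) U (tlift V W U b)"
  using tlift_Lin LinD by blast

lemma tlift_in:
  "is_vspace U \<Longrightarrow> bilinear_on V W U b \<Longrightarrow> t \<in> vcar (V \<Otimes> W) \<Longrightarrow> tlift V W U b t \<in> vcar U"
  by (rule linear_onD(1)[OF tlift_linear])

lemma tlift_eval:
  assumes V: "is_vspace V" and W: "is_vspace W" and U: "is_vspace U" and b: "bilinear_on V W U b"
    and \<Phi>: "linear_on U ground \<Phi>" and t: "t \<in> vcar (V \<Otimes> W)"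
  shows "\<Phi> (tlift V W U b t) = t (\<lambda>v w. \<Phi> (b v w))"
proof -
  have "\<Phi> (tlift V W U b t) = t (\<lambda>v w. \<Phi> (tlift V W U b (tens V W v w)))"
    by (rule functional_eval(1)[OF V W linear_on_comp[OF tlift_linear[OF U b] \<Phi>] t])
  also have "\<dots> = t (\<lambda>v w. \<Phi> (b v w))"
    by (rule eval_cong[OF V W t]) (simp add: tlift_tens[OF U b])
  finally show ?thesis .
qed

text \<open>
  A basis of \<open>S\<close> stays independent when \<open>x\<close> is added to it, so a functional may be prescribed to be \<open>0\<close>
  on the basis and \<open>1\<close> at \<open>x\<close>.
\<close>

lemma separating_functional:
  assumes "vector_space s" "module.subspace s S" "x \<notin> S"
  obtains \<Phi> where "\<And>y z. \<Phi> (y + z) = \<Phi> y + \<Phi> z" "\<And>c y. \<Phi> (s c y) = c * \<Phi> y"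
    "\<And>y. y \<in> S \<Longrightarrow> \<Phi> y = 0" "\<Phi> x = (1::'k::field)"
proof -
  interpret vector_space s by fact
  interpret vector_space_pair s "(*) :: 'k \<Rightarrow> 'k \<Rightarrow> 'k"
    by unfold_locales (auto simp: algebra_simps)
  obtain B where B: "B \<subseteq> S" "independent B" "S \<subseteq> span B" using basis_exists by metis
  have "span B \<subseteq> S" using B(1) assms(2) by (simp add: span_minimal)
  then have ind: "independent (insert x B)" "x \<notin> B"
    using assms(3) B by (auto simp: independent_insert)
  obtain g where g: "Vector_Spaces.linear s (*) g" "\<forall>y\<in>insert x B. g y = (if y = x then 1 else 0)"
    using linear_independent_extend[OF ind(1), of "\<lambda>y. if y = x then 1 else 0"] by blast
  interpret g: Vector_Spaces.linear s "(*)" g by (rule g(1))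
  have "g y = 0" if "y \<in> S" for y
  proof -
    have "y \<in> span B" using that B by auto
    then show ?thesis
      by (rule span_induct_alt) (use g ind in \<open>auto simp: g.add g.scale g.zero\<close>)
  qed
  then show ?thesis using that[of g] g by (auto simp: g.add g.scale)
qed

lemma functionals_separate:
  assumes U: "is_vspace U" and "x \<in> vcar U" "y \<in> vcar U"
    and "\<And>\<Phi>. linear_on U ground \<Phi> \<Longrightarrow> \<Phi> x = \<Phi> y"
  shows "x = y"
proof (rule ccontr)
  interpret vector_space "vscale U" by (rule is_vspaceD[OF U])
  assume "x \<noteq> y"
  then have 0: "x - y \<notin> {0}" by simp
  have "subspace {0}" by (simp add: subspace_def)
  then obtain \<Phi> where \<Phi>: "\<And>y z. \<Phi> (y + z) = \<Phi> y + \<Phi> z"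
    "\<And>c y. \<Phi> (vscale U c y) = c * \<Phi> y" "\<Phi> (x - y) = 1"
    using separating_functional[OF vector_space_axioms _ 0] by metis
  have "\<Phi> (x - y) = \<Phi> x - \<Phi> y" using \<Phi>(1)[of "x - y" y] by simp
  moreover have "linear_on U ground \<Phi>" using \<Phi> by (simp add: linear_on_def)
  ultimately show False using assms(4)[of \<Phi>] \<Phi>(3) by simp
qed

lemma slice_left_bilinear:
  assumes "is_vspace W" "linear_on V ground \<omega>"
  shows "bilinear_on V W W (\<lambda>v w. vscale W (\<omega> v) w)"
proof -
  interpret vector_space "vscale W" by (rule is_vspaceD[OF assms(1)])
  show ?thesis
    using assms(2) is_vspaceD(5)[OF assms(1)]
    by (auto simp: bilinear_on_def linear_on_def scale_left_distrib scale_right_distrib mult.commute)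
qed

lemma slice_right_bilinear:
  assumes "is_vspace V" "linear_on W ground \<omega>"
  shows "bilinear_on V W V (\<lambda>v w. vscale V (\<omega> w) v)"
  using slice_left_bilinear[OF assms] by (simp add: bilinear_on_def)

lemma slice_left:
  assumes "is_vspace V" "is_vspace W" "linear_on V ground \<omega>" "t \<in> vcar (V \<Otimes> W)"
  shows "slice_left V W \<omega> t \<in> vcar W"
    "linear_on W ground \<Phi> \<Longrightarrow> \<Phi> (slice_left V W \<omega> t) = t (\<lambda>v w. \<omega> v * \<Phi> w)"
proof -
  show "slice_left V W \<omega> t \<in> vcar W"
    using tlift_in[OF assms(2) slice_left_bilinear[OF assms(2,3)] assms(4)]
    by (simp add: slice_left_def)
  assume \<Phi>: "linear_on W ground \<Phi>"
  have "\<Phi> (slice_left V W \<omega> t) = t (\<lambda>v w. \<Phi> (vscale W (\<omega> v) w))"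
    using tlift_eval[OF assms(1,2,2) slice_left_bilinear[OF assms(2,3)] \<Phi> assms(4)]
    by (simp add: slice_left_def)
  also have "\<dots> = t (\<lambda>v w. \<omega> v * \<Phi> w)"
    by (rule eval_cong[OF assms(1,2,4)]) (simp add: linear_onD(3)[OF \<Phi>])
  finally show "\<Phi> (slice_left V W \<omega> t) = t (\<lambda>v w. \<omega> v * \<Phi> w)" .
qed

lemma slice_right:
  assumes "is_vspace V" "is_vspace W" "linear_on W ground \<omega>" "t \<in> vcar (V \<Otimes> W)"
  shows "slice_right V W \<omega> t \<in> vcar V"
    "linear_on V ground \<Phi> \<Longrightarrow> \<Phi> (slice_right V W \<omega> t) = t (\<lambda>v w. \<Phi> v * \<omega> w)"
proof -
  show "slice_right V W \<omega> t \<in> vcar V"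
    using tlift_in[OF assms(1) slice_right_bilinear[OF assms(1,3)] assms(4)]
    by (simp add: slice_right_def)
  assume \<Phi>: "linear_on V ground \<Phi>"
  have "\<Phi> (slice_right V W \<omega> t) = t (\<lambda>v w. \<Phi> (vscale V (\<omega> w) v))"
    using tlift_eval[OF assms(1,2,1) slice_right_bilinear[OF assms(1,3)] \<Phi> assms(4)]
    by (simp add: slice_right_def)
  also have "\<dots> = t (\<lambda>v w. \<Phi> v * \<omega> w)"
    by (rule eval_cong[OF assms(1,2,4)]) (simp add: linear_onD(3)[OF \<Phi>])
  finally show "\<Phi> (slice_right V W \<omega> t) = t (\<lambda>v w. \<Phi> v * \<omega> w)" .
qed

lemma product_bilinear:
  "linear_on V ground \<phi> \<Longrightarrow> linear_on W ground \<psi> \<Longrightarrow> bilinear_on V W ground (\<lambda>v w. \<phi> v * \<psi> w)"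
  by (auto simp: bilinear_on_def linear_on_def algebra_simps)

text \<open>
  Expanding all left legs in a basis of \<open>V\<close> collects a tensor into a sum \<open>\<Sum> e \<otimes> y\<^sub>e\<close> over finitely many
  basis vectors \<open>e\<close>, given here in evaluated form.
\<close>

lemma tensor_independent_legs:
  assumes V: "is_vspace V" and W: "is_vspace W" and t: "t \<in> vcar (V \<Otimes> W)"
  obtains B y where "finite B" "B \<subseteq> vcar V" "\<not> module.dependent (vscale V) B"
    "\<And>e. y e \<in> vcar W"
    "\<And>\<beta>. bilinear_on V W ground \<beta> \<Longrightarrow> t \<beta> = (\<Sum>e\<in>B. \<beta> e (y e))"
proof -
  interpret V: vector_space "vscale V" by (rule is_vspaceD[OF V])
  obtain B0 where B0: "B0 \<subseteq> vcar V" "V.independent B0" "vcar V \<subseteq> V.span B0"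
    using V.basis_exists by metis
  have "\<exists>B y. finite B \<and> B \<subseteq> B0 \<and> (\<forall>e. y e \<in> vcar W) \<and> (\<forall>e. e \<notin> B \<longrightarrow> y e = 0) \<and>
    (\<forall>\<beta>. bilinear_on V W ground \<beta> \<longrightarrow> t \<beta> = (\<Sum>e\<in>B. \<beta> e (y e)))"
    using V t
  proof (induction rule: tensor_induct)
    case zero
    show ?case
      by (rule exI[of _ "{}"], rule exI[of _ "\<lambda>_. 0"]) (simp add: is_vspaceD(2)[OF W])
  next
    case (tens v w t)
    then obtain B y where B: "finite B" "B \<subseteq> B0" "\<And>e. y e \<in> vcar W" "\<And>e. e \<notin> B \<Longrightarrow> y e = 0"
      "\<And>\<beta>. bilinear_on V W ground \<beta> \<Longrightarrow> t \<beta> = (\<Sum>e\<in>B. \<beta> e (y e))" by metis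
    define r where "r = V.representation B0 v"
    define C where "C = {e. r e \<noteq> 0}"
    have C: "finite C" "C \<subseteq> B0"
      using V.finite_representation V.representation_ne_zero unfolding C_def r_def by blast+
    have v: "v = (\<Sum>e\<in>C. vscale V (r e) e)"
      unfolding C_def r_def
      using V.sum_nonzero_representation_eq[of B0 v] B0 \<open>v \<in> vcar V\<close> by auto
    interpret W: vector_space "vscale W" by (rule is_vspaceD[OF W])
    define y' where "y' = (\<lambda>e. vscale W (r e) w + y e)"
    have CV: "C \<subseteq> vcar V" "B \<subseteq> vcar V" using C B B0 by auto
    have "(tens V W v w + t) \<beta> = (\<Sum>e\<in>C \<union> B. \<beta> e (y' e))" if \<beta>: "bilinear_on V W ground \<beta>" for \<beta>
    proof -
      have lv: "linear_on V ground (\<lambda>v. \<beta> v w)" and lw: "v \<in> vcar V \<Longrightarrow> linear_on W ground (\<beta> v)" for v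
        using \<beta> tens by (auto simp: bilinear_on_def)
      have *: "\<beta> (\<Sum>e\<in>C'. vscale V (r e) e) w = (\<Sum>e\<in>C'. r e * \<beta> e w)
          \<and> (\<Sum>e\<in>C'. vscale V (r e) e) \<in> vcar V" if "finite C'" "C' \<subseteq> C" for C'
        using that
      proof (induction C' rule: finite_induct)
        case empty
        show ?case using linear_on_zero[OF V lv] is_vspaceD(2)[OF V] by simp
      next
        case (insert x F)
        then have "x \<in> vcar V" using CV by auto
        then show ?case
          using insert linear_onD[OF lv] is_vspaceD[OF V] by auto
      qed
      have "\<beta> v w = (\<Sum>e\<in>C. r e * \<beta> e w)" using *[of C] C v by simp
      also have "\<dots> = (\<Sum>e\<in>C \<union> B. r e * \<beta> e w)"
        by (rule sum.mono_neutral_left) (use C B in \<open>auto simp: C_def\<close>)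
      finally have 1: "\<beta> v w = (\<Sum>e\<in>C \<union> B. r e * \<beta> e w)" .
      have "t \<beta> = (\<Sum>e\<in>B. \<beta> e (y e))" using B \<beta> by simp
      also have "\<dots> = (\<Sum>e\<in>C \<union> B. \<beta> e (y e))"
        by (rule sum.mono_neutral_left)
          (use C B CV linear_on_zero[OF W lw] in auto)
      finally have 2: "t \<beta> = (\<Sum>e\<in>C \<union> B. \<beta> e (y e))" .
      have "\<beta> e (y' e) = r e * \<beta> e w + \<beta> e (y e)" if "e \<in> C \<union> B" for e
      proof -
        have "linear_on W ground (\<beta> e)" using that CV lw by auto
        then show ?thesis
          using B tens(2) is_vspaceD[OF W] by (simp add: y'_def linear_on_def)
      qed
      then have "(\<Sum>e\<in>C \<union> B. \<beta> e (y' e)) = (\<Sum>e\<in>C \<union> B. r e * \<beta> e w + \<beta> e (y e))" by simp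
      then show ?thesis using 1 2 \<beta> by (simp add: tens_eval sum.distrib)
    qed
    moreover have "finite (C \<union> B)" "C \<union> B \<subseteq> B0" using C B by auto
    moreover have "y' e \<in> vcar W" for e
      using tens B is_vspaceD[OF W] by (simp add: y'_def)
    moreover have "y' e = 0" if "e \<notin> C \<union> B" for e
      using that B by (simp add: y'_def C_def)
    ultimately show ?case by blast
  qed
  then obtain B y where By: "finite B" "B \<subseteq> B0" "\<And>e. y e \<in> vcar W"
      "\<And>\<beta>. bilinear_on V W ground \<beta> \<Longrightarrow> t \<beta> = (\<Sum>e\<in>B. \<beta> e (y e))" by metis
  moreover have "V.independent B" using V.independent_mono[OF B0(2) By(2)] .
  ultimately show ?thesis using that B0 by blast
qed

text \<open>
  A functional that is \<open>1\<close> at one of the independent left legs and \<open>0\<close> at the others isolates the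
  corresponding right leg.
\<close>

lemma tensor_eq_0I:
  assumes V: "is_vspace V" and W: "is_vspace W" and t: "t \<in> vcar (V \<Otimes> W)"
    and 0: "\<And>\<phi> \<psi>. linear_on V ground \<phi> \<Longrightarrow> linear_on W ground \<psi> \<Longrightarrow> t (\<lambda>v w. \<phi> v * \<psi> w) = 0"
  shows "t = 0"
proof -
  interpret V: vector_space "vscale V" by (rule is_vspaceD[OF V])
  obtain B y where B: "finite B" "B \<subseteq> vcar V" "V.independent B" "\<And>e. y e \<in> vcar W"
    "\<And>\<beta>. bilinear_on V W ground \<beta> \<Longrightarrow> t \<beta> = (\<Sum>e\<in>B. \<beta> e (y e))"
    using tensor_independent_legs[OF V W t] by metis
  have "y e = 0" if "e \<in> B" for e
  proof (rule functionals_separate[OF W])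
    fix \<psi> assume \<psi>: "linear_on W ground \<psi>"
    have "V.subspace (V.span (B - {e}))" by simp
    moreover have "e \<notin> V.span (B - {e})" using B(3) that by (auto simp: V.dependent_def)
    ultimately obtain \<phi> where \<phi>: "\<And>y z. \<phi> (y + z) = \<phi> y + \<phi> z" "\<And>c y. \<phi> (vscale V c y) = c * \<phi> y"
      "\<And>y. y \<in> V.span (B - {e}) \<Longrightarrow> \<phi> y = 0" "\<phi> e = 1"
      using separating_functional[OF V.vector_space_axioms] by metis
    have l: "linear_on V ground \<phi>" using \<phi> by (simp add: linear_on_def)
    have "0 = (\<Sum>e'\<in>B. \<phi> e' * \<psi> (y e'))"
      using B(5)[OF product_bilinear[OF l \<psi>]] 0[OF l \<psi>] by simp
    also have "\<dots> = (\<Sum>e'\<in>{e}. \<phi> e' * \<psi> (y e'))"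
      by (rule sum.mono_neutral_right) (use B that \<phi>(3) V.span_base in auto)
    finally show "\<psi> (y e) = \<psi> 0" using \<phi> linear_on_zero[OF W \<psi>] by simp
  qed (use B is_vspaceD[OF W] in auto)
  then have "t \<beta> = 0" if "bilinear_on V W ground \<beta>" for \<beta>
  proof -
    have "\<beta> e (y e) = 0" if "e \<in> B" for e
    proof -
      have "linear_on W ground (\<beta> e)"
        using \<open>bilinear_on V W ground \<beta>\<close> that B(2) by (auto simp: bilinear_on_def)
      then show ?thesis using linear_on_zero[OF W] \<open>\<And>e. e \<in> B \<Longrightarrow> y e = 0\<close> that by metis
    qed
    then show ?thesis using B(5)[OF that] by simp
  qed
  then show ?thesis using eval_nonbilinear[OF V t] by (fastforce simp: fun_eq_iff)
qed

lemma tensor_eqI: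
  assumes V: "is_vspace V" and W: "is_vspace W" and t: "t \<in> vcar (V \<Otimes> W)" "t' \<in> vcar (V \<Otimes> W)"
    and "\<And>\<phi> \<psi>. linear_on V ground \<phi> \<Longrightarrow> linear_on W ground \<psi> \<Longrightarrow>
      t (\<lambda>v w. \<phi> v * \<psi> w) = t' (\<lambda>v w. \<phi> v * \<psi> w)"
  shows "t = t'"
proof -
  have "t - t' = 0"
    by (rule tensor_eq_0I[OF V W]) (use assms is_vspaceD(4)[OF is_vspace_tensor] in auto)
  then show ?thesis by simp
qed

text \<open>
  If \<open>t = \<Sum> e \<otimes> y\<^sub>e\<close> with independent \<open>e\<close>, then the vanishing of \<open>\<Sum> \<beta>(s, y\<^sub>e) e\<close> forces
  every \<open>\<beta>(s, y\<^sub>e)\<close> to vanish, in particular the diagonal terms \<open>\<beta>(e, y\<^sub>e)\<close>.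
\<close>

lemma eval_eq_0_if_slices_eq_0:
  assumes V: "is_vspace V" and W: "is_vspace W" and t: "t \<in> vcar (V \<Otimes> W)"
    and \<beta>: "bilinear_on V W ground \<beta>"
    and 0: "\<And>s. s \<in> vcar V \<Longrightarrow> slice_right V W (\<beta> s) t = 0"
  shows "t \<beta> = 0"
proof -
  interpret V: vector_space "vscale V" by (rule is_vspaceD[OF V])
  obtain B y where B: "finite B" "B \<subseteq> vcar V" "V.independent B" "\<And>e. y e \<in> vcar W"
    "\<And>\<beta>. bilinear_on V W ground \<beta> \<Longrightarrow> t \<beta> = (\<Sum>e\<in>B. \<beta> e (y e))"
    using tensor_independent_legs[OF V W t] by metis
  have "\<beta> e (y e) = 0" if e: "e \<in> B" for e
  proof -
    have s: "e \<in> vcar V" using B e by auto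
    have l: "linear_on W ground (\<beta> e)" using \<beta> s by (simp add: bilinear_on_def)
    have "V.subspace (V.span (B - {e}))" by simp
    moreover have "e \<notin> V.span (B - {e})" using B(3) that by (auto simp: V.dependent_def)
    ultimately obtain \<phi> where \<phi>: "\<And>y z. \<phi> (y + z) = \<phi> y + \<phi> z" "\<And>c y. \<phi> (vscale V c y) = c * \<phi> y"
      "\<And>y. y \<in> V.span (B - {e}) \<Longrightarrow> \<phi> y = 0" "\<phi> e = 1"
      using separating_functional[OF V.vector_space_axioms] by metis
    have l': "linear_on V ground \<phi>" using \<phi> by (simp add: linear_on_def)
    have "0 = \<phi> (slice_right V W (\<beta> e) t)" using 0[OF s] linear_on_zero[OF V l'] by simp
    also have "\<dots> = t (\<lambda>v w. \<phi> v * \<beta> e w)" by (rule slice_right(2)[OF V W l t l'])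
    also have "\<dots> = (\<Sum>e'\<in>B. \<phi> e' * \<beta> e (y e'))" by (rule B(5)[OF product_bilinear[OF l' l]])
    also have "\<dots> = (\<Sum>e'\<in>{e}. \<phi> e' * \<beta> e (y e'))"
      by (rule sum.mono_neutral_right) (use B that \<phi>(3) V.span_base in auto)
    finally show ?thesis using \<phi> by simp
  qed
  then show ?thesis using B(5)[OF \<beta>] by simp
qed

lemma eval_param_linear:
  assumes X: "is_vspace X" and V: "is_vspace V" and W: "is_vspace W" and t: "t \<in> vcar (V \<Otimes> W)"
    and 1: "\<And>x. x \<in> vcar X \<Longrightarrow> bilinear_on V W ground (\<gamma> x)"
    and 2: "\<And>v w. v \<in> vcar V \<Longrightarrow> w \<in> vcar W \<Longrightarrow> linear_on X ground (\<lambda>x. \<gamma> x v w)"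
  shows "linear_on X ground (\<lambda>x. t (\<gamma> x))"
proof -
  have "t (\<gamma> (x + y)) = t (\<gamma> x) + t (\<gamma> y)" if "x \<in> vcar X" "y \<in> vcar X" for x y
  proof -
    have "t (\<gamma> (x + y)) = t (\<lambda>v w. \<gamma> x v w + \<gamma> y v w)"
      by (rule eval_cong[OF V W t]) (use linear_onD(2)[OF 2] that in auto)
    then show ?thesis using eval_add[OF V t 1 1] that by simp
  qed
  moreover have "t (\<gamma> (vscale X c x)) = c * t (\<gamma> x)" if "x \<in> vcar X" for x c
  proof -
    have "t (\<gamma> (vscale X c x)) = t (\<lambda>v w. c * \<gamma> x v w)"
      by (rule eval_cong[OF V W t]) (use linear_onD(3)[OF 2] that in auto)
    then show ?thesis using eval_scale[OF V t 1] that by simp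
  qed
  ultimately show ?thesis by (simp add: linear_on_def)
qed

text \<open>
  For fixed \<open>t\<close> the left-hand side is a linear functional of \<open>s\<close>, hence evaluation of \<open>s\<close> at a bilinear form.
\<close>

lemma eval_swap:
  assumes V: "is_vspace V" and W: "is_vspace W" and t: "t \<in> vcar (V \<Otimes> W)"
    and V': "is_vspace V'" and W': "is_vspace W'" and s: "s \<in> vcar (V' \<Otimes> W')"
    and 1: "\<And>u v. u \<in> vcar V' \<Longrightarrow> v \<in> vcar W' \<Longrightarrow> bilinear_on V W ground (\<lambda>x y. \<gamma> x y u v)"
    and 2: "\<And>x y. x \<in> vcar V \<Longrightarrow> y \<in> vcar W \<Longrightarrow> bilinear_on V' W' ground (\<gamma> x y)"
  shows "t (\<lambda>x y. s (\<gamma> x y)) = s (\<lambda>u v. t (\<lambda>x y. \<gamma> x y u v))"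
proof -
  have b: "bilinear_on V W ground (\<lambda>x y. s (\<gamma> x y))" if s: "s \<in> vcar (V' \<Otimes> W')" for s
    unfolding bilinear_on_def
    by (auto intro!: eval_param_linear[OF _ V' W' s] V W 2 dest: bilinear_onD[OF 1])
  have "linear_on (V' \<Otimes> W') ground (\<lambda>s. t (\<lambda>x y. s (\<gamma> x y)))"
    by (rule eval_param_linear[OF is_vspace_tensor V W t b eval_linear])
  from functional_eval(1)[OF V' W' this s]
  have "t (\<lambda>x y. s (\<gamma> x y)) = s (\<lambda>u v. t (\<lambda>x y. tens V' W' u v (\<gamma> x y)))" .
  also have "\<dots> = s (\<lambda>u v. t (\<lambda>x y. \<gamma> x y u v))"
    by (intro eval_cong[OF V' W' s] eval_cong[OF V W t] tens_eval 2)
  finally show ?thesis .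
qed

lemma linear_onI_functionals:
  assumes X: "is_vspace X" and U: "is_vspace U" and car: "\<And>x. x \<in> vcar X \<Longrightarrow> f x \<in> vcar U"
    and lin: "\<And>\<Phi>. linear_on U ground \<Phi> \<Longrightarrow> linear_on X ground (\<lambda>x. \<Phi> (f x))"
  shows "linear_on X U f"
proof -
  have "f (x + y) = f x + f y" if "x \<in> vcar X" "y \<in> vcar X" for x y
  proof (rule functionals_separate[OF U])
    fix \<Phi> assume "linear_on U ground \<Phi>"
    then show "\<Phi> (f (x + y)) = \<Phi> (f x + f y)" using that lin[of \<Phi>] car by (simp add: linear_on_def)
  qed (use that in \<open>auto intro!: is_vspaceD[OF X] is_vspaceD[OF U] car\<close>)
  moreover have "f (vscale X c x) = vscale U c (f x)" if "x \<in> vcar X" for x c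
  proof (rule functionals_separate[OF U])
    fix \<Phi> assume "linear_on U ground \<Phi>"
    then show "\<Phi> (f (vscale X c x)) = \<Phi> (vscale U c (f x))" using that lin[of \<Phi>] car by (simp add: linear_on_def)
  qed (use that in \<open>auto intro!: is_vspaceD[OF X] is_vspaceD[OF U] car\<close>)
  ultimately show ?thesis using car by (simp add: linear_on_def)
qed

lemma linear_into_tensorI:
  assumes X: "is_vspace X" and V: "is_vspace V" and W: "is_vspace W"
    and car: "\<And>x. x \<in> vcar X \<Longrightarrow> f x \<in> vcar (V \<Otimes> W)"
    and lin: "\<And>\<beta>. bilinear_on V W ground \<beta> \<Longrightarrow> linear_on X ground (\<lambda>x. f x \<beta>)"
  shows "linear_on X (V \<Otimes> W) f"
proof (rule linear_onI_functionals[OF X is_vspace_tensor car])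
  fix \<Phi> assume \<Phi>: "linear_on (V \<Otimes> W) ground \<Phi>"
  have "linear_on X ground (\<lambda>x. \<Phi> (f x)) \<longleftrightarrow> linear_on X ground (\<lambda>x. f x (\<lambda>v w. \<Phi> (tens V W v w)))"
    by (rule linear_on_cong[OF X]) (rule functional_eval(1)[OF V W \<Phi> car])
  then show "linear_on X ground (\<lambda>x. \<Phi> (f x))"
    using lin[OF functional_eval(2)[OF V W \<Phi> is_vspaceD(2)[OF is_vspace_tensor]]] by simp
qed

lemma tens_linear:
  assumes "is_vspace V" "is_vspace W"
  shows "w \<in> vcar W \<Longrightarrow> linear_on V (V \<Otimes> W) (\<lambda>v. tens V W v w)"
    "v \<in> vcar V \<Longrightarrow> linear_on W (V \<Otimes> W) (tens V W v)"
  using tens_bilinear[OF assms] by (auto dest: bilinear_onD)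

lemma bilinear_comp:
  assumes "linear_on V V' f" "linear_on W W' g" "bilinear_on V' W' U \<beta>"
  shows "bilinear_on V W U (\<lambda>v w. \<beta> (f v) (g w))"
  unfolding bilinear_on_def
proof (intro conjI ballI)
  fix w assume "w \<in> vcar W"
  then show "linear_on V U (\<lambda>v. \<beta> (f v) (g w))"
    using linear_on_comp[OF assms(1) bilinear_onD(1)[OF assms(3)]] linear_onD(1)[OF assms(2)] by blast
next
  fix v assume "v \<in> vcar V"
  then show "linear_on W U (\<lambda>w. \<beta> (f v) (g w))"
    using linear_on_comp[OF assms(2) bilinear_onD(2)[OF assms(3)]] linear_onD(1)[OF assms(1)] by blast
qed

lemma tmap_bilinear:
  assumes "is_vspace V'" "is_vspace W'" "linear_on V V' f" "linear_on W W' g"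
  shows "bilinear_on V W (V' \<Otimes> W') (\<lambda>v w. tens V' W' (f v) (g w))"
  by (rule bilinear_comp[OF assms(3,4) tens_bilinear[OF assms(1,2)]])

lemma tmap_eval:
  assumes "is_vspace V" "is_vspace W" "is_vspace V'" "is_vspace W'"
    "linear_on V V' f" "linear_on W W' g" "t \<in> vcar (V \<Otimes> W)" "bilinear_on V' W' ground \<beta>"
  shows "tmap V W V' W' f g t \<beta> = t (\<lambda>v w. \<beta> (f v) (g w))"
proof -
  have "tmap V W V' W' f g t \<beta> = t (\<lambda>v w. tens V' W' (f v) (g w) \<beta>)"
    unfolding tmap_def
    by (rule tlift_eval[OF assms(1,2) is_vspace_tensor tmap_bilinear[OF assms(3-6)] eval_linear assms(7)])
  then show ?thesis by (simp add: tens_eval[OF assms(8)])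
qed

lemma tmap_linear:
  assumes "is_vspace V'" "is_vspace W'" "linear_on V V' f" "linear_on W W' g"
  shows "linear_on (V \<Otimes> W) (V' \<Otimes> W') (tmap V W V' W' f g)"
  unfolding tmap_def by (rule tlift_linear[OF is_vspace_tensor tmap_bilinear[OF assms]])

lemma tmap_tens:
  assumes "is_vspace V'" "is_vspace W'" "linear_on V V' f" "linear_on W W' g"
    "v \<in> vcar V" "w \<in> vcar W"
  shows "tmap V W V' W' f g (tens V W v w) = tens V' W' (f v) (g w)"
  unfolding tmap_def by (rule tlift_tens[OF is_vspace_tensor tmap_bilinear[OF assms(1-4)] assms(5,6)])

lemma tmap_Lin:
  assumes "is_vspace V'" "is_vspace W'" "linear_on V V' f" "linear_on W W' g"
  shows "tmap V W V' W' f g \<in> Lin (V \<Otimes> W) (V' \<Otimes> W')"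
  unfolding tmap_def by (rule tlift_Lin[OF is_vspace_tensor tmap_bilinear[OF assms]])

lemma idm_linear: "is_vspace V \<Longrightarrow> linear_on V V (idm V)"
  by (auto simp: linear_on_def idm_def is_vspaceD)

lemma tw_bilinear:
  assumes "is_vspace V" "is_vspace W"
  shows "bilinear_on V W (W \<Otimes> V) (\<lambda>v w. tens W V w v)"
  using tens_linear[OF assms(2,1)] by (simp add: bilinear_on_def)

lemma tw_eval:
  assumes "is_vspace V" "is_vspace W" "t \<in> vcar (V \<Otimes> W)" "bilinear_on W V ground \<beta>"
  shows "tw V W t \<beta> = t (\<lambda>v w. \<beta> w v)"
proof -
  have "tw V W t \<beta> = t (\<lambda>v w. tens W V w v \<beta>)" unfolding tw_def
    by (rule tlift_eval[OF assms(1,2) is_vspace_tensor tw_bilinear[OF assms(1,2)] eval_linear assms(3)])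
  then show ?thesis by (simp add: tens_eval[OF assms(4)])
qed

lemma tw_linear:
  assumes "is_vspace V" "is_vspace W"
  shows "linear_on (V \<Otimes> W) (W \<Otimes> V) (tw V W)"
  unfolding tw_def by (rule tlift_linear[OF is_vspace_tensor tw_bilinear[OF assms]])

section \<open>Threefold tensor products\<close>

text \<open>
  The universal property in two of three arguments; both associativity isomorphisms have this form.
\<close>

lemma tlift_param_bilinear:
  assumes U: "is_vspace U" and V: "is_vspace V" and W: "is_vspace W" and X: "is_vspace X"
    and 1: "\<And>w. w \<in> vcar W \<Longrightarrow> bilinear_on U V X (\<lambda>u v. c u v w)"
    and 2: "\<And>u v. u \<in> vcar U \<Longrightarrow> v \<in> vcar V \<Longrightarrow> linear_on W X (c u v)"
  shows "bilinear_on (U \<Otimes> V) W X (\<lambda>t w. tlift U V X (\<lambda>u v. c u v w) t)"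
  unfolding bilinear_on_def
proof (intro conjI ballI)
  fix w assume "w \<in> vcar W"
  then show "linear_on (U \<Otimes> V) X (tlift U V X (\<lambda>u v. c u v w))" by (intro tlift_linear X 1)
next
  fix t assume t: "t \<in> vcar (U \<Otimes> V)"
  show "linear_on W X (\<lambda>w. tlift U V X (\<lambda>u v. c u v w) t)"
  proof (rule linear_onI_functionals[OF W X])
    show "tlift U V X (\<lambda>u v. c u v w) t \<in> vcar X" if "w \<in> vcar W" for w by (intro tlift_in X 1 that t)
    fix \<Phi> assume \<Phi>: "linear_on X ground \<Phi>"
    have "linear_on W ground (\<lambda>w. t (\<lambda>u v. \<Phi> (c u v w)))"
    proof (rule eval_param_linear[OF W U V t])
      show "bilinear_on U V ground (\<lambda>u v. \<Phi> (c u v w))" if "w \<in> vcar W" for w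
        unfolding bilinear_on_def
        by (intro conjI ballI linear_on_comp[OF _ \<Phi>] bilinear_onD[OF 1[OF that]])
      show "linear_on W ground (\<lambda>w. \<Phi> (c u v w))" if "u \<in> vcar U" "v \<in> vcar V" for u v
        by (rule linear_on_comp[OF 2[OF that] \<Phi>])
    qed
    then show "linear_on W ground (\<lambda>w. \<Phi> (tlift U V X (\<lambda>u v. c u v w) t))"
      using linear_on_cong[OF W, of "\<lambda>w. \<Phi> (tlift U V X (\<lambda>u v. c u v w) t)" "\<lambda>w. t (\<lambda>u v. \<Phi> (c u v w))"]
        tlift_eval[OF U V X 1 \<Phi> t] by simp
  qed
qed

context
  fixes U :: "('k::field, 'u::ab_group_add) vspace" and V :: "('k, 'v::ab_group_add) vspace"
    and W :: "('k, 'w::ab_group_add) vspace"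
  assumes U: "is_vspace U" and V: "is_vspace V" and W: "is_vspace W"
begin

lemma assoc_bilinear:
  "w \<in> vcar W \<Longrightarrow> bilinear_on U V (U \<Otimes> (V \<Otimes> W)) (\<lambda>u v. tens U (V \<Otimes> W) u (tens V W v w))"
  "u \<in> vcar U \<Longrightarrow> v \<in> vcar V \<Longrightarrow> linear_on W (U \<Otimes> (V \<Otimes> W)) (\<lambda>w. tens U (V \<Otimes> W) u (tens V W v w))"
  unfolding bilinear_on_def
  by (intro conjI ballI tens_linear(1)[OF U is_vspace_tensor] tens_in
      linear_on_comp[OF tens_linear(1)[OF V W] tens_linear(2)[OF U is_vspace_tensor]]
      linear_on_comp[OF tens_linear(2)[OF V W] tens_linear(2)[OF U is_vspace_tensor]]; assumption)+

lemma assoc_inv_bilinear: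
  "u \<in> vcar U \<Longrightarrow> bilinear_on V W (U \<Otimes> V \<Otimes> W) (\<lambda>v w. tens (U \<Otimes> V) W (tens U V u v) w)"
  "v \<in> vcar V \<Longrightarrow> w \<in> vcar W \<Longrightarrow> linear_on U (U \<Otimes> V \<Otimes> W) (\<lambda>u. tens (U \<Otimes> V) W (tens U V u v) w)"
  unfolding bilinear_on_def
  by (intro conjI ballI tens_linear(2)[OF is_vspace_tensor W] tens_in
      linear_on_comp[OF tens_linear(2)[OF U V] tens_linear(1)[OF is_vspace_tensor W]]
      linear_on_comp[OF tens_linear(1)[OF U V] tens_linear(1)[OF is_vspace_tensor W]]; assumption)+

lemmas assoc_bilinear' = tlift_param_bilinear[OF U V W is_vspace_tensor assoc_bilinear]

lemma assoc_inv_bilinear':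
  "bilinear_on U (V \<Otimes> W) (U \<Otimes> V \<Otimes> W)
    (\<lambda>u y. tlift V W (U \<Otimes> V \<Otimes> W) (\<lambda>v w. tens (U \<Otimes> V) W (tens U V u v) w) y)"
  using tlift_param_bilinear[OF V W U is_vspace_tensor assoc_inv_bilinear]
  by (simp add: bilinear_on_def)

lemma assoc_linear: "linear_on (U \<Otimes> V \<Otimes> W) (U \<Otimes> (V \<Otimes> W)) (assoc U V W)"
  unfolding assoc_def by (rule tlift_linear[OF is_vspace_tensor assoc_bilinear'])

lemma assoc_eval:
  assumes s: "s \<in> vcar (U \<Otimes> V \<Otimes> W)" and b: "bilinear_on U (V \<Otimes> W) ground \<beta>"
  shows "assoc U V W s \<beta> = s (\<lambda>t w. t (\<lambda>u v. \<beta> u (tens V W v w)))"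
proof -
  have "assoc U V W s \<beta> =
    s (\<lambda>x w. tlift U V (U \<Otimes> (V \<Otimes> W)) (\<lambda>u v. tens U (V \<Otimes> W) u (tens V W v w)) x \<beta>)"
    unfolding assoc_def
    by (rule tlift_eval[OF is_vspace_tensor W is_vspace_tensor assoc_bilinear' eval_linear s])
  also have "\<dots> = s (\<lambda>t w. t (\<lambda>u v. \<beta> u (tens V W v w)))"
  proof (rule eval_cong[OF is_vspace_tensor W s])
    fix x w assume "x \<in> vcar (U \<Otimes> V)" "w \<in> vcar W"
    then show "tlift U V (U \<Otimes> (V \<Otimes> W)) (\<lambda>u v. tens U (V \<Otimes> W) u (tens V W v w)) x \<beta> =
        x (\<lambda>u v. \<beta> u (tens V W v w))"
      using tlift_eval[OF U V is_vspace_tensor assoc_bilinear(1) eval_linear[of _ _ \<beta>]]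
      by (simp add: tens_eval[OF b])
  qed
  finally show ?thesis .
qed

lemma assoc_inv_linear: "linear_on (U \<Otimes> (V \<Otimes> W)) (U \<Otimes> V \<Otimes> W) (assoc_inv U V W)"
  unfolding assoc_inv_def by (rule tlift_linear[OF is_vspace_tensor assoc_inv_bilinear'])

lemma assoc_inv_eval:
  assumes s: "s \<in> vcar (U \<Otimes> (V \<Otimes> W))" and b: "bilinear_on (U \<Otimes> V) W ground \<beta>"
  shows "assoc_inv U V W s \<beta> = s (\<lambda>u y. y (\<lambda>v w. \<beta> (tens U V u v) w))"
proof -
  have "assoc_inv U V W s \<beta> =
    s (\<lambda>u y. tlift V W (U \<Otimes> V \<Otimes> W) (\<lambda>v w. tens (U \<Otimes> V) W (tens U V u v) w) y \<beta>)"
    unfolding assoc_inv_def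
    by (rule tlift_eval[OF U is_vspace_tensor is_vspace_tensor assoc_inv_bilinear' eval_linear s])
  also have "\<dots> = s (\<lambda>u y. y (\<lambda>v w. \<beta> (tens U V u v) w))"
  proof (rule eval_cong[OF U is_vspace_tensor s])
    fix u y assume "u \<in> vcar U" "y \<in> vcar (V \<Otimes> W)"
    then show "tlift V W (U \<Otimes> V \<Otimes> W) (\<lambda>v w. tens (U \<Otimes> V) W (tens U V u v) w) y \<beta> =
        y (\<lambda>v w. \<beta> (tens U V u v) w)"
      using tlift_eval[OF V W is_vspace_tensor assoc_inv_bilinear(1) eval_linear[of _ _ \<beta>]]
      by (simp add: tens_eval[OF b])
  qed
  finally show ?thesis .
qed

lemma bilinear_assoc_form:
  assumes b: "bilinear_on (U \<Otimes> V) W ground \<beta>"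
  shows "bilinear_on U (V \<Otimes> W) ground (\<lambda>u y. y (\<lambda>v w. \<beta> (tens U V u v) w))"
  unfolding bilinear_on_def
proof (intro conjI ballI eval_linear)
  fix y assume y: "y \<in> vcar (V \<Otimes> W)"
  show "linear_on U ground (\<lambda>u. y (\<lambda>v w. \<beta> (tens U V u v) w))"
  proof (rule eval_param_linear[OF U V W y])
    fix u assume u: "u \<in> vcar U"
    show "bilinear_on V W ground (\<lambda>v w. \<beta> (tens U V u v) w)"
      by (rule bilinear_comp[OF tens_linear(2)[OF U V u] _ b, of W "\<lambda>u. u"]) (simp add: linear_on_def)
  next
    fix v w assume "v \<in> vcar V" "w \<in> vcar W"
    then show "linear_on U ground (\<lambda>u. \<beta> (tens U V u v) w)"
      by (intro linear_on_comp[OF tens_linear(1)[OF U V] bilinear_onD(1)[OF b]])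
  qed
qed

end

section \<open>Multipliers of nondegenerate algebras\<close>

lemma is_vspace_multiplier_algebra:
  assumes V: "is_vspace V" and m: "bilinear_on V V V m"
  shows "is_vspace (multiplier_algebra V m)"
proof -
  interpret vector_space "vscale V" by (rule is_vspaceD[OF V])
  have sc: "vscale (multiplier_algebra V m) c x = (\<lambda>b. vscale V c (fst x b), \<lambda>b. vscale V c (snd x b))" for c x
    by (simp add: multiplier_algebra_def)
  have iff: "x \<in> vcar (multiplier_algebra V m) \<longleftrightarrow> fst x \<in> Lin V V \<and> snd x \<in> Lin V V \<and>
      (\<forall>a\<in>vcar V. \<forall>b\<in>vcar V. m a (fst x b) = m (snd x a) b)" for x
    by (auto simp: multiplier_algebra_def)
  note m1 = bilinear_onD(1)[OF m] and m2 = bilinear_onD(2)[OF m]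
  have Lin_add: "f + g \<in> Lin V V" if "f \<in> Lin V V" "g \<in> Lin V V" for f g
    using that is_vspaceD[OF V] by (auto simp: Lin_def linear_on_def scale_right_distrib algebra_simps)
  have Lin_scale: "(\<lambda>x. vscale V c (f x)) \<in> Lin V V" if "f \<in> Lin V V" for f c
    using that is_vspaceD[OF V] by (auto simp: Lin_def linear_on_def scale_right_distrib scale_left_commute)
  show ?thesis
  proof (rule is_vspaceI)
    show "vector_space (vscale (multiplier_algebra V m))"
      by unfold_locales (auto simp: sc fun_eq_iff scale_right_distrib scale_left_distrib)
    have "0 \<in> Lin V V" using is_vspaceD[OF V] by (simp add: Lin_def linear_on_def)
    then show "0 \<in> vcar (multiplier_algebra V m)"
      using linear_on_zero[OF V m1] linear_on_zero[OF V m2] by (simp add: iff)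
    fix x y assume x: "x \<in> vcar (multiplier_algebra V m)" and y: "y \<in> vcar (multiplier_algebra V m)"
    have "m a (fst x b + fst y b) = m (snd x a + snd y a) b" if ab: "a \<in> vcar V" "b \<in> vcar V" for a b
    proof -
      have "fst x b \<in> vcar V" "fst y b \<in> vcar V" "snd x a \<in> vcar V" "snd y a \<in> vcar V"
        using x y ab linear_onD(1)[OF LinD(1)] unfolding iff by metis+
      then show ?thesis
        using x y ab linear_onD(2)[OF m1[OF ab(2)]] linear_onD(2)[OF m2[OF ab(1)]] by (simp add: iff)
    qed
    then show "x + y \<in> vcar (multiplier_algebra V m)" using x y Lin_add by (simp add: iff)
  next
    fix c x assume x: "x \<in> vcar (multiplier_algebra V m)"
    have "m a (vscale V c (fst x b)) = m (vscale V c (snd x a)) b" if ab: "a \<in> vcar V" "b \<in> vcar V" for a b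
    proof -
      have "fst x b \<in> vcar V" "snd x a \<in> vcar V"
        using x ab linear_onD(1)[OF LinD(1)] unfolding iff by metis+
      then show ?thesis
        using x ab linear_onD(3)[OF m1[OF ab(2)]] linear_onD(3)[OF m2[OF ab(1)]] by (simp add: iff)
    qed
    then show "vscale (multiplier_algebra V m) c x \<in> vcar (multiplier_algebra V m)"
      using x Lin_scale by (simp add: iff sc)
  qed
qed

lemma span_induct_carrier [consumes 3, case_names base zero add scale]:
  assumes "is_vspace V" "vcar V \<subseteq> module.span (vscale V) S" "x \<in> vcar V"
    and "\<And>x. x \<in> S \<Longrightarrow> P x" "P 0" "\<And>x y. P x \<Longrightarrow> P y \<Longrightarrow> P (x + y)" "\<And>c x. P x \<Longrightarrow> P (vscale V c x)"
  shows "P x"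
proof -
  interpret vector_space "vscale V" by (rule is_vspaceD[OF assms(1)])
  have "x \<in> span S" using assms by auto
  then show ?thesis by (induction rule: span_induct_alt) (use assms in auto)
qed

text \<open>
  The identity \<open>m z (l x) = m w x\<close> determines \<open>l x\<close>, since the elements \<open>z\<close> span and \<open>m\<close> is nondegenerate.
  This uniqueness makes \<open>l\<close> well defined and linear, and the existence of \<open>l x\<close> passes from generators to sums.
\<close>

lemma one_sided_extension:
  assumes V: "is_vspace V" and m: "bilinear_on V V V m"
    and nondeg: "\<And>y. y \<in> vcar V \<Longrightarrow> (\<And>z. z \<in> vcar V \<Longrightarrow> m z y = 0) \<Longrightarrow> y = 0"
    and G: "G \<subseteq> vcar V \<times> vcar V" "vcar V \<subseteq> module.span (vscale V) (fst ` G)"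
    and K: "K \<subseteq> vcar V \<times> vcar V" "vcar V \<subseteq> module.span (vscale V) (fst ` K)"
    and compat: "\<And>x y z w. (x, y) \<in> G \<Longrightarrow> (z, w) \<in> K \<Longrightarrow> m z y = m w x"
  obtains l where "l \<in> Lin V V" "\<And>x y. (x, y) \<in> G \<Longrightarrow> l x = y"
    "\<And>x z w. x \<in> vcar V \<Longrightarrow> (z, w) \<in> K \<Longrightarrow> m z (l x) = m w x"
proof -
  note m1 = bilinear_onD(1)[OF m] and m2 = bilinear_onD(2)[OF m] and car = is_vspaceD[OF V]
  define Q where "Q x y \<longleftrightarrow> y \<in> vcar V \<and> (\<forall>(z, w)\<in>K. m z y = m w x)" for x y
  have uniq: "y = y'" if "Q x y" "Q x y'" for x y y'
  proof -
    have y: "y \<in> vcar V" "y' \<in> vcar V" using that by (auto simp: Q_def)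
    have "m z y = m z y' \<and> z \<in> vcar V" if "z \<in> vcar V" for z
      using V K(2) that
    proof (induction rule: span_induct_carrier)
      case (base z)
      then show ?case using \<open>Q x y\<close> \<open>Q x y'\<close> K(1) by (fastforce simp: Q_def)
    next
      case zero
      then show ?case using y linear_on_zero[OF V m1] car by simp
    next
      case (add z z')
      then show ?case using linear_onD(2)[OF m1[OF y(1)]] linear_onD(2)[OF m1[OF y(2)]] car by simp
    next
      case (scale c z)
      then show ?case using linear_onD(3)[OF m1[OF y(1)]] linear_onD(3)[OF m1[OF y(2)]] car by simp
    qed
    then have "m z (y - y') = 0" if "z \<in> vcar V" for z
      using linear_on_diff[OF V m2[OF that] y] that by simp
    then have "y - y' = 0" using nondeg car(4)[OF y] by blast
    then show ?thesis by simp
  qed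
  have Kc: "z \<in> vcar V" "w \<in> vcar V" if "(z, w) \<in> K" for z w using that K(1) by auto
  have Q_add: "Q (x + x') (y + y')" if "Q x y" "Q x' y'" "x \<in> vcar V" "x' \<in> vcar V" for x y x' y'
  proof -
    have "m z (y + y') = m w (x + x')" if "(z, w) \<in> K" for z w
    proof -
      have "m z y = m w x" "m z y' = m w x'" "y \<in> vcar V" "y' \<in> vcar V"
        using \<open>Q x y\<close> \<open>Q x' y'\<close> that by (auto simp: Q_def)
      then show ?thesis
        using linear_onD(2)[OF m2[OF Kc(1)[OF that]]] linear_onD(2)[OF m2[OF Kc(2)[OF that]]]
          \<open>x \<in> vcar V\<close> \<open>x' \<in> vcar V\<close> by simp
    qed
    then show ?thesis using that car(3) by (auto simp: Q_def)
  qed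
  have Q_scale: "Q (vscale V c x) (vscale V c y)" if "Q x y" "x \<in> vcar V" for c x y
  proof -
    have "m z (vscale V c y) = m w (vscale V c x)" if "(z, w) \<in> K" for z w
    proof -
      have "m z y = m w x" "y \<in> vcar V" using \<open>Q x y\<close> that by (auto simp: Q_def)
      then show ?thesis
        using linear_onD(3)[OF m2[OF Kc(1)[OF that]]] linear_onD(3)[OF m2[OF Kc(2)[OF that]]]
          \<open>x \<in> vcar V\<close> by simp
    qed
    then show ?thesis using that car(5) by (auto simp: Q_def)
  qed
  have Q_G: "Q x y" if "(x, y) \<in> G" for x y
    using that G(1) compat by (auto simp: Q_def)
  have ex: "x \<in> vcar V \<and> (\<exists>y. Q x y)" if "x \<in> vcar V" for x
    using V G(2) that
  proof (induction rule: span_induct_carrier)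
    case (base x)
    then show ?case using Q_G G(1) by fastforce
  next
    case zero
    have "m z 0 = m w 0" if "(z, w) \<in> K" for z w
      using linear_on_zero[OF V m2[OF Kc(1)[OF that]]] linear_on_zero[OF V m2[OF Kc(2)[OF that]]] by simp
    then have "Q 0 0" using car(2) by (auto simp: Q_def)
    then show ?case using car by blast
  next
    case (add x y)
    then show ?case using Q_add car by blast
  next
    case (scale c x)
    then show ?case using Q_scale car by blast
  qed
  define l where "l x = (if x \<in> vcar V then (THE y. Q x y) else 0)" for x
  have lQ: "Q x (l x)" if "x \<in> vcar V" for x
    using ex[OF that] theI'[of "Q x"] uniq that unfolding l_def by (metis (mono_tags, lifting))
  have l_eq: "l x = y" if "Q x y" "x \<in> vcar V" for x y using uniq lQ that by blast
  show ?thesis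
  proof (rule that[of l])
    have "linear_on V V l"
      unfolding linear_on_def
    proof (intro conjI ballI allI)
      fix x assume x: "x \<in> vcar V"
      show "l x \<in> vcar V" using lQ[OF x] by (simp add: Q_def)
      show "l (vscale V c x) = vscale V c (l x)" for c
        by (rule l_eq[OF Q_scale[OF lQ[OF x] x] car(5)[OF x]])
      fix y assume y: "y \<in> vcar V"
      show "l (x + y) = l x + l y"
        by (rule l_eq[OF Q_add[OF lQ[OF x] lQ[OF y] x y] car(3)[OF x y]])
    qed
    then show "l \<in> Lin V V" by (simp add: Lin_def l_def)
    show "l x = y" if "(x, y) \<in> G" for x y using l_eq[OF Q_G[OF that]] that G(1) by auto
    show "m z (l x) = m w x" if "x \<in> vcar V" "(z, w) \<in> K" for x z w
      using lQ[OF that(1)] that(2) by (auto simp: Q_def)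
  qed
qed

text \<open>
  Each of the two actions is determined by the prescribed values of the other, so that both are
  constructed separately; the multiplier identity extends from generators by linearity. This produces the
  canonical multiplier \<open>F\<close>, whose defining formulas only concern products.
\<close>

lemma multiplier_extension:
  assumes V: "is_vspace V" and m: "bilinear_on V V V m"
    and nondeg: "\<And>y. y \<in> vcar V \<Longrightarrow> (\<And>z. z \<in> vcar V \<Longrightarrow> m z y = 0) \<Longrightarrow> y = 0"
      "\<And>y. y \<in> vcar V \<Longrightarrow> (\<And>z. z \<in> vcar V \<Longrightarrow> m y z = 0) \<Longrightarrow> y = 0"
    and G: "G \<subseteq> vcar V \<times> vcar V" "vcar V \<subseteq> module.span (vscale V) (fst ` G)"
    and K: "K \<subseteq> vcar V \<times> vcar V" "vcar V \<subseteq> module.span (vscale V) (fst ` K)"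
    and compat: "\<And>x y z w. (x, y) \<in> G \<Longrightarrow> (z, w) \<in> K \<Longrightarrow> m z y = m w x"
  obtains F where "F \<in> vcar (multiplier_algebra V m)" "\<And>x y. (x, y) \<in> G \<Longrightarrow> fst F x = y"
    "\<And>z w. (z, w) \<in> K \<Longrightarrow> snd F z = w"
proof -
  obtain l where l: "l \<in> Lin V V" "\<And>x y. (x, y) \<in> G \<Longrightarrow> l x = y"
    "\<And>x z w. x \<in> vcar V \<Longrightarrow> (z, w) \<in> K \<Longrightarrow> m z (l x) = m w x"
    using one_sided_extension[OF V m nondeg(1) G K compat] by blast
  have m': "bilinear_on V V V (\<lambda>a b. m b a)" using m by (simp add: bilinear_on_def)
  obtain r where r: "r \<in> Lin V V" "\<And>x y. (x, y) \<in> K \<Longrightarrow> r x = y"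
    "\<And>x z w. x \<in> vcar V \<Longrightarrow> (z, w) \<in> G \<Longrightarrow> m (r x) z = m x w"
    using one_sided_extension[OF V m' nondeg(2) K G compat[symmetric]] by blast
  note lr = linear_onD[OF LinD(1)[OF l(1)]] linear_onD[OF LinD(1)[OF r(1)]]
  have "m z (l x) = m (r z) x \<and> z \<in> vcar V" if x: "x \<in> vcar V" and z: "z \<in> vcar V" for x z
    using V K(2) z
  proof (induction rule: span_induct_carrier)
    case (base z)
    then show ?case using l(3)[OF x] r(2) K(1) by fastforce
  next
    case zero
    then show ?case
      using linear_on_zero[OF V bilinear_onD(1)[OF m]] lr x linear_on_zero[OF V LinD(1)[OF r(1)]] is_vspaceD[OF V] by simp
  next
    case (add z z')
    then show ?case
      using linear_onD(2)[OF bilinear_onD(1)[OF m]] lr x is_vspaceD[OF V] by simp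
  next
    case (scale c z)
    then show ?case
      using linear_onD(3)[OF bilinear_onD(1)[OF m]] lr x is_vspaceD[OF V] by simp
  qed
  then have "(l, r) \<in> vcar (multiplier_algebra V m)"
    using l(1) r(1) by (simp add: multiplier_algebra_def)
  then show ?thesis using that[of "(l, r)"] l(2) r(2) by simp
qed

lemma linear_eq_on_tensors:
  assumes V: "is_vspace V" and f: "linear_on (V \<Otimes> W) U f" and g: "linear_on (V \<Otimes> W) U g"
    and eq: "\<And>v w. v \<in> vcar V \<Longrightarrow> w \<in> vcar W \<Longrightarrow> f (tens V W v w) = g (tens V W v w)"
    and t: "t \<in> vcar (V \<Otimes> W)"
  shows "f t = g t"
  using V t
proof (induction rule: tensor_induct)
  case zero
  have "f 0 = g 0" using linear_on_zero[OF is_vspace_tensor f] linear_on_zero[OF is_vspace_tensor g] by simp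
  then show ?case .
next
  case (tens v w t)
  then have "f (tens V W v w + t) = g (tens V W v w + t)"
    using linear_onD(2)[OF f tens_in tens(3)] linear_onD(2)[OF g tens_in tens(3)] eq by simp
  then show ?case .
qed

text \<open>
  The evaluations below are linear in each of their variables. The rules \<open>lin\<close> decompose such conditions
  along the syntax of the expression; rules for the forms and functionals at hand are added locally.
\<close>

named_theorems lin

section \<open>Sweedler calculus in a regular weak multiplier bialgebra\<close>

context regular_weak_multiplier_bialgebra
begin

abbreviation prod (infixl "\<cdot>" 75) where "a \<cdot> b \<equiv> mult H a b"
abbreviation \<epsilon> where "\<epsilon> \<equiv> counit H"
abbreviation lf where "lf \<equiv> linear_on (spc H) ground"
abbreviation le where "le \<equiv> linear_on (spc H) (spc H)"
abbreviation bl where "bl \<equiv> bilinear_on (spc H) (spc H) ground"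
abbreviation AA where "AA \<equiv> vcar (spc2 H)"

definition tri :: "('a \<Rightarrow> 'a \<Rightarrow> 'a \<Rightarrow> 'k) \<Rightarrow> bool" where
  "tri \<gamma> \<longleftrightarrow> (\<forall>y z. lf (\<lambda>x. \<gamma> x y z)) \<and> (\<forall>x z. lf (\<lambda>y. \<gamma> x y z)) \<and> (\<forall>x y. lf (\<gamma> x y))"

definition "e1 a b = E\<^sub>1 H (pure H a b)"
definition "e2 a b = E\<^sub>2 H (pure H a b)"
definition "t1 a b = T\<^sub>1 H (pure H a b)"
definition "t2 a b = T\<^sub>2 H (pure H a b)"
definition "t3 a b = T\<^sub>3 H (pure H a b)"
definition "t4 a b = T\<^sub>4 H (pure H a b)"

lemma carA [simp]: "vcar (spc H) = UNIV" and scaleA [simp]: "vscale (spc H) = smult H"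
  by (simp_all add: spc_def)

lemma is_vspaceA: "is_vspace (spc H)"
  using algebra by (simp add: is_algebra_def)

sublocale A: vector_space "smult H"
  using is_vspaceD(1)[OF is_vspaceA] by simp

lemma idmA: "idm (spc H) = (\<lambda>x. x)"
  by (simp add: idm_def fun_eq_iff)

lemma prod_bilinear: "bilinear_on (spc H) (spc H) (spc H) (mult H)"
  using algebra by (simp add: is_algebra_def)

lemma prod_assoc [simp]: "a \<cdot> b \<cdot> c = a \<cdot> (b \<cdot> c)"
  using algebra by (simp add: is_algebra_def)

lemma prod_eq_0: "(\<And>b. a \<cdot> b = 0) \<Longrightarrow> a = 0" "(\<And>b. b \<cdot> a = 0) \<Longrightarrow> a = 0"
  using nondegenerate unfolding nondegenerate_algebra_def carA by (metis UNIV_I)+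

subsection \<open>Linearity\<close>

lemma lf_0 [lin]: "lf (\<lambda>x. 0)"
  and lf_add [lin]: "lf f \<Longrightarrow> lf g \<Longrightarrow> lf (\<lambda>x. f x + g x)"
  and lf_mult_left [lin]: "lf f \<Longrightarrow> lf (\<lambda>x. c * f x)"
  and lf_mult_right [lin]: "lf f \<Longrightarrow> lf (\<lambda>x. f x * c)"
  by (auto simp: linear_on_def algebra_simps)

lemma lf_comp: "lf \<phi> \<Longrightarrow> le g \<Longrightarrow> lf (\<lambda>x. \<phi> (g x))"
  by (rule linear_on_comp)

lemma lf_eps [lin]: "le g \<Longrightarrow> lf (\<lambda>x. \<epsilon> (g x))"
  using LinD(1)[OF linear(7)] by (rule lf_comp)

lemma le_id [lin]: "le (\<lambda>x. x)"
  by (simp add: linear_on_def)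

lemma le_prod_left [lin]: "le g \<Longrightarrow> le (\<lambda>x. a \<cdot> g x)"
  by (rule linear_on_comp[OF _ bilinear_onD(2)[OF prod_bilinear]]) auto

lemma le_prod_right [lin]: "le g \<Longrightarrow> le (\<lambda>x. g x \<cdot> a)"
  by (rule linear_on_comp[OF _ bilinear_onD(1)[OF prod_bilinear]]) auto

lemma blI [lin]: "(\<And>y. lf (\<lambda>x. \<beta> x y)) \<Longrightarrow> (\<And>x. lf (\<lambda>y. \<beta> x y)) \<Longrightarrow> bl \<beta>"
  by (simp add: bilinear_on_def)

lemma bl_left: "bl \<beta> \<Longrightarrow> le g \<Longrightarrow> lf (\<lambda>x. \<beta> (g x) y)"
  by (rule linear_on_comp) (auto dest: bilinear_onD)

lemma bl_right: "bl \<beta> \<Longrightarrow> le g \<Longrightarrow> lf (\<lambda>x. \<beta> y (g x))"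
  by (rule linear_on_comp) (auto dest: bilinear_onD)

lemma tri1: "tri \<gamma> \<Longrightarrow> le g \<Longrightarrow> lf (\<lambda>x. \<gamma> (g x) y z)"
  unfolding tri_def by (rule linear_on_comp) auto

lemma tri2: "tri \<gamma> \<Longrightarrow> le g \<Longrightarrow> lf (\<lambda>x. \<gamma> y (g x) z)"
  unfolding tri_def by (rule linear_on_comp[of _ _ g _ "\<lambda>y'. \<gamma> y y' z"]) auto

lemma tri3: "tri \<gamma> \<Longrightarrow> le g \<Longrightarrow> lf (\<lambda>x. \<gamma> y z (g x))"
  unfolding tri_def by (rule linear_on_comp) auto

lemma triI [lin]: "(\<And>y z. lf (\<lambda>x. \<gamma> x y z)) \<Longrightarrow> (\<And>x z. lf (\<lambda>y. \<gamma> x y z)) \<Longrightarrow>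
    (\<And>x y. lf (\<lambda>z. \<gamma> x y z)) \<Longrightarrow> tri \<gamma>"
  by (simp add: tri_def)

lemma pure_in [simp]: "pure H a b \<in> AA"
  by (rule tens_in) auto

lemma structure_linear:
  "linear_on (spc2 H) (spc2 H) (E\<^sub>1 H)" "linear_on (spc2 H) (spc2 H) (E\<^sub>2 H)"
  "linear_on (spc2 H) (spc2 H) (T\<^sub>1 H)" "linear_on (spc2 H) (spc2 H) (T\<^sub>2 H)"
  "linear_on (spc2 H) (spc2 H) (T\<^sub>3 H)" "linear_on (spc2 H) (spc2 H) (T\<^sub>4 H)"
  by (rule LinD(1), rule linear)+

lemma structure_in [simp]:
  "e1 a b \<in> AA" "e2 a b \<in> AA" "t1 a b \<in> AA" "t2 a b \<in> AA" "t3 a b \<in> AA" "t4 a b \<in> AA"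
  unfolding e1_def e2_def t1_def t2_def t3_def t4_def
  by (rule linear_onD(1)[OF structure_linear(1)] linear_onD(1)[OF structure_linear(2)]
      linear_onD(1)[OF structure_linear(3)] linear_onD(1)[OF structure_linear(4)]
      linear_onD(1)[OF structure_linear(5)] linear_onD(1)[OF structure_linear(6)], simp)+

lemma map_eval:
  assumes "linear_on (spc2 H) (spc2 H) f" "t \<in> AA"
  shows "f t \<beta> = t (\<lambda>u v. f (pure H u v) \<beta>)"
  by (rule functional_eval(1)[OF is_vspaceA is_vspaceA linear_on_comp[OF assms(1) eval_linear] assms(2)])

lemma map_pure_linear:
  assumes f: "linear_on (spc2 H) (spc2 H) f" and g: "le g"
  shows "lf (\<lambda>x. f (pure H (g x) b) \<beta>)" "lf (\<lambda>x. f (pure H b (g x)) \<beta>)"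
proof -
  note l = linear_on_comp[OF f eval_linear]
  show "lf (\<lambda>x. f (pure H (g x) b) \<beta>)"
    by (rule linear_on_comp[OF g linear_on_comp[OF tens_linear(1)[OF is_vspaceA is_vspaceA] l]]) simp
  show "lf (\<lambda>x. f (pure H b (g x)) \<beta>)"
    by (rule linear_on_comp[OF g linear_on_comp[OF tens_linear(2)[OF is_vspaceA is_vspaceA] l]]) simp
qed

lemmas lf_structure [lin] =
  map_pure_linear(1)[OF structure_linear(1), folded e1_def] map_pure_linear(2)[OF structure_linear(1), folded e1_def]
  map_pure_linear(1)[OF structure_linear(2), folded e2_def] map_pure_linear(2)[OF structure_linear(2), folded e2_def]
  map_pure_linear(1)[OF structure_linear(3), folded t1_def] map_pure_linear(2)[OF structure_linear(3), folded t1_def]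
  map_pure_linear(1)[OF structure_linear(4), folded t2_def] map_pure_linear(2)[OF structure_linear(4), folded t2_def]
  map_pure_linear(1)[OF structure_linear(5), folded t3_def] map_pure_linear(2)[OF structure_linear(5), folded t3_def]
  map_pure_linear(1)[OF structure_linear(6), folded t4_def] map_pure_linear(2)[OF structure_linear(6), folded t4_def]

lemma lf_eval:
  assumes "t \<in> AA" "\<And>x. bl (\<gamma> x)" "\<And>u v. lf (\<lambda>x. \<gamma> x u v)"
  shows "lf (\<lambda>x. t (\<gamma> x))"
  by (rule eval_param_linear[OF is_vspaceA is_vspaceA is_vspaceA assms(1)]) (use assms in auto)

lemmas lf_evals [lin] = lf_eval[OF structure_in(1)] lf_eval[OF structure_in(2)] lf_eval[OF structure_in(3)]
  lf_eval[OF structure_in(4)] lf_eval[OF structure_in(5)] lf_eval[OF structure_in(6)]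

lemma eval_commute:
  assumes "t \<in> AA" "s \<in> AA" "\<And>u v. bl (\<lambda>x y. \<gamma> x y u v)" "\<And>x y. bl (\<gamma> x y)"
  shows "t (\<lambda>x y. s (\<lambda>u v. \<gamma> x y u v)) = s (\<lambda>u v. t (\<lambda>x y. \<gamma> x y u v))"
  by (rule eval_swap[OF is_vspaceA is_vspaceA assms(1) is_vspaceA is_vspaceA assms(2-4)])

lemma pure_eval: "bl \<beta> \<Longrightarrow> pure H a b \<beta> = \<beta> a b"
  by (rule tens_eval)

lemma eval_times:
  assumes "t \<in> AA" "bl \<beta>"
  shows "t (\<lambda>u v. c * \<beta> u v) = c * t \<beta>" "t (\<lambda>u v. \<beta> u v * c) = t \<beta> * c"
  using eval_scale[OF is_vspaceA assms] by (simp_all add: mult.commute)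

subsection \<open>Nondegeneracy\<close>

lemma A_eqI: "(\<And>\<phi>. lf \<phi> \<Longrightarrow> \<phi> a = \<phi> b) \<Longrightarrow> a = b"
  by (rule functionals_separate[OF is_vspaceA]) auto

lemma AA_eqI:
  assumes "t \<in> AA" "t' \<in> AA" "\<And>\<phi> \<psi>. lf \<phi> \<Longrightarrow> lf \<psi> \<Longrightarrow> t (\<lambda>u v. \<phi> u * \<psi> v) = t' (\<lambda>u v. \<phi> u * \<psi> v)"
  shows "t = t'"
  by (rule tensor_eqI[OF is_vspaceA is_vspaceA assms])

lemma prod_diff: "a \<cdot> (b - c) = a \<cdot> b - a \<cdot> c" "(b - c) \<cdot> a = b \<cdot> a - c \<cdot> a"
  using linear_on_diff[OF is_vspaceA le_prod_left[OF le_id], of b c a]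
    linear_on_diff[OF is_vspaceA le_prod_right[OF le_id], of b c a] by auto

lemma left_cancel: "(\<And>\<phi> p. lf \<phi> \<Longrightarrow> \<phi> (p \<cdot> a) = \<phi> (p \<cdot> b)) \<Longrightarrow> a = b"
proof -
  assume *: "\<And>\<phi> p. lf \<phi> \<Longrightarrow> \<phi> (p \<cdot> a) = \<phi> (p \<cdot> b)"
  have "p \<cdot> (a - b) = 0" for p
    using A_eqI[OF *[of _ p]] by (simp add: prod_diff)
  then have "a - b = 0" by (rule prod_eq_0)
  then show "a = b" by simp
qed

lemma right_cancel: "(\<And>\<phi> p. lf \<phi> \<Longrightarrow> \<phi> (a \<cdot> p) = \<phi> (b \<cdot> p)) \<Longrightarrow> a = b"
proof -
  assume *: "\<And>\<phi> p. lf \<phi> \<Longrightarrow> \<phi> (a \<cdot> p) = \<phi> (b \<cdot> p)"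
  have "(a - b) \<cdot> p = 0" for p
    using A_eqI[OF *[of _ p]] by (simp add: prod_diff)
  then have "a - b = 0" by (rule prod_eq_0)
  then show "a = b" by simp
qed

abbreviation SL where "SL \<equiv> slice_left (spc H) (spc H)"
abbreviation SR where "SR \<equiv> slice_right (spc H) (spc H)"

lemma SL_eval: "lf \<omega> \<Longrightarrow> t \<in> AA \<Longrightarrow> lf \<phi> \<Longrightarrow> \<phi> (SL \<omega> t) = t (\<lambda>u v. \<omega> u * \<phi> v)"
  by (rule slice_left(2)[OF is_vspaceA is_vspaceA])

lemma SR_eval: "lf \<omega> \<Longrightarrow> t \<in> AA \<Longrightarrow> lf \<phi> \<Longrightarrow> \<phi> (SR \<omega> t) = t (\<lambda>u v. \<phi> u * \<omega> v)"
  by (rule slice_right(2)[OF is_vspaceA is_vspaceA])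

text \<open>
  Slicing off the other leg leaves elements of \<open>A\<close>, to which nondegeneracy applies.
\<close>

lemma cancel_tensor:
  assumes t: "t \<in> AA" "t' \<in> AA"
  shows "(\<And>\<beta> p. bl \<beta> \<Longrightarrow> t (\<lambda>u v. \<beta> (p \<cdot> u) v) = t' (\<lambda>u v. \<beta> (p \<cdot> u) v)) \<Longrightarrow> t = t'"
    and "(\<And>\<beta> p. bl \<beta> \<Longrightarrow> t (\<lambda>u v. \<beta> (u \<cdot> p) v) = t' (\<lambda>u v. \<beta> (u \<cdot> p) v)) \<Longrightarrow> t = t'"
    and "(\<And>\<beta> p. bl \<beta> \<Longrightarrow> t (\<lambda>u v. \<beta> u (p \<cdot> v)) = t' (\<lambda>u v. \<beta> u (p \<cdot> v))) \<Longrightarrow> t = t'"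
    and "(\<And>\<beta> p. bl \<beta> \<Longrightarrow> t (\<lambda>u v. \<beta> u (v \<cdot> p)) = t' (\<lambda>u v. \<beta> u (v \<cdot> p))) \<Longrightarrow> t = t'"
proof -
  have R: "t = t'" if "\<And>\<psi>. lf \<psi> \<Longrightarrow> SR \<psi> t = SR \<psi> t'"
    by (rule AA_eqI[OF t]) (use that SR_eval[OF _ t(1)] SR_eval[OF _ t(2)] in metis)
  have L: "t = t'" if "\<And>\<psi>. lf \<psi> \<Longrightarrow> SL \<psi> t = SL \<psi> t'"
    by (rule AA_eqI[OF t]) (use that SL_eval[OF _ t(1)] SL_eval[OF _ t(2)] in metis)
  show "t = t'" if *: "\<And>\<beta> p. bl \<beta> \<Longrightarrow> t (\<lambda>u v. \<beta> (p \<cdot> u) v) = t' (\<lambda>u v. \<beta> (p \<cdot> u) v)"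
  proof (rule R, rule left_cancel)
    fix \<psi> \<phi> p assume l: "lf \<psi>" "lf \<phi>"
    show "\<phi> (p \<cdot> SR \<psi> t) = \<phi> (p \<cdot> SR \<psi> t')"
      using *[OF product_bilinear[OF l(2,1)], of p]
        SR_eval[OF l(1) t(1) lf_comp[OF l(2) le_prod_left[OF le_id, of p]]]
        SR_eval[OF l(1) t(2) lf_comp[OF l(2) le_prod_left[OF le_id, of p]]]
      by simp
  qed
  show "t = t'" if *: "\<And>\<beta> p. bl \<beta> \<Longrightarrow> t (\<lambda>u v. \<beta> (u \<cdot> p) v) = t' (\<lambda>u v. \<beta> (u \<cdot> p) v)"
  proof (rule R, rule right_cancel)
    fix \<psi> \<phi> p assume l: "lf \<psi>" "lf \<phi>"
    show "\<phi> (SR \<psi> t \<cdot> p) = \<phi> (SR \<psi> t' \<cdot> p)"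
      using *[OF product_bilinear[OF l(2,1)], of p]
        SR_eval[OF l(1) t(1) lf_comp[OF l(2) le_prod_right[OF le_id, of p]]]
        SR_eval[OF l(1) t(2) lf_comp[OF l(2) le_prod_right[OF le_id, of p]]]
      by simp
  qed
  show "t = t'" if *: "\<And>\<beta> p. bl \<beta> \<Longrightarrow> t (\<lambda>u v. \<beta> u (p \<cdot> v)) = t' (\<lambda>u v. \<beta> u (p \<cdot> v))"
  proof (rule L, rule left_cancel)
    fix \<psi> \<phi> p assume l: "lf \<psi>" "lf \<phi>"
    show "\<phi> (p \<cdot> SL \<psi> t) = \<phi> (p \<cdot> SL \<psi> t')"
      using *[OF product_bilinear[OF l(1,2)], of p]
        SL_eval[OF l(1) t(1) lf_comp[OF l(2) le_prod_left[OF le_id, of p]]]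
        SL_eval[OF l(1) t(2) lf_comp[OF l(2) le_prod_left[OF le_id, of p]]]
      by simp
  qed
  show "t = t'" if *: "\<And>\<beta> p. bl \<beta> \<Longrightarrow> t (\<lambda>u v. \<beta> u (v \<cdot> p)) = t' (\<lambda>u v. \<beta> u (v \<cdot> p))"
  proof (rule L, rule right_cancel)
    fix \<psi> \<phi> p assume l: "lf \<psi>" "lf \<phi>"
    show "\<phi> (SL \<psi> t \<cdot> p) = \<phi> (SL \<psi> t' \<cdot> p)"
      using *[OF product_bilinear[OF l(1,2)], of p]
        SL_eval[OF l(1) t(1) lf_comp[OF l(2) le_prod_right[OF le_id, of p]]]
        SL_eval[OF l(1) t(2) lf_comp[OF l(2) le_prod_right[OF le_id, of p]]]
      by simp
  qed
qed

text \<open>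
  Nested evaluations, as functions of the innermost form, are evaluations at elements of \<open>A \<otimes> A\<close> that
  need not be named. Recording their mere existence suffices for cancelling factors.
\<close>

definition tensorial :: "(('a \<Rightarrow> 'a \<Rightarrow> 'k) \<Rightarrow> 'k) \<Rightarrow> bool" where
  "tensorial \<Phi> \<longleftrightarrow> (\<exists>t\<in>AA. \<forall>\<beta>. bl \<beta> \<longrightarrow> \<Phi> \<beta> = t \<beta>)"

lemma tensorial_AA: "t \<in> AA \<Longrightarrow> tensorial (\<lambda>\<beta>. t \<beta>)"
  by (auto simp: tensorial_def)

lemma tensorial_bind:
  assumes t: "t \<in> AA" and f: "\<And>x y. tensorial (f x y)" and b: "\<And>\<beta>. bl \<beta> \<Longrightarrow> bl (\<lambda>x y. f x y \<beta>)"
  shows "tensorial (\<lambda>\<beta>. t (\<lambda>x y. f x y \<beta>))"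
proof -
  obtain g where g: "\<And>x y. g x y \<in> AA" "\<And>x y \<beta>. bl \<beta> \<Longrightarrow> f x y \<beta> = g x y \<beta>"
    using f unfolding tensorial_def by metis
  have g_bilinear: "bilinear_on (spc H) (spc H) (spc2 H) g"
    unfolding bilinear_on_def
  proof (intro conjI ballI)
    fix w
    show "linear_on (spc H) (spc2 H) (\<lambda>v. g v w)"
    proof (rule linear_into_tensorI[OF is_vspaceA is_vspaceA is_vspaceA g(1)])
      fix \<beta> assume "bl \<beta>"
      then show "lf (\<lambda>v. g v w \<beta>)" using b[of \<beta>] by (simp add: g(2) bilinear_on_def)
    qed
  next
    fix v
    show "linear_on (spc H) (spc2 H) (g v)"
    proof (rule linear_into_tensorI[OF is_vspaceA is_vspaceA is_vspaceA g(1)])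
      fix \<beta> assume "bl \<beta>"
      then show "lf (\<lambda>w. g v w \<beta>)" using b[of \<beta>] by (simp add: g(2) bilinear_on_def)
    qed
  qed
  show ?thesis unfolding tensorial_def
  proof (intro bexI allI impI)
    show "tlift (spc H) (spc H) (spc2 H) g t \<in> AA" by (rule tlift_in[OF is_vspace_tensor g_bilinear t])
    fix \<beta> assume "bl \<beta>"
    then show "t (\<lambda>x y. f x y \<beta>) = tlift (spc H) (spc H) (spc2 H) g t \<beta>"
      using tlift_eval[OF is_vspaceA is_vspaceA is_vspace_tensor g_bilinear eval_linear[of _ _ \<beta>] t] by (simp add: g(2))
  qed
qed

lemma tensorial_map:
  assumes \<Phi>: "tensorial \<Phi>" and g: "le g" and h: "le h"
  shows "tensorial (\<lambda>\<beta>. \<Phi> (\<lambda>u v. \<beta> (g u) (h v)))"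
proof -
  obtain t where t: "t \<in> AA" "\<And>\<beta>. bl \<beta> \<Longrightarrow> \<Phi> \<beta> = t \<beta>" using \<Phi> by (auto simp: tensorial_def)
  show ?thesis unfolding tensorial_def
  proof (intro bexI allI impI)
    show "tmap (spc H) (spc H) (spc H) (spc H) g h t \<in> AA"
      by (rule linear_onD(1)[OF tmap_linear[OF is_vspaceA is_vspaceA g h] t(1)])
    fix \<beta> assume "bl \<beta>"
    then show "\<Phi> (\<lambda>u v. \<beta> (g u) (h v)) = tmap (spc H) (spc H) (spc H) (spc H) g h t \<beta>"
      using tmap_eval[OF is_vspaceA is_vspaceA is_vspaceA is_vspaceA g h t(1)] t(2)[OF bilinear_comp[OF g h]]
      by simp
  qed
qed

lemma cancel:
  assumes "tensorial \<Phi>" "tensorial \<Psi>" and \<beta>: "bl \<beta>"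
  shows "(\<And>\<beta> p. bl \<beta> \<Longrightarrow> \<Phi> (\<lambda>u v. \<beta> (p \<cdot> u) v) = \<Psi> (\<lambda>u v. \<beta> (p \<cdot> u) v)) \<Longrightarrow> \<Phi> \<beta> = \<Psi> \<beta>"
    and "(\<And>\<beta> p. bl \<beta> \<Longrightarrow> \<Phi> (\<lambda>u v. \<beta> (u \<cdot> p) v) = \<Psi> (\<lambda>u v. \<beta> (u \<cdot> p) v)) \<Longrightarrow> \<Phi> \<beta> = \<Psi> \<beta>"
    and "(\<And>\<beta> p. bl \<beta> \<Longrightarrow> \<Phi> (\<lambda>u v. \<beta> u (p \<cdot> v)) = \<Psi> (\<lambda>u v. \<beta> u (p \<cdot> v))) \<Longrightarrow> \<Phi> \<beta> = \<Psi> \<beta>"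
    and "(\<And>\<beta> p. bl \<beta> \<Longrightarrow> \<Phi> (\<lambda>u v. \<beta> u (v \<cdot> p)) = \<Psi> (\<lambda>u v. \<beta> u (v \<cdot> p))) \<Longrightarrow> \<Phi> \<beta> = \<Psi> \<beta>"
proof -
  obtain t t' where t: "t \<in> AA" "t' \<in> AA" "\<And>\<beta>. bl \<beta> \<Longrightarrow> \<Phi> \<beta> = t \<beta>" "\<And>\<beta>. bl \<beta> \<Longrightarrow> \<Psi> \<beta> = t' \<beta>"
    using assms by (auto simp: tensorial_def)
  have b: "bl (\<lambda>u v. \<beta> (g u) (h v))" if "bl \<beta>" "le g" "le h" for \<beta> g h
    by (rule bilinear_comp[OF that(2,3,1)])
  show "\<Phi> \<beta> = \<Psi> \<beta>" if *: "\<And>\<beta> p. bl \<beta> \<Longrightarrow> \<Phi> (\<lambda>u v. \<beta> (p \<cdot> u) v) = \<Psi> (\<lambda>u v. \<beta> (p \<cdot> u) v)"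
  proof -
    have "t = t'" by (rule cancel_tensor(1)[OF t(1,2)])
      (use * t(3,4) b[OF _ le_prod_left[OF le_id] le_id] in metis)
    then show ?thesis using t \<beta> by simp
  qed
  show "\<Phi> \<beta> = \<Psi> \<beta>" if *: "\<And>\<beta> p. bl \<beta> \<Longrightarrow> \<Phi> (\<lambda>u v. \<beta> (u \<cdot> p) v) = \<Psi> (\<lambda>u v. \<beta> (u \<cdot> p) v)"
  proof -
    have "t = t'" by (rule cancel_tensor(2)[OF t(1,2)])
      (use * t(3,4) b[OF _ le_prod_right[OF le_id] le_id] in metis)
    then show ?thesis using t \<beta> by simp
  qed
  show "\<Phi> \<beta> = \<Psi> \<beta>" if *: "\<And>\<beta> p. bl \<beta> \<Longrightarrow> \<Phi> (\<lambda>u v. \<beta> u (p \<cdot> v)) = \<Psi> (\<lambda>u v. \<beta> u (p \<cdot> v))"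
  proof -
    have "t = t'" by (rule cancel_tensor(3)[OF t(1,2)])
      (use * t(3,4) b[OF _ le_id le_prod_left[OF le_id]] in metis)
    then show ?thesis using t \<beta> by simp
  qed
  show "\<Phi> \<beta> = \<Psi> \<beta>" if *: "\<And>\<beta> p. bl \<beta> \<Longrightarrow> \<Phi> (\<lambda>u v. \<beta> u (v \<cdot> p)) = \<Psi> (\<lambda>u v. \<beta> u (v \<cdot> p))"
  proof -
    have "t = t'" by (rule cancel_tensor(4)[OF t(1,2)])
      (use * t(3,4) b[OF _ le_id le_prod_right[OF le_id]] in metis)
    then show ?thesis using t \<beta> by simp
  qed
qed

subsection \<open>The axioms as identities between evaluations\<close>

text \<open>
  Trilinear forms on \<open>A\<close> become bilinear forms on \<open>(A \<otimes> A) \<times> A\<close>, at which elements of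
  \<open>(A \<otimes> A) \<otimes> A\<close> can be evaluated.
\<close>

lemma tri_form:
  assumes "tri \<gamma>"
  shows "bilinear_on (spc2 H) (spc H) ground (\<lambda>t w. t (\<lambda>u v. \<gamma> u v w))"
proof -
  have "bl (\<lambda>u v. \<gamma> u v w)" for w using assms by (auto simp: bilinear_on_def tri_def)
  then show ?thesis unfolding bilinear_on_def[of "spc2 H"]
    using lf_eval[of _ "\<lambda>w u v. \<gamma> u v w"] assms eval_linear by (auto simp: tri_def)
qed

lemma on12_tens:
  assumes f: "linear_on (spc2 H) (spc2 H) f" and t: "t \<in> AA"
  shows "on12 H f (tens (spc2 H) (spc H) t c) = tens (spc2 H) (spc H) (f t) c"
  using tmap_tens[OF is_vspace_tensor is_vspaceA f idm_linear[OF is_vspaceA] t, of c]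
  by (simp add: leg12_def idmA)

lemma on12_in:
  assumes f: "linear_on (spc2 H) (spc2 H) f" and s: "s \<in> vcar (spc2 H \<Otimes> spc H)"
  shows "on12 H f s \<in> vcar (spc2 H \<Otimes> spc H)"
  unfolding leg12_def
  by (rule linear_onD(1)[OF tmap_linear[OF is_vspace_tensor is_vspaceA f idm_linear[OF is_vspaceA]] s])

lemma on12_eval:
  assumes f: "linear_on (spc2 H) (spc2 H) f" and s: "s \<in> vcar (spc2 H \<Otimes> spc H)"
    and d: "bilinear_on (spc2 H) (spc H) ground \<delta>"
  shows "on12 H f s \<delta> = s (\<lambda>t w. \<delta> (f t) w)"
  unfolding leg12_def
  using tmap_eval[OF is_vspace_tensor is_vspaceA is_vspace_tensor is_vspaceA f idm_linear[OF is_vspaceA] s d]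
  by (simp add: idmA)

lemma on23_in:
  assumes f: "linear_on (spc2 H) (spc2 H) f" and s: "s \<in> vcar (spc2 H \<Otimes> spc H)"
  shows "on23 H f s \<in> vcar (spc2 H \<Otimes> spc H)"
  unfolding leg23_def o_def
  by (intro linear_onD(1)[OF assoc_inv_linear[OF is_vspaceA is_vspaceA is_vspaceA]]
      linear_onD(1)[OF tmap_linear[OF is_vspaceA is_vspace_tensor idm_linear[OF is_vspaceA] f]]
      linear_onD(1)[OF assoc_linear[OF is_vspaceA is_vspaceA is_vspaceA]] s)

text \<open>
  Used for \<open>f\<close> acting on the last two legs, and with the flip as \<open>f\<close>, from which the action on the outer legs is
  composed.
\<close>

lemma middle_eval:
  assumes f: "linear_on (spc2 H) (spc2 H) f" and s: "s \<in> vcar (spc2 H \<Otimes> spc H)"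
    and d: "bilinear_on (spc2 H) (spc H) ground \<delta>"
  shows "(assoc_inv (spc H) (spc H) (spc H)
      (tmap (spc H) (spc2 H) (spc H) (spc2 H) (idm (spc H)) f (assoc (spc H) (spc H) (spc H) s))) \<delta> =
    s (\<lambda>t w. t (\<lambda>u v. f (pure H v w) (\<lambda>x y. \<delta> (pure H u x) y)))"
proof -
  note A = is_vspaceA and AT = is_vspace_tensor[of "spc H" "spc H"]
  note l = linear_onD(1)[OF assoc_linear[OF A A A] s]
  have "(assoc_inv (spc H) (spc H) (spc H)
      (tmap (spc H) (spc2 H) (spc H) (spc2 H) (idm (spc H)) f (assoc (spc H) (spc H) (spc H) s))) \<delta> =
    tmap (spc H) (spc2 H) (spc H) (spc2 H) (idm (spc H)) f (assoc (spc H) (spc H) (spc H) s)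
      (\<lambda>u y. y (\<lambda>v w. \<delta> (pure H u v) w))"
    by (rule assoc_inv_eval[OF A A A _ d])
      (rule linear_onD(1)[OF tmap_linear[OF A AT idm_linear[OF A] f] l])
  also have "\<dots> = assoc (spc H) (spc H) (spc H) s (\<lambda>u y. (f y) (\<lambda>v w. \<delta> (pure H (idm (spc H) u) v) w))"
    by (rule tmap_eval[OF A AT A AT idm_linear[OF A] f l bilinear_assoc_form[OF A A A d]])
  also have "\<dots> = s (\<lambda>t w. t (\<lambda>u v. f (pure H v w) (\<lambda>x y. \<delta> (pure H (idm (spc H) u) x) y)))"
    by (rule assoc_eval[OF A A A s bilinear_comp[OF idm_linear[OF A] f bilinear_assoc_form[OF A A A d]]])
  finally show ?thesis by (simp add: idmA)
qed

lemma on23_eval: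
  assumes f: "linear_on (spc2 H) (spc2 H) f" and s: "s \<in> vcar (spc2 H \<Otimes> spc H)"
    and d: "bilinear_on (spc2 H) (spc H) ground \<delta>"
  shows "on23 H f s \<delta> = s (\<lambda>t w. t (\<lambda>u v. f (pure H v w) (\<lambda>x y. \<delta> (pure H u x) y)))"
  using middle_eval[OF assms] by (simp add: leg23_def)

lemma on13_eval:
  assumes f: "linear_on (spc2 H) (spc2 H) f" and s: "s \<in> vcar (spc2 H \<Otimes> spc H)"
    and d: "bilinear_on (spc2 H) (spc H) ground \<delta>"
  shows "on13 H f s \<delta> = s (\<lambda>t w. t (\<lambda>u v. f (pure H u w) (\<lambda>x y. \<delta> (pure H x v) y)))"
proof -
  note A = is_vspaceA and AT = is_vspace_tensor[of "spc H" "spc H"]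
  define swap where "swap s = assoc_inv (spc H) (spc H) (spc H)
      (tmap (spc H) (spc2 H) (spc H) (spc2 H) (idm (spc H)) (tw (spc H) (spc H)) (assoc (spc H) (spc H) (spc H) s))" for s
  have tw: "linear_on (spc2 H) (spc2 H) (tw (spc H) (spc H))" by (rule tw_linear[OF A A])
  have swap_in: "swap s \<in> vcar (spc2 H \<Otimes> spc H)" if "s \<in> vcar (spc2 H \<Otimes> spc H)" for s
    using on23_in[OF tw that] by (simp add: swap_def leg23_def)
  have bd: "bl (\<lambda>x y. \<delta> (pure H u x) y)" "bl (\<lambda>x y. \<delta> (pure H x u) y)" "bl (\<lambda>x y. \<delta> (pure H u y) x)"
    if d: "bilinear_on (spc2 H) (spc H) ground \<delta>" for \<delta> u
  proof -
    show b: "bl (\<lambda>x y. \<delta> (pure H u x) y)"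
      by (rule bilinear_comp[OF tens_linear(2)[OF A A] le_id d]) simp
    show "bl (\<lambda>x y. \<delta> (pure H x u) y)"
      by (rule bilinear_comp[OF tens_linear(1)[OF A A] le_id d]) simp
    show "bl (\<lambda>x y. \<delta> (pure H u y) x)" using b by (auto simp: bilinear_on_def)
  qed
  have swap: "swap s \<delta> = s (\<lambda>t w. t (\<lambda>u v. \<delta> (pure H u w) v))"
    if s: "s \<in> vcar (spc2 H \<Otimes> spc H)" and d: "bilinear_on (spc2 H) (spc H) ground \<delta>" for s \<delta>
  proof -
    have "swap s \<delta> = s (\<lambda>t w. t (\<lambda>u v. tw (spc H) (spc H) (pure H v w) (\<lambda>x y. \<delta> (pure H u x) y)))"
      using middle_eval[OF tw s d] by (simp add: swap_def)
    then show ?thesis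
      by (simp add: tw_eval[OF A A pure_in bd(1)[OF d]] pure_eval[OF bd(3)[OF d]])
  qed
  have in2: "tmap (spc2 H) (spc H) (spc2 H) (spc H) f (idm (spc H)) s \<in> vcar (spc2 H \<Otimes> spc H)"
    if "s \<in> vcar (spc2 H \<Otimes> spc H)" for s
    using on12_in[OF f that] by (simp add: leg12_def)
  have d': "bilinear_on (spc2 H) (spc H) ground (\<lambda>t w. t (\<lambda>u v. \<delta> (pure H u w) v))"
  proof (rule tri_form, rule triI)
    show "lf (\<lambda>x. \<delta> (pure H x z) y)" "lf (\<lambda>y. \<delta> (pure H x z) y)" "lf (\<lambda>z. \<delta> (pure H x z) y)" for x y z
      using bd[OF d] by (auto simp: bilinear_on_def)
  qed
  have d2: "bilinear_on (spc2 H) (spc H) ground (\<lambda>t w. (f t) (\<lambda>u v. \<delta> (pure H u w) v))"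
    using bilinear_comp[OF f le_id d'] by simp
  have "on13 H f s \<delta> = swap (tmap (spc2 H) (spc H) (spc2 H) (spc H) f (idm (spc H)) (swap s)) \<delta>"
    by (simp add: leg13_def swap_def)
  also have "\<dots> = tmap (spc2 H) (spc H) (spc2 H) (spc H) f (idm (spc H)) (swap s)
      (\<lambda>t w. t (\<lambda>u v. \<delta> (pure H u w) v))"
    by (rule swap[OF in2[OF swap_in[OF s]] d])
  also have "\<dots> = swap s (\<lambda>t w. (f t) (\<lambda>u v. \<delta> (pure H u w) v))"
    using on12_eval[OF f swap_in[OF s] d'] by (simp add: leg12_def)
  also have "\<dots> = s (\<lambda>t w. t (\<lambda>u v. f (pure H u w) (\<lambda>x y. \<delta> (pure H x v) y)))"
    by (rule swap[OF s d2])
  finally show ?thesis .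
qed

lemma triple_in [simp]: "t \<in> AA \<Longrightarrow> tens (spc2 H) (spc H) t c \<in> vcar (spc2 H \<Otimes> spc H)"
  by (rule tens_in) auto

lemma mu_linear: "linear_on (spc2 H) (spc H) (mu H)"
  unfolding mult_map_def by (rule tlift_linear[OF is_vspaceA prod_bilinear])

lemma mu_pure: "mu H (pure H a b) = a \<cdot> b"
  unfolding mult_map_def by (rule tlift_tens[OF is_vspaceA prod_bilinear]) auto

lemma inner_mult_bilinear:
  "bilinear_on (spc H) (spc H) (spc2 H) (\<lambda>c d. pure H (a \<cdot> c) (b \<cdot> d))"
  by (rule tmap_bilinear[OF is_vspaceA is_vspaceA le_prod_left[OF le_id] le_prod_left[OF le_id]])

lemma inner_mult_eval:
  assumes "t \<in> AA" "bl \<beta>"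
  shows "tlift (spc H) (spc H) (spc2 H) (\<lambda>c d. pure H (a \<cdot> c) (b \<cdot> d)) t \<beta> = t (\<lambda>c d. \<beta> (a \<cdot> c) (b \<cdot> d))"
  using tlift_eval[OF is_vspaceA is_vspaceA is_vspace_tensor inner_mult_bilinear eval_linear[of _ _ \<beta>] assms(1)]
  by (simp add: pure_eval[OF assms(2)])

lemma mult2_bilinear:
  assumes t: "t \<in> AA"
  shows "bilinear_on (spc H) (spc H) (spc2 H)
    (\<lambda>a b. tlift (spc H) (spc H) (spc2 H) (\<lambda>c d. pure H (a \<cdot> c) (b \<cdot> d)) t)"
  unfolding bilinear_on_def
proof (intro conjI ballI; rule linear_into_tensorI[OF is_vspaceA is_vspaceA is_vspaceA])
  show "tlift (spc H) (spc H) (spc2 H) (\<lambda>c d. pure H (a \<cdot> c) (b \<cdot> d)) t \<in> AA" for a b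
    by (rule tlift_in[OF is_vspace_tensor inner_mult_bilinear t])
  then show "tlift (spc H) (spc H) (spc2 H) (\<lambda>c d. pure H (a \<cdot> c) (b \<cdot> d)) t \<in> AA" for a b .
  fix \<beta> a assume b: "bl \<beta>"
  show "lf (\<lambda>b. tlift (spc H) (spc H) (spc2 H) (\<lambda>c d. pure H (a \<cdot> c) (b \<cdot> d)) t \<beta>)"
    unfolding inner_mult_eval[OF t b]
    by (rule lf_eval[OF t]) (intro lin bl_left[OF b] bl_right[OF b])+
  show "lf (\<lambda>b. tlift (spc H) (spc H) (spc2 H) (\<lambda>c d. pure H (b \<cdot> c) (a \<cdot> d)) t \<beta>)"
    unfolding inner_mult_eval[OF t b]
    by (rule lf_eval[OF t]) (intro lin bl_left[OF b] bl_right[OF b])+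
qed

lemma mult2_in [simp]: "s \<in> AA \<Longrightarrow> t \<in> AA \<Longrightarrow> mult2 H s t \<in> AA"
  unfolding tmult_def by (rule tlift_in[OF is_vspace_tensor mult2_bilinear])

lemma mult2_eval:
  assumes "s \<in> AA" "t \<in> AA" "bl \<beta>"
  shows "mult2 H s t \<beta> = s (\<lambda>a b. t (\<lambda>c d. \<beta> (a \<cdot> c) (b \<cdot> d)))"
  using tlift_eval[OF is_vspaceA is_vspaceA is_vspace_tensor mult2_bilinear[OF assms(2)] eval_linear[of _ _ \<beta>] assms(1)]
  by (simp add: tmult_def inner_mult_eval[OF assms(2,3)])

lemma inj1_simps [simp]: "fst (inj1 H a) = (\<lambda>b. a \<cdot> b)" "snd (inj1 H a) = (\<lambda>b. b \<cdot> a)"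
  by (simp_all add: minj_def)

lemma side_eval:
  assumes t: "t \<in> AA" and b: "bl \<beta>"
  shows "fst (lft H a) t \<beta> = t (\<lambda>u v. \<beta> (a \<cdot> u) v)" "snd (lft H a) t \<beta> = t (\<lambda>u v. \<beta> (u \<cdot> a) v)"
    "fst (rgt H a) t \<beta> = t (\<lambda>u v. \<beta> u (a \<cdot> v))" "snd (rgt H a) t \<beta> = t (\<lambda>u v. \<beta> u (v \<cdot> a))"
  using tmap_eval[OF is_vspaceA is_vspaceA is_vspaceA is_vspaceA le_prod_left[OF le_id] le_id t b]
    tmap_eval[OF is_vspaceA is_vspaceA is_vspaceA is_vspaceA le_prod_right[OF le_id] le_id t b]
    tmap_eval[OF is_vspaceA is_vspaceA is_vspaceA is_vspaceA le_id le_prod_left[OF le_id] t b]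
    tmap_eval[OF is_vspaceA is_vspaceA is_vspaceA is_vspaceA le_id le_prod_right[OF le_id] t b]
  by (simp_all add: lft_def rgt_def mtens_def mone_def idmA)

lemma side_in [simp]:
  assumes t: "t \<in> AA"
  shows "fst (lft H a) t \<in> AA" "snd (lft H a) t \<in> AA" "fst (rgt H a) t \<in> AA" "snd (rgt H a) t \<in> AA"
  using linear_onD(1)[OF tmap_linear[OF is_vspaceA is_vspaceA le_prod_left[OF le_id] le_id] t]
    linear_onD(1)[OF tmap_linear[OF is_vspaceA is_vspaceA le_prod_right[OF le_id] le_id] t]
    linear_onD(1)[OF tmap_linear[OF is_vspaceA is_vspaceA le_id le_prod_left[OF le_id]] t]
    linear_onD(1)[OF tmap_linear[OF is_vspaceA is_vspaceA le_id le_prod_right[OF le_id]] t]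
  by (simp_all add: lft_def rgt_def mtens_def mone_def idmA)

lemma E_sides:
  assumes b: "bl \<beta>"
  shows "e1 c d (\<lambda>x y. \<beta> (a \<cdot> x) (b \<cdot> y)) = e2 a b (\<lambda>x y. \<beta> (x \<cdot> c) (y \<cdot> d))"
proof -
  have "mult2 H (pure H a b) (e1 c d) \<beta> = mult2 H (e2 a b) (pure H c d) \<beta>"
    using ax_i by (simp add: e1_def e2_def)
  moreover have "bl (\<lambda>p q. e1 c d (\<lambda>x y. \<beta> (p \<cdot> x) (q \<cdot> y)))"
    by (intro lin bl_left[OF b] bl_right[OF b])
  moreover have "bl (\<lambda>c d. \<beta> (x \<cdot> c) (y \<cdot> d))" for x y
    by (intro lin bl_left[OF b] bl_right[OF b])
  ultimately show ?thesis by (simp add: mult2_eval b pure_eval)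
qed

lemma E1_E1: "e1 a b (\<lambda>u v. e1 u v \<beta>) = e1 a b \<beta>"
  using fun_cong[OF ax_ii, of "pure H a b"] map_eval[OF structure_linear(1), of "e1 a b" \<beta>]
  by (simp add: e1_def[symmetric])

lemma legs_on_pure:
  assumes f: "linear_on (spc2 H) (spc2 H) f" and h: "linear_on (spc2 H) (spc2 H) h" and g: "tri \<gamma>"
  shows "on12 H f (on23 H h (tens (spc2 H) (spc H) (pure H a b) c)) (\<lambda>t w. t (\<lambda>u v. \<gamma> u v w)) =
      h (pure H b c) (\<lambda>x y. f (pure H a x) (\<lambda>u v. \<gamma> u v y))"
    and "on23 H h (on12 H f (tens (spc2 H) (spc H) (pure H a b) c)) (\<lambda>t w. t (\<lambda>u v. \<gamma> u v w)) =
      f (pure H a b) (\<lambda>u v. h (pure H v c) (\<lambda>x y. \<gamma> u x y))"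
proof -
  note d = tri_form[OF g]
  note [lin] = tri1[OF g] tri2[OF g] tri3[OF g] map_pure_linear[OF f] map_pure_linear[OF h]
    lf_eval[OF linear_onD(1)[OF f pure_in]] lf_eval[OF linear_onD(1)[OF h pure_in]]
  let ?s = "\<lambda>t. tens (spc2 H) (spc H) t c"
  have "on12 H f (on23 H h (?s (pure H a b))) (\<lambda>t w. t (\<lambda>u v. \<gamma> u v w)) =
      ?s (pure H a b) (\<lambda>t w. t (\<lambda>u v. h (pure H v w) (\<lambda>x y. f (pure H u x) (\<lambda>u v. \<gamma> u v y))))"
    using on12_eval[OF f on23_in[OF h] d] on23_eval[OF h _ bilinear_comp[OF f le_id d]] by simp
  also have "\<dots> = (pure H a b) (\<lambda>u v. h (pure H v c) (\<lambda>x y. f (pure H u x) (\<lambda>u v. \<gamma> u v y)))"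
    by (rule tens_eval, rule tri_form) (intro lin)
  also have "\<dots> = h (pure H b c) (\<lambda>x y. f (pure H a x) (\<lambda>u v. \<gamma> u v y))"
    by (rule pure_eval) (intro lin)
  finally show "on12 H f (on23 H h (?s (pure H a b))) (\<lambda>t w. t (\<lambda>u v. \<gamma> u v w)) =
      h (pure H b c) (\<lambda>x y. f (pure H a x) (\<lambda>u v. \<gamma> u v y))" .
  have i: "f (pure H a b) \<in> AA" by (rule linear_onD(1)[OF f pure_in])
  have "on23 H h (on12 H f (?s (pure H a b))) (\<lambda>t w. t (\<lambda>u v. \<gamma> u v w)) =
      ?s (f (pure H a b)) (\<lambda>t w. t (\<lambda>u v. h (pure H v w) (\<lambda>x y. (pure H u x) (\<lambda>u v. \<gamma> u v y))))"
    using on23_eval[OF h triple_in[OF i] d] by (simp add: on12_tens[OF f])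
  also have "\<dots> = ?s (f (pure H a b)) (\<lambda>t w. t (\<lambda>u v. h (pure H v w) (\<lambda>x y. \<gamma> u x y)))"
    by (subst pure_eval) (intro lin refl)+
  also have "\<dots> = f (pure H a b) (\<lambda>u v. h (pure H v c) (\<lambda>x y. \<gamma> u x y))"
    by (rule tens_eval, rule tri_form) (intro lin)
  finally show "on23 H h (on12 H f (?s (pure H a b))) (\<lambda>t w. t (\<lambda>u v. \<gamma> u v w)) =
      f (pure H a b) (\<lambda>u v. h (pure H v c) (\<lambda>x y. \<gamma> u x y))" .
qed

lemma coassoc:
  assumes g: "tri \<gamma>"
  shows "t1 b c (\<lambda>x y. t2 a x (\<lambda>u v. \<gamma> u v y)) = t2 a b (\<lambda>u v. t1 v c (\<lambda>x y. \<gamma> u x y))"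
  using legs_on_pure[OF structure_linear(4,3) g, of a b c] fun_cong[OF ax_iii, of "tens (spc2 H) (spc H) (pure H a b) c"]
  by (simp add: t1_def t2_def)

lemma counit_t1: "lf \<phi> \<Longrightarrow> t1 a b (\<lambda>u v. \<epsilon> u * \<phi> v) = \<phi> (a \<cdot> b)"
  using SL_eval[OF lf_eps[OF le_id] structure_in(3), of \<phi> a b] fun_cong[OF ax_iv(1), of "pure H a b"]
  by (simp add: t1_def mu_pure)

lemma counit_t2: "lf \<phi> \<Longrightarrow> t2 a b (\<lambda>u v. \<phi> u * \<epsilon> v) = \<phi> (a \<cdot> b)"
  using SR_eval[OF lf_eps[OF le_id] structure_in(4), of \<phi> a b] fun_cong[OF ax_iv(2), of "pure H a b"]
  by (simp add: t2_def mu_pure)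

lemma mult_t1:
  assumes b: "bl \<beta>"
  shows "t1 (a \<cdot> b) c \<beta> = t1 b c (\<lambda>x y. t1 a y (\<lambda>u v. \<beta> (u \<cdot> x) v))"
proof -
  note A = is_vspaceA
  let ?s = "tens (spc2 H) (spc H) (pure H a b) c"
  note l = structure_linear and b' = bl_left[OF b] bl_right[OF b]
  have mb: "bilinear_on (spc2 H) (spc H) ground (\<lambda>t w. \<beta> (mu H t) w)"
    using bilinear_comp[OF mu_linear le_id b] .
  have in23: "on23 H (T\<^sub>1 H) ?s \<in> vcar (spc2 H \<Otimes> spc H)" by (rule on23_in[OF l(3)]) simp
  have in13: "on13 H (T\<^sub>1 H) (on23 H (T\<^sub>1 H) ?s) \<in> vcar (spc2 H \<Otimes> spc H)"
    unfolding leg13_def o_def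
    by (intro linear_onD(1)[OF assoc_inv_linear[OF A A A]] linear_onD(1)[OF assoc_linear[OF A A A]]
        linear_onD(1)[OF tmap_linear[OF A is_vspace_tensor idm_linear[OF A] tw_linear[OF A A]]]
        linear_onD(1)[OF tmap_linear[OF is_vspace_tensor A l(3) idm_linear[OF A]]] in23)
  have mu_ev: "mu12 H s \<beta> = s (\<lambda>t w. \<beta> (mu H t) w)" if "s \<in> vcar (spc2 H \<Otimes> spc H)" for s
    using tmap_eval[OF is_vspace_tensor A A A mu_linear idm_linear[OF A] that b] by (simp add: idmA)
  have t: "bilinear_on (spc2 H) (spc H) ground (\<lambda>t w. t (\<lambda>u v. t1 u w (\<lambda>x y. \<beta> (x \<cdot> v) y)))"
    by (rule tri_form) (intro lin b')
  have "mu12 H (on13 H (T\<^sub>1 H) (on23 H (T\<^sub>1 H) ?s)) \<beta> =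
      on23 H (T\<^sub>1 H) ?s (\<lambda>t w. t (\<lambda>u v. t1 u w (\<lambda>x y. \<beta> (x \<cdot> v) y)))"
    using mu_ev[OF in13] on13_eval[OF l(3) in23 mb] by (simp add: mu_pure t1_def)
  also have "\<dots> = ?s (\<lambda>t w. t (\<lambda>u v. t1 v w (\<lambda>x y. (pure H u x) (\<lambda>u v. t1 u y (\<lambda>x y. \<beta> (x \<cdot> v) y)))))"
    using on23_eval[OF l(3) _ t] by (simp add: t1_def)
  also have "\<dots> = ?s (\<lambda>t w. t (\<lambda>u v. t1 v w (\<lambda>x y. t1 u y (\<lambda>p q. \<beta> (p \<cdot> x) q))))"
    by (subst pure_eval) (intro lin b' refl)+
  also have "\<dots> = (pure H a b) (\<lambda>u v. t1 v c (\<lambda>x y. t1 u y (\<lambda>p q. \<beta> (p \<cdot> x) q)))"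
    by (rule tens_eval, rule tri_form) (intro lin b')
  also have "\<dots> = t1 b c (\<lambda>x y. t1 a y (\<lambda>u v. \<beta> (u \<cdot> x) v))"
    by (rule pure_eval) (intro lin b')
  finally have 1: "mu12 H (on13 H (T\<^sub>1 H) (on23 H (T\<^sub>1 H) ?s)) \<beta> = t1 b c (\<lambda>x y. t1 a y (\<lambda>u v. \<beta> (u \<cdot> x) v))" .
  have "mu12 H ?s = pure H (a \<cdot> b) c"
    using tmap_tens[OF A A mu_linear idm_linear[OF A], of "pure H a b" c] by (simp add: idmA mu_pure)
  then show ?thesis using 1 fun_cong[OF ax_v, of ?s] by (simp add: t1_def)
qed

lemma span_eval_eq:
  fixes t :: "('k, 'a, 'a) tensor"
  assumes "t \<in> tspan S" "\<And>s. s \<in> S \<Longrightarrow> s \<beta> = s \<beta>'"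
  shows "t \<beta> = t \<beta>'"
proof -
  interpret vector_space "tscale :: 'k \<Rightarrow> ('k, 'a, 'a) tensor \<Rightarrow> _" by (rule vector_space_tscale)
  show ?thesis using assms(1)
  proof (induction rule: span_induct_alt)
    case base show ?case by simp
  next
    case (step c x y)
    then show ?case using assms(2) by (simp add: tscale_def)
  qed
qed

text \<open>
  By \<open>ax_vi\<close>, every \<open>E(b \<otimes> c)\<close> is a sum of elements \<open>\<Delta>(a)(b' \<otimes> c')\<close>, so linear identities may be checked on
  the latter.
\<close>

lemma E1_induct:
  assumes "bl \<beta>" "bl \<beta>'"
    and "\<And>a b c. t1 a c (\<lambda>u v. \<beta> (u \<cdot> b) v) = t1 a c (\<lambda>u v. \<beta>' (u \<cdot> b) v)"
  shows "e1 b c \<beta> = e1 b c \<beta>'"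
proof -
  interpret vector_space "tscale :: 'k \<Rightarrow> ('k, 'a, 'a) tensor \<Rightarrow> _" by (rule vector_space_tscale)
  have "e1 b c \<in> tspan {E\<^sub>1 H (pure H b c) | b c. True}" by (rule span_base) (auto simp: e1_def)
  then have "e1 b c \<in> tspan {snd (lft H b) (t1 a c) | a b c. True}" using ax_vi(1) by (simp add: t1_def)
  then show ?thesis by (rule span_eval_eq) (auto simp: side_eval assms)
qed

lemma E2_induct:
  assumes "bl \<beta>" "bl \<beta>'"
    and "\<And>a b c. t2 b a (\<lambda>u v. \<beta> u (c \<cdot> v)) = t2 b a (\<lambda>u v. \<beta>' u (c \<cdot> v))"
  shows "e2 b c \<beta> = e2 b c \<beta>'"
proof -
  interpret vector_space "tscale :: 'k \<Rightarrow> ('k, 'a, 'a) tensor \<Rightarrow> _" by (rule vector_space_tscale)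
  have "e2 b c \<in> tspan {E\<^sub>2 H (pure H b c) | b c. True}" by (rule span_base) (auto simp: e2_def)
  then have "e2 b c \<in> tspan {fst (rgt H c) (t2 b a) | a b c. True}" using ax_vi(2) by (simp add: t2_def)
  then show ?thesis by (rule span_eval_eq) (auto simp: side_eval assms)
qed

text \<open>
  \<open>E\<Delta>(a) = \<Delta>(a)\<close>, because \<open>\<Delta>(a)(b \<otimes> c)\<close> lies in the range of the idempotent \<open>E\<close>.
\<close>

lemma E1_t1:
  assumes b: "bl \<beta>"
  shows "t1 a c (\<lambda>u v. e1 (u \<cdot> b) v \<beta>) = t1 a c (\<lambda>u v. \<beta> (u \<cdot> b) v)"
proof -
  interpret vector_space "tscale :: 'k \<Rightarrow> ('k, 'a, 'a) tensor \<Rightarrow> _" by (rule vector_space_tscale)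
  have "snd (lft H b) (t1 a c) \<in> tspan {snd (lft H b) (T\<^sub>1 H (pure H a c)) | a b c. True}"
    by (rule span_base) (auto simp: t1_def)
  then have "snd (lft H b) (t1 a c) \<in> tspan {E\<^sub>1 H (pure H b c) | b c. True}" using ax_vi(1) by simp
  then have "snd (lft H b) (t1 a c) (\<lambda>u v. e1 u v \<beta>) = snd (lft H b) (t1 a c) \<beta>"
    by (rule span_eval_eq) (auto simp: e1_def[symmetric] E1_E1)
  moreover have "bl (\<lambda>u v. e1 u v \<beta>)" by (intro lin)
  ultimately show ?thesis by (simp add: side_eval b)
qed

text \<open>
  By nondegeneracy, idempotency passes from the left action of \<open>E\<close> to the right action.
\<close>

lemma E2_E2:
  assumes b: "bl \<beta>"
  shows "e2 a b (\<lambda>u v. e2 u v \<beta>) = e2 a b \<beta>"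
proof -
  have "tensorial (\<lambda>\<beta>. e2 a b (\<lambda>u v. e2 u v \<beta>))"
    by (rule tensorial_bind) (auto intro!: tensorial_AA lin)
  moreover have "e2 a b (\<lambda>u v. e2 u v (\<lambda>u v. \<beta> (u \<cdot> p) v)) = e2 a b (\<lambda>u v. \<beta> (u \<cdot> p) v)"
    if b: "bl \<beta>" for \<beta> p
  proof -
    note b' = bl_left[OF b] bl_right[OF b]
    have l: "tensorial (\<lambda>\<beta>. e2 a b (\<lambda>u v. e2 u v (\<lambda>u v. \<beta> (u \<cdot> p) v)))"
      by (rule tensorial_bind[OF structure_in(2) tensorial_map[OF tensorial_AA[OF structure_in(2)]
            le_prod_right[OF le_id] le_id]]) (intro lin)
    have r: "tensorial (\<lambda>\<beta>. e2 a b (\<lambda>u v. \<beta> (u \<cdot> p) v))"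
      by (rule tensorial_map[OF tensorial_AA]) (auto intro!: lin)
    show ?thesis
    proof (rule cancel(4)[OF l r b])
      fix \<beta> q assume b: "bl \<beta>"
      note b' = bl_left[OF b] bl_right[OF b]
      have "e2 a b (\<lambda>u v. e2 u v (\<lambda>u v. \<beta> (u \<cdot> p) (v \<cdot> q))) = e2 a b (\<lambda>u v. e1 p q (\<lambda>x y. \<beta> (u \<cdot> x) (v \<cdot> y)))"
        by (simp add: E_sides[OF b])
      also have "\<dots> = e1 p q (\<lambda>x y. e2 a b (\<lambda>u v. \<beta> (u \<cdot> x) (v \<cdot> y)))"
        by (rule eval_commute) (auto intro!: lin b')
      also have "\<dots> = e1 p q (\<lambda>x y. e1 x y (\<lambda>u v. \<beta> (a \<cdot> u) (b \<cdot> v)))"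
        by (simp add: E_sides[OF b])
      also have "\<dots> = e2 a b (\<lambda>u v. \<beta> (u \<cdot> p) (v \<cdot> q))" unfolding E1_E1 by (rule E_sides[OF b])
      finally show "e2 a b (\<lambda>u v. e2 u v (\<lambda>u v. \<beta> (u \<cdot> p) (v \<cdot> q))) = e2 a b (\<lambda>u v. \<beta> (u \<cdot> p) (v \<cdot> q))" .
    qed
  qed
  ultimately show ?thesis by (rule cancel(2)[OF _ tensorial_AA[OF structure_in(2)] b])
qed

lemma E2_t2:
  assumes b: "bl \<beta>"
  shows "t2 b a (\<lambda>u v. e2 u (c \<cdot> v) \<beta>) = t2 b a (\<lambda>u v. \<beta> u (c \<cdot> v))"
proof -
  interpret vector_space "tscale :: 'k \<Rightarrow> ('k, 'a, 'a) tensor \<Rightarrow> _" by (rule vector_space_tscale)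
  have "fst (rgt H c) (t2 b a) \<in> tspan {fst (rgt H c) (T\<^sub>2 H (pure H b a)) | a b c. True}"
    by (rule span_base) (auto simp: t2_def)
  then have "fst (rgt H c) (t2 b a) \<in> tspan {E\<^sub>2 H (pure H b c) | b c. True}" using ax_vi(2) by simp
  then have "fst (rgt H c) (t2 b a) (\<lambda>u v. e2 u v \<beta>) = fst (rgt H c) (t2 b a) \<beta>"
    by (rule span_eval_eq) (auto simp: e2_def[symmetric] E2_E2[OF assms])
  moreover have "bl (\<lambda>u v. e2 u v \<beta>)" by (intro lin)
  ultimately show ?thesis by (simp add: side_eval b)
qed

lemma E1_coproduct:
  assumes g: "tri \<gamma>"
  shows "t1 b c (\<lambda>x y. e1 a x (\<lambda>u v. \<gamma> u v y)) = e1 a b (\<lambda>u v. t1 v c (\<lambda>x y. \<gamma> u x y))"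
  using legs_on_pure[OF structure_linear(1,3) g, of a b c] fun_cong[OF ax_vii(1), of "tens (spc2 H) (spc H) (pure H a b) c"]
  by (simp add: t1_def e1_def)

lemma E2_coproduct:
  assumes g: "tri \<gamma>"
  shows "t2 b c (\<lambda>x y. e2 a x (\<lambda>u v. \<gamma> u v y)) = e2 a c (\<lambda>u y. t2 b y (\<lambda>v w. \<gamma> u v w))"
proof -
  let ?\<delta> = "\<lambda>t w. t (\<lambda>u v. \<gamma> u v w)" and ?s = "tens (spc2 H) (spc H) (pure H a b) c"
  note d = tri_form[OF g] and l = structure_linear
  note g' = tri1[OF g] tri2[OF g] tri3[OF g]
  have 1: "on12 H (E\<^sub>2 H) (on23 H (T\<^sub>2 H) ?s) ?\<delta> = t2 b c (\<lambda>x y. e2 a x (\<lambda>u v. \<gamma> u v y))"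
    using legs_on_pure(1)[OF l(2,4) g] by (simp add: t2_def e2_def)
  have d': "bilinear_on (spc2 H) (spc H) ground (\<lambda>t w. t (\<lambda>u v. t2 v w (\<lambda>x y. \<gamma> u x y)))"
    by (rule tri_form) (intro lin g')
  have in13: "on13 H (E\<^sub>2 H) ?s \<in> vcar (spc2 H \<Otimes> spc H)"
    unfolding leg13_def o_def
    by (intro linear_onD(1)[OF assoc_inv_linear[OF is_vspaceA is_vspaceA is_vspaceA]]
        linear_onD(1)[OF assoc_linear[OF is_vspaceA is_vspaceA is_vspaceA]]
        linear_onD(1)[OF tmap_linear[OF is_vspaceA is_vspace_tensor idm_linear[OF is_vspaceA] tw_linear[OF is_vspaceA is_vspaceA]]]
        linear_onD(1)[OF tmap_linear[OF is_vspace_tensor is_vspaceA l(2) idm_linear[OF is_vspaceA]]]) simp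
  have "on23 H (T\<^sub>2 H) (on13 H (E\<^sub>2 H) ?s) ?\<delta> =
      on13 H (E\<^sub>2 H) ?s (\<lambda>t w. t (\<lambda>u v. t2 v w (\<lambda>x y. (pure H u x) (\<lambda>u v. \<gamma> u v y))))"
    using on23_eval[OF l(4) in13 d] by (simp add: t2_def)
  also have "\<dots> = on13 H (E\<^sub>2 H) ?s (\<lambda>t w. t (\<lambda>u v. t2 v w (\<lambda>x y. \<gamma> u x y)))"
    by (subst pure_eval) (intro lin g' refl)+
  also have "\<dots> = ?s (\<lambda>t w. t (\<lambda>u v. e2 u w (\<lambda>x y. (pure H x v) (\<lambda>u v. t2 v y (\<lambda>x y. \<gamma> u x y)))))"
    using on13_eval[OF l(2) _ d'] by (simp add: e2_def)
  also have "\<dots> = ?s (\<lambda>t w. t (\<lambda>u v. e2 u w (\<lambda>p y. t2 v y (\<lambda>x y. \<gamma> p x y))))"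
    by (subst pure_eval) (intro lin g' refl)+
  also have "\<dots> = (pure H a b) (\<lambda>u v. e2 u c (\<lambda>p y. t2 v y (\<lambda>x y. \<gamma> p x y)))"
    by (rule tens_eval, rule tri_form) (intro lin g')
  also have "\<dots> = e2 a c (\<lambda>u y. t2 b y (\<lambda>v w. \<gamma> u v w))"
    by (rule pure_eval) (intro lin g')
  finally show ?thesis using 1 fun_cong[OF ax_vii(2), of ?s] by simp
qed

lemma counit_E1:
  assumes l: "lf \<phi>"
  shows "e1 b c (\<lambda>u v. \<epsilon> u * \<phi> (a \<cdot> v)) = t1 a c (\<lambda>u v. \<epsilon> (u \<cdot> b) * \<phi> v)"
proof -
  have b: "bl (\<lambda>u v. \<epsilon> u * \<phi> v)" by (intro lin lf_comp[OF l])
  have "\<phi> (SL \<epsilon> (fst (rgt H a) (e1 b c))) = \<phi> (SL \<epsilon> (snd (lft H b) (t1 a c)))"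
    using ax_viii(1)[of a b c] by (simp add: e1_def t1_def)
  then show ?thesis by (simp add: SL_eval lf_eps[OF le_id] l side_eval b)
qed

lemma counit_E2:
  assumes l: "lf \<phi>"
  shows "e2 a b (\<lambda>u v. \<epsilon> u * \<phi> (v \<cdot> c)) = t2 a c (\<lambda>u v. \<epsilon> u * \<phi> (b \<cdot> v))"
proof -
  have b: "bl (\<lambda>u v. \<epsilon> u * \<phi> v)" by (intro lin lf_comp[OF l])
  have "\<phi> (SL \<epsilon> (snd (rgt H c) (e2 a b))) = \<phi> (SL \<epsilon> (fst (rgt H b) (t2 a c)))"
    using ax_viii(2)[of c a b] by (simp add: e2_def t2_def)
  then show ?thesis by (simp add: SL_eval lf_eps[OF le_id] l side_eval b)
qed

lemma t1_t3: "bl \<beta> \<Longrightarrow> t1 c b (\<lambda>u v. \<beta> u (a \<cdot> v)) = t3 c a (\<lambda>u v. \<beta> u (v \<cdot> b))"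
  using fun_cong[OF ax_ix(1)[of a c b], of \<beta>] by (simp add: side_eval t1_def[symmetric] t3_def[symmetric])

lemma t2_t4: "bl \<beta> \<Longrightarrow> t2 a c (\<lambda>u v. \<beta> (u \<cdot> b) v) = t4 b c (\<lambda>u v. \<beta> (a \<cdot> u) v)"
  using fun_cong[OF ax_ix(2)[of b a c], of \<beta>] by (simp add: side_eval t2_def[symmetric] t4_def[symmetric])

lemma counits:
  assumes l: "lf \<phi>"
  shows "t1 a b (\<lambda>u v. \<phi> v * \<epsilon> u) = \<phi> (a \<cdot> b)" "t2 a b (\<lambda>u v. \<epsilon> v * \<phi> u) = \<phi> (a \<cdot> b)"
  using counit_t1[OF l] counit_t2[OF l] by (simp_all add: mult.commute)

lemma cancel2_left:
  assumes "tensorial \<Phi>" "tensorial \<Psi>" and "bl \<beta>"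
    and *: "\<And>\<beta> p q. bl \<beta> \<Longrightarrow> \<Phi> (\<lambda>u v. \<beta> (p \<cdot> u) (q \<cdot> v)) = \<Psi> (\<lambda>u v. \<beta> (p \<cdot> u) (q \<cdot> v))"
  shows "\<Phi> \<beta> = \<Psi> \<beta>"
proof (rule cancel(1)[OF assms(1-3)])
  fix \<beta> p assume b: "bl \<beta>"
  show "\<Phi> (\<lambda>u v. \<beta> (p \<cdot> u) v) = \<Psi> (\<lambda>u v. \<beta> (p \<cdot> u) v)"
    by (rule cancel(3)[OF tensorial_map[OF assms(1) le_prod_left[OF le_id] le_id]
          tensorial_map[OF assms(2) le_prod_left[OF le_id] le_id] b *])
qed

lemma cancel2_right:
  assumes "tensorial \<Phi>" "tensorial \<Psi>" and "bl \<beta>"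
    and *: "\<And>\<beta> p q. bl \<beta> \<Longrightarrow> \<Phi> (\<lambda>u v. \<beta> (u \<cdot> p) (v \<cdot> q)) = \<Psi> (\<lambda>u v. \<beta> (u \<cdot> p) (v \<cdot> q))"
  shows "\<Phi> \<beta> = \<Psi> \<beta>"
proof (rule cancel(2)[OF assms(1-3)])
  fix \<beta> p assume b: "bl \<beta>"
  show "\<Phi> (\<lambda>u v. \<beta> (u \<cdot> p) v) = \<Psi> (\<lambda>u v. \<beta> (u \<cdot> p) v)"
    by (rule cancel(4)[OF tensorial_map[OF assms(1) le_prod_right[OF le_id] le_id]
          tensorial_map[OF assms(2) le_prod_right[OF le_id] le_id] b *])
qed

lemma leI: "(\<And>\<phi>. lf \<phi> \<Longrightarrow> lf (\<lambda>x. \<phi> (g x))) \<Longrightarrow> le g"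
  by (rule linear_onI_functionals[OF is_vspaceA is_vspaceA]) auto

text \<open>
  The counterpart of \<open>tensorial\<close> for elements of \<open>A\<close>.
\<close>

definition vectorial :: "(('a \<Rightarrow> 'k) \<Rightarrow> 'k) \<Rightarrow> bool" where
  "vectorial \<Phi> \<longleftrightarrow> (\<exists>w. \<forall>\<phi>. lf \<phi> \<longrightarrow> \<Phi> \<phi> = \<phi> w)"

lemma vectorial_element: "vectorial (\<lambda>\<phi>. \<phi> w)"
  by (auto simp: vectorial_def)

lemma vectorial_slice:
  assumes "t \<in> AA" "lf \<omega>"
  shows "vectorial (\<lambda>\<phi>. t (\<lambda>u v. \<phi> u * \<omega> v))" "vectorial (\<lambda>\<phi>. t (\<lambda>u v. \<omega> v * \<phi> u))"
    "vectorial (\<lambda>\<phi>. t (\<lambda>u v. \<phi> v * \<omega> u))" "vectorial (\<lambda>\<phi>. t (\<lambda>u v. \<omega> u * \<phi> v))"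
  unfolding vectorial_def
  using SR_eval[OF assms(2,1), symmetric] SL_eval[OF assms(2,1), symmetric]
  by (simp_all add: mult.commute) blast+

lemma vectorial_bind:
  assumes t: "t \<in> AA" and f: "\<And>x y. vectorial (f x y)" and b: "\<And>\<phi>. lf \<phi> \<Longrightarrow> bl (\<lambda>x y. f x y \<phi>)"
  shows "vectorial (\<lambda>\<phi>. t (\<lambda>x y. f x y \<phi>))"
proof -
  obtain g where g: "\<And>x y \<phi>. lf \<phi> \<Longrightarrow> f x y \<phi> = \<phi> (g x y)"
    using f unfolding vectorial_def by metis
  have l: "lf (\<lambda>x. \<phi> (g x y))" "lf (\<lambda>y. \<phi> (g x y))" if "lf \<phi>" for \<phi> x y
    using b[OF that] by (simp_all add: g[OF that] bilinear_on_def)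
  have "bilinear_on (spc H) (spc H) (spc H) g"
    unfolding bilinear_on_def by (auto intro!: leI l)
  from tlift_eval[OF is_vspaceA is_vspaceA is_vspaceA this _ t]
  show ?thesis unfolding vectorial_def using g by (metis (no_types, lifting) ext)
qed

lemma vectorial_map:
  assumes \<Phi>: "vectorial \<Phi>" and g: "le g"
  shows "vectorial (\<lambda>\<phi>. \<Phi> (\<lambda>x. \<phi> (g x)))"
  using \<Phi> lf_comp[OF _ g] unfolding vectorial_def by metis

lemma cancel_vector:
  assumes "vectorial \<Phi>" "vectorial \<Psi>" and \<phi>: "lf \<phi>"
  shows "(\<And>\<phi> p. lf \<phi> \<Longrightarrow> \<Phi> (\<lambda>x. \<phi> (p \<cdot> x)) = \<Psi> (\<lambda>x. \<phi> (p \<cdot> x))) \<Longrightarrow> \<Phi> \<phi> = \<Psi> \<phi>"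
    and "(\<And>\<phi> p. lf \<phi> \<Longrightarrow> \<Phi> (\<lambda>x. \<phi> (x \<cdot> p)) = \<Psi> (\<lambda>x. \<phi> (x \<cdot> p))) \<Longrightarrow> \<Phi> \<phi> = \<Psi> \<phi>"
proof -
  obtain w w' where w: "\<And>\<phi>. lf \<phi> \<Longrightarrow> \<Phi> \<phi> = \<phi> w" "\<And>\<phi>. lf \<phi> \<Longrightarrow> \<Psi> \<phi> = \<phi> w'"
    using assms by (auto simp: vectorial_def)
  show "\<Phi> \<phi> = \<Psi> \<phi>" if *: "\<And>\<phi> p. lf \<phi> \<Longrightarrow> \<Phi> (\<lambda>x. \<phi> (p \<cdot> x)) = \<Psi> (\<lambda>x. \<phi> (p \<cdot> x))"
  proof -
    have "w = w'"
      by (rule left_cancel) (use * w lf_comp[OF _ le_prod_left[OF le_id]] in metis)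
    then show ?thesis using w \<phi> by simp
  qed
  show "\<Phi> \<phi> = \<Psi> \<phi>" if *: "\<And>\<phi> p. lf \<phi> \<Longrightarrow> \<Phi> (\<lambda>x. \<phi> (x \<cdot> p)) = \<Psi> (\<lambda>x. \<phi> (x \<cdot> p))"
  proof -
    have "w = w'"
      by (rule right_cancel) (use * w lf_comp[OF _ le_prod_right[OF le_id]] in metis)
    then show ?thesis using w \<phi> by simp
  qed
qed

section \<open>The comultiplication\<close>

text \<open>
  The counit applied to the middle leg of coassociativity.
\<close>

lemma t1_t2:
  assumes b: "bl \<beta>"
  shows "t1 b c (\<lambda>u v. \<beta> (a \<cdot> u) v) = t2 a b (\<lambda>u v. \<beta> u (v \<cdot> c))"
proof -
  note [lin] = bl_left[OF b] bl_right[OF b]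
  have "t2 a x (\<lambda>u v. \<epsilon> v * \<beta> u y) = \<beta> (a \<cdot> x) y" for x y
    by (rule counits) (intro lin)
  moreover have "t1 v c (\<lambda>x y. \<epsilon> x * \<beta> u y) = \<beta> u (v \<cdot> c)" for u v
    by (rule counit_t1) (intro lin)
  ultimately show ?thesis using coassoc[of "\<lambda>u v y. \<epsilon> v * \<beta> u y" b c a] by (simp add: lin)
qed

lemma t1_t4:
  assumes b: "bl \<beta>"
  shows "t1 b c (\<lambda>u v. \<beta> (u \<cdot> a) v) = t4 a b (\<lambda>u v. \<beta> u (v \<cdot> c))"
proof (rule cancel(1)[OF _ _ b])
  show "tensorial (\<lambda>\<beta>. t1 b c (\<lambda>u. \<beta> (u \<cdot> a)))" "tensorial (\<lambda>\<beta>. t4 a b (\<lambda>u v. \<beta> u (v \<cdot> c)))"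
    using tensorial_map[OF tensorial_AA[OF structure_in(3)] le_prod_right[OF le_id] le_id]
      tensorial_map[OF tensorial_AA[OF structure_in(6)] le_id le_prod_right[OF le_id]] by auto
  fix \<beta> p assume b: "bl \<beta>"
  note [lin] = bl_left[OF b] bl_right[OF b]
  show "t1 b c (\<lambda>u v. \<beta> (p \<cdot> (u \<cdot> a)) v) = t4 a b (\<lambda>u v. \<beta> (p \<cdot> u) (v \<cdot> c))"
    using t1_t2[of "\<lambda>u v. \<beta> (u \<cdot> a) v" b c p] t2_t4[of "\<lambda>u v. \<beta> u (v \<cdot> c)" p b a] by (simp add: lin)
qed

lemma t3_t2:
  assumes b: "bl \<beta>"
  shows "t3 c a (\<lambda>u v. \<beta> (b \<cdot> u) v) = t2 b c (\<lambda>u v. \<beta> u (a \<cdot> v))"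
proof (rule cancel(4)[OF _ _ b])
  show "tensorial (\<lambda>\<beta>. t3 c a (\<lambda>u. \<beta> (b \<cdot> u)))" "tensorial (\<lambda>\<beta>. t2 b c (\<lambda>u v. \<beta> u (a \<cdot> v)))"
    using tensorial_map[OF tensorial_AA[OF structure_in(5)] le_prod_left[OF le_id] le_id]
      tensorial_map[OF tensorial_AA[OF structure_in(4)] le_id le_prod_left[OF le_id]] by auto
  fix \<beta> q assume b: "bl \<beta>"
  note [lin] = bl_left[OF b] bl_right[OF b]
  show "t3 c a (\<lambda>u v. \<beta> (b \<cdot> u) (v \<cdot> q)) = t2 b c (\<lambda>u v. \<beta> u (a \<cdot> v \<cdot> q))"
    using t1_t3[of "\<lambda>u v. \<beta> (b \<cdot> u) v" c q a] t1_t2[of "\<lambda>u v. \<beta> u (a \<cdot> v)" c q b] by (simp add: lin)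
qed

lemma t3_t4:
  assumes b: "bl \<beta>"
  shows "t3 c a (\<lambda>u v. \<beta> (u \<cdot> b) v) = t4 b c (\<lambda>u v. \<beta> u (a \<cdot> v))"
proof (rule cancel(4)[OF _ _ b])
  show "tensorial (\<lambda>\<beta>. t3 c a (\<lambda>u. \<beta> (u \<cdot> b)))" "tensorial (\<lambda>\<beta>. t4 b c (\<lambda>u v. \<beta> u (a \<cdot> v)))"
    using tensorial_map[OF tensorial_AA[OF structure_in(5)] le_prod_right[OF le_id] le_id]
      tensorial_map[OF tensorial_AA[OF structure_in(6)] le_id le_prod_left[OF le_id]] by auto
  fix \<beta> q assume b: "bl \<beta>"
  note [lin] = bl_left[OF b] bl_right[OF b]
  show "t3 c a (\<lambda>u v. \<beta> (u \<cdot> b) (v \<cdot> q)) = t4 b c (\<lambda>u v. \<beta> u (a \<cdot> v \<cdot> q))"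
    using t1_t3[of "\<lambda>u v. \<beta> (u \<cdot> b) v" c q a] t1_t4[of "\<lambda>u v. \<beta> u (a \<cdot> v)" c q b] by (simp add: lin)
qed

lemma t1_right:
  assumes b: "bl \<beta>"
  shows "t1 x (s \<cdot> c) \<beta> = t1 x s (\<lambda>u v. \<beta> u (v \<cdot> c))"
proof (rule cancel(1)[OF tensorial_AA[OF structure_in(3)] _ b])
  show "tensorial (\<lambda>\<beta>. t1 x s (\<lambda>u v. \<beta> u (v \<cdot> c)))"
    by (rule tensorial_map[OF tensorial_AA[OF structure_in(3)] le_id]) (intro lin)
  fix \<beta> p assume b: "bl \<beta>"
  note [lin] = bl_left[OF b] bl_right[OF b]
  show "t1 x (s \<cdot> c) (\<lambda>u v. \<beta> (p \<cdot> u) v) = t1 x s (\<lambda>u v. \<beta> (p \<cdot> u) (v \<cdot> c))"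
    using t1_t2[OF b, of x "s \<cdot> c" p] t1_t2[of "\<lambda>u v. \<beta> u (v \<cdot> c)" x s p] by (simp add: lin)
qed

lemma e1_right:
  assumes b: "bl \<beta>"
  shows "e1 c (d \<cdot> r) \<beta> = e1 c d (\<lambda>u v. \<beta> u (v \<cdot> r))"
proof (rule cancel2_left[OF _ _ b])
  show "tensorial (e1 c (d \<cdot> r))" "tensorial (\<lambda>\<beta>. e1 c d (\<lambda>u v. \<beta> u (v \<cdot> r)))"
    using tensorial_AA[OF structure_in(1)]
      tensorial_map[OF tensorial_AA[OF structure_in(1)] le_id le_prod_right[OF le_id]] by auto
  fix \<beta> p q assume b: "bl \<beta>"
  note [lin] = bl_left[OF b] bl_right[OF b]
  show "e1 c (d \<cdot> r) (\<lambda>u v. \<beta> (p \<cdot> u) (q \<cdot> v)) = e1 c d (\<lambda>u v. \<beta> (p \<cdot> u) (q \<cdot> (v \<cdot> r)))"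
    using E_sides[of \<beta> c "d \<cdot> r" p q] E_sides[of "\<lambda>u v. \<beta> u (v \<cdot> r)" c d p q] b by (simp add: lin)
qed

lemma e2_left:
  assumes b: "bl \<beta>"
  shows "e2 c (r \<cdot> d) \<beta> = e2 c d (\<lambda>u v. \<beta> u (r \<cdot> v))"
proof (rule cancel2_right[OF _ _ b])
  show "tensorial (e2 c (r \<cdot> d))" "tensorial (\<lambda>\<beta>. e2 c d (\<lambda>u v. \<beta> u (r \<cdot> v)))"
    using tensorial_AA[OF structure_in(2)]
      tensorial_map[OF tensorial_AA[OF structure_in(2)] le_id le_prod_left[OF le_id]] by auto
  fix \<beta> p q assume b: "bl \<beta>"
  note [lin] = bl_left[OF b] bl_right[OF b]
  show "e2 c (r \<cdot> d) (\<lambda>u v. \<beta> (u \<cdot> p) (v \<cdot> q)) = e2 c d (\<lambda>u v. \<beta> (u \<cdot> p) (r \<cdot> v \<cdot> q))"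
    using E_sides[of \<beta> p q c "r \<cdot> d"] E_sides[of "\<lambda>u v. \<beta> u (r \<cdot> v)" p q c d] b by (simp add: lin)
qed

lemma mult_t2:
  assumes b: "bl \<beta>"
  shows "t2 z (b \<cdot> d) \<beta> = t2 z b (\<lambda>u v. t2 u d (\<lambda>p q. \<beta> p (v \<cdot> q)))"
proof (rule cancel(4)[OF _ _ b])
  show "tensorial (t2 z (b \<cdot> d))" by (rule tensorial_AA[OF structure_in(4)])
  show "tensorial (\<lambda>\<beta>. t2 z b (\<lambda>u v. t2 u d (\<lambda>p q. \<beta> p (v \<cdot> q))))"
  proof (rule tensorial_bind[OF structure_in(4)])
    show "tensorial (\<lambda>\<beta>. t2 u d (\<lambda>p q. \<beta> p (v \<cdot> q)))" for u v
      by (rule tensorial_map[OF tensorial_AA[OF structure_in(4)] le_id le_prod_left[OF le_id]])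
    fix \<beta> assume b: "bl \<beta>"
    note [lin] = bl_left[OF b] bl_right[OF b]
    show "bl (\<lambda>u v. t2 u d (\<lambda>p q. \<beta> p (v \<cdot> q)))" by (intro lin)
  qed
  fix \<beta> c assume b: "bl \<beta>"
  note [lin] = bl_left[OF b] bl_right[OF b]
  have "t2 z (b \<cdot> d) (\<lambda>u v. \<beta> u (v \<cdot> c)) = t1 (b \<cdot> d) c (\<lambda>u v. \<beta> (z \<cdot> u) v)"
    by (rule t1_t2[OF b, symmetric])
  also have "\<dots> = t1 d c (\<lambda>x y. t1 b y (\<lambda>u v. \<beta> (z \<cdot> (u \<cdot> x)) v))"
    by (rule mult_t1) (intro lin)
  also have "\<dots> = t1 d c (\<lambda>x y. t2 z b (\<lambda>u v. \<beta> (u \<cdot> x) (v \<cdot> y)))"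
    using t1_t2[of "\<lambda>u v. \<beta> (u \<cdot> x) v" for x] by (simp add: lin)
  also have "\<dots> = t2 z b (\<lambda>u v. t1 d c (\<lambda>x y. \<beta> (u \<cdot> x) (v \<cdot> y)))"
    by (rule eval_commute[OF structure_in(3) structure_in(4)]) (intro lin)+
  also have "\<dots> = t2 z b (\<lambda>u v. t2 u d (\<lambda>p q. \<beta> p (v \<cdot> (q \<cdot> c))))"
    using t1_t2[of "\<lambda>x y. \<beta> x (v \<cdot> y)" for v] by (simp add: lin)
  finally show "t2 z (b \<cdot> d) (\<lambda>u v. \<beta> u (v \<cdot> c)) = t2 z b (\<lambda>u v. t2 u d (\<lambda>p q. \<beta> p (v \<cdot> q \<cdot> c)))"
    by simp
qed

lemma coassoc_t3:
  assumes b: "bl \<beta>" and l: "lf \<psi>"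
  shows "t3 b a (\<lambda>x y. t2 z x \<beta> * \<psi> y) = t2 z b (\<lambda>u v. t3 v a (\<lambda>p q. \<beta> u p * \<psi> q))"
proof (rule cancel_vector(2)[where \<Phi> = "\<lambda>\<psi>. t3 b a (\<lambda>x y. t2 z x \<beta> * \<psi> y)"
      and \<Psi> = "\<lambda>\<psi>. t2 z b (\<lambda>u v. t3 v a (\<lambda>p q. \<beta> u p * \<psi> q))", OF _ _ l])
  note [lin] = bl_left[OF b] bl_right[OF b]
  show "vectorial (\<lambda>\<psi>. t3 b a (\<lambda>x y. t2 z x \<beta> * \<psi> y))"
    by (rule vectorial_slice) (simp, intro lin)
  show "vectorial (\<lambda>\<psi>. t2 z b (\<lambda>u v. t3 v a (\<lambda>p q. \<beta> u p * \<psi> q)))"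
  proof (rule vectorial_bind[OF structure_in(4)])
    fix \<phi> assume l: "lf \<phi>"
    note [lin] = lf_comp[OF l]
    show "bl (\<lambda>u v. t3 v a (\<lambda>p q. \<beta> u p * \<phi> q))" by (intro lin)
  next
    show "vectorial (\<lambda>\<psi>. t3 v a (\<lambda>p q. \<beta> u p * \<psi> q))" for u v
      by (rule vectorial_slice) (simp, intro lin)
  qed
  fix \<psi> c assume l: "lf \<psi>"
  note [lin] = lf_comp[OF l]
  have "t3 b a (\<lambda>x y. t2 z x \<beta> * \<psi> (y \<cdot> c)) = t1 b c (\<lambda>x y. t2 z x \<beta> * \<psi> (a \<cdot> y))"
    by (rule t1_t3[symmetric]) (intro lin)
  also have "\<dots> = t1 b c (\<lambda>x y. t2 z x (\<lambda>u v. \<beta> u v * \<psi> (a \<cdot> y)))"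
    by (simp add: eval_times b)
  also have "\<dots> = t2 z b (\<lambda>u v. t1 v c (\<lambda>x y. \<beta> u x * \<psi> (a \<cdot> y)))"
    by (rule coassoc) (intro lin)
  also have "\<dots> = t2 z b (\<lambda>u v. t3 v a (\<lambda>x y. \<beta> u x * \<psi> (y \<cdot> c)))"
    using t1_t3[of "\<lambda>x y. \<beta> u x * \<psi> y" for u] by (simp add: lin)
  finally show "t3 b a (\<lambda>x y. t2 z x \<beta> * \<psi> (y \<cdot> c)) = t2 z b (\<lambda>u v. t3 v a (\<lambda>p q. \<beta> u p * \<psi> (q \<cdot> c)))" .
qed

text \<open>
  \<open>\<Delta>(b)E = \<Delta>(b)\<close>: once \<open>\<Delta>(b)\<close> is covered from the left, \<open>E\<close> may act from the right on the covered
  coproduct, which it fixes.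
\<close>

lemma coproduct_E:
  assumes b: "bl \<beta>"
  shows "e1 c a (\<lambda>x y. t1 b y (\<lambda>u v. \<beta> (u \<cdot> x) v)) = t1 b a (\<lambda>u v. \<beta> (u \<cdot> c) v)"
proof (rule cancel2_left[OF _ _ b])
  show "tensorial (\<lambda>\<beta>. e1 c a (\<lambda>x y. t1 b y (\<lambda>u. \<beta> (u \<cdot> x))))"
  proof (rule tensorial_bind[OF structure_in(1)])
    show "tensorial (\<lambda>\<beta>. t1 b y (\<lambda>u v. \<beta> (u \<cdot> x) v))" for x y
      by (rule tensorial_map[OF tensorial_AA[OF structure_in(3)] le_prod_right[OF le_id] le_id])
    fix \<beta> assume b: "bl \<beta>"
    note [lin] = bl_left[OF b] bl_right[OF b]
    show "bl (\<lambda>x y. t1 b y (\<lambda>u v. \<beta> (u \<cdot> x) v))" by (intro lin)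
  qed
  show "tensorial (\<lambda>\<beta>. t1 b a (\<lambda>u. \<beta> (u \<cdot> c)))"
    using tensorial_map[OF tensorial_AA[OF structure_in(3)] le_prod_right[OF le_id] le_id] by auto
  fix \<beta> p q assume bb: "bl \<beta>"
  note [lin] = bl_left[OF bb] bl_right[OF bb]
  \<comment> \<open>Covering by \<open>p\<close> turns \<open>\<Delta>(b)\<close> into the tensor \<open>(p \<otimes> 1)\<Delta>(b)\<close>; then the left and the right action of \<open>E\<close> may be exchanged.\<close>
  have "e1 c a (\<lambda>x y. t1 b y (\<lambda>u v. \<beta> (p \<cdot> (u \<cdot> x)) (q \<cdot> v))) =
      e1 c a (\<lambda>x y. t2 p b (\<lambda>u v. \<beta> (u \<cdot> x) (q \<cdot> (v \<cdot> y))))"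
    using t1_t2[of "\<lambda>u v. \<beta> (u \<cdot> x) (q \<cdot> v)" for x] by (simp add: lin)
  also have "\<dots> = t2 p b (\<lambda>u v. e1 c a (\<lambda>x y. \<beta> (u \<cdot> x) (q \<cdot> (v \<cdot> y))))"
    by (rule eval_commute[OF structure_in(1) structure_in(4)]) (intro lin)+
  also have "\<dots> = t2 p b (\<lambda>u v. e2 u (q \<cdot> v) (\<lambda>x y. \<beta> (x \<cdot> c) (y \<cdot> a)))"
    using E_sides[OF bb, of c a u "q \<cdot> v" for u v] by simp
  also have "\<dots> = t2 p b (\<lambda>u v. \<beta> (u \<cdot> c) (q \<cdot> v \<cdot> a))"
    by (rule E2_t2) (intro lin)
  also have "\<dots> = t1 b a (\<lambda>u v. \<beta> (p \<cdot> (u \<cdot> c)) (q \<cdot> v))"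
    using t1_t2[of "\<lambda>u v. \<beta> (u \<cdot> c) (q \<cdot> v)" b a p] by (simp add: lin)
  finally show "e1 c a (\<lambda>x y. t1 b y (\<lambda>u v. \<beta> (p \<cdot> (u \<cdot> x)) (q \<cdot> v))) =
      t1 b a (\<lambda>u v. \<beta> (p \<cdot> (u \<cdot> c)) (q \<cdot> v))" .
qed

text \<open>
  \<open>E\<Delta>(c) = \<Delta>(c)\<close>, by the mirror image of the preceding argument: once \<open>\<Delta>(c)\<close> is also covered from the right,
  \<open>E\<close> may act from the left on the covered coproduct.
\<close>

lemma E_coproduct:
  assumes b: "bl \<beta>"
  shows "e2 b a (\<lambda>u v. t2 u c (\<lambda>p q. \<beta> p (v \<cdot> q))) = t2 b c (\<lambda>p q. \<beta> p (a \<cdot> q))"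
proof (rule cancel2_right[OF _ _ b])
  show "tensorial (\<lambda>\<beta>. e2 b a (\<lambda>u v. t2 u c (\<lambda>p q. \<beta> p (v \<cdot> q))))"
  proof (rule tensorial_bind[OF structure_in(2)])
    show "tensorial (\<lambda>\<beta>. t2 u c (\<lambda>p q. \<beta> p (v \<cdot> q)))" for u v
      by (rule tensorial_map[OF tensorial_AA[OF structure_in(4)] le_id le_prod_left[OF le_id]])
    fix \<beta> assume b: "bl \<beta>"
    note [lin] = bl_left[OF b] bl_right[OF b]
    show "bl (\<lambda>u v. t2 u c (\<lambda>p q. \<beta> p (v \<cdot> q)))" by (intro lin)
  qed
  show "tensorial (\<lambda>\<beta>. t2 b c (\<lambda>p q. \<beta> p (a \<cdot> q)))"
    by (rule tensorial_map[OF tensorial_AA[OF structure_in(4)] le_id le_prod_left[OF le_id]])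
  fix \<beta> p q assume bb: "bl \<beta>"
  note [lin] = bl_left[OF bb] bl_right[OF bb]
  have "e2 b a (\<lambda>u v. t2 u c (\<lambda>x y. \<beta> (x \<cdot> p) (v \<cdot> (y \<cdot> q)))) =
      e2 b a (\<lambda>u v. t1 c q (\<lambda>x y. \<beta> (u \<cdot> (x \<cdot> p)) (v \<cdot> y)))"
    using t1_t2[of "\<lambda>x y. \<beta> (x \<cdot> p) (v \<cdot> y)" for v] by (simp add: lin)
  also have "\<dots> = t1 c q (\<lambda>x y. e2 b a (\<lambda>u v. \<beta> (u \<cdot> (x \<cdot> p)) (v \<cdot> y)))"
    by (rule eval_commute[OF structure_in(2) structure_in(3)]) (intro lin)+
  also have "\<dots> = t1 c q (\<lambda>x y. e1 (x \<cdot> p) y (\<lambda>u v. \<beta> (b \<cdot> u) (a \<cdot> v)))"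
    using E_sides[OF bb, of "x \<cdot> p" y b a for x y] by simp
  also have "\<dots> = t1 c q (\<lambda>x y. \<beta> (b \<cdot> (x \<cdot> p)) (a \<cdot> y))"
    by (rule E1_t1) (intro lin)
  also have "\<dots> = t2 b c (\<lambda>x y. \<beta> (x \<cdot> p) (a \<cdot> (y \<cdot> q)))"
    using t1_t2[of "\<lambda>u v. \<beta> (u \<cdot> p) (a \<cdot> v)" c q b] by (simp add: lin)
  finally show "e2 b a (\<lambda>u v. t2 u c (\<lambda>x y. \<beta> (x \<cdot> p) (v \<cdot> y \<cdot> q))) =
      t2 b c (\<lambda>x y. \<beta> (x \<cdot> p) (a \<cdot> y \<cdot> q))" by simp
qed

section \<open>The counit and the base maps\<close>

text \<open>
  \<open>\<epsilon>(x y\<^sub>1) \<epsilon>(y\<^sub>2 a) = \<epsilon>(x y a)\<close>. By \<open>ax_viii\<close> the element \<open>\<epsilon>(x y\<^sub>1) y\<^sub>2 = \<epsilon>(x E\<^sup>1) E\<^sup>2 y\<close> depends on \<open>y\<close> in a right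
  \<open>A\<close>-linear way. So \<open>a\<close> may be moved into \<open>y\<close>, and then the counit axiom applies.
\<close>

lemma counit_prod:
  "t2 x y (\<lambda>u v. \<epsilon> u * \<epsilon> (v \<cdot> a)) = \<epsilon> (x \<cdot> (y \<cdot> a))"
proof -
  have "t2 x (y \<cdot> a) (\<lambda>u v. \<epsilon> u * \<epsilon> v) = t2 x y (\<lambda>u v. \<epsilon> u * \<epsilon> (v \<cdot> a))"
  proof (rule cancel_vector(1)[of "\<lambda>\<phi>. t2 x (y \<cdot> a) (\<lambda>u v. \<epsilon> u * \<phi> v)" "\<lambda>\<phi>. t2 x y (\<lambda>u v. \<epsilon> u * \<phi> (v \<cdot> a))"])
    show v: "vectorial (\<lambda>\<phi>. t2 x y (\<lambda>u v. \<epsilon> u * \<phi> v))" for y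
      by (rule vectorial_slice) (simp, intro lin)
    show "vectorial (\<lambda>\<phi>. t2 x y (\<lambda>u v. \<epsilon> u * \<phi> (v \<cdot> a)))"
      by (rule vectorial_map[OF v]) (intro lin)
    fix \<phi> b assume l: "lf \<phi>"
    note [lin] = lf_comp[OF l]
    show "t2 x (y \<cdot> a) (\<lambda>u v. \<epsilon> u * \<phi> (b \<cdot> v)) = t2 x y (\<lambda>u v. \<epsilon> u * \<phi> (b \<cdot> (v \<cdot> a)))"
      using counit_E2[OF l, of x b "y \<cdot> a"] counit_E2[of "\<lambda>w. \<phi> (w \<cdot> a)" x b y] by (simp add: lin)
  qed (intro lin)
  then show ?thesis using counit_t2[of \<epsilon> x "y \<cdot> a"] by (simp add: lin lf_eps[OF le_id])
qed

lemma counit_t4: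
  assumes l: "lf \<phi>"
  shows "t4 a b (\<lambda>u v. \<phi> u * \<epsilon> v) = \<phi> (b \<cdot> a)"
proof (rule cancel_vector(1)[OF _ vectorial_element l])
  show "vectorial (\<lambda>\<phi>. t4 a b (\<lambda>u v. \<phi> u * \<epsilon> v))"
    by (rule vectorial_slice) (simp, intro lin)
  fix \<phi> p assume l: "lf \<phi>"
  note [lin] = lf_comp[OF l]
  show "t4 a b (\<lambda>u v. \<phi> (p \<cdot> u) * \<epsilon> v) = \<phi> (p \<cdot> (b \<cdot> a))"
    using t2_t4[of "\<lambda>u v. \<phi> u * \<epsilon> v" p b a] counit_t2[of "\<lambda>u. \<phi> (u \<cdot> a)" p b] by (simp add: lin)
qed

text \<open>
  The mirror image \<open>\<epsilon>(y\<^sub>1 x) \<epsilon>(a y\<^sub>2) = \<epsilon>(a y x)\<close>.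
\<close>

lemma counit_prod':
  "t4 x y (\<lambda>u v. \<epsilon> u * \<epsilon> (a \<cdot> v)) = \<epsilon> (a \<cdot> (y \<cdot> x))"
proof -
  have "t4 x (a \<cdot> y) (\<lambda>u v. \<epsilon> u * \<epsilon> v) = t4 x y (\<lambda>u v. \<epsilon> u * \<epsilon> (a \<cdot> v))"
  proof (rule cancel_vector(2)[of "\<lambda>\<phi>. t4 x (a \<cdot> y) (\<lambda>u v. \<epsilon> u * \<phi> v)" "\<lambda>\<phi>. t4 x y (\<lambda>u v. \<epsilon> u * \<phi> (a \<cdot> v))"])
    show v: "vectorial (\<lambda>\<phi>. t4 x y (\<lambda>u v. \<epsilon> u * \<phi> v))" for y
      by (rule vectorial_slice) (simp, intro lin)
    show "vectorial (\<lambda>\<phi>. t4 x y (\<lambda>u v. \<epsilon> u * \<phi> (a \<cdot> v)))"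
      by (rule vectorial_map[OF v]) (intro lin)
    fix \<phi> c assume l: "lf \<phi>"
    note [lin] = lf_comp[OF l]
    show "t4 x (a \<cdot> y) (\<lambda>u v. \<epsilon> u * \<phi> (v \<cdot> c)) = t4 x y (\<lambda>u v. \<epsilon> u * \<phi> (a \<cdot> v \<cdot> c))"
      using counit_E1[OF l, of x c "a \<cdot> y"] t1_t4[of "\<lambda>u v. \<epsilon> u * \<phi> v" "a \<cdot> y" c x]
        counit_E1[of "\<lambda>w. \<phi> (a \<cdot> w)" x c y] t1_t4[of "\<lambda>u v. \<epsilon> u * \<phi> (a \<cdot> v)" y c x]
      by (simp add: lin)
  qed (intro lin)
  then show ?thesis using counit_t4[of \<epsilon> x "a \<cdot> y"] by (simp add: lin lf_eps[OF le_id])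
qed

lemma capR_eval:
  assumes l: "lf \<phi>"
  shows "\<phi> (fst (capR H a) c) = t3 c a (\<lambda>u v. \<phi> u * \<epsilon> v)"
    "\<phi> (snd (capR H a) c) = e2 c a (\<lambda>u v. \<phi> u * \<epsilon> v)"
    "\<phi> (fst (capR_bar H a) c) = e1 c a (\<lambda>u v. \<phi> u * \<epsilon> v)"
    "\<phi> (snd (capR_bar H a) c) = t1 c a (\<lambda>u v. \<phi> u * \<epsilon> v)"
  unfolding capR_def capR_bar_def fst_conv snd_conv t3_def[symmetric] e2_def[symmetric]
    e1_def[symmetric] t1_def[symmetric]
  by (rule SR_eval[OF lf_eps[OF le_id] _ l]; simp)+

lemma le_capR_arg [lin]:
  assumes g: "le g"
  shows "le (\<lambda>x. fst (capR H a) (g x))" "le (\<lambda>x. snd (capR H a) (g x))"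
    "le (\<lambda>x. fst (capR_bar H a) (g x))" "le (\<lambda>x. snd (capR_bar H a) (g x))"
    "le (\<lambda>x. fst (capR H (g x)) c)" "le (\<lambda>x. snd (capR H (g x)) c)"
    "le (\<lambda>x. fst (capR_bar H (g x)) c)" "le (\<lambda>x. snd (capR_bar H (g x)) c)"
  by (rule leI, simp add: capR_eval, intro lin g lf_comp; assumption)+

text \<open>
  \<open>b\<^sub>1 d\<^sub>1 \<epsilon>(b\<^sub>2 d\<^sub>2 a) = b\<^sub>1 d\<^sub>1 \<epsilon>(b\<^sub>2 d\<^sub>2) \<epsilon>(d\<^sub>3 a) = b d\<^sub>1 \<epsilon>(d\<^sub>2 a)\<close>, by \<open>counit_prod\<close> and then the counit axiom for
  the product \<open>b d\<^sub>1\<close>.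
\<close>

lemma snd_capR_bar_prod: "snd (capR_bar H a) (b \<cdot> d) = b \<cdot> snd (capR_bar H a) d"
proof (rule A_eqI)
  fix \<phi> assume l: "lf \<phi>"
  note [lin] = lf_comp[OF l]
  have "t1 (b \<cdot> d) a (\<lambda>u v. \<phi> u * \<epsilon> v) = t1 d a (\<lambda>u v. \<phi> (b \<cdot> u) * \<epsilon> v)"
  proof (rule cancel_vector(1)[of "\<lambda>\<phi>. t1 (b \<cdot> d) a (\<lambda>u v. \<phi> u * \<epsilon> v)"
        "\<lambda>\<phi>. t1 d a (\<lambda>u v. \<phi> (b \<cdot> u) * \<epsilon> v)", OF _ _ l])
    show v: "vectorial (\<lambda>\<phi>. t1 d a (\<lambda>u v. \<phi> u * \<epsilon> v))" for d
      by (rule vectorial_slice) (simp, intro lin)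
    show "vectorial (\<lambda>\<phi>. t1 d a (\<lambda>u v. \<phi> (b \<cdot> u) * \<epsilon> v))"
      by (rule vectorial_map[OF v]) (intro lin)
    fix \<phi> z assume l: "lf \<phi>"
    note [lin] = lf_comp[OF l]
    \<comment> \<open>By \<open>counit_prod\<close>, \<open>\<epsilon>(v d\<^sub>2 a) = \<epsilon>(v d\<^sub>2) \<epsilon>(d\<^sub>3 a)\<close>.\<close>
    have inner: "t1 d a (\<lambda>x y. \<phi> (u \<cdot> x) * \<epsilon> (v \<cdot> y)) =
        t1 d a (\<lambda>p q. t2 u p (\<lambda>x y. \<phi> x * \<epsilon> (v \<cdot> y)) * \<epsilon> q)" for u v
    proof -
      have "t1 d a (\<lambda>x y. \<phi> (u \<cdot> x) * \<epsilon> (v \<cdot> y)) = t2 u d (\<lambda>x y. \<phi> x * \<epsilon> (v \<cdot> (y \<cdot> a)))"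
        using t1_t2[of "\<lambda>x y. \<phi> x * \<epsilon> (v \<cdot> y)" d a u] by (simp add: lin)
      also have "\<dots> = t2 u d (\<lambda>x y. t2 v y (\<lambda>p q. \<phi> x * (\<epsilon> p * \<epsilon> (q \<cdot> a))))"
        by (subst eval_times) (auto simp: counit_prod intro!: lin)
      also have "\<dots> = t2 u d (\<lambda>x y. t1 y a (\<lambda>p q. \<phi> x * \<epsilon> (v \<cdot> p) * \<epsilon> q))"
        using t1_t2[of "\<lambda>p q. \<phi> x * (\<epsilon> p * \<epsilon> q)" y a v for x y] by (simp add: lin mult.assoc)
      also have "\<dots> = t1 d a (\<lambda>p q. t2 u p (\<lambda>x y. \<phi> x * \<epsilon> (v \<cdot> y) * \<epsilon> q))"
        by (rule coassoc[symmetric]) (intro lin)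
      also have "\<dots> = t1 d a (\<lambda>p q. t2 u p (\<lambda>x y. \<phi> x * \<epsilon> (v \<cdot> y)) * \<epsilon> q)"
        by (subst eval_times(2)) (auto intro!: lin)
      finally show ?thesis .
    qed
    have "t1 (b \<cdot> d) a (\<lambda>u v. \<phi> (z \<cdot> u) * \<epsilon> v) = t1 d a (\<lambda>x y. t1 b y (\<lambda>u v. \<phi> (z \<cdot> (u \<cdot> x)) * \<epsilon> v))"
      by (rule mult_t1) (intro lin)
    also have "\<dots> = t1 d a (\<lambda>x y. t2 z b (\<lambda>u v. \<phi> (u \<cdot> x) * \<epsilon> (v \<cdot> y)))"
      using t1_t2[of "\<lambda>u v. \<phi> (u \<cdot> x) * \<epsilon> v" for x] by (simp add: lin)
    also have "\<dots> = t2 z b (\<lambda>u v. t1 d a (\<lambda>x y. \<phi> (u \<cdot> x) * \<epsilon> (v \<cdot> y)))"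
      by (rule eval_commute[OF structure_in(3) structure_in(4)]) (intro lin)+
    also have "\<dots> = t2 z b (\<lambda>u v. t1 d a (\<lambda>p q. t2 u p (\<lambda>x y. \<phi> x * \<epsilon> (v \<cdot> y)) * \<epsilon> q))"
      by (simp only: inner)
    also have "\<dots> = t1 d a (\<lambda>p q. t2 z b (\<lambda>u v. t2 u p (\<lambda>x y. \<phi> x * \<epsilon> (v \<cdot> y)) * \<epsilon> q))"
      by (rule eval_commute[OF structure_in(4) structure_in(3)]) (intro lin)+
    also have "\<dots> = t1 d a (\<lambda>p q. t2 z (b \<cdot> p) (\<lambda>x y. \<phi> x * \<epsilon> y) * \<epsilon> q)"
    proof -
      have "t2 z (b \<cdot> p) (\<lambda>x y. \<phi> x * \<epsilon> y) = t2 z b (\<lambda>u v. t2 u p (\<lambda>x y. \<phi> x * \<epsilon> (v \<cdot> y)))" for p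
        by (rule mult_t2) (intro lin)
      then show ?thesis by (subst eval_times(2)[OF structure_in(4)]) (auto intro!: lin)
    qed
    also have "\<dots> = t1 d a (\<lambda>p q. \<phi> (z \<cdot> (b \<cdot> p)) * \<epsilon> q)"
      by (simp add: counit_t2[OF l])
    finally show "t1 (b \<cdot> d) a (\<lambda>u v. \<phi> (z \<cdot> u) * \<epsilon> v) = t1 d a (\<lambda>u v. \<phi> (z \<cdot> (b \<cdot> u)) * \<epsilon> v)" .
  qed
  then show "\<phi> (snd (capR_bar H a) (b \<cdot> d)) = \<phi> (b \<cdot> snd (capR_bar H a) d)"
    using capR_eval(4)[of "\<lambda>x. \<phi> (b \<cdot> x)" a d] by (simp add: capR_eval l lin)
qed

text \<open>
  The two actions of \<open>N'(a)\<close> are defined through \<open>E\<close> and through \<open>\<Delta>\<close>. Writing \<open>E(c \<otimes> a)\<close> as a sum of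
  elements \<open>\<Delta>(d)(c' \<otimes> a')\<close>, the left linearity just proved turns \<open>b E\<^sup>1 c \<epsilon>(E\<^sup>2 a)\<close> into the value of
  \<open>\<Delta>(b)E = \<Delta>(b)\<close>.
\<close>

lemma capR_bar_multiplier: "b \<cdot> fst (capR_bar H a) c = snd (capR_bar H a) b \<cdot> c"
proof (rule A_eqI)
  fix \<phi> assume l: "lf \<phi>"
  note [lin] = lf_comp[OF l]
  have "e1 c a (\<lambda>u v. \<phi> (b \<cdot> u) * \<epsilon> v) = e1 c a (\<lambda>x y. t1 b y (\<lambda>u v. \<phi> (u \<cdot> x) * \<epsilon> v))"
  proof (rule E1_induct)
    fix c d a
    have "t1 d a (\<lambda>u v. \<phi> (b \<cdot> (u \<cdot> c)) * \<epsilon> v) = t1 (b \<cdot> d) a (\<lambda>u v. \<phi> (u \<cdot> c) * \<epsilon> v)"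
      using capR_eval(4)[of "\<lambda>x. \<phi> (x \<cdot> c)" a "b \<cdot> d"] capR_eval(4)[of "\<lambda>x. \<phi> (b \<cdot> (x \<cdot> c))" a d]
      by (simp add: snd_capR_bar_prod lin)
    also have "\<dots> = t1 d a (\<lambda>x y. t1 b y (\<lambda>u v. \<phi> (u \<cdot> (x \<cdot> c)) * \<epsilon> v))"
      using mult_t1[of "\<lambda>u v. \<phi> (u \<cdot> c) * \<epsilon> v" b d a] by (simp add: lin)
    finally show "t1 d a (\<lambda>u v. \<phi> (b \<cdot> (u \<cdot> c)) * \<epsilon> v) = t1 d a (\<lambda>x y. t1 b y (\<lambda>u v. \<phi> (u \<cdot> (x \<cdot> c)) * \<epsilon> v))" .
  qed (intro lin)+
  also have "\<dots> = t1 b a (\<lambda>u v. \<phi> (u \<cdot> c) * \<epsilon> v)"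
    by (rule coproduct_E) (intro lin)
  finally show "\<phi> (b \<cdot> fst (capR_bar H a) c) = \<phi> (snd (capR_bar H a) b \<cdot> c)"
    using capR_eval(3)[of "\<lambda>x. \<phi> (b \<cdot> x)" a c] capR_eval(4)[of "\<lambda>x. \<phi> (x \<cdot> c)" a b] by (simp add: lin)
qed

lemma fst_capR_eval:
  assumes l: "lf \<phi>"
  shows "\<phi> (z \<cdot> fst (capR H a) b) = t2 z b (\<lambda>u v. \<phi> u * \<epsilon> (a \<cdot> v))"
proof -
  note [lin] = lf_comp[OF l]
  show ?thesis
    using capR_eval(1)[of "\<lambda>x. \<phi> (z \<cdot> x)" a b] t3_t2[of "\<lambda>u v. \<phi> u * \<epsilon> v" b a z] by (simp add: lin)
qed

text \<open>
  Mirror image of \<open>snd_capR_bar_prod\<close>: \<open>b\<^sub>1 d\<^sub>1 \<epsilon>(a b\<^sub>2 d\<^sub>2) = b\<^sub>1 d\<^sub>1 \<epsilon>(b\<^sub>2 d\<^sub>2) \<epsilon>(a b\<^sub>3) = b\<^sub>1 d \<epsilon>(a b\<^sub>2)\<close>.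
\<close>

lemma fst_capR_prod: "fst (capR H a) (b \<cdot> d) = fst (capR H a) b \<cdot> d"
proof (rule left_cancel)
  fix \<phi> z assume l: "lf \<phi>"
  note [lin] = lf_comp[OF l]
  have inner: "t2 u d (\<lambda>p q. \<phi> p * \<epsilon> (a \<cdot> (v \<cdot> q))) = t3 v a (\<lambda>r s. t2 u d (\<lambda>p q. \<phi> p * \<epsilon> (r \<cdot> q)) * \<epsilon> s)" for u v
  proof -
    have "t2 u d (\<lambda>p q. \<phi> p * \<epsilon> (a \<cdot> (v \<cdot> q))) = t2 u d (\<lambda>p q. t4 q v (\<lambda>r s. \<phi> p * (\<epsilon> r * \<epsilon> (a \<cdot> s))))"
      by (subst eval_times) (auto simp: counit_prod' intro!: lin)
    also have "\<dots> = t2 u d (\<lambda>p q. t3 v a (\<lambda>r s. \<phi> p * \<epsilon> (r \<cdot> q) * \<epsilon> s))"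
      using t3_t4[of "\<lambda>r s. \<phi> p * (\<epsilon> r * \<epsilon> s)" v a q for p q] by (simp add: lin mult.assoc)
    also have "\<dots> = t3 v a (\<lambda>r s. t2 u d (\<lambda>p q. \<phi> p * \<epsilon> (r \<cdot> q) * \<epsilon> s))"
      by (rule eval_commute[OF structure_in(4) structure_in(5)]) (intro lin)+
    also have "\<dots> = t3 v a (\<lambda>r s. t2 u d (\<lambda>p q. \<phi> p * \<epsilon> (r \<cdot> q)) * \<epsilon> s)"
      by (subst eval_times(2)) (auto intro!: lin)
    finally show ?thesis .
  qed
  have "t2 z (b \<cdot> d) (\<lambda>u v. \<phi> u * \<epsilon> (a \<cdot> v)) = t2 z b (\<lambda>u v. t2 u d (\<lambda>p q. \<phi> p * \<epsilon> (a \<cdot> (v \<cdot> q))))"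
    by (rule mult_t2) (intro lin)
  also have "\<dots> = t2 z b (\<lambda>u v. t3 v a (\<lambda>r s. t2 u d (\<lambda>p q. \<phi> p * \<epsilon> (r \<cdot> q)) * \<epsilon> s))"
    by (simp only: inner)
  also have "\<dots> = t3 b a (\<lambda>x y. t2 z x (\<lambda>u v. t2 u d (\<lambda>p q. \<phi> p * \<epsilon> (v \<cdot> q))) * \<epsilon> y)"
    by (rule coassoc_t3[symmetric]) (intro lin)+
  also have "\<dots> = t3 b a (\<lambda>x y. \<phi> (z \<cdot> (x \<cdot> d)) * \<epsilon> y)"
    using mult_t2[of "\<lambda>p q. \<phi> p * \<epsilon> q" z _ d] counit_t2[OF l] by (simp add: lin)
  also have "\<dots> = \<phi> (z \<cdot> (fst (capR H a) b \<cdot> d))"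
    using capR_eval(1)[of "\<lambda>x. \<phi> (z \<cdot> (x \<cdot> d))" a b] by (simp add: lin)
  finally show "\<phi> (z \<cdot> fst (capR H a) (b \<cdot> d)) = \<phi> (z \<cdot> (fst (capR H a) b \<cdot> d))" by (simp add: fst_capR_eval[OF l])
qed

lemma capR_multiplier: "b \<cdot> fst (capR H a) c = snd (capR H a) b \<cdot> c"
proof (rule A_eqI)
  fix \<phi> assume l: "lf \<phi>"
  note [lin] = lf_comp[OF l]
  have "e2 b a (\<lambda>u v. \<phi> (u \<cdot> c) * \<epsilon> v) = e2 b a (\<lambda>u v. t2 u c (\<lambda>p q. \<phi> p * \<epsilon> (v \<cdot> q)))"
  proof (rule E2_induct)
    fix a d b
    have "t2 b d (\<lambda>u v. \<phi> (u \<cdot> c) * \<epsilon> (a \<cdot> v)) = t2 b (d \<cdot> c) (\<lambda>u v. \<phi> u * \<epsilon> (a \<cdot> v))"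
      using fst_capR_eval[of \<phi> b a "d \<cdot> c"] fst_capR_eval[of "\<lambda>x. \<phi> (x \<cdot> c)" b a d] l
      by (simp add: fst_capR_prod lin)
    also have "\<dots> = t2 b d (\<lambda>u v. t2 u c (\<lambda>p q. \<phi> p * \<epsilon> (a \<cdot> v \<cdot> q)))"
      using mult_t2[of "\<lambda>u v. \<phi> u * \<epsilon> (a \<cdot> v)" b d c] by (simp add: lin)
    finally show "t2 b d (\<lambda>u v. \<phi> (u \<cdot> c) * \<epsilon> (a \<cdot> v)) = t2 b d (\<lambda>u v. t2 u c (\<lambda>p q. \<phi> p * \<epsilon> (a \<cdot> v \<cdot> q)))" .
  qed (intro lin)+
  also have "\<dots> = t2 b c (\<lambda>p q. \<phi> p * \<epsilon> (a \<cdot> q))"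
    by (rule E_coproduct) (intro lin)
  finally show "\<phi> (b \<cdot> fst (capR H a) c) = \<phi> (snd (capR H a) b \<cdot> c)"
    using fst_capR_eval[OF l, of b a c] capR_eval(2)[of "\<lambda>x. \<phi> (x \<cdot> c)" a b] by (simp add: lin)
qed

text \<open>
  \<open>E(1 \<otimes> bc) = N'(b\<^sub>1) \<otimes> b\<^sub>2 c\<close>: apply the counit to the middle leg of
  \<open>(E \<otimes> 1)(1 \<otimes> \<Delta>(b)) = (A \<otimes> \<Delta>)(E(1 \<otimes> b))\<close>.
\<close>

lemma E_capR_bar:
  assumes b: "bl \<beta>"
  shows "e1 a (b \<cdot> c) \<beta> = t1 b c (\<lambda>x y. \<beta> (fst (capR_bar H x) a) y)"
proof -
  note [lin] = bl_left[OF b] bl_right[OF b]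
  have "t1 b c (\<lambda>x y. \<beta> (fst (capR_bar H x) a) y) = t1 b c (\<lambda>x y. e1 a x (\<lambda>u v. \<beta> u y * \<epsilon> v))"
    by (subst capR_eval) (auto intro!: lin)
  also have "\<dots> = e1 a b (\<lambda>u v. t1 v c (\<lambda>x y. \<beta> u y * \<epsilon> x))"
    by (rule E1_coproduct) (intro lin)
  also have "\<dots> = e1 a b (\<lambda>u v. \<beta> u (v \<cdot> c))"
    by (subst counits) (auto intro!: lin)
  finally show ?thesis using e1_right[OF b] by simp
qed

text \<open>
  \<open>(1 \<otimes> c)E(1 \<otimes> d) = N(c\<^sub>1) \<otimes> c\<^sub>2 d\<close>, by the same argument for the right action of \<open>E\<close>. The axiom now carries a
  factor in the middle leg, which has to be cancelled before the counit can be applied there.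
\<close>

lemma E_capR:
  assumes b: "bl \<beta>"
  shows "e2 a c (\<lambda>u v. \<beta> u (v \<cdot> d)) = t1 c d (\<lambda>x y. \<beta> (snd (capR H x) a) y)"
proof -
  note [lin] = bl_left[OF b] bl_right[OF b]
  have "t1 c d (\<lambda>x y. e2 a x (\<lambda>u v. \<epsilon> v * \<beta> u y)) = e2 a c (\<lambda>u y. t1 y d (\<lambda>v w. \<epsilon> v * \<beta> u w))"
  proof (rule cancel_vector(1)[where \<Phi> = "\<lambda>\<phi>. t1 c d (\<lambda>x y. e2 a x (\<lambda>u v. \<phi> v * \<beta> u y))"
        and \<Psi> = "\<lambda>\<phi>. e2 a c (\<lambda>u y. t1 y d (\<lambda>v w. \<phi> v * \<beta> u w))"])
    show "vectorial (\<lambda>\<phi>. t1 c d (\<lambda>x y. e2 a x (\<lambda>u v. \<phi> v * \<beta> u y)))"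
    proof (rule vectorial_bind[OF structure_in(3)])
      fix \<phi> assume l: "lf \<phi>"
      note [lin] = lf_comp[OF l]
      show "bl (\<lambda>x y. e2 a x (\<lambda>u v. \<phi> v * \<beta> u y))" by (intro lin)
    next
      show "vectorial (\<lambda>\<phi>. e2 a x (\<lambda>u v. \<phi> v * \<beta> u y))" for x y
        by (rule vectorial_slice) (simp, intro lin)
    qed
    show "vectorial (\<lambda>\<phi>. e2 a c (\<lambda>u y. t1 y d (\<lambda>v w. \<phi> v * \<beta> u w)))"
    proof (rule vectorial_bind[OF structure_in(2)])
      fix \<phi> assume l: "lf \<phi>"
      note [lin] = lf_comp[OF l]
      show "bl (\<lambda>u y. t1 y d (\<lambda>v w. \<phi> v * \<beta> u w))" by (intro lin)
    next
      show "vectorial (\<lambda>\<phi>. t1 y d (\<lambda>v w. \<phi> v * \<beta> u w))" for u y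
        by (rule vectorial_slice) (simp, intro lin)
    qed
    fix \<phi> z assume l: "lf \<phi>"
    note [lin] = lf_comp[OF l]
    have "t1 c d (\<lambda>x y. e2 a x (\<lambda>u v. \<phi> (z \<cdot> v) * \<beta> u y)) = t1 c d (\<lambda>x y. e2 a (z \<cdot> x) (\<lambda>u v. \<phi> v * \<beta> u y))"
      by (subst e2_left) (auto intro!: lin)
    also have "\<dots> = t2 z c (\<lambda>x y. e2 a x (\<lambda>u v. \<phi> v * \<beta> u (y \<cdot> d)))"
      by (rule t1_t2) (intro lin)
    also have "\<dots> = e2 a c (\<lambda>u y. t2 z y (\<lambda>v w. \<phi> v * \<beta> u (w \<cdot> d)))"
      by (rule E2_coproduct) (intro lin)
    also have "\<dots> = e2 a c (\<lambda>u y. t1 y d (\<lambda>v w. \<phi> (z \<cdot> v) * \<beta> u w))"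
      using t1_t2[of "\<lambda>v w. \<phi> v * \<beta> u w" for u] by (simp add: lin)
    finally show "t1 c d (\<lambda>x y. e2 a x (\<lambda>u v. \<phi> (z \<cdot> v) * \<beta> u y)) = e2 a c (\<lambda>u y. t1 y d (\<lambda>v w. \<phi> (z \<cdot> v) * \<beta> u w))" .
  qed (intro lin)
  moreover have "e2 a x (\<lambda>u v. \<epsilon> v * \<beta> u y) = \<beta> (snd (capR H x) a) y" for x y
    using capR_eval(2)[of "\<lambda>u. \<beta> u y" x a] by (simp add: lin mult.commute)
  moreover have "t1 y d (\<lambda>v w. \<epsilon> v * \<beta> u w) = \<beta> u (y \<cdot> d)" for u y
    by (rule counit_t1) (intro lin)
  ultimately show ?thesis by simp
qed

subsection \<open>Elements of the multiplier algebra\<close>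

lemma MA_iff: "x \<in> vcar (MA H) \<longleftrightarrow> le (fst x) \<and> le (snd x) \<and> (\<forall>a b. a \<cdot> fst x b = snd x a \<cdot> b)"
  by (auto simp: multiplier_algebra_def Lin_def)

lemma MA_scale: "vscale (MA H) c x = (\<lambda>b. smult H c (fst x b), \<lambda>b. smult H c (snd x b))"
  by (simp add: multiplier_algebra_def)

lemma MA_multiplier: "x \<in> vcar (MA H) \<Longrightarrow> a \<cdot> fst x b = snd x a \<cdot> b"
  and MA_le: "x \<in> vcar (MA H) \<Longrightarrow> le (fst x)" "x \<in> vcar (MA H) \<Longrightarrow> le (snd x)"
  by (auto simp: MA_iff)

lemma is_vspace_MA: "is_vspace (MA H)"
  by (rule is_vspace_multiplier_algebra[OF is_vspaceA prod_bilinear])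

lemma MA_eqI:
  assumes x: "x \<in> vcar (MA H)" and y: "y \<in> vcar (MA H)"
    and eq: "\<And>\<phi> b. lf \<phi> \<Longrightarrow> \<phi> (fst x b) = \<phi> (fst y b)"
  shows "x = y"
proof -
  have 1: "fst x b = fst y b" for b by (rule A_eqI) (rule eq)
  have "snd x a = snd y a" for a
    by (rule right_cancel) (simp add: MA_multiplier[OF x, symmetric] MA_multiplier[OF y, symmetric] 1)
  with 1 show ?thesis by (simp add: prod_eq_iff fun_eq_iff)
qed

lemma capR_in: "capR H a \<in> vcar (MA H)" and capR_bar_in: "capR_bar H a \<in> vcar (MA H)"
  by (auto simp: MA_iff capR_multiplier capR_bar_multiplier intro: lin)

lemma fst_linear: "lf \<phi> \<Longrightarrow> linear_on (MA H) ground (\<lambda>r. \<phi> (fst r c))"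
  and snd_linear: "lf \<phi> \<Longrightarrow> linear_on (MA H) ground (\<lambda>r. \<phi> (snd r c))"
  by (simp_all add: linear_on_def MA_scale)

lemma MA_linearI:
  assumes car: "\<And>a. f a \<in> vcar (MA H)" and lin: "\<And>\<phi> c. lf \<phi> \<Longrightarrow> lf (\<lambda>a. \<phi> (fst (f a) c))"
  shows "linear_on (spc H) (MA H) f"
proof -
  note V = is_vspaceD[OF is_vspace_MA]
  have "f (a + b) = f a + f b" for a b
  proof (rule MA_eqI[OF car V(3)[OF car car]])
    fix \<phi> c assume p: "lf \<phi>"
    show "\<phi> (fst (f (a + b)) c) = \<phi> (fst (f a + f b) c)"
      using lin[OF p, of c] p by (simp add: linear_on_def)
  qed
  moreover have "f (smult H k a) = vscale (MA H) k (f a)" for a k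
  proof (rule MA_eqI[OF car V(5)[OF car]])
    fix \<phi> c assume p: "lf \<phi>"
    show "\<phi> (fst (f (smult H k a)) c) = \<phi> (fst (vscale (MA H) k (f a)) c)"
      using lin[OF p, of c] p by (simp add: linear_on_def MA_scale)
  qed
  ultimately show ?thesis using car by (simp add: linear_on_def)
qed

lemma capR_linear: "linear_on (spc H) (MA H) (capR H)"
  and capR_bar_linear: "linear_on (spc H) (MA H) (capR_bar H)"
  by (rule MA_linearI[OF capR_in], rule lf_comp, assumption, intro lin)
    (rule MA_linearI[OF capR_bar_in], rule lf_comp, assumption, intro lin)

lemma base_simps [simp]: "vcar (base H) = range (capR H)" "vscale (base H) = vscale (MA H)"
  by (simp_all add: base_def)

lemma base_in_MA: "r \<in> range (capR H) \<Longrightarrow> r \<in> vcar (MA H)"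
  using capR_in by auto

lemma is_vspace_base: "is_vspace (base H)"
proof (rule is_vspaceI)
  show "vector_space (vscale (base H))" using is_vspaceD(1)[OF is_vspace_MA] by simp
  show "0 \<in> vcar (base H)" using linear_on_zero[OF is_vspaceA capR_linear] by (metis base_simps(1) rangeI)
  show "x + y \<in> vcar (base H)" if "x \<in> vcar (base H)" "y \<in> vcar (base H)" for x y
    using that linear_onD(2)[OF capR_linear] by (auto simp: image_iff) (metis UNIV_I carA)
  show "vscale (base H) c x \<in> vcar (base H)" if "x \<in> vcar (base H)" for c x
    using that linear_onD(3)[OF capR_linear] by (auto simp: image_iff) (metis UNIV_I carA scaleA)
qed

lemma base_linear: "linear_on (MA H) W f \<Longrightarrow> linear_on (base H) W f"
  using capR_in by (auto simp: linear_on_def)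

lemma capR_linear_base: "linear_on (spc H) (base H) (capR H)"
  using capR_linear by (auto simp: linear_on_def)

lemma prod_induct [case_names prod add]:
  assumes "\<And>a b. P (a \<cdot> b)" "\<And>x y. P x \<Longrightarrow> P y \<Longrightarrow> P (x + y)"
  shows "P x"
proof -
  obtain t where t: "t \<in> AA" "x = mu H t"
    using idempotent unfolding idempotent_algebra_def by auto
  have "P (mu H t)" using is_vspaceA t(1)
  proof (induction rule: tensor_induct)
    case zero
    have "0 \<cdot> 0 = (0::'a)" using linear_on_zero[OF is_vspaceA le_prod_left[OF le_id]] .
    then have "P (mu H 0)" using assms(1)[of 0 0] linear_on_zero[OF is_vspace_tensor mu_linear] by simp
    then show ?case .
  next
    case (tens v w t)
    then have "P (mu H (pure H v w + t))"
      using assms linear_onD(2)[OF mu_linear pure_in tens(3), of v w] by (simp add: mu_pure)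
    then show ?case .
  qed
  then show ?thesis using t by simp
qed

lemma lf_eq_on_products: "lf f \<Longrightarrow> lf g \<Longrightarrow> (\<And>a b. f (a \<cdot> b) = g (a \<cdot> b)) \<Longrightarrow> f x = g x"
  by (induction x rule: prod_induct) (auto simp: linear_on_def)

lemma counit_t3:
  assumes l: "lf \<phi>"
  shows "t3 c a (\<lambda>u v. \<epsilon> u * \<phi> v) = \<phi> (a \<cdot> c)"
proof (rule cancel_vector(2)[OF _ vectorial_element l])
  show "vectorial (\<lambda>\<phi>. t3 c a (\<lambda>u v. \<epsilon> u * \<phi> v))"
    by (rule vectorial_slice) (simp, intro lin)
  fix \<phi> p assume l: "lf \<phi>"
  note [lin] = lf_comp[OF l]
  show "t3 c a (\<lambda>u v. \<epsilon> u * \<phi> (v \<cdot> p)) = \<phi> (a \<cdot> c \<cdot> p)"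
    using t1_t3[of "\<lambda>u v. \<epsilon> u * \<phi> v" c p a] counit_t1[of "\<lambda>v. \<phi> (a \<cdot> v)" c p] by (simp add: lin)
qed

lemma eps_capR: "\<epsilon> (fst (capR H a) c) = \<epsilon> (a \<cdot> c)"
  using capR_eval(1)[OF lf_eps[OF le_id]] counit_t3[OF lf_eps[OF le_id]] by simp

lemma eps_capR_bar: "\<epsilon> (snd (capR_bar H c) a) = \<epsilon> (a \<cdot> c)"
  using capR_eval(4)[OF lf_eps[OF le_id]] counit_t1[OF lf_eps[OF le_id]] by simp

text \<open>
  The numbers \<open>\<epsilon>(N(a)c) = \<epsilon>(ac)\<close> determine \<open>N(a)\<close>, because \<open>z N(a)b = z b\<^sub>1 \<epsilon>(a b\<^sub>2)\<close>.
\<close>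

lemma base_eqI:
  assumes "r \<in> range (capR H)" "r' \<in> range (capR H)" "\<And>c. \<epsilon> (fst r c) = \<epsilon> (fst r' c)"
  shows "r = r'"
proof -
  obtain a a' where a: "r = capR H a" "r' = capR H a'" using assms by auto
  have eq: "\<epsilon> (a \<cdot> c) = \<epsilon> (a' \<cdot> c)" for c using assms(3)[of c] by (simp add: a eps_capR)
  have "fst r b = fst r' b" for b
    by (rule left_cancel) (simp add: a fst_capR_eval eq)
  then show ?thesis using MA_eqI[OF base_in_MA[OF assms(1)] base_in_MA[OF assms(2)]] by simp
qed

lemma capR_slice:
  assumes \<phi>: "lf \<phi>" and \<omega>: "lf \<omega>"
  shows "\<phi> (z \<cdot> fst (capR H (SR \<omega> (t1 p q))) c) = e1 c q (\<lambda>u v. \<phi> (z \<cdot> u) * \<omega> (p \<cdot> v))"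
proof -
  note [lin] = lf_comp[OF \<phi>] lf_comp[OF \<omega>]
  have "\<phi> (z \<cdot> fst (capR H (SR \<omega> (t1 p q))) c) = \<phi> (snd (capR H (SR \<omega> (t1 p q))) z \<cdot> c)"
    by (simp add: capR_multiplier)
  also have "\<dots> = t1 p q (\<lambda>u v. \<phi> (snd (capR H u) z \<cdot> c) * \<omega> v)"
    by (rule SR_eval[OF \<omega> structure_in(3)]) (intro lin)
  also have "\<dots> = e2 z p (\<lambda>u v. \<phi> (u \<cdot> c) * \<omega> (v \<cdot> q))"
    using E_capR[of "\<lambda>u v. \<phi> (u \<cdot> c) * \<omega> v" z p q] by (simp add: lin)
  also have "\<dots> = e1 c q (\<lambda>u v. \<phi> (z \<cdot> u) * \<omega> (p \<cdot> v))"
    using E_sides[of "\<lambda>u v. \<phi> u * \<omega> v" c q z p] by (simp add: lin)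
  finally show ?thesis .
qed

lemma capR_bar_slice:
  assumes \<phi>: "lf \<phi>" and \<omega>: "lf \<omega>"
  shows "\<phi> (fst (capR_bar H (SR \<omega> (t1 p q))) c) = e1 c (p \<cdot> q) (\<lambda>u v. \<phi> u * \<omega> v)"
proof -
  note [lin] = lf_comp[OF \<phi>] lf_comp[OF \<omega>]
  have "\<phi> (fst (capR_bar H (SR \<omega> (t1 p q))) c) = t1 p q (\<lambda>u v. \<phi> (fst (capR_bar H u) c) * \<omega> v)"
    by (rule SR_eval[OF \<omega> structure_in(3)]) (intro lin)
  then show ?thesis using E_capR_bar[of "\<lambda>u v. \<phi> u * \<omega> v" c p q] by (simp add: lin)
qed

text \<open>
  Both sides are the slice of \<open>(1 \<otimes> p)E(1 \<otimes> qq')\<close> by \<open>\<omega>\<close>, computed from the two expressions for \<open>E\<close>.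
\<close>

lemma capR_eq_capR_bar_slice:
  assumes \<omega>: "lf \<omega>"
  shows "capR H (SR \<omega> (t1 p (q \<cdot> q'))) = capR_bar H (SR (\<lambda>v. \<omega> (p \<cdot> v)) (t1 q q'))"
proof (rule MA_eqI[OF capR_in capR_bar_in])
  note [lin] = lf_comp[OF \<omega>]
  have w: "lf (\<lambda>v. \<omega> (p \<cdot> v))" by (intro lin)
  have "fst (capR H (SR \<omega> (t1 p (q \<cdot> q')))) c = fst (capR_bar H (SR (\<lambda>v. \<omega> (p \<cdot> v)) (t1 q q'))) c" for c
  proof (rule left_cancel)
    fix \<phi> z assume \<phi>: "lf \<phi>"
    note [lin] = lf_comp[OF \<phi>]
    have z: "lf (\<lambda>u. \<phi> (z \<cdot> u))" by (intro lin)
    show "\<phi> (z \<cdot> fst (capR H (SR \<omega> (t1 p (q \<cdot> q')))) c) =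
        \<phi> (z \<cdot> fst (capR_bar H (SR (\<lambda>v. \<omega> (p \<cdot> v)) (t1 q q'))) c)"
      using capR_bar_slice[OF z w, of q q' c] by (simp add: capR_slice[OF \<phi> \<omega>])
  qed
  then show "\<phi> (fst (capR H (SR \<omega> (t1 p (q \<cdot> q')))) b) = \<phi> (fst (capR_bar H (SR (\<lambda>v. \<omega> (p \<cdot> v)) (t1 q q'))) b)"
    for \<phi> b by simp
qed

section \<open>The base algebra\<close>

lemma E2_t2':
  assumes b: "bl \<beta>"
  shows "t2 a b (\<lambda>u v. e2 u v \<beta>) = t2 a b \<beta>"
proof (rule cancel(3)[OF _ tensorial_AA[OF structure_in(4)] b])
  show "tensorial (\<lambda>\<beta>. t2 a b (\<lambda>u v. e2 u v \<beta>))"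
    by (rule tensorial_bind[OF structure_in(4) tensorial_AA[OF structure_in(2)]]) (intro lin)
  fix \<beta> p assume b: "bl \<beta>"
  show "t2 a b (\<lambda>u v. e2 u v (\<lambda>u v. \<beta> u (p \<cdot> v))) = t2 a b (\<lambda>u v. \<beta> u (p \<cdot> v))"
    using E2_t2[OF b, of a b p] by (simp add: e2_left[OF b])
qed

lemma coproduct_eps: "lf \<phi> \<Longrightarrow> t2 a b (\<lambda>u v. \<phi> u * \<epsilon> (fst (capR H v) c)) = \<phi> (snd (capR_bar H c) (a \<cdot> b))"
proof -
  assume l: "lf \<phi>"
  note [lin] = lf_comp[OF l]
  have "t2 a b (\<lambda>u v. \<phi> u * \<epsilon> (v \<cdot> c)) = t1 b c (\<lambda>u v. \<phi> (a \<cdot> u) * \<epsilon> v)"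
    by (rule t1_t2[symmetric]) (intro lin)
  then show ?thesis
    using capR_eval(4)[of "\<lambda>x. \<phi> (a \<cdot> x)" c b] by (simp add: eps_capR snd_capR_bar_prod lin)
qed

text \<open>
  \<open>a b\<^sub>1 N(b\<^sub>2) = ab\<close>, since \<open>\<Delta>(b)E = \<Delta>(b)\<close>.
\<close>

lemma coproduct_capR: "lf \<phi> \<Longrightarrow> t2 a b (\<lambda>u v. \<phi> (snd (capR H v) u)) = \<phi> (a \<cdot> b)"
proof -
  assume l: "lf \<phi>"
  note [lin] = lf_comp[OF l]
  have "t2 a b (\<lambda>u v. \<phi> (snd (capR H v) u)) = t2 a b (\<lambda>u v. \<phi> u * \<epsilon> v)"
    using E2_t2'[of "\<lambda>u v. \<phi> u * \<epsilon> v" a b] by (simp add: capR_eval l lin)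
  then show ?thesis by (simp add: counit_t2[OF l])
qed

text \<open>
  The range of \<open>N'\<close> is closed under multiplication, since \<open>\<epsilon>(v\<^sub>1 c) \<epsilon>(v\<^sub>2 a) = \<epsilon>(v d)\<close> for \<open>d = \<epsilon>(E\<^sup>1 c) E\<^sup>2 a\<close>.
\<close>

lemma capR_bar_closed: "snd (capR_bar H c) (snd (capR_bar H a) b) = snd (capR_bar H (SL \<epsilon> (e1 c a))) b"
proof (rule left_cancel)
  fix \<phi> z assume l: "lf \<phi>"
  note [lin] = lf_comp[OF l]
  note e = lf_eps[OF le_id]
  define f where "f w = t2 z w (\<lambda>u v. \<phi> u * \<epsilon> (v \<cdot> c))" for w
  have f: "\<phi> (z \<cdot> snd (capR_bar H c) w) = f w" for w
    using capR_eval(4)[of "\<lambda>x. \<phi> (z \<cdot> x)" c w] t1_t2[of "\<lambda>u v. \<phi> u * \<epsilon> v" w c z] by (simp add: f_def lin)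
  have lf: "lf f" unfolding f_def by (intro lin)
  have inner: "t1 v a (\<lambda>x y. \<epsilon> (x \<cdot> c) * \<epsilon> y) = \<epsilon> (v \<cdot> SL \<epsilon> (e1 c a))" for v
    using counit_E1[OF e, of c a v] SL_eval[OF e structure_in(1), of "\<lambda>x. \<epsilon> (v \<cdot> x)" c a] by (simp add: lin)
  have "f (snd (capR_bar H a) b) = t1 b a (\<lambda>x y. f x * \<epsilon> y)"
    by (rule capR_eval(4)[OF lf])
  also have "\<dots> = t1 b a (\<lambda>x y. t2 z x (\<lambda>u v. \<phi> u * \<epsilon> (v \<cdot> c) * \<epsilon> y))"
    unfolding f_def by (subst eval_times(2)[OF structure_in(4)]) (auto intro!: lin)
  also have "\<dots> = t2 z b (\<lambda>u v. t1 v a (\<lambda>x y. \<phi> u * \<epsilon> (x \<cdot> c) * \<epsilon> y))"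
    by (rule coassoc) (intro lin)
  also have "\<dots> = t2 z b (\<lambda>u v. \<phi> u * t1 v a (\<lambda>x y. \<epsilon> (x \<cdot> c) * \<epsilon> y))"
    by (subst eval_times(1)[OF structure_in(3), symmetric]) (auto simp: mult.assoc intro!: lin)
  also have "\<dots> = t2 z b (\<lambda>u v. \<phi> u * \<epsilon> (v \<cdot> SL \<epsilon> (e1 c a)))"
    by (simp only: inner)
  also have "\<dots> = \<phi> (z \<cdot> snd (capR_bar H (SL \<epsilon> (e1 c a))) b)"
    using capR_eval(4)[of "\<lambda>x. \<phi> (z \<cdot> x)" "SL \<epsilon> (e1 c a)" b] t1_t2[of "\<lambda>u v. \<phi> u * \<epsilon> v" b "SL \<epsilon> (e1 c a)" z]
    by (simp add: lin)
  finally show "\<phi> (z \<cdot> snd (capR_bar H c) (snd (capR_bar H a) b)) = \<phi> (z \<cdot> snd (capR_bar H (SL \<epsilon> (e1 c a))) b)"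
    by (simp add: f)
qed

text \<open>
  \<open>\<Delta>(rd) = (1 \<otimes> r)\<Delta>(d)\<close> for \<open>r = N(x)\<close>: as \<open>rd = d\<^sub>1 \<epsilon>(x d\<^sub>2)\<close>, both sides are \<open>d\<^sub>1 \<otimes> d\<^sub>2 \<epsilon>(x d\<^sub>3)\<close> by
  coassociativity.
\<close>

lemma coproduct_capR_left:
  assumes b: "bl \<beta>"
  shows "t1 (fst (capR H x) d) b \<beta> = t1 d b (\<lambda>u v. \<beta> u (fst (capR H x) v))"
proof (rule cancel(1)[OF tensorial_AA[OF structure_in(3)] _ b])
  show "tensorial (\<lambda>\<beta>. t1 d b (\<lambda>u v. \<beta> u (fst (capR H x) v)))"
    by (rule tensorial_map[OF tensorial_AA[OF structure_in(3)] le_id]) (intro lin)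
  fix \<beta> z assume bb: "bl \<beta>"
  note [lin] = bl_left[OF bb] bl_right[OF bb]
  define g where "g w = t2 z w (\<lambda>u v. \<beta> u (v \<cdot> b))" for w
  have g: "t1 w b (\<lambda>u v. \<beta> (z \<cdot> u) v) = g w" for w
    unfolding g_def by (rule t1_t2[OF bb])
  have lf: "lf g" unfolding g_def by (intro lin)
  have "g (fst (capR H x) d) = t3 d x (\<lambda>p q. t2 z p (\<lambda>u v. \<beta> u (v \<cdot> b)) * \<epsilon> q)"
    using capR_eval(1)[OF lf] by (simp add: g_def)
  also have "\<dots> = t2 z d (\<lambda>u v. t3 v x (\<lambda>p q. \<beta> u (p \<cdot> b) * \<epsilon> q))"
    by (rule coassoc_t3) (intro lin)+
  also have "\<dots> = t2 z d (\<lambda>u v. \<beta> u (fst (capR H x) v \<cdot> b))"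
    using capR_eval(1)[of "\<lambda>p. \<beta> u (p \<cdot> b)" for u] by (simp add: lin)
  also have "\<dots> = t1 d b (\<lambda>u v. \<beta> (z \<cdot> u) (fst (capR H x) v))"
    using t1_t2[of "\<lambda>u v. \<beta> u (fst (capR H x) v)" d b z] by (simp add: lin fst_capR_prod)
  finally show "t1 (fst (capR H x) d) b (\<lambda>u v. \<beta> (z \<cdot> u) v) = t1 d b (\<lambda>u v. \<beta> (z \<cdot> u) (fst (capR H x) v))"
    by (simp add: g)
qed

text \<open>
  \<open>\<Delta>(dr) = \<Delta>(d)(1 \<otimes> r)\<close> for \<open>r = N'(y)\<close>, again by coassociativity.
\<close>

lemma coproduct_capR_bar_right:
  assumes b: "bl \<beta>"
  shows "t2 z (snd (capR_bar H y) d) \<beta> = t2 z d (\<lambda>u v. \<beta> u (snd (capR_bar H y) v))"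
proof -
  note [lin] = bl_left[OF b] bl_right[OF b]
  have "t2 z (snd (capR_bar H y) d) \<beta> = t1 d y (\<lambda>p q. t2 z p \<beta> * \<epsilon> q)"
    by (rule capR_eval(4)) (intro lin)
  also have "\<dots> = t1 d y (\<lambda>p q. t2 z p (\<lambda>u v. \<beta> u v * \<epsilon> q))"
    by (subst eval_times(2)[OF structure_in(4) b]) simp
  also have "\<dots> = t2 z d (\<lambda>u v. t1 v y (\<lambda>p q. \<beta> u p * \<epsilon> q))"
    by (rule coassoc) (intro lin)
  also have "\<dots> = t2 z d (\<lambda>u v. \<beta> u (snd (capR_bar H y) v))"
    using capR_eval(4)[of "\<lambda>p. \<beta> u p" for u] by (simp add: lin)
  finally show ?thesis .
qed

text \<open>
  \<open>(1 \<otimes> r)E = E(1 \<otimes> r)E\<close> for \<open>r = N(x)\<close>: the range of \<open>E\<close> is spanned by the \<open>\<Delta>(d)(c \<otimes> b)\<close>, and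
  \<open>(1 \<otimes> r)\<Delta>(d) = \<Delta>(rd)\<close> is fixed by \<open>E\<close>.
\<close>

lemma capR_E:
  assumes b: "bl \<beta>"
  shows "e1 c b (\<lambda>u v. \<beta> u (fst (capR H x) v)) = e1 c b (\<lambda>u v. e1 u (fst (capR H x) v) \<beta>)"
proof (rule E1_induct)
  note [lin] = bl_left[OF b] bl_right[OF b]
  show "bl (\<lambda>u v. \<beta> u (fst (capR H x) v))" "bl (\<lambda>u v. e1 u (fst (capR H x) v) \<beta>)" by (intro lin)+
  fix d c b
  have "t1 d b (\<lambda>u v. \<beta> (u \<cdot> c) (fst (capR H x) v)) = t1 (fst (capR H x) d) b (\<lambda>u v. \<beta> (u \<cdot> c) v)"
    by (rule coproduct_capR_left[symmetric]) (intro lin)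
  also have "\<dots> = t1 (fst (capR H x) d) b (\<lambda>u v. e1 (u \<cdot> c) v \<beta>)"
    by (rule E1_t1[OF assms, symmetric])
  also have "\<dots> = t1 d b (\<lambda>u v. e1 (u \<cdot> c) (fst (capR H x) v) \<beta>)"
    by (rule coproduct_capR_left) (intro lin)
  finally show "t1 d b (\<lambda>u v. \<beta> (u \<cdot> c) (fst (capR H x) v)) = t1 d b (\<lambda>u v. e1 (u \<cdot> c) (fst (capR H x) v) \<beta>)" .
qed

text \<open>
  \<open>E(1 \<otimes> r) = E(1 \<otimes> r)E\<close> for \<open>r = N'(x)\<close>, because \<open>\<Delta>(d)(1 \<otimes> r) = \<Delta>(dr)\<close> is fixed by \<open>E\<close> on the other side.
\<close>

lemma E_capR_bar_E:
  assumes b: "bl \<beta>"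
  shows "e1 c (fst (capR_bar H x) b) \<beta> = e1 c b (\<lambda>u v. e1 u (fst (capR_bar H x) v) \<beta>)"
proof (rule cancel2_left[OF tensorial_AA[OF structure_in(1)] _ b])
  show "tensorial (\<lambda>\<beta>. e1 c b (\<lambda>u v. e1 u (fst (capR_bar H x) v) \<beta>))"
    by (rule tensorial_bind[OF structure_in(1) tensorial_AA[OF structure_in(1)]]) (intro lin)
  fix \<beta> p q assume bb: "bl \<beta>"
  note [lin] = bl_left[OF bb] bl_right[OF bb]
  let ?r = "capR_bar H x"
  have "e1 c (fst ?r b) (\<lambda>u v. \<beta> (p \<cdot> u) (q \<cdot> v)) = e2 p q (\<lambda>u v. \<beta> (u \<cdot> c) (snd ?r v \<cdot> b))"
    by (simp add: E_sides[OF bb] capR_bar_multiplier)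
  also have "\<dots> = e2 p q (\<lambda>u v. e1 c b (\<lambda>x y. \<beta> (u \<cdot> x) (snd ?r v \<cdot> y)))"
  proof (rule E2_induct)
    fix d p q
    let ?d = "snd ?r d"
    have "t2 p d (\<lambda>u v. \<beta> (u \<cdot> c) (snd ?r (q \<cdot> v) \<cdot> b)) = t2 p ?d (\<lambda>u v. \<beta> (u \<cdot> c) (q \<cdot> (v \<cdot> b)))"
      by (subst coproduct_capR_bar_right) (auto simp: snd_capR_bar_prod intro!: lin)
    also have "\<dots> = t1 ?d b (\<lambda>u v. \<beta> (p \<cdot> (u \<cdot> c)) (q \<cdot> v))"
      using t1_t2[of "\<lambda>u v. \<beta> (u \<cdot> c) (q \<cdot> v)" ?d b p] by (simp add: lin)
    also have "\<dots> = e1 c b (\<lambda>x y. t1 ?d y (\<lambda>u v. \<beta> (p \<cdot> (u \<cdot> x)) (q \<cdot> v)))"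
      by (rule coproduct_E[symmetric]) (intro lin)
    also have "\<dots> = e1 c b (\<lambda>x y. t2 p ?d (\<lambda>u v. \<beta> (u \<cdot> x) (q \<cdot> (v \<cdot> y))))"
      using t1_t2[of "\<lambda>u v. \<beta> (u \<cdot> x) (q \<cdot> v)" ?d _ p for x] by (simp add: lin)
    also have "\<dots> = t2 p ?d (\<lambda>u v. e1 c b (\<lambda>x y. \<beta> (u \<cdot> x) (q \<cdot> (v \<cdot> y))))"
      by (rule eval_commute[OF structure_in(1) structure_in(4)]) (intro lin)+
    also have "\<dots> = t2 p d (\<lambda>u v. e1 c b (\<lambda>x y. \<beta> (u \<cdot> x) (snd ?r (q \<cdot> v) \<cdot> y)))"
      by (subst coproduct_capR_bar_right) (auto simp: snd_capR_bar_prod intro!: lin)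
    finally show "t2 p d (\<lambda>u v. \<beta> (u \<cdot> c) (snd ?r (q \<cdot> v) \<cdot> b)) =
        t2 p d (\<lambda>u v. e1 c b (\<lambda>x y. \<beta> (u \<cdot> x) (snd ?r (q \<cdot> v) \<cdot> y)))" .
  qed (intro lin)+
  also have "\<dots> = e1 c b (\<lambda>x y. e2 p q (\<lambda>u v. \<beta> (u \<cdot> x) (snd ?r v \<cdot> y)))"
    by (rule eval_commute[OF structure_in(2) structure_in(1)]) (intro lin)+
  also have "\<dots> = e1 c b (\<lambda>x y. e1 x (fst ?r y) (\<lambda>u v. \<beta> (p \<cdot> u) (q \<cdot> v)))"
    by (simp add: E_sides[OF bb] capR_bar_multiplier)
  finally show "e1 c (fst ?r b) (\<lambda>u v. \<beta> (p \<cdot> u) (q \<cdot> v)) =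
      e1 c b (\<lambda>x y. e1 x (fst ?r y) (\<lambda>u v. \<beta> (p \<cdot> u) (q \<cdot> v)))" .
qed

section \<open>Slices of the comultiplication\<close>

text \<open>
  The coproduct \<open>\<phi>(a\<^sub>1) \<Delta>(a\<^sub>2)\<close> of a slice. It makes sense for every \<open>\<phi>\<close> when written through \<open>T\<^sub>1\<close> twice;
  for functionals of the form \<open>\<phi>(z -)\<close> coassociativity rewrites it as a single outer evaluation.
\<close>

lemma coproduct_slice:
  assumes l: "lf \<phi>" and b: "bl \<beta>"
  shows "t1 a t (\<lambda>x y. t1 x s (\<lambda>u v. \<phi> (z \<cdot> u) * \<beta> v y)) = t2 z a (\<lambda>u v. \<phi> u * t1 v t (\<lambda>x y. \<beta> (x \<cdot> s) y))"
proof -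
  note [lin] = lf_comp[OF l] bl_left[OF b] bl_right[OF b]
  have "t1 a t (\<lambda>x y. t1 x s (\<lambda>u v. \<phi> (z \<cdot> u) * \<beta> v y)) = t1 a t (\<lambda>x y. t2 z x (\<lambda>u v. \<phi> u * \<beta> (v \<cdot> s) y))"
    using t1_t2[of "\<lambda>u v. \<phi> u * \<beta> v y" _ s z for y] by (simp add: lin)
  also have "\<dots> = t2 z a (\<lambda>u v. t1 v t (\<lambda>x y. \<phi> u * \<beta> (x \<cdot> s) y))"
    by (rule coassoc) (intro lin)
  also have "\<dots> = t2 z a (\<lambda>u v. \<phi> u * t1 v t (\<lambda>x y. \<beta> (x \<cdot> s) y))"
    by (subst eval_times(1)[OF structure_in(3)]) (auto intro!: lin)
  finally show ?thesis .
qed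

text \<open>
  \<open>\<phi>(a\<^sub>1) \<Delta>(a\<^sub>2 d) = \<phi>(a\<^sub>1) \<Delta>(a\<^sub>2) \<Delta>(d)\<close>. Multiplicativity needs the first leg to be covered, and the covering
  factor is cancelled afterwards.
\<close>

lemma coproduct_slice_prod:
  assumes l: "lf \<phi>" and b: "bl \<beta>"
  shows "t1 a d (\<lambda>p q. \<phi> p * t1 q b \<beta>) = t1 d b (\<lambda>s t. t1 a t (\<lambda>x y. t1 x s (\<lambda>u v. \<phi> u * \<beta> v y)))"
proof (rule cancel_vector(1)[where \<Phi> = "\<lambda>\<phi>. t1 a d (\<lambda>p q. \<phi> p * t1 q b \<beta>)" and
    \<Psi> = "\<lambda>\<phi>. t1 d b (\<lambda>s t. t1 a t (\<lambda>x y. t1 x s (\<lambda>u v. \<phi> u * \<beta> v y)))", OF _ _ l])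
  note [lin] = bl_left[OF b] bl_right[OF b]
  show "vectorial (\<lambda>\<phi>. t1 a d (\<lambda>p q. \<phi> p * t1 q b \<beta>))"
    by (rule vectorial_slice) (simp, intro lin)
  have lfs: "bl (\<lambda>s t. t1 a t (\<lambda>x y. t1 x s (\<lambda>u v. \<phi> u * \<beta> v y)))"
    "bl (\<lambda>x y. t1 x s (\<lambda>u v. \<phi> u * \<beta> v y))" if l: "lf \<phi>" for \<phi> s
  proof -
    note [lin] = lf_comp[OF l]
    show "bl (\<lambda>s t. t1 a t (\<lambda>x y. t1 x s (\<lambda>u v. \<phi> u * \<beta> v y)))"
      "bl (\<lambda>x y. t1 x s (\<lambda>u v. \<phi> u * \<beta> v y))" by (intro lin)+
  qed
  show "vectorial (\<lambda>\<phi>. t1 d b (\<lambda>s t. t1 a t (\<lambda>x y. t1 x s (\<lambda>u v. \<phi> u * \<beta> v y))))"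
  proof (rule vectorial_bind[OF structure_in(3) _ lfs(1)])
    show "vectorial (\<lambda>\<phi>. t1 a t (\<lambda>x y. t1 x s (\<lambda>u v. \<phi> u * \<beta> v y)))" for s t
    proof (rule vectorial_bind[OF structure_in(3) _ lfs(2)])
      show "vectorial (\<lambda>\<phi>. t1 x s (\<lambda>u v. \<phi> u * \<beta> v y))" for x y
        by (rule vectorial_slice) (simp, intro lin)
    qed
  qed
  fix \<phi> z assume l: "lf \<phi>"
  note [lin] = lf_comp[OF l]
  have "t1 a d (\<lambda>p q. \<phi> (z \<cdot> p) * t1 q b \<beta>) = t2 z a (\<lambda>p q. \<phi> p * t1 (q \<cdot> d) b \<beta>)"
    by (rule t1_t2) (intro lin)
  also have "\<dots> = t2 z a (\<lambda>p q. \<phi> p * t1 d b (\<lambda>s t. t1 q t (\<lambda>u v. \<beta> (u \<cdot> s) v)))"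
    by (simp add: mult_t1[OF b])
  also have "\<dots> = t2 z a (\<lambda>p q. t1 d b (\<lambda>s t. \<phi> p * t1 q t (\<lambda>u v. \<beta> (u \<cdot> s) v)))"
    by (subst eval_times(1)[OF structure_in(3)]) (auto intro!: lin)
  also have "\<dots> = t1 d b (\<lambda>s t. t2 z a (\<lambda>p q. \<phi> p * t1 q t (\<lambda>u v. \<beta> (u \<cdot> s) v)))"
    by (rule eval_commute[OF structure_in(4) structure_in(3)]) (intro lin)+
  finally show "t1 a d (\<lambda>p q. \<phi> (z \<cdot> p) * t1 q b \<beta>) =
      t1 d b (\<lambda>s t. t1 a t (\<lambda>x y. t1 x s (\<lambda>u v. \<phi> (z \<cdot> u) * \<beta> v y)))"
    by (simp add: coproduct_slice[OF l b])
qed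

text \<open>
  \<open>\<phi>(a\<^sub>1) \<Delta>(a\<^sub>2) E = \<phi>(a\<^sub>1) \<Delta>(a\<^sub>2)\<close>, proved in the same way.
\<close>

lemma coproduct_slice_E:
  assumes l: "lf \<phi>" and b: "bl \<beta>"
  shows "e1 c d (\<lambda>s t. t1 a t (\<lambda>x y. t1 x s (\<lambda>u v. \<phi> u * \<beta> v y))) = t1 a d (\<lambda>x y. t1 x c (\<lambda>u v. \<phi> u * \<beta> v y))"
proof (rule cancel_vector(1)[where \<Phi> = "\<lambda>\<phi>. e1 c d (\<lambda>s t. t1 a t (\<lambda>x y. t1 x s (\<lambda>u v. \<phi> u * \<beta> v y)))"
    and \<Psi> = "\<lambda>\<phi>. t1 a d (\<lambda>x y. t1 x c (\<lambda>u v. \<phi> u * \<beta> v y))", OF _ _ l])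
  note [lin] = bl_left[OF b] bl_right[OF b]
  have lfs: "bl (\<lambda>s t. t1 a t (\<lambda>x y. t1 x s (\<lambda>u v. \<phi> u * \<beta> v y)))"
    "bl (\<lambda>x y. t1 x s (\<lambda>u v. \<phi> u * \<beta> v y))" if l: "lf \<phi>" for \<phi> s
  proof -
    note [lin] = lf_comp[OF l]
    show "bl (\<lambda>s t. t1 a t (\<lambda>x y. t1 x s (\<lambda>u v. \<phi> u * \<beta> v y)))"
      "bl (\<lambda>x y. t1 x s (\<lambda>u v. \<phi> u * \<beta> v y))" by (intro lin)+
  qed
  show v: "vectorial (\<lambda>\<phi>. t1 a t (\<lambda>x y. t1 x s (\<lambda>u v. \<phi> u * \<beta> v y)))" for s t
  proof (rule vectorial_bind[OF structure_in(3) _ lfs(2)])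
    show "vectorial (\<lambda>\<phi>. t1 x s (\<lambda>u v. \<phi> u * \<beta> v y))" for x y
      by (rule vectorial_slice) (simp, intro lin)
  qed
  show "vectorial (\<lambda>\<phi>. e1 c d (\<lambda>s t. t1 a t (\<lambda>x y. t1 x s (\<lambda>u v. \<phi> u * \<beta> v y))))"
    by (rule vectorial_bind[OF structure_in(1) v lfs(1)])
  fix \<phi> z assume l: "lf \<phi>"
  note [lin] = lf_comp[OF l]
  have "e1 c d (\<lambda>s t. t2 z a (\<lambda>p q. \<phi> p * t1 q t (\<lambda>u v. \<beta> (u \<cdot> s) v))) =
      t2 z a (\<lambda>p q. e1 c d (\<lambda>s t. \<phi> p * t1 q t (\<lambda>u v. \<beta> (u \<cdot> s) v)))"
    by (rule eval_commute[OF structure_in(1) structure_in(4)]) (intro lin)+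
  also have "\<dots> = t2 z a (\<lambda>p q. \<phi> p * e1 c d (\<lambda>s t. t1 q t (\<lambda>u v. \<beta> (u \<cdot> s) v)))"
    by (subst eval_times(1)[OF structure_in(1)]) (auto intro!: lin)
  also have "\<dots> = t2 z a (\<lambda>p q. \<phi> p * t1 q d (\<lambda>u v. \<beta> (u \<cdot> c) v))"
    by (simp add: coproduct_E[OF b])
  finally show "e1 c d (\<lambda>s t. t1 a t (\<lambda>x y. t1 x s (\<lambda>u v. \<phi> (z \<cdot> u) * \<beta> v y))) =
      t1 a d (\<lambda>x y. t1 x c (\<lambda>u v. \<phi> (z \<cdot> u) * \<beta> v y))"
    by (simp add: coproduct_slice[OF l b])
qed

end

locale right_full_wmb = regular_weak_multiplier_bialgebra H
  for H :: "('k::field, 'a::ab_group_add) wmb" +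
  assumes full: "right_full H"
begin

lemma full_induct [case_names slice zero add scale]:
  assumes "\<And>a b \<omega>. lf \<omega> \<Longrightarrow> P (SR \<omega> (t1 a b))"
    and "P 0" "\<And>x y. P x \<Longrightarrow> P y \<Longrightarrow> P (x + y)" "\<And>c x. P x \<Longrightarrow> P (smult H c x)"
  shows "P x"
proof -
  have "x \<in> A.span {SR \<omega> (T\<^sub>1 H (pure H a b)) | a b \<omega>. \<omega> \<in> Lin (spc H) ground}"
    using full by (simp add: right_full_def)
  then show ?thesis
  proof (induction rule: A.span_induct_alt)
    case base show ?case by (rule assms(2))
  next
    case (step c x y)
    then obtain a b \<omega> where "x = SR \<omega> (t1 a b)" "\<omega> \<in> Lin (spc H) ground" unfolding t1_def by blast
    moreover then have "lf \<omega>" by (simp add: LinD(1))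
    ultimately show ?case using step assms by simp
  qed
qed

text \<open>
  Fullness writes \<open>a\<close> as a sum of slices \<open>p\<^sub>1 \<omega>(p\<^sub>2 q)\<close>, and idempotency writes \<open>q\<close> as a sum of products.
\<close>

lemma capR_subset: "\<exists>d. capR H a = capR_bar H d"
proof (induction a rule: full_induct)
  case (slice a b \<omega>)
  note [lin] = lf_comp[OF slice]
  show ?case
  proof (induction b rule: prod_induct)
    case (prod q q')
    then show ?case using capR_eq_capR_bar_slice[OF slice] by blast
  next
    case (add x y)
    then obtain d d' where d: "capR H (SR \<omega> (t1 a x)) = capR_bar H d" "capR H (SR \<omega> (t1 a y)) = capR_bar H d'"
      by auto
    have "SR \<omega> (t1 a (x + y)) = SR \<omega> (t1 a x) + SR \<omega> (t1 a y)"
    proof (rule A_eqI)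
      fix \<phi> assume l: "lf \<phi>"
      note [lin] = lf_comp[OF l]
      have "lf (\<lambda>x. t1 a x (\<lambda>u v. \<phi> u * \<omega> v))" by (intro lin)
      then show "\<phi> (SR \<omega> (t1 a (x + y))) = \<phi> (SR \<omega> (t1 a x) + SR \<omega> (t1 a y))"
        using l by (simp add: SR_eval[OF slice structure_in(3) l] linear_on_def)
    qed
    then have "capR H (SR \<omega> (t1 a (x + y))) = capR_bar H (d + d')"
      using d linear_onD(2)[OF capR_linear] linear_onD(2)[OF capR_bar_linear] by simp
    then show ?case by blast
  qed
next
  case zero
  show ?case using linear_on_zero[OF is_vspaceA capR_linear] linear_on_zero[OF is_vspaceA capR_bar_linear]
    by metis
next
  case (add x y)
  then obtain d d' where "capR H x = capR_bar H d" "capR H y = capR_bar H d'" by auto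
  then have "capR H (x + y) = capR_bar H (d + d')"
    using linear_onD(2)[OF capR_linear, of x y] linear_onD(2)[OF capR_bar_linear, of d d'] by simp
  then show ?case by blast
next
  case (scale c x)
  then obtain d where "capR H x = capR_bar H d" by auto
  then have "capR H (smult H c x) = capR_bar H (smult H c d)"
    using linear_onD(3)[OF capR_linear, of x c] linear_onD(3)[OF capR_bar_linear, of d c] by simp
  then show ?case by blast
qed

text \<open>
  Let \<open>\<Omega>\<close> be a functional vanishing on the range of \<open>N\<close>. By \<open>capR_eq_capR_bar_slice\<close> the element
  \<open>\<Omega>(N'(p\<^sub>1)) p\<^sub>2 q\<close> of \<open>A\<close> is killed by all functionals \<open>\<psi>(x -)\<close>, hence it is zero. So \<open>\<Omega>\<close> vanishes at \<open>N'\<close>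
  of every slice, and by fullness on the range of \<open>N'\<close>.
\<close>

lemma capR_bar_subset: "capR_bar H a \<in> range (capR H)"
proof (rule ccontr)
  assume "capR_bar H a \<notin> range (capR H)"
  moreover have "module.subspace (vscale (MA H)) (range (capR H))"
    using is_vspace_base by (simp add: is_vspace_def)
  ultimately obtain \<Omega> where \<Omega>: "\<And>y z. \<Omega> (y + z) = \<Omega> y + \<Omega> z" "\<And>c y. \<Omega> (vscale (MA H) c y) = c * \<Omega> y"
    "\<And>y. y \<in> range (capR H) \<Longrightarrow> \<Omega> y = 0" "\<Omega> (capR_bar H a) = 1"
    using separating_functional[OF is_vspaceD(1)[OF is_vspace_MA]] by metis
  define f where "f x = \<Omega> (capR_bar H x)" for x
  have f: "lf f"
    using linear_onD(2,3)[OF capR_bar_linear] by (simp add: linear_on_def f_def \<Omega>)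
  have "f x = 0" for x
  proof (induction x rule: full_induct)
    case (slice p q \<omega>)
    have "SL f (t1 p q) = 0"
    proof (rule left_cancel)
      fix \<psi> x assume l: "lf \<psi>"
      note [lin] = lf_comp[OF l] lf_comp[OF f]
      have "\<psi> (x \<cdot> SL f (t1 p q)) = t1 p q (\<lambda>u v. f u * \<psi> (x \<cdot> v))"
        by (rule SL_eval[OF f structure_in(3)]) (intro lin)
      also have "\<dots> = f (SR (\<lambda>v. \<psi> (x \<cdot> v)) (t1 p q))"
        by (rule SR_eval[OF _ structure_in(3) f, symmetric]) (intro lin)
      also have "\<dots> = \<Omega> (capR H (SR \<psi> (t1 x (p \<cdot> q))))"
        by (simp add: f_def capR_eq_capR_bar_slice[OF l])
      also have "\<dots> = 0" using \<Omega>(3) by simp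
      finally show "\<psi> (x \<cdot> SL f (t1 p q)) = \<psi> (x \<cdot> 0)"
        using linear_on_zero[OF is_vspaceA le_prod_left[OF le_id]] linear_on_zero[OF is_vspaceA l] by simp
    qed
    moreover have "f (SR \<omega> (t1 p q)) = \<omega> (SL f (t1 p q))"
      using SR_eval[OF slice structure_in(3) f] SL_eval[OF f structure_in(3) slice] by simp
    ultimately show ?case using linear_on_zero[OF is_vspaceA slice] by simp
  qed (use f in \<open>auto simp: linear_on_def linear_on_zero[OF is_vspaceA f]\<close>)
  then show False using \<Omega>(4) by (simp add: f_def)
qed

text \<open>
  Elements of the base algebra have both forms \<open>N(x)\<close> and \<open>N'(y)\<close>, so both one-sided identities apply.
\<close>

lemma base_commutes_E:
  assumes r: "r \<in> range (capR H)" and b: "bl \<beta>"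
  shows "e1 c (fst r b) \<beta> = e1 c b (\<lambda>u v. \<beta> u (fst r v))"
proof -
  obtain x where x: "r = capR H x" using r by auto
  obtain y where y: "r = capR_bar H y" using capR_subset x by metis
  have "e1 c (fst r b) \<beta> = e1 c b (\<lambda>u v. e1 u (fst r v) \<beta>)" unfolding y by (rule E_capR_bar_E[OF b])
  also have "\<dots> = e1 c b (\<lambda>u v. \<beta> u (fst r v))" unfolding x by (rule capR_E[OF b, symmetric])
  finally show ?thesis .
qed

text \<open>
  For \<open>p = ab\<close> the tensor is \<open>N(b\<^sub>2) \<otimes> a b\<^sub>1\<close>, the flip of \<open>(p \<otimes> 1)F\<close>. Multiplying its legs gives back \<open>p\<close>, and
  pairing its left leg with \<open>\<epsilon>(- c)\<close> gives \<open>p N'(c)\<close>.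
\<close>

lemma local_unit_tensor:
  "\<exists>t\<in>vcar (base H \<Otimes> spc H). \<forall>\<phi>. lf \<phi> \<longrightarrow> t (\<lambda>r u. \<phi> (snd r u)) = \<phi> p \<and>
    (\<forall>c. t (\<lambda>r u. \<phi> u * \<epsilon> (fst r c)) = \<phi> (snd (capR_bar H c) p))"
proof (induction p rule: prod_induct)
  case (prod a b)
  let ?t = "tmap (spc H) (spc H) (base H) (spc H) (capR H) (\<lambda>x. x) (tw (spc H) (spc H) (t2 a b))"
  have tw_in: "tw (spc H) (spc H) (t2 a b) \<in> AA"
    by (rule linear_onD(1)[OF tw_linear[OF is_vspaceA is_vspaceA] structure_in(4)])
  have "?t \<in> vcar (base H \<Otimes> spc H)"
    by (rule linear_onD(1)[OF tmap_linear[OF is_vspace_base is_vspaceA capR_linear_base le_id] tw_in])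
  moreover have ev: "?t \<beta> = t2 a b (\<lambda>u v. \<beta> (capR H v) u)" if b: "bilinear_on (base H) (spc H) ground \<beta>" for \<beta>
    using tmap_eval[OF is_vspaceA is_vspaceA is_vspace_base is_vspaceA capR_linear_base le_id tw_in b]
      tw_eval[OF is_vspaceA is_vspaceA structure_in(4) bilinear_comp[OF capR_linear_base le_id b]] by simp
  moreover have "bilinear_on (base H) (spc H) ground (\<lambda>r u. \<phi> (snd r u))"
    "bilinear_on (base H) (spc H) ground (\<lambda>r u. \<phi> u * \<epsilon> (fst r c))" if l: "lf \<phi>" for \<phi> c
  proof -
    show "bilinear_on (base H) (spc H) ground (\<lambda>r u. \<phi> (snd r u))"
      unfolding bilinear_on_def
      using base_linear[OF snd_linear[OF l]] lf_comp[OF l MA_le(2)] capR_in by auto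
    show "bilinear_on (base H) (spc H) ground (\<lambda>r u. \<phi> u * \<epsilon> (fst r c))"
      using product_bilinear[OF base_linear[OF fst_linear[OF lf_eps[OF le_id]], of c] l] by (simp add: mult.commute)
  qed
  ultimately show ?case using coproduct_capR coproduct_eps by (intro bexI[of _ ?t]) auto
next
  case (add x y)
  obtain t where t: "t \<in> vcar (base H \<Otimes> spc H)"
    "\<forall>\<phi>. lf \<phi> \<longrightarrow> t (\<lambda>r u. \<phi> (snd r u)) = \<phi> x \<and>
      (\<forall>c. t (\<lambda>r u. \<phi> u * \<epsilon> (fst r c)) = \<phi> (snd (capR_bar H c) x))"
    using add(1) by (elim bexE)
  obtain t' where t': "t' \<in> vcar (base H \<Otimes> spc H)"
    "\<forall>\<phi>. lf \<phi> \<longrightarrow> t' (\<lambda>r u. \<phi> (snd r u)) = \<phi> y \<and>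
      (\<forall>c. t' (\<lambda>r u. \<phi> u * \<epsilon> (fst r c)) = \<phi> (snd (capR_bar H c) y))"
    using add(2) by (elim bexE)
  have "snd (capR_bar H c) (x + y) = snd (capR_bar H c) x + snd (capR_bar H c) y" for c
    using linear_onD(2)[OF MA_le(2)[OF capR_bar_in]] by simp
  moreover have "\<phi> (x + y) = \<phi> x + \<phi> y" if "lf \<phi>" for \<phi> x y
    using linear_onD(2)[OF that] by simp
  ultimately have "\<forall>\<phi>. lf \<phi> \<longrightarrow> (t + t') (\<lambda>r u. \<phi> (snd r u)) = \<phi> (x + y) \<and>
    (\<forall>c. (t + t') (\<lambda>r u. \<phi> u * \<epsilon> (fst r c)) = \<phi> (snd (capR_bar H c) (x + y)))"
    using t(2) t'(2) by simp
  then show ?case by (rule bexI[OF _ is_vspaceD(3)[OF is_vspace_tensor t(1) t'(1)]])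
qed

text \<open>
  Suppose that a functional \<open>\<Omega>\<close> vanishes on all \<open>p N'(c)\<close>, but \<open>\<Omega>(p) = 1\<close>. Let \<open>\<Sum> r\<^sub>j \<otimes> p\<^sub>j\<close> be the tensor above
  and \<open>s \<in> R\<close>. The element \<open>\<Sum> \<Omega>(p\<^sub>j s) r\<^sub>j\<close> of \<open>R\<close> is killed by every \<open>\<epsilon>(- c)\<close>, because \<open>\<Sum> \<epsilon>(r\<^sub>j c) p\<^sub>j s =
  p N'(c) s\<close> is again of the form \<open>p N'(d)\<close>; so it is zero. By \<open>eval_eq_0_if_slices_eq_0\<close>, then also
  \<open>\<Omega>(p) = \<Sum> \<Omega>(p\<^sub>j r\<^sub>j) = 0\<close>.
\<close>

lemma local_unit: "\<exists>c. snd (capR_bar H c) p = p"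
proof (rule ccontr)
  define S where "S = range (\<lambda>c. snd (capR_bar H c) p)"
  assume no_unit: "\<nexists>c. snd (capR_bar H c) p = p"
  have "p \<notin> S"
  proof
    assume "p \<in> S"
    then obtain c where "p = snd (capR_bar H c) p" unfolding S_def by (rule imageE)
    from exI[of "\<lambda>c. snd (capR_bar H c) p = p", OF this[symmetric]] show False
      using no_unit by (rule notE[rotated])
  qed
  moreover have "A.subspace S"
  proof -
    have l: "le (\<lambda>c. snd (capR_bar H c) p)" by (intro lin)
    note z = linear_on_zero[OF is_vspaceA l] and l' = linear_onD(2,3)[OF l, simplified]
    show ?thesis unfolding S_def
    proof (rule A.subspaceI)
      show "0 \<in> range (\<lambda>c. snd (capR_bar H c) p)" using rangeI[of "\<lambda>c. snd (capR_bar H c) p" 0] unfolding z .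
      fix x y k assume "x \<in> range (\<lambda>c. snd (capR_bar H c) p)"
      then obtain c where c: "x = snd (capR_bar H c) p" by blast
      show "smult H k x \<in> range (\<lambda>c. snd (capR_bar H c) p)"
        unfolding c l'(2)[symmetric] by (rule rangeI)
      assume "y \<in> range (\<lambda>c. snd (capR_bar H c) p)"
      then obtain d where d: "y = snd (capR_bar H d) p" by blast
      show "x + y \<in> range (\<lambda>c. snd (capR_bar H c) p)"
        unfolding c d l'(1)[symmetric] by (rule rangeI)
    qed
  qed
  ultimately obtain \<Omega> where \<Omega>: "\<And>y z. \<Omega> (y + z) = \<Omega> y + \<Omega> z" "\<And>c y. \<Omega> (smult H c y) = c * \<Omega> y"
    "\<And>y. y \<in> S \<Longrightarrow> \<Omega> y = 0" "\<Omega> p = 1"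
    using separating_functional[OF A.vector_space_axioms] by metis
  have l: "lf \<Omega>" using \<Omega> by (simp add: linear_on_def)
  obtain t where t0: "t \<in> vcar (base H \<Otimes> spc H)"
    "\<forall>\<phi>. lf \<phi> \<longrightarrow> t (\<lambda>r u. \<phi> (snd r u)) = \<phi> p \<and>
      (\<forall>c. t (\<lambda>r u. \<phi> u * \<epsilon> (fst r c)) = \<phi> (snd (capR_bar H c) p))"
    using local_unit_tensor[of p] by (elim bexE)
  then have t: "t \<in> vcar (base H \<Otimes> spc H)" "\<And>\<phi>. lf \<phi> \<Longrightarrow> t (\<lambda>r u. \<phi> (snd r u)) = \<phi> p"
    "\<And>\<phi> c. lf \<phi> \<Longrightarrow> t (\<lambda>r u. \<phi> u * \<epsilon> (fst r c)) = \<phi> (snd (capR_bar H c) p)"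
    by simp_all
  have "t (\<lambda>r u. \<Omega> (snd r u)) = 0"
  proof (rule eval_eq_0_if_slices_eq_0[OF is_vspace_base is_vspaceA t(1)])
    show "bilinear_on (base H) (spc H) ground (\<lambda>r u. \<Omega> (snd r u))"
      unfolding bilinear_on_def
      using base_linear[OF snd_linear[OF l]] lf_comp[OF l MA_le(2)] capR_in by auto
    \<comment> \<open>The slice is taken with \<open>\<Omega>(- s)\<close>, and it is compared with \<open>0\<close> through the functionals \<open>\<epsilon>(- c)\<close>.\<close>
    fix s assume "s \<in> vcar (base H)"
    then obtain d where d: "s = capR_bar H d" using capR_subset by auto
    note [lin] = lf_comp[OF l]
    have ls: "lf (\<lambda>u. \<Omega> (snd s u))" unfolding d by (intro lin)
    show "slice_right (base H) (spc H) (\<lambda>u. \<Omega> (snd s u)) t = 0"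
    proof (rule base_eqI)
      show "slice_right (base H) (spc H) (\<lambda>u. \<Omega> (snd s u)) t \<in> range (capR H)"
        using slice_right(1)[OF is_vspace_base is_vspaceA ls t(1)] by simp
      show "0 \<in> range (capR H)" using is_vspaceD(2)[OF is_vspace_base] by simp
      fix c
      have "\<epsilon> (fst (slice_right (base H) (spc H) (\<lambda>u. \<Omega> (snd s u)) t) c) =
          t (\<lambda>r u. \<epsilon> (fst r c) * \<Omega> (snd s u))"
        by (rule slice_right(2)[OF is_vspace_base is_vspaceA ls t(1) base_linear[OF fst_linear[OF lf_eps[OF le_id]]]])
      also have "\<dots> = \<Omega> (snd s (snd (capR_bar H c) p))" using t(3)[OF ls] by (simp add: mult.commute)
      also have "\<dots> = 0" unfolding d capR_bar_closed by (rule \<Omega>(3)) (simp add: S_def)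
      finally show "\<epsilon> (fst (slice_right (base H) (spc H) (\<lambda>u. \<Omega> (snd s u)) t) c) = \<epsilon> (fst (0 :: 'a multiplier) c)"
        using linear_on_zero[OF is_vspaceA lf_eps[OF le_id]] by simp
    qed
  qed
  then show False using t(2)[OF l] \<Omega>(4) by simp
qed

text \<open>
  With a local unit \<open>p = p N'(d)\<close> for \<open>p = a' - a\<close>, the number \<open>\<epsilon>(p) = \<epsilon>(p d) = \<epsilon>(N(p) d)\<close> depends only on \<open>N(p)\<close>,
  so that \<open>\<epsilon>\<^sub>R\<close> is well defined.
\<close>

lemma base_counit_capR: "base_counit H (capR H a) = \<epsilon> a"
  unfolding base_counit_def
proof (rule the_equality)
  fix c assume "\<exists>a'. capR H a' = capR H a \<and> \<epsilon> a' = c"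
  then obtain a' where a': "capR H a' = capR H a" "\<epsilon> a' = c" by auto
  obtain d where d: "snd (capR_bar H d) (a' - a) = a' - a" using local_unit by blast
  have "\<epsilon> (a' - a) = \<epsilon> ((a' - a) \<cdot> d)" using eps_capR_bar[of d "a' - a"] d by simp
  also have "\<dots> = \<epsilon> (a' \<cdot> d) - \<epsilon> (a \<cdot> d)"
    using linear_on_diff[OF is_vspaceA lf_eps[OF le_id]] by (simp add: prod_diff)
  also have "\<dots> = 0" using eps_capR[of a' d] eps_capR[of a d] a' by simp
  finally show "c = \<epsilon> a" using linear_on_diff[OF is_vspaceA lf_eps[OF le_id]] a' by simp
qed auto

lemma base_counit_linear: "linear_on (base H) ground (base_counit H)"
proof -
  have "base_counit H (capR H a + capR H b) = base_counit H (capR H a) + base_counit H (capR H b)" for a b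
    using linear_onD(2)[OF capR_linear, of a b, symmetric] linear_onD(2)[OF lf_eps[OF le_id], of a b]
    by (simp add: base_counit_capR)
  moreover have "base_counit H (vscale (MA H) c (capR H a)) = c * base_counit H (capR H a)" for a c
    using linear_onD(3)[OF capR_linear, of a c, symmetric] linear_onD(3)[OF lf_eps[OF le_id], of a c]
    by (simp add: base_counit_capR)
  ultimately show ?thesis by (auto simp: linear_on_def)
qed

text \<open>
  For \<open>r = a \<leftharpoonup> \<psi>\<close>, the identities \<open>\<psi>(a\<^sub>1) \<Delta>(a\<^sub>2) \<Delta>(d) = \<Delta>(rd) = (1 \<otimes> r)\<Delta>(d)\<close> give
  \<open>\<psi>(a\<^sub>1) \<Delta>(a\<^sub>2) = \<psi>(a\<^sub>1) \<Delta>(a\<^sub>2)E = (1 \<otimes> r)E = E(1 \<otimes> r)\<close>.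
\<close>

lemma integral_coproduct:
  assumes r: "r \<in> range (capR H)" and \<psi>: "lf \<psi>" and b: "bl \<beta>"
    and int: "\<And>b. fst r b = SL \<psi> (t1 a b)"
  shows "e1 c (fst r b) \<beta> = t1 a b (\<lambda>x y. t1 x c (\<lambda>u v. \<psi> u * \<beta> v y))"
proof -
  note [lin] = bl_left[OF b] bl_right[OF b] lf_comp[OF \<psi>]
  have lr: "le (fst r)" by (rule MA_le[OF base_in_MA[OF r]])
  have "e1 c (fst r b) \<beta> = e1 c b (\<lambda>u v. \<beta> u (fst r v))" by (rule base_commutes_E[OF r b])
  \<comment> \<open>The range of \<open>E\<close> is spanned by the \<open>\<Delta>(d)(c \<otimes> b)\<close>, so both sides need only be compared on these.\<close>
  also have "\<dots> = e1 c b (\<lambda>s t. t1 a t (\<lambda>x y. t1 x s (\<lambda>u v. \<psi> u * \<beta> v y)))"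
  proof (rule E1_induct)
    show "bl (\<lambda>u v. \<beta> u (fst r v))" by (intro lin bl_right[OF b lr])
    show "bl (\<lambda>s t. t1 a t (\<lambda>x y. t1 x s (\<lambda>u v. \<psi> u * \<beta> v y)))" by (intro lin)
    fix d c b
    obtain x where x: "r = capR H x" using r by auto
    have "t1 d b (\<lambda>u v. \<beta> (u \<cdot> c) (fst r v)) = t1 (fst r d) b (\<lambda>u v. \<beta> (u \<cdot> c) v)"
      unfolding x by (rule coproduct_capR_left[symmetric]) (intro lin)
    also have "\<dots> = t1 a d (\<lambda>p q. \<psi> p * t1 q b (\<lambda>u v. \<beta> (u \<cdot> c) v))"
      unfolding int by (rule SL_eval[OF \<psi> structure_in(3)]) (intro lin)
    also have "\<dots> = t1 d b (\<lambda>s t. t1 a t (\<lambda>x y. t1 x s (\<lambda>u v. \<psi> u * \<beta> (v \<cdot> c) y)))"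
      by (rule coproduct_slice_prod[OF \<psi>]) (intro lin)
    also have "\<dots> = t1 d b (\<lambda>s t. t1 a t (\<lambda>x y. t1 x (s \<cdot> c) (\<lambda>u v. \<psi> u * \<beta> v y)))"
    proof -
      have "t1 x (s \<cdot> c) (\<lambda>u v. \<psi> u * \<beta> v y) = t1 x s (\<lambda>u v. \<psi> u * \<beta> (v \<cdot> c) y)" for x s y
        by (rule t1_right) (intro lin)
      then show ?thesis by simp
    qed
    finally show "t1 d b (\<lambda>u v. \<beta> (u \<cdot> c) (fst r v)) =
        t1 d b (\<lambda>s t. t1 a t (\<lambda>x y. t1 x (s \<cdot> c) (\<lambda>u v. \<psi> u * \<beta> v y)))" .
  qed
  also have "\<dots> = t1 a b (\<lambda>x y. t1 x c (\<lambda>u v. \<psi> u * \<beta> v y))" by (rule coproduct_slice_E[OF \<psi> b])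
  finally show ?thesis .
qed

section \<open>Multipliers of the tensor square\<close>

lemma mult2_bilinear2: "bilinear_on (spc2 H) (spc2 H) (spc2 H) (mult2 H)"
  unfolding bilinear_on_def
proof (intro conjI ballI)
  fix t assume t: "t \<in> AA"
  show "linear_on (spc2 H) (spc2 H) (\<lambda>s. mult2 H s t)"
    unfolding tmult_def by (rule tlift_linear[OF is_vspace_tensor mult2_bilinear[OF t]])
  show "linear_on (spc2 H) (spc2 H) (mult2 H t)"
  proof (rule linear_into_tensorI[OF is_vspace_tensor is_vspaceA is_vspaceA])
    fix \<beta> assume b: "bl \<beta>"
    note [lin] = bl_left[OF b] bl_right[OF b]
    have "mult2 H t s \<beta> = s (\<lambda>c d. t (\<lambda>a b. \<beta> (a \<cdot> c) (b \<cdot> d)))" if s: "s \<in> AA" for s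
      unfolding mult2_eval[OF t s b] by (rule eval_commute[OF t s]) (intro lin)+
    then show "linear_on (spc2 H) ground (\<lambda>s. mult2 H t s \<beta>)"
      using linear_on_cong[OF is_vspace_tensor, of _ _ "\<lambda>s. mult2 H t s \<beta>" "\<lambda>s. s (\<lambda>c d. t (\<lambda>a b. \<beta> (a \<cdot> c) (b \<cdot> d)))"]
        eval_linear by blast
  qed (use t in simp)
qed

lemma mult2_pure_left: "t \<in> AA \<Longrightarrow> bl \<beta> \<Longrightarrow> mult2 H (pure H p q) t \<beta> = t (\<lambda>u v. \<beta> (p \<cdot> u) (q \<cdot> v))"
  and mult2_pure_right: "t \<in> AA \<Longrightarrow> bl \<beta> \<Longrightarrow> mult2 H t (pure H p q) \<beta> = t (\<lambda>u v. \<beta> (u \<cdot> p) (v \<cdot> q))"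
proof -
  assume t: "t \<in> AA" and b: "bl \<beta>"
  note [lin] = bl_left[OF b] bl_right[OF b]
  have "pure H p q (\<lambda>a b. t (\<lambda>c d. \<beta> (a \<cdot> c) (b \<cdot> d))) = t (\<lambda>c d. \<beta> (p \<cdot> c) (q \<cdot> d))"
    by (rule pure_eval) (intro lin lf_eval[OF t])
  then show "mult2 H (pure H p q) t \<beta> = t (\<lambda>u v. \<beta> (p \<cdot> u) (q \<cdot> v))" using mult2_eval[OF _ t b] by simp
  have "pure H p q (\<lambda>c d. \<beta> (u \<cdot> c) (v \<cdot> d)) = \<beta> (u \<cdot> p) (v \<cdot> q)" for u v
    by (rule pure_eval) (intro lin)
  then show "mult2 H t (pure H p q) \<beta> = t (\<lambda>u v. \<beta> (u \<cdot> p) (v \<cdot> q))"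
    using mult2_eval[OF t pure_in b] by simp
qed

lemma mult2_cancel:
  assumes t: "t \<in> AA" "t' \<in> AA"
  shows "(\<And>p q. mult2 H (pure H p q) t = mult2 H (pure H p q) t') \<Longrightarrow> t = t'"
    and "(\<And>p q. mult2 H t (pure H p q) = mult2 H t' (pure H p q)) \<Longrightarrow> t = t'"
proof -
  show "t = t'" if *: "\<And>p q. mult2 H (pure H p q) t = mult2 H (pure H p q) t'"
  proof (rule AA_eqI[OF t])
    fix \<phi> \<psi> assume l: "lf \<phi>" "lf \<psi>"
    show "t (\<lambda>u v. \<phi> u * \<psi> v) = t' (\<lambda>u v. \<phi> u * \<psi> v)"
    proof (rule cancel2_left[OF tensorial_AA[OF t(1)] tensorial_AA[OF t(2)] product_bilinear[OF l]])
      fix \<beta> p q assume b: "bl \<beta>"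
      show "t (\<lambda>u v. \<beta> (p \<cdot> u) (q \<cdot> v)) = t' (\<lambda>u v. \<beta> (p \<cdot> u) (q \<cdot> v))"
        using fun_cong[OF *[of p q], of \<beta>] by (simp add: mult2_pure_left t b)
    qed
  qed
  show "t = t'" if *: "\<And>p q. mult2 H t (pure H p q) = mult2 H t' (pure H p q)"
  proof (rule AA_eqI[OF t])
    fix \<phi> \<psi> assume l: "lf \<phi>" "lf \<psi>"
    show "t (\<lambda>u v. \<phi> u * \<psi> v) = t' (\<lambda>u v. \<phi> u * \<psi> v)"
    proof (rule cancel2_right[OF tensorial_AA[OF t(1)] tensorial_AA[OF t(2)] product_bilinear[OF l]])
      fix \<beta> p q assume b: "bl \<beta>"
      show "t (\<lambda>u v. \<beta> (u \<cdot> p) (v \<cdot> q)) = t' (\<lambda>u v. \<beta> (u \<cdot> p) (v \<cdot> q))"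
        using fun_cong[OF *[of p q], of \<beta>] by (simp add: mult2_pure_right t b)
    qed
  qed
qed

lemma mult2_assoc:
  assumes "r \<in> AA" "s \<in> AA" "t \<in> AA"
  shows "mult2 H (mult2 H r s) t = mult2 H r (mult2 H s t)"
proof (rule AA_eqI)
  fix \<phi> \<psi> assume l: "lf \<phi>" "lf \<psi>"
  note [lin] = lf_comp[OF l(1)] lf_comp[OF l(2)]
  have b: "bl (\<lambda>u v. \<phi> u * \<psi> v)" by (intro lin)
  have b1: "bl (\<lambda>x y. t (\<lambda>c d. \<phi> (x \<cdot> c) * \<psi> (y \<cdot> d)))" by (intro lin lf_eval[OF assms(3)])
  have b2: "bl (\<lambda>x y. \<phi> (p \<cdot> x) * \<psi> (q \<cdot> y))" for p q by (intro lin)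
  show "mult2 H (mult2 H r s) t (\<lambda>u v. \<phi> u * \<psi> v) = mult2 H r (mult2 H s t) (\<lambda>u v. \<phi> u * \<psi> v)"
    by (simp add: mult2_eval[OF mult2_in[OF assms(1,2)] assms(3) b] mult2_eval[OF assms(1,2) b1]
        mult2_eval[OF assms(1) mult2_in[OF assms(2,3)] b] mult2_eval[OF assms(2,3) b2])
qed (use assms in simp_all)

lemma is_vspace_MAA: "is_vspace (MAA H)"
  by (rule is_vspace_multiplier_algebra[OF is_vspace_tensor mult2_bilinear2])

lemma MAA_iff: "x \<in> vcar (MAA H) \<longleftrightarrow> fst x \<in> Lin (spc2 H) (spc2 H) \<and> snd x \<in> Lin (spc2 H) (spc2 H) \<and>
    (\<forall>s\<in>AA. \<forall>t\<in>AA. mult2 H s (fst x t) = mult2 H (snd x s) t)"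
  by (auto simp: multiplier_algebra_def)

lemma MAA_scale: "vscale (MAA H) c x = (\<lambda>b. tscale c (fst x b), \<lambda>b. tscale c (snd x b))"
  by (simp add: multiplier_algebra_def)

lemma MAA_linear: "x \<in> vcar (MAA H) \<Longrightarrow> linear_on (spc2 H) (spc2 H) (fst x)"
    "x \<in> vcar (MAA H) \<Longrightarrow> linear_on (spc2 H) (spc2 H) (snd x)"
  using LinD(1) by (auto simp: MAA_iff)

lemma MAA_in [simp]: "x \<in> vcar (MAA H) \<Longrightarrow> t \<in> AA \<Longrightarrow> fst x t \<in> AA"
    "x \<in> vcar (MAA H) \<Longrightarrow> t \<in> AA \<Longrightarrow> snd x t \<in> AA"
  using MAA_linear linear_onD(1) by blast+

lemma MAA_multiplier: "x \<in> vcar (MAA H) \<Longrightarrow> s \<in> AA \<Longrightarrow> t \<in> AA \<Longrightarrow> mult2 H s (fst x t) = mult2 H (snd x s) t"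
  by (simp add: MAA_iff)

text \<open>
  By nondegeneracy the left action determines the right action of a multiplier.
\<close>

lemma MAA_eqI:
  assumes x: "x \<in> vcar (MAA H)" and y: "y \<in> vcar (MAA H)"
    and eq: "\<And>c d \<beta>. bl \<beta> \<Longrightarrow> fst x (pure H c d) \<beta> = fst y (pure H c d) \<beta>"
  shows "x = y"
proof -
  have pure: "fst x (pure H c d) = fst y (pure H c d)" for c d
    by (rule AA_eqI) (simp_all add: x y eq[OF product_bilinear])
  have 1: "fst x t = fst y t" if "t \<in> AA" for t
    using linear_eq_on_tensors[OF is_vspaceA MAA_linear(1)[OF x] MAA_linear(1)[OF y] pure that] .
  have 2: "snd x s = snd y s" if "s \<in> AA" for s
    by (rule mult2_cancel(2))
      (use that x y 1 in \<open>simp_all add: MAA_multiplier[symmetric]\<close>)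
  have L: "fst x \<in> Lin (spc2 H) (spc2 H)" "snd x \<in> Lin (spc2 H) (spc2 H)"
    "fst y \<in> Lin (spc2 H) (spc2 H)" "snd y \<in> Lin (spc2 H) (spc2 H)"
    using x y by (simp_all only: MAA_iff)
  have "fst x t = fst y t \<and> snd x t = snd y t" for t
  proof (cases "t \<in> AA")
    case True
    then show ?thesis using 1 2 by blast
  next
    case False
    then show ?thesis unfolding LinD(2)[OF L(1) False] LinD(2)[OF L(2) False]
      LinD(2)[OF L(3) False] LinD(2)[OF L(4) False] by simp
  qed
  then show ?thesis by (simp add: prod_eq_iff fun_eq_iff)
qed

lemma MAA_module:
  assumes "x \<in> vcar (MAA H)" "s \<in> AA" "t \<in> AA"
  shows "fst x (mult2 H s t) = mult2 H (fst x s) t"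
  by (rule mult2_cancel(1)) (use assms in \<open>simp_all add: MAA_multiplier mult2_assoc[symmetric]\<close>)

lemma mmult_in:
  assumes x: "x \<in> vcar (MAA H)" and y: "y \<in> vcar (MAA H)"
  shows "x \<bullet> y \<in> vcar (MAA H)"
proof -
  have "(\<lambda>t. f (g t)) \<in> Lin (spc2 H) (spc2 H)" if "f \<in> Lin (spc2 H) (spc2 H)" "g \<in> Lin (spc2 H) (spc2 H)" for f g
    using linear_on_comp[OF LinD(1)[OF that(2)] LinD(1)[OF that(1)]] LinD(2)[OF that(2)]
      linear_on_zero[OF is_vspace_tensor LinD(1)[OF that(1)]] by (simp add: Lin_def)
  then show ?thesis using x y unfolding MAA_iff mmult_def by (simp add: o_def) (metis MAA_in MAA_multiplier x y)
qed

lemma inj2_in: "t \<in> AA \<Longrightarrow> inj2 H t \<in> vcar (MAA H)"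
proof -
  assume t: "t \<in> AA"
  have c: "linear_on (spc2 H) (spc2 H) f \<longleftrightarrow> linear_on (spc2 H) (spc2 H) (\<lambda>x. if x \<in> AA then f x else 0)" for f
    by (rule linear_on_cong[OF is_vspace_tensor]) simp
  have "linear_on (spc2 H) (spc2 H) (mult2 H t)" "linear_on (spc2 H) (spc2 H) (\<lambda>s. mult2 H s t)"
    using bilinear_onD[OF mult2_bilinear2] t by auto
  then show ?thesis using t c[of "mult2 H t"] c[of "\<lambda>s. mult2 H s t"]
    by (simp add: MAA_iff minj_def Lin_def mult2_assoc)
qed

lemma inj2_eval: "s \<in> AA \<Longrightarrow> fst (inj2 H t) s = mult2 H t s"
  by (simp add: minj_def)

lemma mtens_in:
  assumes x: "x \<in> vcar (MA H)" and y: "y \<in> vcar (MA H)"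
  shows "mtens (spc H) x y \<in> vcar (MAA H)"
proof -
  let ?l = "tmap (spc H) (spc H) (spc H) (spc H) (fst x) (fst y)" and ?r = "tmap (spc H) (spc H) (spc H) (spc H) (snd x) (snd y)"
  note A = is_vspaceA and xl = MA_le[OF x] and yl = MA_le[OF y]
  have L: "?l \<in> Lin (spc2 H) (spc2 H)" "?r \<in> Lin (spc2 H) (spc2 H)"
    by (rule tmap_Lin[OF A A xl(1) yl(1)], rule tmap_Lin[OF A A xl(2) yl(2)])
  have "mult2 H s (?l t) = mult2 H (?r s) t" if s: "s \<in> AA" and t: "t \<in> AA" for s t
  proof (rule AA_eqI)
    have i: "?l t \<in> AA" "?r s \<in> AA" using L linear_onD(1)[OF LinD(1)] s t by blast+
    then show "mult2 H s (?l t) \<in> AA" "mult2 H (?r s) t \<in> AA" using s t by simp_all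
    fix \<phi> \<psi> assume l: "lf \<phi>" "lf \<psi>"
    note [lin] = lf_comp[OF l(1)] lf_comp[OF l(2)]
    have b: "bl (\<lambda>u v. \<phi> u * \<psi> v)" "bl (\<lambda>u v. \<phi> (a \<cdot> u) * \<psi> (b \<cdot> v))" for a b by (intro lin)+
    have b': "bl (\<lambda>a b. t (\<lambda>c d. \<phi> (a \<cdot> c) * \<psi> (b \<cdot> d)))" by (intro lin lf_eval[OF t])
    show "mult2 H s (?l t) (\<lambda>u v. \<phi> u * \<psi> v) = mult2 H (?r s) t (\<lambda>u v. \<phi> u * \<psi> v)"
      by (simp add: mult2_eval[OF s i(1) b(1)] mult2_eval[OF i(2) t b(1)]
          tmap_eval[OF A A A A xl(1) yl(1) t b(2)] tmap_eval[OF A A A A xl(2) yl(2) s b']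
          MA_multiplier[OF x] MA_multiplier[OF y])
  qed
  then show ?thesis using L by (simp add: mtens_def MAA_iff)
qed

lemma mtens_eval:
  assumes "x \<in> vcar (MA H)" "y \<in> vcar (MA H)"
  shows "fst (mtens (spc H) x y) (pure H c d) = pure H (fst x c) (fst y d)"
  using tmap_tens[OF is_vspaceA is_vspaceA MA_le(1)[OF assms(1)] MA_le(1)[OF assms(2)]]
  by (simp add: mtens_def)

lemma mtens_bilinear: "bilinear_on (MA H) (MA H) (MAA H) (mtens (spc H))"
proof -
  note M = is_vspaceD[OF is_vspace_MA] and MM = is_vspaceD[OF is_vspace_MAA]
  have bl': "\<beta> (a + b) c = \<beta> a c + \<beta> b c" "\<beta> c (a + b) = \<beta> c a + \<beta> c b"
    "\<beta> (smult H k a) c = k * \<beta> a c" "\<beta> c (smult H k a) = k * \<beta> c a" if "bl \<beta>" for \<beta> a b c k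
    using that by (simp_all add: bilinear_on_def linear_on_def)
  show ?thesis
    unfolding bilinear_on_def linear_on_def
  proof (intro conjI ballI allI)
    fix x y z k assume x: "x \<in> vcar (MA H)" and y: "y \<in> vcar (MA H)" and z: "z \<in> vcar (MA H)"
    show "mtens (spc H) (y + z) x = mtens (spc H) y x + mtens (spc H) z x"
      by (rule MAA_eqI) (auto simp: mtens_in M MM x y z mtens_eval pure_eval bl')
    show "mtens (spc H) x (y + z) = mtens (spc H) x y + mtens (spc H) x z"
      by (rule MAA_eqI) (auto simp: mtens_in M MM x y z mtens_eval pure_eval bl')
  next
    fix x y k assume x: "x \<in> vcar (MA H)" and y: "y \<in> vcar (MA H)"
    show "mtens (spc H) (vscale (MA H) k y) x = vscale (MAA H) k (mtens (spc H) y x)"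
      by (rule MAA_eqI)
        (auto simp: mtens_in M MM x y mtens_eval pure_eval bl' MA_scale[of k y] MAA_scale tscale_def
          mtens_eval[OF M(5)[OF y] x, unfolded MA_scale] intro: mtens_in[OF M(5)[OF y] x, unfolded MA_scale] MM(5)[OF mtens_in[OF y x], unfolded MAA_scale tscale_def])
    show "mtens (spc H) x (vscale (MA H) k y) = vscale (MAA H) k (mtens (spc H) x y)"
      by (rule MAA_eqI)
        (auto simp: mtens_in M MM x y mtens_eval pure_eval bl' MA_scale[of k y] MAA_scale tscale_def
          mtens_eval[OF x M(5)[OF y], unfolded MA_scale] intro: mtens_in[OF x M(5)[OF y], unfolded MA_scale] MM(5)[OF mtens_in[OF x y], unfolded MAA_scale tscale_def])
  qed (simp_all add: mtens_in)
qed

lemma inj1_in: "inj1 H a \<in> vcar (MA H)"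
  by (simp add: MA_iff lin)

lemma inj1_linear: "linear_on (spc H) (MA H) (inj1 H)"
  by (rule MA_linearI[OF inj1_in], rule lf_comp, assumption) (simp add: lin)

lemma mone_in: "mone (spc H) \<in> vcar (MA H)"
  by (simp add: MA_iff mone_def idmA lin)

lemma lft_in: "lft H a \<in> vcar (MAA H)" and rgt_in: "rgt H a \<in> vcar (MAA H)"
  unfolding lft_def rgt_def by (auto intro: mtens_in inj1_in mone_in)

lemma side_pure: "fst (lft H a) (pure H c d) = pure H (a \<cdot> c) d" "fst (rgt H a) (pure H c d) = pure H c (a \<cdot> d)"
  unfolding lft_def rgt_def by (simp_all add: mtens_eval inj1_in mone_in) (simp_all add: mone_def idmA)

lemma embed_bilinear:
  assumes "linear_on V (MA H) i" "linear_on W (MA H) j"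
  shows "bilinear_on V W (MAA H) (\<lambda>v w. mtens (spc H) (i v) (j w))"
  by (rule bilinear_comp[OF assms mtens_bilinear])

lemma embed_in:
  assumes "linear_on V (MA H) i" "linear_on W (MA H) j" "t \<in> vcar (V \<Otimes> W)"
  shows "embed H V W i j t \<in> vcar (MAA H)"
  unfolding embed_def by (rule tlift_in[OF is_vspace_MAA embed_bilinear[OF assms(1,2)] assms(3)])

lemma embed_eval:
  assumes V: "is_vspace V" and W: "is_vspace W"
    and i: "linear_on V (MA H) i" and j: "linear_on W (MA H) j" and t: "t \<in> vcar (V \<Otimes> W)" and b: "bl \<beta>"
  shows "fst (embed H V W i j t) (pure H c d) \<beta> = t (\<lambda>v w. \<beta> (fst (i v) c) (fst (j w) d))"
proof -
  have "linear_on (MAA H) ground (\<lambda>x. fst x (pure H c d) \<beta>)"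
    by (simp add: linear_on_def MAA_scale tscale_def)
  then have "fst (embed H V W i j t) (pure H c d) \<beta> = t (\<lambda>v w. fst (mtens (spc H) (i v) (j w)) (pure H c d) \<beta>)"
    unfolding embed_def by (rule tlift_eval[OF V W is_vspace_MAA embed_bilinear[OF i j] _ t])
  also have "\<dots> = t (\<lambda>v w. \<beta> (fst (i v) c) (fst (j w) d))"
    by (rule eval_cong[OF V W t]) (simp add: mtens_eval linear_onD(1)[OF i] linear_onD(1)[OF j] pure_eval b)
  finally show ?thesis .
qed

text \<open>
  Multiplying by \<open>c\<close> and \<open>d\<close> only tests a tensor with functionals of the form \<open>\<phi>(i(-)c)\<close> and \<open>\<phi>'(j(-)d)\<close>. These
  separate \<open>V\<close> and \<open>W\<close>, and slices replace them by arbitrary functionals, one leg at a time.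
\<close>

lemma embed_inject:
  assumes V: "is_vspace V" and W: "is_vspace W"
    and i: "linear_on V (MA H) i" and j: "linear_on W (MA H) j"
    and inj: "inj_on i (vcar V)" "inj_on j (vcar W)"
    and t: "t \<in> vcar (V \<Otimes> W)" "t' \<in> vcar (V \<Otimes> W)" and eq: "embed H V W i j t = embed H V W i j t'"
  shows "t = t'"
proof (rule tensor_eqI[OF V W t])
  fix \<chi> \<psi> assume \<chi>: "linear_on V ground \<chi>" and \<psi>: "linear_on W ground \<psi>"
  have fi: "linear_on V ground (\<lambda>v. \<phi> (fst (i v) c))" if "lf \<phi>" for \<phi> c
    by (rule linear_on_comp[OF i fst_linear[OF that]])
  have fj: "linear_on W ground (\<lambda>w. \<phi> (fst (j w) c))" if "lf \<phi>" for \<phi> c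
    by (rule linear_on_comp[OF j fst_linear[OF that]])
  have 0: "t (\<lambda>v w. \<phi> (fst (i v) c) * \<phi>' (fst (j w) d)) = t' (\<lambda>v w. \<phi> (fst (i v) c) * \<phi>' (fst (j w) d))"
    if "lf \<phi>" "lf \<phi>'" for \<phi> \<phi>' c d
    using fun_cong[OF fun_cong[OF arg_cong[OF eq, of fst], of "pure H c d"], of "\<lambda>u v. \<phi> u * \<phi>' v"]
    by (simp add: embed_eval[OF V W i j] t product_bilinear that)
  have 1: "slice_right V W (\<lambda>w. \<phi>' (fst (j w) d)) t = slice_right V W (\<lambda>w. \<phi>' (fst (j w) d)) t'"
    if l: "lf \<phi>'" for \<phi>' d
  proof (rule inj_onD[OF inj(1)])
    note s = slice_right[OF V W fj[OF l] t(1)] slice_right[OF V W fj[OF l] t(2)]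
    show "slice_right V W (\<lambda>w. \<phi>' (fst (j w) d)) t \<in> vcar V" "slice_right V W (\<lambda>w. \<phi>' (fst (j w) d)) t' \<in> vcar V"
      by (rule s(1), rule s(3))
    show "i (slice_right V W (\<lambda>w. \<phi>' (fst (j w) d)) t) = i (slice_right V W (\<lambda>w. \<phi>' (fst (j w) d)) t')"
    proof (rule MA_eqI)
      fix \<phi> c assume p: "lf \<phi>"
      show "\<phi> (fst (i (slice_right V W (\<lambda>w. \<phi>' (fst (j w) d)) t)) c) =
          \<phi> (fst (i (slice_right V W (\<lambda>w. \<phi>' (fst (j w) d)) t')) c)"
        using s(2)[OF fi[OF p]] s(4)[OF fi[OF p]] 0[OF p l] by simp
    qed (use s linear_onD(1)[OF i] in auto)
  qed
  have 2: "t (\<lambda>v w. \<chi> v * \<phi>' (fst (j w) d)) = t' (\<lambda>v w. \<chi> v * \<phi>' (fst (j w) d))" if l: "lf \<phi>'" for \<phi>' d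
    using slice_right(2)[OF V W fj[OF l] t(1) \<chi>] slice_right(2)[OF V W fj[OF l] t(2) \<chi>] 1[OF l] by simp
  have "slice_left V W \<chi> t = slice_left V W \<chi> t'"
  proof (rule inj_onD[OF inj(2)])
    note s = slice_left[OF V W \<chi> t(1)] slice_left[OF V W \<chi> t(2)]
    show "slice_left V W \<chi> t \<in> vcar W" "slice_left V W \<chi> t' \<in> vcar W" by (rule s(1), rule s(3))
    show "j (slice_left V W \<chi> t) = j (slice_left V W \<chi> t')"
    proof (rule MA_eqI)
      fix \<phi> c assume p: "lf \<phi>"
      show "\<phi> (fst (j (slice_left V W \<chi> t)) c) = \<phi> (fst (j (slice_left V W \<chi> t')) c)"
        using s(2)[OF fj[OF p]] s(4)[OF fj[OF p]] 2[OF p] by simp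
    qed (use s linear_onD(1)[OF j] in auto)
  qed
  then show "t (\<lambda>v w. \<chi> v * \<psi> w) = t' (\<lambda>v w. \<chi> v * \<psi> w)"
    using slice_left(2)[OF V W \<chi> t(1) \<psi>] slice_left(2)[OF V W \<chi> t(2) \<psi>] by simp
qed

lemma inj1_inj: "inj_on (inj1 H) (vcar (spc H))"
proof (rule inj_onI)
  fix a b assume "inj1 H a = inj1 H b"
  then have "a \<cdot> p = b \<cdot> p" for p using inj1_simps(1) by metis
  then show "a = b" by (intro right_cancel) simp
qed

lemma id_linear_base: "linear_on (base H) (MA H) id"
  using capR_in by (auto simp: linear_on_def)

lemma id_linear_MA: "linear_on (MA H) (MA H) id"
  by (simp add: linear_on_def)

section \<open>The canonical multiplier\<close>

text \<open>
  The prescribed values \<open>F(a \<otimes> bc) = N'(b\<^sub>2)a \<otimes> b\<^sub>1 c\<close> and \<open>(ab \<otimes> c)F = a b\<^sub>1 \<otimes> c N(b\<^sub>2)\<close> of the canonical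
  multiplier.
\<close>

definition F_left :: "'a \<Rightarrow> 'a \<Rightarrow> 'a \<Rightarrow> ('k, 'a, 'a) tensor" where
  "F_left a b c = tmap (spc H) (spc H) (spc H) (spc H) (\<lambda>v. fst (capR_bar H v) a) (\<lambda>u. u) (tw (spc H) (spc H) (t4 c b))"

definition F_right :: "'a \<Rightarrow> 'a \<Rightarrow> 'a \<Rightarrow> ('k, 'a, 'a) tensor" where
  "F_right a b c = tmap (spc H) (spc H) (spc H) (spc H) (\<lambda>u. u) (\<lambda>v. snd (capR H v) c) (t2 a b)"

lemma tw_in: "t \<in> AA \<Longrightarrow> tw (spc H) (spc H) t \<in> AA"
  by (rule linear_onD(1)[OF tw_linear[OF is_vspaceA is_vspaceA]])

lemma F_left_in [simp]: "F_left a b c \<in> AA" and F_right_in [simp]: "F_right a b c \<in> AA"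
  unfolding F_left_def F_right_def
  by (rule linear_onD(1)[OF tmap_linear[OF is_vspaceA is_vspaceA]]; intro lin tw_in structure_in)+

lemma F_left_eval:
  assumes b: "bl \<beta>"
  shows "F_left a b c \<beta> = t4 c b (\<lambda>u v. \<beta> (fst (capR_bar H v) a) u)"
proof -
  note [lin] = bl_left[OF b] bl_right[OF b]
  have "le (\<lambda>v. fst (capR_bar H v) a)" "bl (\<lambda>v u. \<beta> (fst (capR_bar H v) a) u)" by (intro lin)+
  then show ?thesis unfolding F_left_def
    using tmap_eval[OF is_vspaceA is_vspaceA is_vspaceA is_vspaceA _ le_id tw_in b]
      tw_eval[OF is_vspaceA is_vspaceA structure_in(6)] by simp
qed

lemma F_right_eval:
  assumes b: "bl \<beta>"
  shows "F_right a b c \<beta> = t2 a b (\<lambda>u v. \<beta> u (snd (capR H v) c))"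
proof -
  have "le (\<lambda>v. snd (capR H v) c)" by (intro lin)
  then show ?thesis unfolding F_right_def
    by (rule tmap_eval[OF is_vspaceA is_vspaceA is_vspaceA is_vspaceA le_id _ structure_in(4) b])
qed

text \<open>
  Both sides are \<open>x y\<^sub>1 a \<otimes> z b\<^sub>1 c \<epsilon>(y\<^sub>2 b\<^sub>2)\<close>.
\<close>

lemma F_compat: "mult2 H (pure H (x \<cdot> y) z) (F_left a b c) = mult2 H (F_right x y z) (pure H a (b \<cdot> c))"
proof (rule AA_eqI)
  fix \<phi> \<psi> assume l: "lf \<phi>" "lf \<psi>"
  note [lin] = lf_comp[OF l(1)] lf_comp[OF l(2)]
  have b: "bl (\<lambda>u v. \<phi> u * \<psi> v)" "bl (\<lambda>u v. \<phi> (x \<cdot> y \<cdot> u) * \<psi> (z \<cdot> v))" "bl (\<lambda>u v. \<phi> (u \<cdot> a) * \<psi> (v \<cdot> (b \<cdot> c)))"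
    by (intro lin)+
  have left: "\<phi> (x \<cdot> (y \<cdot> fst (capR_bar H v) a)) = t2 x y (\<lambda>s t. \<phi> (s \<cdot> a) * \<epsilon> (t \<cdot> v))" for v
    using capR_eval(4)[of "\<lambda>w. \<phi> (x \<cdot> (w \<cdot> a))" v y] t1_t2[of "\<lambda>s t. \<phi> (s \<cdot> a) * \<epsilon> t" y v x]
    by (simp add: capR_bar_multiplier lin)
  have right: "\<psi> (snd (capR H v) z \<cdot> (b \<cdot> c)) = t2 z b (\<lambda>p q. \<psi> (p \<cdot> c) * \<epsilon> (v \<cdot> q))" for v
    using fst_capR_eval[of "\<lambda>w. \<psi> (w \<cdot> c)" z v b] capR_multiplier[of z v b, symmetric]
    by (simp add: lin flip: prod_assoc)
  have "mult2 H (pure H (x \<cdot> y) z) (F_left a b c) (\<lambda>u v. \<phi> u * \<psi> v) =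
      t4 c b (\<lambda>u v. t2 x y (\<lambda>s t. \<phi> (s \<cdot> a) * \<epsilon> (t \<cdot> v)) * \<psi> (z \<cdot> u))"
    by (simp add: mult2_pure_left b F_left_eval[OF b(2), simplified] left)
  also have "\<dots> = t4 c b (\<lambda>u v. t2 x y (\<lambda>s t. \<phi> (s \<cdot> a) * \<epsilon> (t \<cdot> v) * \<psi> (z \<cdot> u)))"
    by (subst eval_times(2)[OF structure_in(4)]) (auto intro!: lin)
  also have "\<dots> = t2 x y (\<lambda>s t. t4 c b (\<lambda>u v. \<phi> (s \<cdot> a) * \<epsilon> (t \<cdot> v) * \<psi> (z \<cdot> u)))"
    by (rule eval_commute[OF structure_in(6) structure_in(4)]) (intro lin)+
  also have "\<dots> = t2 x y (\<lambda>s t. t2 z b (\<lambda>p q. \<phi> (s \<cdot> a) * \<epsilon> (t \<cdot> q) * \<psi> (p \<cdot> c)))"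
    using t2_t4[of "\<lambda>p q. \<phi> (s \<cdot> a) * \<epsilon> (t \<cdot> q) * \<psi> p" z b c for s t] by (simp add: lin)
  also have "\<dots> = t2 x y (\<lambda>s t. \<phi> (s \<cdot> a) * t2 z b (\<lambda>p q. \<psi> (p \<cdot> c) * \<epsilon> (t \<cdot> q)))"
    by (subst eval_times(1)[OF structure_in(4), symmetric]) (auto simp: ac_simps intro!: lin)
  also have "\<dots> = mult2 H (F_right x y z) (pure H a (b \<cdot> c)) (\<lambda>u v. \<phi> u * \<psi> v)"
    by (simp add: mult2_pure_right b F_right_eval right)
  finally show "mult2 H (pure H (x \<cdot> y) z) (F_left a b c) (\<lambda>u v. \<phi> u * \<psi> v) =
      mult2 H (F_right x y z) (pure H a (b \<cdot> c)) (\<lambda>u v. \<phi> u * \<psi> v)" .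
qed simp_all

lemma span_prod_pure:
  "AA \<subseteq> tspan (range (\<lambda>(a, b, c). pure H a (b \<cdot> c)))"
  "AA \<subseteq> tspan (range (\<lambda>(a, b, c). pure H (a \<cdot> b) c))"
proof -
  interpret T: vector_space "tscale :: 'k \<Rightarrow> ('k, 'a, 'a) tensor \<Rightarrow> _" by (rule vector_space_tscale)
  have 1: "pure H a d \<in> tspan (range (\<lambda>(a, b, c). pure H a (b \<cdot> c)))" for a d
  proof (induction d rule: prod_induct)
    case (prod b c) show ?case by (intro T.span_base range_eqI[of _ _ "(a, b, c)"]) simp
  next
    case (add x y)
    have "pure H a (x + y) = pure H a x + pure H a y"
      using linear_onD(2)[OF tens_linear(2)[OF is_vspaceA is_vspaceA], of a x y] by simp
    with T.span_add[OF add] have "pure H a (x + y) \<in> tspan (range (\<lambda>(a, b, c). pure H a (b \<cdot> c)))"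
      by metis
    then show ?case .
  qed
  have 2: "pure H d c \<in> tspan (range (\<lambda>(a, b, c). pure H (a \<cdot> b) c))" for c d
  proof (induction d rule: prod_induct)
    case (prod a b) show ?case by (intro T.span_base range_eqI[of _ _ "(a, b, c)"]) simp
  next
    case (add x y)
    have "pure H (x + y) c = pure H x c + pure H y c"
      using linear_onD(2)[OF tens_linear(1)[OF is_vspaceA is_vspaceA], of c x y] by simp
    with T.span_add[OF add] have "pure H (x + y) c \<in> tspan (range (\<lambda>(a, b, c). pure H (a \<cdot> b) c))"
      by metis
    then show ?case .
  qed
  have AA: "AA = tspan {pure H v w |v w. v \<in> UNIV \<and> w \<in> UNIV}" by (simp add: tensor_space_def)
  show "AA \<subseteq> tspan (range (\<lambda>(a, b, c). pure H a (b \<cdot> c)))"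
    unfolding AA by (rule T.span_minimal[OF _ T.subspace_span]) (use 1 in blast)
  show "AA \<subseteq> tspan (range (\<lambda>(a, b, c). pure H (a \<cdot> b) c))"
    unfolding AA by (rule T.span_minimal[OF _ T.subspace_span]) (use 2 in blast)
qed

lemma F_exists:
  obtains F where "F \<in> vcar (MAA H)" "\<And>a b c. fst F (pure H a (b \<cdot> c)) = F_left a b c"
    "\<And>a b c. snd F (pure H (a \<cdot> b) c) = F_right a b c"
proof -
  define G where "G = range (\<lambda>(a, b, c). (pure H a (b \<cdot> c), F_left a b c))"
  define K where "K = range (\<lambda>(a, b, c). (pure H (a \<cdot> b) c, F_right a b c))"
  have fstG: "fst ` G = range (\<lambda>(a, b, c). pure H a (b \<cdot> c))" "fst ` K = range (\<lambda>(a, b, c). pure H (a \<cdot> b) c)"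
    unfolding G_def K_def by force+
  have z: "mult2 H s 0 = 0" "mult2 H 0 s = 0" if "s \<in> AA" for s
    using linear_on_zero[OF is_vspace_tensor bilinear_onD(2)[OF mult2_bilinear2 that]]
      linear_on_zero[OF is_vspace_tensor bilinear_onD(1)[OF mult2_bilinear2 that]] by simp_all
  note T = is_vspaceD[OF is_vspace_tensor[of "spc H" "spc H"]]
  obtain F where F: "F \<in> vcar (MAA H)" "\<And>x y. (x, y) \<in> G \<Longrightarrow> fst F x = y" "\<And>x y. (x, y) \<in> K \<Longrightarrow> snd F x = y"
  proof (rule multiplier_extension[OF is_vspace_tensor mult2_bilinear2, of G K])
    show "y = 0" if "y \<in> AA" "\<And>z. z \<in> AA \<Longrightarrow> mult2 H z y = 0" for y
      by (rule mult2_cancel(1)[OF that(1) T(2)]) (simp add: that z)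
    show "y = 0" if "y \<in> AA" "\<And>z. z \<in> AA \<Longrightarrow> mult2 H y z = 0" for y
      by (rule mult2_cancel(2)[OF that(1) T(2)]) (simp add: that z)
    show "G \<subseteq> AA \<times> AA" "K \<subseteq> AA \<times> AA" by (auto simp: G_def K_def)
    show "AA \<subseteq> module.span (vscale (spc2 H)) (fst ` G)" "AA \<subseteq> module.span (vscale (spc2 H)) (fst ` K)"
      using span_prod_pure by (simp_all add: fstG)
    show "mult2 H z y = mult2 H w x" if "(x, y) \<in> G" "(z, w) \<in> K" for x y z w
      using that F_compat unfolding G_def K_def by auto
  qed (use that in blast)
  show ?thesis
  proof (rule that[OF F(1)])
    show "fst F (pure H a (b \<cdot> c)) = F_left a b c" for a b c by (rule F(2)) (simp add: G_def range_eqI[of _ _ "(a, b, c)"])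
    show "snd F (pure H (a \<cdot> b) c) = F_right a b c" for a b c by (rule F(3)) (simp add: K_def range_eqI[of _ _ "(a, b, c)"])
  qed
qed

text \<open>
  Multiplying the defining identities of \<open>F\<close> by elements of \<open>A \<otimes> A\<close> shows that they amount to the values
  \<open>F_left\<close> and \<open>F_right\<close>, and that the values \<open>F_left\<close> alone determine \<open>F\<close>.
\<close>

lemma canF: "canF H \<in> vcar (MAA H)" "fst (canF H) (pure H a (b \<cdot> c)) = F_left a b c"
  "snd (canF H) (pure H (a \<cdot> b) c) = F_right a b c"
proof -
  note A = is_vspaceA and M = is_vspace_MA
  obtain F where F: "F \<in> vcar (MAA H)" "\<And>a b c. fst F (pure H a (b \<cdot> c)) = F_left a b c"
    "\<And>a b c. snd F (pure H (a \<cdot> b) c) = F_right a b c" using F_exists by metis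
  define X where "X b c = embed H (MA H) (spc H) id (inj1 H)
      (tmap (spc H) (spc H) (MA H) (spc H) (capR_bar H) (idm (spc H)) (tw (spc H) (spc H) (T\<^sub>4 H (pure H c b))))" for b c
  define Y where "Y a b = embed H (spc H) (MA H) (inj1 H) id
      (tmap (spc H) (spc H) (spc H) (MA H) (idm (spc H)) (capR H) (T\<^sub>2 H (pure H a b)))" for a b
  have Xt: "tmap (spc H) (spc H) (MA H) (spc H) (capR_bar H) (idm (spc H)) (tw (spc H) (spc H) (T\<^sub>4 H (pure H c b)))
      \<in> vcar (MA H \<Otimes> spc H)" for b c
    unfolding t4_def[symmetric]
    by (rule linear_onD(1)[OF tmap_linear[OF M A capR_bar_linear idm_linear[OF A]] tw_in]) simp
  have Yt: "tmap (spc H) (spc H) (spc H) (MA H) (idm (spc H)) (capR H) (T\<^sub>2 H (pure H a b)) \<in> vcar (spc H \<Otimes> MA H)" for a b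
    unfolding t2_def[symmetric]
    by (rule linear_onD(1)[OF tmap_linear[OF A M idm_linear[OF A] capR_linear]]) simp
  have X_in: "X b c \<in> vcar (MAA H)" and Y_in: "Y b c \<in> vcar (MAA H)" for b c
    unfolding X_def Y_def by (rule embed_in[OF id_linear_MA inj1_linear Xt], rule embed_in[OF inj1_linear id_linear_MA Yt])
  have bb: "bilinear_on (MA H) (spc H) ground (\<lambda>r w. \<beta> (fst r p) (w \<cdot> q))"
    "bilinear_on (spc H) (MA H) ground (\<lambda>w r. \<beta> (w \<cdot> p) (fst r q))" if b: "bl \<beta>" for \<beta> p q
  proof -
    have l: "le (\<lambda>w. w \<cdot> q)" "linear_on (MA H) (spc H) (\<lambda>r. fst r p)" for p q
      by (intro lin) (simp add: linear_on_def MA_scale)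
    show "bilinear_on (MA H) (spc H) ground (\<lambda>r w. \<beta> (fst r p) (w \<cdot> q))"
      "bilinear_on (spc H) (MA H) ground (\<lambda>w r. \<beta> (w \<cdot> p) (fst r q))"
      by (rule bilinear_comp[OF l(2) l(1) b], rule bilinear_comp[OF l(1) l(2) b])
  qed
  have X_eval: "fst (X b c) (pure H p q) \<beta> = t4 c b (\<lambda>u v. \<beta> (fst (capR_bar H v) p) (u \<cdot> q))"
    if b: "bl \<beta>" for b c p q \<beta>
  proof -
    note [lin] = bl_left[OF b] bl_right[OF b]
    have b2: "bl (\<lambda>v u. \<beta> (fst (capR_bar H v) p) (u \<cdot> q))" by (intro lin)
    show ?thesis
      unfolding X_def
      using embed_eval[OF M A id_linear_MA inj1_linear Xt b, of c b p q]
        tmap_eval[OF A A M A capR_bar_linear idm_linear[OF A] tw_in[OF structure_in(6)] bb(1)[OF b], of c b p q]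
        tw_eval[OF A A structure_in(6) b2]
      by (simp add: t4_def[symmetric] idmA)
  qed
  have Y_eval: "fst (Y x y) (pure H p q) \<beta> = t2 x y (\<lambda>u v. \<beta> (u \<cdot> p) (fst (capR H v) q))"
    if b: "bl \<beta>" for x y p q \<beta>
    unfolding Y_def
    using embed_eval[OF A M inj1_linear id_linear_MA Yt b, of x y p q]
      tmap_eval[OF A A A M idm_linear[OF A] capR_linear structure_in(4) bb(2)[OF b], of x y p q]
    by (simp add: t2_def[symmetric] idmA)
  define P where "P F \<longleftrightarrow> F \<in> vcar (MAA H) \<and> (\<forall>a b c. F \<bullet> inj2 H (pure H a (b \<cdot> c)) = X b c \<bullet> lft H a \<and>
      inj2 H (pure H (a \<cdot> b) c) \<bullet> F = rgt H c \<bullet> Y a b)" for F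
  have val: "fst (X b c \<bullet> lft H a) (pure H p q) \<beta> = mult2 H (F_left a b c) (pure H p q) \<beta>"
    if b: "bl \<beta>" for a b c p q \<beta>
  proof -
    note [lin] = bl_left[OF b] bl_right[OF b]
    have "fst (capR_bar H v) (a \<cdot> p) = fst (capR_bar H v) a \<cdot> p" for v
      by (rule left_cancel) (simp add: capR_bar_multiplier flip: prod_assoc)
    moreover have "bl (\<lambda>u v. \<beta> (u \<cdot> p) (v \<cdot> q))" by (intro lin)
    ultimately show ?thesis
      by (simp add: mmult_def side_pure X_eval[OF b] mult2_pure_right b F_left_eval)
  qed
  have "P F"
    unfolding P_def
  proof (intro conjI allI F(1))
    fix a b c
    show "F \<bullet> inj2 H (pure H a (b \<cdot> c)) = X b c \<bullet> lft H a"
    proof (rule MAA_eqI[OF mmult_in[OF F(1) inj2_in[OF pure_in]] mmult_in[OF X_in lft_in]])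
      fix p q \<beta> assume b: "bl \<beta>"
      show "fst (F \<bullet> inj2 H (pure H a (b \<cdot> c))) (pure H p q) \<beta> = fst (X b c \<bullet> lft H a) (pure H p q) \<beta>"
        unfolding val[OF b] by (simp add: mmult_def inj2_eval MAA_module[OF F(1)] F(2))
    qed
    show "inj2 H (pure H (a \<cdot> b) c) \<bullet> F = rgt H c \<bullet> Y a b"
    proof (rule MAA_eqI[OF mmult_in[OF inj2_in[OF pure_in] F(1)] mmult_in[OF rgt_in Y_in]])
      fix p q \<beta> assume b: "bl \<beta>"
      note [lin] = bl_left[OF b] bl_right[OF b]
      have b1: "bl (\<lambda>u v. \<beta> u (c \<cdot> v))" "bl (\<lambda>u v. \<beta> (u \<cdot> p) (v \<cdot> q))" by (intro lin)+
      have "fst (inj2 H (pure H (a \<cdot> b) c) \<bullet> F) (pure H p q) \<beta> = mult2 H (F_right a b c) (pure H p q) \<beta>"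
        by (simp add: mmult_def inj2_eval F(1) MAA_multiplier[OF F(1)] F(3))
      also have "\<dots> = t2 a b (\<lambda>u v. \<beta> (u \<cdot> p) (c \<cdot> fst (capR H v) q))"
        by (simp add: mult2_pure_right b F_right_eval b1 capR_multiplier)
      also have "\<dots> = fst (rgt H c \<bullet> Y a b) (pure H p q) \<beta>"
        by (simp add: mmult_def side_eval(3)[OF _ b] Y_in Y_eval[OF b1(1)])
      finally show "fst (inj2 H (pure H (a \<cdot> b) c) \<bullet> F) (pure H p q) \<beta> = fst (rgt H c \<bullet> Y a b) (pure H p q) \<beta>" .
    qed
  qed
  moreover have "F' = F" if "P F'" for F'
  proof -
    have F': "F' \<in> vcar (MAA H)" using that by (simp add: P_def)
    have "fst F' (pure H a (b \<cdot> c)) = F_left a b c" for a b c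
    proof (rule mult2_cancel(2))
      fix p q
      have "fst (F' \<bullet> inj2 H (pure H a (b \<cdot> c))) (pure H p q) = fst (X b c \<bullet> lft H a) (pure H p q)"
        using that by (simp add: P_def)
      then have *: "mult2 H (fst F' (pure H a (b \<cdot> c))) (pure H p q) = fst (X b c \<bullet> lft H a) (pure H p q)"
        by (simp add: mmult_def inj2_eval MAA_module[OF F'])
      show "mult2 H (fst F' (pure H a (b \<cdot> c))) (pure H p q) = mult2 H (F_left a b c) (pure H p q)"
      proof (rule AA_eqI)
        fix \<phi> \<psi> assume l: "lf \<phi>" "lf \<psi>"
        show "mult2 H (fst F' (pure H a (b \<cdot> c))) (pure H p q) (\<lambda>u v. \<phi> u * \<psi> v) =
            mult2 H (F_left a b c) (pure H p q) (\<lambda>u v. \<phi> u * \<psi> v)"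
          unfolding * by (rule val[OF product_bilinear[OF l]])
      qed (use F' in simp_all)
    qed (use F' in simp_all)
    then have gen: "fst F' (pure H a (b \<cdot> c)) = fst F (pure H a (b \<cdot> c))" for a b c by (simp add: F(2))
    have eq: "fst F' (pure H a d) = fst F (pure H a d)" for a d
    proof (induction d rule: prod_induct)
      case (add x y)
      have p: "pure H a (x + y) = pure H a x + pure H a y"
        using linear_onD(2)[OF tens_linear(2)[OF A A], of a x y] by simp
      show ?case
        unfolding p linear_onD(2)[OF MAA_linear(1)[OF F'] pure_in pure_in]
          linear_onD(2)[OF MAA_linear(1)[OF F(1)] pure_in pure_in] add ..
    qed (rule gen)
    show ?thesis by (rule MAA_eqI[OF F' F(1)]) (simp add: eq)
  qed
  ultimately have "(THE F. P F) = F" by (rule the_equality)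
  then have "canF H = F" by (simp add: canF_def P_def X_def Y_def)
  then show "canF H \<in> vcar (MAA H)" "fst (canF H) (pure H a (b \<cdot> c)) = F_left a b c"
    "snd (canF H) (pure H (a \<cdot> b) c) = F_right a b c" using F by auto
qed

lemma aF_iff:
  assumes t: "t \<in> vcar (spc H \<Otimes> base H)"
  shows "embed H (spc H) (base H) (inj1 H) id t = lft H a \<bullet> canF H \<longleftrightarrow>
    (\<forall>\<beta> p q. bl \<beta> \<longrightarrow> t (\<lambda>u r. \<beta> (u \<cdot> p) (fst r q)) = fst (canF H) (pure H p q) (\<lambda>u v. \<beta> (a \<cdot> u) v))"
proof -
  note ev = embed_eval[OF is_vspaceA is_vspace_base inj1_linear id_linear_base t]
  have lev: "fst (lft H a \<bullet> canF H) (pure H p q) \<beta> = fst (canF H) (pure H p q) (\<lambda>u v. \<beta> (a \<cdot> u) v)"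
    if "bl \<beta>" for \<beta> p q
    using side_eval(1)[OF MAA_in(1)[OF canF(1) pure_in] that] by (simp add: mmult_def)
  show ?thesis
  proof
    assume "embed H (spc H) (base H) (inj1 H) id t = lft H a \<bullet> canF H"
    then show "\<forall>\<beta> p q. bl \<beta> \<longrightarrow> t (\<lambda>u r. \<beta> (u \<cdot> p) (fst r q)) = fst (canF H) (pure H p q) (\<lambda>u v. \<beta> (a \<cdot> u) v)"
      using ev lev by simp
  next
    assume "\<forall>\<beta> p q. bl \<beta> \<longrightarrow> t (\<lambda>u r. \<beta> (u \<cdot> p) (fst r q)) = fst (canF H) (pure H p q) (\<lambda>u v. \<beta> (a \<cdot> u) v)"
    then show "embed H (spc H) (base H) (inj1 H) id t = lft H a \<bullet> canF H"
      by (intro MAA_eqI[OF embed_in[OF inj1_linear id_linear_base t] mmult_in[OF lft_in canF(1)]])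
        (simp add: ev lev)
  qed
qed

lemma aF_eqI:
  assumes t: "t \<in> vcar (spc H \<Otimes> base H)"
    and eq: "\<And>\<beta> p q. bl \<beta> \<Longrightarrow> t (\<lambda>u r. \<beta> (u \<cdot> p) (fst r q)) = fst (canF H) (pure H p q) (\<lambda>u v. \<beta> (a \<cdot> u) v)"
  shows "aF H a = t"
  unfolding aF_def
proof (rule the_equality)
  have e: "embed H (spc H) (base H) (inj1 H) id t = lft H a \<bullet> canF H"
    using aF_iff[OF t] eq by simp
  then show "t \<in> vcar (spc H \<Otimes> base H) \<and> embed H (spc H) (base H) (inj1 H) id t = lft H a \<bullet> canF H"
    using t by simp
  fix t' assume "t' \<in> vcar (spc H \<Otimes> base H) \<and> embed H (spc H) (base H) (inj1 H) id t' = lft H a \<bullet> canF H"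
  then show "t' = t"
    by (intro embed_inject[OF is_vspaceA is_vspace_base inj1_linear id_linear_base inj1_inj inj_on_id _ t])
      (simp_all add: e)
qed

lemma F_form_linear:
  assumes b: "bl \<beta>"
  shows "lf (\<lambda>a. fst (canF H) (pure H p q) (\<lambda>u v. \<beta> (a \<cdot> u) v))"
proof -
  note [lin] = bl_left[OF b] bl_right[OF b]
  show ?thesis by (intro lin lf_eval[OF MAA_in(1)[OF canF(1) pure_in]])
qed

lemma aF_tensor_prod:
  fixes x y
  defines "t \<equiv> tmap (spc H) (spc H) (spc H) (base H) (\<lambda>u. u) (capR H) (t2 x y)"
  shows "t \<in> vcar (spc H \<Otimes> base H)"
    and "bl \<beta> \<Longrightarrow> t (\<lambda>u r. \<beta> (u \<cdot> p) (fst r q)) = fst (canF H) (pure H p q) (\<lambda>u v. \<beta> (x \<cdot> y \<cdot> u) v)"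
proof -
  note A = is_vspaceA and B = is_vspace_base
  show "t \<in> vcar (spc H \<Otimes> base H)"
    unfolding t_def by (rule linear_onD(1)[OF tmap_linear[OF A B le_id capR_linear_base]]) simp
  assume b: "bl \<beta>"
  have F_in: "fst (canF H) (pure H p q) \<in> AA" using canF(1) by simp
  have "bilinear_on (spc H) (base H) ground (\<lambda>u r. \<beta> (u \<cdot> p) (fst r q))"
    by (rule bilinear_comp[OF _ _ b]) (intro lin, simp add: linear_on_def MA_scale)
  then have "t (\<lambda>u r. \<beta> (u \<cdot> p) (fst r q)) = t2 x y (\<lambda>u v. \<beta> (u \<cdot> p) (fst (capR H v) q))"
    unfolding t_def by (rule tmap_eval[OF A A A B le_id capR_linear_base structure_in(4)])
  also have "\<dots> = fst (canF H) (pure H p q) (\<lambda>u v. \<beta> (x \<cdot> y \<cdot> u) v)"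
  proof (rule cancel(3)[where \<Phi> = "\<lambda>\<beta>. t2 x y (\<lambda>u v. \<beta> (u \<cdot> p) (fst (capR H v) q))"
        and \<Psi> = "\<lambda>\<beta>. fst (canF H) (pure H p q) (\<lambda>u v. \<beta> (x \<cdot> y \<cdot> u) v)", OF _ _ b])
    show "tensorial (\<lambda>\<beta>. t2 x y (\<lambda>u v. \<beta> (u \<cdot> p) (fst (capR H v) q)))"
      by (rule tensorial_map[OF tensorial_AA[OF structure_in(4)]]) (intro lin)+
    show "tensorial (\<lambda>\<beta>. fst (canF H) (pure H p q) (\<lambda>u v. \<beta> (x \<cdot> y \<cdot> u) v))"
      by (rule tensorial_map[OF tensorial_AA[OF F_in] le_prod_left[OF le_id] le_id])
    fix \<beta> z assume b: "bl \<beta>"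
    note [lin] = bl_left[OF b] bl_right[OF b]
    have b1: "bl (\<lambda>u v. \<beta> (u \<cdot> p) (v \<cdot> q))" by (intro lin)
    have "fst (canF H) (pure H p q) (\<lambda>u v. \<beta> (x \<cdot> y \<cdot> u) (z \<cdot> v)) =
        mult2 H (F_right x y z) (pure H p q) \<beta>"
      by (simp add: mult2_pure_left[OF F_in b, symmetric] MAA_multiplier[OF canF(1)] canF(3) flip: prod_assoc)
    also have "\<dots> = t2 x y (\<lambda>u v. \<beta> (u \<cdot> p) (z \<cdot> fst (capR H v) q))"
      by (simp add: mult2_pure_right b F_right_eval b1 capR_multiplier)
    finally show "t2 x y (\<lambda>u v. \<beta> (u \<cdot> p) (z \<cdot> fst (capR H v) q)) =
        fst (canF H) (pure H p q) (\<lambda>u v. \<beta> (x \<cdot> y \<cdot> u) (z \<cdot> v))" by simp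
  qed
  finally show "t (\<lambda>u r. \<beta> (u \<cdot> p) (fst r q)) = fst (canF H) (pure H p q) (\<lambda>u v. \<beta> (x \<cdot> y \<cdot> u) v)" .
qed

lemma aF_exists:
  "\<exists>t\<in>vcar (spc H \<Otimes> base H). \<forall>\<beta> p q. bl \<beta> \<longrightarrow>
    t (\<lambda>u r. \<beta> (u \<cdot> p) (fst r q)) = fst (canF H) (pure H p q) (\<lambda>u v. \<beta> (a \<cdot> u) v)"
proof (induction a rule: prod_induct)
  case (prod x y)
  show ?case by (rule bexI[OF _ aF_tensor_prod(1)[of x y]]) (use aF_tensor_prod(2) in blast)
next
  case (add x y)
  obtain t where t: "t \<in> vcar (spc H \<Otimes> base H)" "\<forall>\<beta> p q. bl \<beta> \<longrightarrow>
      t (\<lambda>u r. \<beta> (u \<cdot> p) (fst r q)) = fst (canF H) (pure H p q) (\<lambda>u v. \<beta> (x \<cdot> u) v)"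
    using add(1) by (elim bexE)
  obtain t' where t': "t' \<in> vcar (spc H \<Otimes> base H)" "\<forall>\<beta> p q. bl \<beta> \<longrightarrow>
      t' (\<lambda>u r. \<beta> (u \<cdot> p) (fst r q)) = fst (canF H) (pure H p q) (\<lambda>u v. \<beta> (y \<cdot> u) v)"
    using add(2) by (elim bexE)
  show ?case
    by (rule bexI[OF _ is_vspaceD(3)[OF is_vspace_tensor t(1) t'(1)]])
      (use t(2) t'(2) linear_onD(2)[OF F_form_linear] in simp)
qed

lemma aF: "aF H a \<in> vcar (spc H \<Otimes> base H)"
  "bl \<beta> \<Longrightarrow> aF H a (\<lambda>u r. \<beta> (u \<cdot> p) (fst r q)) = fst (canF H) (pure H p q) (\<lambda>u v. \<beta> (a \<cdot> u) v)"
proof -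
  obtain t where t: "t \<in> vcar (spc H \<Otimes> base H)" "\<forall>\<beta> p q. bl \<beta> \<longrightarrow>
      t (\<lambda>u r. \<beta> (u \<cdot> p) (fst r q)) = fst (canF H) (pure H p q) (\<lambda>u v. \<beta> (a \<cdot> u) v)"
    using aF_exists[of a] by (elim bexE)
  then have "aF H a = t" by (intro aF_eqI) auto
  then show "aF H a \<in> vcar (spc H \<Otimes> base H)"
    "bl \<beta> \<Longrightarrow> aF H a (\<lambda>u r. \<beta> (u \<cdot> p) (fst r q)) = fst (canF H) (pure H p q) (\<lambda>u v. \<beta> (a \<cdot> u) v)"
    using t by simp_all
qed

lemma aF_prod: "aF H (x \<cdot> y) = tmap (spc H) (spc H) (spc H) (base H) (\<lambda>u. u) (capR H) (t2 x y)"
  by (rule aF_eqI[OF aF_tensor_prod])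

lemma aF_linear: "linear_on (spc H) (spc H \<Otimes> base H) (aF H)"
proof -
  note T = is_vspaceD[OF is_vspace_tensor[of "spc H" "base H"], unfolded vscale_tensor]
  have "aF H (a + b) = aF H a + aF H b" for a b
    by (rule aF_eqI[OF T(3)[OF aF(1) aF(1)]])
      (use linear_onD(2)[OF F_form_linear] in \<open>simp add: aF(2)\<close>)
  moreover have "aF H (smult H c a) = tscale c (aF H a)" for c a
    by (rule aF_eqI[OF T(5)[OF aF(1)]])
      (use linear_onD(3)[OF F_form_linear] in \<open>simp add: aF(2) tscale_def\<close>)
  ultimately show ?thesis using aF(1) by (simp add: linear_on_def)
qed

lemma aF_eval:
  assumes "linear_on (base H) ground \<Phi>" "lf \<psi>"
  shows "aF H (x \<cdot> y) (\<lambda>u r. \<psi> u * \<Phi> r) = t2 x y (\<lambda>u v. \<psi> u * \<Phi> (capR H v))"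
  unfolding aF_prod
  by (rule tmap_eval[OF is_vspaceA is_vspaceA is_vspaceA is_vspace_base le_id capR_linear_base structure_in(4)
        product_bilinear[OF assms(2,1)]])

lemma aF_functional:
  assumes "linear_on (base H) ground \<Phi>" "lf \<psi>"
  shows "lf (\<lambda>a. aF H a (\<lambda>u r. \<psi> u * \<Phi> r))"
  by (rule linear_on_comp[OF aF_linear eval_linear])

definition base_slice :: "('a \<Rightarrow> 'k) \<Rightarrow> 'a \<Rightarrow> 'a multiplier" where
  "base_slice \<psi> a = slice_left (spc H) (base H) \<psi> (aF H a)"

text \<open>
  Both sides of the second equation are linear in \<open>a\<close>, and for \<open>a = xy\<close> they are
  \<open>\<psi>(x y\<^sub>1) \<epsilon>(N(y\<^sub>2) c) = \<psi>(xy N'(c))\<close>.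
\<close>

lemma base_slice:
  assumes \<psi>: "lf \<psi>"
  shows "base_slice \<psi> a \<in> range (capR H)"
    "\<epsilon> (fst (base_slice \<psi> a) c) = \<psi> (snd (capR_bar H c) a)"
proof -
  note s = slice_left[OF is_vspaceA is_vspace_base \<psi> aF(1)]
  show "base_slice \<psi> a \<in> range (capR H)" unfolding base_slice_def using s(1) by simp
  note L = base_linear[OF fst_linear[OF lf_eps[OF le_id]]]
  have "\<epsilon> (fst (base_slice \<psi> a) c) = aF H a (\<lambda>u r. \<psi> u * \<epsilon> (fst r c))"
    unfolding base_slice_def by (rule s(2)[OF L])
  also have "\<dots> = \<psi> (snd (capR_bar H c) a)"
  proof (rule lf_eq_on_products[OF aF_functional[OF L \<psi>]])
    show "lf (\<lambda>a. \<psi> (snd (capR_bar H c) a))" by (intro lin lf_comp[OF \<psi>])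
    show "aF H (x \<cdot> y) (\<lambda>u r. \<psi> u * \<epsilon> (fst r c)) = \<psi> (snd (capR_bar H c) (x \<cdot> y))" for x y
      using aF_eval[OF L \<psi>] coproduct_eps[OF \<psi>] by simp
  qed
  finally show "\<epsilon> (fst (base_slice \<psi> a) c) = \<psi> (snd (capR_bar H c) a)" .
qed

end

context right_full_wmb
begin

lemma base_counit_slice:
  assumes \<psi>: "lf \<psi>"
  shows "base_counit H (base_slice \<psi> a) = \<psi> a"
proof -
  have "base_counit H (base_slice \<psi> a) = aF H a (\<lambda>u r. \<psi> u * base_counit H r)"
    unfolding base_slice_def
    by (rule slice_left(2)[OF is_vspaceA is_vspace_base \<psi> aF(1) base_counit_linear])
  also have "\<dots> = \<psi> a"
    by (rule lf_eq_on_products[OF aF_functional[OF base_counit_linear \<psi>] \<psi>])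
      (simp add: aF_eval[OF base_counit_linear \<psi>] base_counit_capR counit_t2[OF \<psi>])
  finally show ?thesis .
qed

section \<open>The coaction on the base algebra\<close>

lemma base_tensor_eqI:
  assumes t: "t \<in> vcar (base H \<Otimes> spc H)" "t' \<in> vcar (base H \<Otimes> spc H)"
    and eq: "\<And>\<beta> p. bl \<beta> \<Longrightarrow> t (\<lambda>r u. \<beta> (fst r p) u) = t' (\<lambda>r u. \<beta> (fst r p) u)"
  shows "t = t'"
proof (rule tensor_eqI[OF is_vspace_base is_vspaceA t])
  fix \<phi> \<psi> assume \<phi>: "linear_on (base H) ground \<phi>" and \<psi>: "lf \<psi>"
  note s = slice_right[OF is_vspace_base is_vspaceA \<psi> t(1)] slice_right[OF is_vspace_base is_vspaceA \<psi> t(2)]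
  have "slice_right (base H) (spc H) \<psi> t = slice_right (base H) (spc H) \<psi> t'"
  proof (rule MA_eqI)
    fix \<phi> p assume p: "lf \<phi>"
    show "\<phi> (fst (slice_right (base H) (spc H) \<psi> t) p) = \<phi> (fst (slice_right (base H) (spc H) \<psi> t') p)"
      using s(2,4)[OF base_linear[OF fst_linear[OF p]]] eq[OF product_bilinear[OF p \<psi>]] by simp
  qed (use s base_in_MA in auto)
  then show "t (\<lambda>v w. \<phi> v * \<psi> w) = t' (\<lambda>v w. \<phi> v * \<psi> w)"
    using s(2,4)[OF \<phi>] by simp
qed

lemma capR_bar_linear_base: "linear_on (spc H) (base H) (capR_bar H)"
  using capR_bar_linear capR_bar_subset by (auto simp: linear_on_def)

lemma base_form: "bl \<beta> \<Longrightarrow> bilinear_on (base H) (spc H) ground (\<lambda>r u. \<beta> (fst r p) u)"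
  by (rule bilinear_comp[OF _ le_id]) (simp_all add: linear_on_def MA_scale)

lemma E_in_MAA: "(E\<^sub>1 H, E\<^sub>2 H) \<in> vcar (MAA H)"
proof -
  have "mult2 H s (E\<^sub>1 H t) = mult2 H (E\<^sub>2 H s) t" if s: "s \<in> AA" and t: "t \<in> AA" for s t
  proof -
    note B = mult2_bilinear2
    have "mult2 H s (E\<^sub>1 H (pure H c d)) = mult2 H (E\<^sub>2 H s) (pure H c d)" for c d
      by (rule linear_eq_on_tensors[OF is_vspaceA bilinear_onD(1)[OF B]
            linear_on_comp[OF structure_linear(2) bilinear_onD(1)[OF B]] _ s])
        (simp_all add: ax_i linear_onD(1)[OF structure_linear(1)])
    then show ?thesis
      by (intro linear_eq_on_tensors[OF is_vspaceA linear_on_comp[OF structure_linear(1) bilinear_onD(2)[OF B]]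
            bilinear_onD(2)[OF B] _ t])
        (simp_all add: s linear_onD(1)[OF structure_linear(2)])
  qed
  then show ?thesis using linear by (simp add: MAA_iff)
qed

text \<open>
  The element \<open>E(1 \<otimes> d)\<close> of \<open>R \<otimes> A\<close>; the coaction \<open>\<lambda>\<^sub>R\<close> sends \<open>r \<otimes> a\<close> to \<open>coact (ra)\<close>.
\<close>

definition coact :: "'a \<Rightarrow> ('k, 'a multiplier, 'a) tensor" where
  "coact d = in_base_A H ((E\<^sub>1 H, E\<^sub>2 H) \<bullet> rgt H d)"

lemma E_tensor_exists: "\<exists>t\<in>vcar (base H \<Otimes> spc H). \<forall>\<beta> p. bl \<beta> \<longrightarrow> t (\<lambda>r u. \<beta> (fst r p) u) = e1 p d \<beta>"
proof (induction d rule: prod_induct)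
  case (prod b c)
  let ?t = "tmap (spc H) (spc H) (base H) (spc H) (capR_bar H) (\<lambda>u. u) (t1 b c)"
  show ?case
  proof (intro bexI[of _ ?t] allI impI)
    show "?t \<in> vcar (base H \<Otimes> spc H)"
      by (rule linear_onD(1)[OF tmap_linear[OF is_vspace_base is_vspaceA capR_bar_linear_base le_id]]) simp
    fix \<beta> p assume b: "bl \<beta>"
    show "?t (\<lambda>r u. \<beta> (fst r p) u) = e1 p (b \<cdot> c) \<beta>"
      using tmap_eval[OF is_vspaceA is_vspaceA is_vspace_base is_vspaceA capR_bar_linear_base le_id
          structure_in(3) base_form[OF b]] E_capR_bar[OF b] by simp
  qed
next
  case (add x y)
  obtain t where t: "t \<in> vcar (base H \<Otimes> spc H)" "\<forall>\<beta> p. bl \<beta> \<longrightarrow> t (\<lambda>r u. \<beta> (fst r p) u) = e1 p x \<beta>"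
    using add(1) by (elim bexE)
  obtain t' where t': "t' \<in> vcar (base H \<Otimes> spc H)" "\<forall>\<beta> p. bl \<beta> \<longrightarrow> t' (\<lambda>r u. \<beta> (fst r p) u) = e1 p y \<beta>"
    using add(2) by (elim bexE)
  have "e1 p (x + y) \<beta> = e1 p x \<beta> + e1 p y \<beta>" for p \<beta>
  proof -
    have "lf (\<lambda>d. e1 p d \<beta>)" by (intro lin)
    then show ?thesis using linear_onD(2) by fastforce
  qed
  then have "\<forall>\<beta> p. bl \<beta> \<longrightarrow> (t + t') (\<lambda>r u. \<beta> (fst r p) u) = e1 p (x + y) \<beta>"
    using t(2) t'(2) by simp
  then show ?case by (rule bexI[OF _ is_vspaceD(3)[OF is_vspace_tensor t(1) t'(1)]])
qed

lemma coact: "coact d \<in> vcar (base H \<Otimes> spc H)" "bl \<beta> \<Longrightarrow> coact d (\<lambda>r u. \<beta> (fst r p) u) = e1 p d \<beta>"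
proof -
  obtain t where t: "t \<in> vcar (base H \<Otimes> spc H)" "\<forall>\<beta> p. bl \<beta> \<longrightarrow> t (\<lambda>r u. \<beta> (fst r p) u) = e1 p d \<beta>"
    using E_tensor_exists[of d] by (elim bexE)
  note A = is_vspaceA and B = is_vspace_base
  note e_in = embed_in[OF id_linear_base inj1_linear]
  have emb: "embed H (base H) (spc H) id (inj1 H) t = (E\<^sub>1 H, E\<^sub>2 H) \<bullet> rgt H d"
  proof (rule MAA_eqI[OF e_in[OF t(1)] mmult_in[OF E_in_MAA rgt_in]])
    fix p q \<beta> assume b: "bl \<beta>"
    note [lin] = bl_left[OF b] bl_right[OF b]
    have b1: "bl (\<lambda>u v. \<beta> u (v \<cdot> q))" by (intro lin)
    show "fst (embed H (base H) (spc H) id (inj1 H) t) (pure H p q) \<beta> =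
        fst ((E\<^sub>1 H, E\<^sub>2 H) \<bullet> rgt H d) (pure H p q) \<beta>"
      using embed_eval[OF B A id_linear_base inj1_linear t(1) b, of p q] t(2)[rule_format, OF b1, of p]
        e1_right[OF b, of p d q]
      by (simp add: mmult_def side_pure e1_def)
  qed
  have inj: "inj_on id (vcar (base H))" by simp
  have "coact d = t" unfolding coact_def in_base_A_def
  proof (rule the_equality)
    show "t \<in> vcar (base H \<Otimes> spc H) \<and> embed H (base H) (spc H) id (inj1 H) t = (E\<^sub>1 H, E\<^sub>2 H) \<bullet> rgt H d"
      using t emb by simp
    fix t' assume "t' \<in> vcar (base H \<Otimes> spc H) \<and> embed H (base H) (spc H) id (inj1 H) t' = (E\<^sub>1 H, E\<^sub>2 H) \<bullet> rgt H d"
    then show "t' = t"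
      by (intro embed_inject[OF B A id_linear_base inj1_linear inj inj1_inj _ t(1)]) (simp_all add: emb)
  qed
  then show "coact d \<in> vcar (base H \<Otimes> spc H)" "bl \<beta> \<Longrightarrow> coact d (\<lambda>r u. \<beta> (fst r p) u) = e1 p d \<beta>"
    using t by simp_all
qed

lemma coact_linear: "linear_on (spc H) (base H \<Otimes> spc H) coact"
proof -
  note T = is_vspaceD[OF is_vspace_tensor[of "base H" "spc H"], unfolded vscale_tensor]
  have l: "lf (\<lambda>d. e1 p d \<beta>)" for p \<beta> by (intro lin)
  have "coact (x + y) = coact x + coact y" for x y
    by (rule base_tensor_eqI) (use linear_onD(2)[OF l] in \<open>simp_all add: coact T\<close>)
  moreover have "coact (smult H c x) = tscale c (coact x)" for c x
    by (rule base_tensor_eqI) (use linear_onD(3)[OF l] in \<open>simp_all add: coact T tscale_def[of c "coact x"] T(5)[OF coact(1), unfolded tscale_def]\<close>)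
  ultimately show ?thesis by (simp add: linear_on_def coact)
qed

text \<open>
  Multiply by \<open>1 \<otimes> x\<close> from the left: \<open>(1 \<otimes> x)E(1 \<otimes> d) = N(x\<^sub>1) \<otimes> x\<^sub>2 d\<close> is mapped by \<open>\<epsilon>\<^sub>R\<close> to
  \<open>\<epsilon>(x\<^sub>1) x\<^sub>2 d = xd\<close>, and \<open>x\<close> can be cancelled.
\<close>

lemma coact_counit:
  assumes l: "lf \<phi>"
  shows "coact d (\<lambda>r u. base_counit H r * \<phi> u) = \<phi> d"
proof -
  note A = is_vspaceA and B = is_vspace_base
  define w where "w = slice_left (base H) (spc H) (base_counit H) (coact d)"
  have w: "\<phi> w = coact d (\<lambda>r u. base_counit H r * \<phi> u)" if "lf \<phi>" for \<phi>
    unfolding w_def by (rule slice_left(2)[OF B A base_counit_linear coact(1) that])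
  have "w = d"
  proof (rule left_cancel)
    fix \<phi> x assume l: "lf \<phi>"
    note [lin] = lf_comp[OF l]
    have lx: "lf (\<lambda>u. \<phi> (x \<cdot> u))" by (intro lin)
    define \<rho> where "\<rho> = slice_right (base H) (spc H) (\<lambda>u. \<phi> (x \<cdot> u)) (coact d)"
    note s = slice_right[OF B A lx coact(1)[of d], folded \<rho>_def]
    have "\<rho> = capR H (SR \<phi> (t1 x d))"
    proof (rule MA_eqI[OF base_in_MA capR_in])
      have "fst \<rho> c = fst (capR H (SR \<phi> (t1 x d))) c" for c
      proof (rule left_cancel)
        fix \<chi> z assume l': "lf \<chi>"
        have lz: "lf (\<lambda>u. \<chi> (z \<cdot> u))" by (intro lin lf_comp[OF l'])
        show "\<chi> (z \<cdot> fst \<rho> c) = \<chi> (z \<cdot> fst (capR H (SR \<phi> (t1 x d))) c)"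
          using s(2)[OF base_linear[OF fst_linear[OF lz]]] coact(2)[OF product_bilinear[OF lz lx], where d = d and p = c]
            capR_slice[OF l' l, of z x d c] by simp
      qed
      then show "\<chi> (fst \<rho> c) = \<chi> (fst (capR H (SR \<phi> (t1 x d))) c)" for \<chi> c by simp
      show "\<rho> \<in> range (capR H)" using s(1) by simp
    qed
    then have "base_counit H \<rho> = \<phi> (x \<cdot> d)"
      using SR_eval[OF l structure_in(3) lf_eps[OF le_id], of x d] counit_t1[OF l, of x d]
      by (simp add: base_counit_capR)
    then show "\<phi> (x \<cdot> w) = \<phi> (x \<cdot> d)"
      using w[OF lx] s(2)[OF base_counit_linear] by simp
  qed
  then show ?thesis using w[OF l] by simp
qed

section \<open>Comodule homomorphisms and integrals\<close>

text \<open>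
  The homomorphism condition is the equality \<open>E(1 \<otimes> \<Psi>(a)b) = \<Psi>(a\<^sub>1) \<otimes> a\<^sub>2 b\<close> in \<open>R \<otimes> A\<close>.
\<close>

lemma hom_iff:
  "\<Psi> \<in> comodule_homs H (regular_comod H) (base_comod H) \<longleftrightarrow> linear_on (spc H) (base H) \<Psi> \<and>
    (\<forall>a b. coact (fst (\<Psi> a) b) = tmap (spc H) (spc H) (base H) (spc H) \<Psi> (\<lambda>u. u) (t1 a b))"
proof (cases "linear_on (spc H) (base H) \<Psi>")
  case False
  then show ?thesis by (auto simp: comodule_homs_def regular_comod_def base_comod_def dest: LinD(1))
next
  case True
  note A = is_vspaceA and B = is_vspace_base and TV = is_vspace_tensor
  let ?m = "tmap (spc H) (spc H) (base H) (spc H) \<Psi> (\<lambda>u. u)"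
  let ?l = "tlift (base H) (spc H) (base H \<Otimes> spc H) (\<lambda>r a. coact (fst r a))"
  have bil: "bilinear_on (base H) (spc H) (base H \<Otimes> spc H) (\<lambda>r a. coact (fst r a))"
    unfolding bilinear_on_def
  proof (intro conjI ballI)
    fix a show "linear_on (base H) (base H \<Otimes> spc H) (\<lambda>r. coact (fst r a))"
      by (rule linear_on_comp[OF _ coact_linear]) (simp add: linear_on_def MA_scale)
  next
    fix r assume "r \<in> vcar (base H)"
    then show "linear_on (spc H) (base H \<Otimes> spc H) (\<lambda>a. coact (fst r a))"
      using linear_on_comp[OF MA_le(1) coact_linear] base_in_MA by auto
  qed
  have mL: "?m \<in> Lin (spc2 H) (base H \<Otimes> spc H)" by (rule tmap_Lin[OF B A True le_id])
  have lL: "?l \<in> Lin (base H \<Otimes> spc H) (base H \<Otimes> spc H)" by (rule tlift_Lin[OF TV bil])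
  note m = LinD(1)[OF mL] and l = LinD(1)[OF lL]
  have P: "\<Psi> a \<in> vcar (base H)" for a using linear_onD(1)[OF True] by simp
  have "\<Psi> \<in> Lin (spc H) (base H)" using True by (simp add: Lin_def)
  then have "\<Psi> \<in> comodule_homs H (regular_comod H) (base_comod H) \<longleftrightarrow> ?l \<circ> ?m = ?m \<circ> T\<^sub>1 H"
    by (simp add: comodule_homs_def regular_comod_def base_comod_def idmA coact_def)
  also have "\<dots> \<longleftrightarrow> (\<forall>a b. coact (fst (\<Psi> a) b) = ?m (t1 a b))"
  proof
    assume eq: "?l \<circ> ?m = ?m \<circ> T\<^sub>1 H"
    show "\<forall>a b. coact (fst (\<Psi> a) b) = ?m (t1 a b)"
    proof (intro allI)
      fix a b
      have "?l (?m (pure H a b)) = ?m (t1 a b)" using fun_cong[OF eq, of "pure H a b"] by (simp add: t1_def)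
      then show "coact (fst (\<Psi> a) b) = ?m (t1 a b)"
        using tmap_tens[OF B A True le_id, of a b] tlift_tens[OF TV bil P, of b a] by simp
    qed
  next
    assume eq: "\<forall>a b. coact (fst (\<Psi> a) b) = ?m (t1 a b)"
    show "?l \<circ> ?m = ?m \<circ> T\<^sub>1 H"
    proof
      fix t
      show "(?l \<circ> ?m) t = (?m \<circ> T\<^sub>1 H) t"
      proof (cases "t \<in> AA")
        case t: True
        have "?l (?m t) = ?m (T\<^sub>1 H t)"
        proof (rule linear_eq_on_tensors[OF A linear_on_comp[OF m l] linear_on_comp[OF structure_linear(3) m] _ t])
          fix a b
          show "?l (?m (pure H a b)) = ?m (T\<^sub>1 H (pure H a b))"
            using tmap_tens[OF B A True le_id, of a b] tlift_tens[OF TV bil P, of b a] eq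
            by (simp add: t1_def)
        qed
        then show ?thesis by simp
      next
        case t: False
        then show ?thesis
          using LinD(2)[OF mL t] LinD(2)[OF linear(3) t] linear_on_zero[OF TV l] linear_on_zero[OF TV m]
          by simp
      qed
    qed
  qed
  finally show ?thesis using True by simp
qed

lemma hom_iff_eval:
  "\<Psi> \<in> comodule_homs H (regular_comod H) (base_comod H) \<longleftrightarrow> linear_on (spc H) (base H) \<Psi> \<and>
    (\<forall>a b c \<beta>. bl \<beta> \<longrightarrow> e1 c (fst (\<Psi> a) b) \<beta> = t1 a b (\<lambda>x y. \<beta> (fst (\<Psi> x) c) y))"
proof (cases "linear_on (spc H) (base H) \<Psi>")
  case True
  note A = is_vspaceA and B = is_vspace_base
  let ?m = "tmap (spc H) (spc H) (base H) (spc H) \<Psi> (\<lambda>u. u)"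
  have m_in: "?m (t1 a b) \<in> vcar (base H \<Otimes> spc H)" for a b
    by (rule linear_onD(1)[OF tmap_linear[OF B A True le_id]]) simp
  have ev: "?m (t1 a b) (\<lambda>r u. \<beta> (fst r c) u) = t1 a b (\<lambda>x y. \<beta> (fst (\<Psi> x) c) y)" if "bl \<beta>" for a b c \<beta>
    by (rule tmap_eval[OF A A B A True le_id structure_in(3) base_form[OF that]])
  have "coact (fst (\<Psi> a) b) = ?m (t1 a b) \<longleftrightarrow>
      (\<forall>c \<beta>. bl \<beta> \<longrightarrow> e1 c (fst (\<Psi> a) b) \<beta> = t1 a b (\<lambda>x y. \<beta> (fst (\<Psi> x) c) y))" for a b
  proof
    assume eq: "coact (fst (\<Psi> a) b) = ?m (t1 a b)"
    show "\<forall>c \<beta>. bl \<beta> \<longrightarrow> e1 c (fst (\<Psi> a) b) \<beta> = t1 a b (\<lambda>x y. \<beta> (fst (\<Psi> x) c) y)"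
    proof (intro allI impI)
      fix c \<beta> assume b: "bl \<beta>"
      show "e1 c (fst (\<Psi> a) b) \<beta> = t1 a b (\<lambda>x y. \<beta> (fst (\<Psi> x) c) y)"
        using ev[OF b, of a b c] coact(2)[OF b, of "fst (\<Psi> a) b" c] unfolding eq by simp
    qed
  next
    assume eq: "\<forall>c \<beta>. bl \<beta> \<longrightarrow> e1 c (fst (\<Psi> a) b) \<beta> = t1 a b (\<lambda>x y. \<beta> (fst (\<Psi> x) c) y)"
    show "coact (fst (\<Psi> a) b) = ?m (t1 a b)"
      by (rule base_tensor_eqI[OF coact(1) m_in]) (simp add: coact(2) ev eq)
  qed
  then show ?thesis using hom_iff by blast
qed (use hom_iff in blast)

text \<open>
  If \<open>r\<close> has the same left action as \<open>a \<leftharpoonup> \<psi>\<close>, then the multiplier identities of both force equality of the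
  right actions.
\<close>

lemma integral_iff:
  "\<psi> \<in> right_integrals H \<longleftrightarrow> lf \<psi> \<and> (\<forall>a. \<exists>r\<in>range (capR H). \<forall>b. fst r b = SL \<psi> (t1 a b))"
proof (cases "lf \<psi>")
  case True
  have h: "harpoon H a \<psi> = (\<lambda>b. SL \<psi> (t1 a b), \<lambda>b. SL \<psi> (t3 a b))" for a
    by (simp add: harpoon_def t1_def t3_def)
  have "harpoon H a \<psi> = r" if r: "r \<in> range (capR H)" "\<And>b. fst r b = SL \<psi> (t1 a b)" for a r
  proof -
    have "SL \<psi> (t3 a b) = snd r b" for b
    proof (rule right_cancel)
      fix \<phi> c assume l: "lf \<phi>"
      note [lin] = lf_comp[OF l] lf_comp[OF True]
      have lf: "lf (\<lambda>v. \<phi> (v \<cdot> c))" "lf (\<lambda>v. \<phi> (b \<cdot> v))" by (intro lin)+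
      have "\<phi> (SL \<psi> (t3 a b) \<cdot> c) = t3 a b (\<lambda>u v. \<psi> u * \<phi> (v \<cdot> c))"
        by (rule SL_eval[OF True structure_in(5) lf(1)])
      also have "\<dots> = t1 a c (\<lambda>u v. \<psi> u * \<phi> (b \<cdot> v))"
        by (rule t1_t3[symmetric]) (intro lin)
      also have "\<dots> = \<phi> (b \<cdot> fst r c)"
        unfolding r(2) by (rule SL_eval[OF True structure_in(3) lf(2), symmetric])
      finally show "\<phi> (SL \<psi> (t3 a b) \<cdot> c) = \<phi> (snd r b \<cdot> c)"
        using MA_multiplier[OF base_in_MA[OF r(1)]] by simp
    qed
    then show ?thesis by (simp add: h prod_eq_iff fun_eq_iff r(2))
  qed
  then have "harpoon H a \<psi> \<in> range (capR H) \<longleftrightarrow> (\<exists>r\<in>range (capR H). \<forall>b. fst r b = SL \<psi> (t1 a b))" for a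
    by (metis h fst_conv)
  then show ?thesis using True by (simp add: right_integrals_def Lin_def)
qed (auto simp: right_integrals_def dest: LinD)

text \<open>
  Apply \<open>\<epsilon>\<^sub>R\<close> to the left leg of \<open>E(1 \<otimes> \<Psi>(a)b) = \<Psi>(a\<^sub>1) \<otimes> a\<^sub>2 b\<close>.
\<close>

lemma hom_integral:
  assumes "\<Psi> \<in> comodule_homs H (regular_comod H) (base_comod H)"
  shows "fst (\<Psi> a) b = SL (base_counit H \<circ> \<Psi>) (t1 a b)" "base_counit H \<circ> \<Psi> \<in> right_integrals H"
proof -
  have P: "linear_on (spc H) (base H) \<Psi>"
    and eq: "\<And>a b. coact (fst (\<Psi> a) b) = tmap (spc H) (spc H) (base H) (spc H) \<Psi> (\<lambda>u. u) (t1 a b)"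
    using assms by (simp_all add: hom_iff)
  have l: "lf (base_counit H \<circ> \<Psi>)" using linear_on_comp[OF P base_counit_linear] by (simp add: o_def)
  show *: "fst (\<Psi> a) b = SL (base_counit H \<circ> \<Psi>) (t1 a b)" for a b
  proof (rule A_eqI)
    fix \<phi> assume p: "lf \<phi>"
    have "\<phi> (fst (\<Psi> a) b) = coact (fst (\<Psi> a) b) (\<lambda>r u. base_counit H r * \<phi> u)"
      by (rule coact_counit[OF p, symmetric])
    also have "\<dots> = t1 a b (\<lambda>u v. base_counit H (\<Psi> u) * \<phi> v)"
      unfolding eq
      by (rule tmap_eval[OF is_vspaceA is_vspaceA is_vspace_base is_vspaceA P le_id structure_in(3)
            product_bilinear[OF base_counit_linear p]])
    finally show "\<phi> (fst (\<Psi> a) b) = \<phi> (SL (base_counit H \<circ> \<Psi>) (t1 a b))"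
      using SL_eval[OF l structure_in(3) p] by simp
  qed
  show "base_counit H \<circ> \<Psi> \<in> right_integrals H"
    unfolding integral_iff
  proof (intro conjI allI l)
    fix a
    show "\<exists>r\<in>range (capR H). \<forall>b. fst r b = SL (base_counit H \<circ> \<Psi>) (t1 a b)"
      by (rule bexI[of _ "\<Psi> a"]) (use * linear_onD(1)[OF P, of a] in simp_all)
  qed
qed

text \<open>
  Both elements of \<open>R\<close> are mapped to \<open>\<psi>(a N'(c))\<close> by the functional \<open>\<epsilon>(- c)\<close>.
\<close>

lemma base_slice_eqI:
  assumes l: "lf \<psi>" and r: "r \<in> range (capR H)" "\<And>b. fst r b = SL \<psi> (t1 a b)"
  shows "base_slice \<psi> a = r"
proof (rule base_eqI[OF base_slice(1)[OF l] r(1)])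
  fix c
  have "\<epsilon> (fst r c) = t1 a c (\<lambda>u v. \<psi> u * \<epsilon> v)"
    unfolding r(2) by (rule SL_eval[OF l structure_in(3) lf_eps[OF le_id]])
  then show "\<epsilon> (fst (base_slice \<psi> a) c) = \<epsilon> (fst r c)"
    using capR_eval(4)[OF l] base_slice(2)[OF l] by simp
qed

lemma base_slice_linear: "lf \<psi> \<Longrightarrow> linear_on (spc H) (base H) (base_slice \<psi>)"
  unfolding base_slice_def slice_left_def
  by (rule linear_on_comp[OF aF_linear tlift_linear[OF is_vspace_base slice_left_bilinear[OF is_vspace_base]]])

lemma integral_hom:
  assumes "\<psi> \<in> right_integrals H"
  shows "base_slice \<psi> \<in> comodule_homs H (regular_comod H) (base_comod H)"
proof -
  have l: "lf \<psi>" and int: "\<And>a. \<exists>r\<in>range (capR H). \<forall>b. fst r b = SL \<psi> (t1 a b)"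
    using assms by (simp_all add: integral_iff)
  have eq: "fst (base_slice \<psi> a) b = SL \<psi> (t1 a b)" for a b
    using int[of a] base_slice_eqI[OF l] by metis
  have "e1 c (fst (base_slice \<psi> a) b) \<beta> = t1 a b (\<lambda>x y. \<beta> (fst (base_slice \<psi> x) c) y)" if b: "bl \<beta>" for a b c \<beta>
  proof -
    note [lin] = bl_left[OF b] bl_right[OF b] lf_comp[OF l]
    have "\<beta> (SL \<psi> (t1 x c)) y = t1 x c (\<lambda>u v. \<psi> u * \<beta> v y)" for x y
      by (rule SL_eval[OF l structure_in(3), of "\<lambda>v. \<beta> v y"]) (intro lin)
    then show ?thesis
      using integral_coproduct[OF base_slice(1)[OF l] l b eq, of c a b] by (simp add: eq)
  qed
  then show ?thesis using base_slice_linear[OF l] by (simp add: hom_iff_eval)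
qed

lemma is_vspace_hom_space: "is_vspace (hom_space H)"
proof (rule is_vspaceI)
  interpret M: vector_space "vscale (MA H)" by (rule is_vspaceD[OF is_vspace_MA])
  note B = is_vspaceD[OF is_vspace_base, unfolded base_simps]
  show "vector_space (vscale (hom_space H))"
    by unfold_locales (auto simp: hom_space_def fun_eq_iff M.scale_right_distrib M.scale_left_distrib)
  have add: "\<beta> (a + b) c = \<beta> a c + \<beta> b c" "\<beta> (smult H k a) c = k * \<beta> a c" "\<beta> 0 c = 0"
    "bl \<beta> \<Longrightarrow> \<beta> c (a + b) = \<beta> c a + \<beta> c b" if "bl \<beta>" for \<beta> a b c k
    using that linear_on_zero[OF is_vspaceA, of ground "\<lambda>a. \<beta> a c"] by (simp_all add: bilinear_on_def linear_on_def)
  have e1: "e1 c (a + b) \<beta> = e1 c a \<beta> + e1 c b \<beta>" "e1 c (smult H k a) \<beta> = k * e1 c a \<beta>" "e1 c 0 \<beta> = 0" for c a b k \<beta>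
  proof -
    have "lf (\<lambda>d. e1 c d \<beta>)" by (intro lin)
    then show "e1 c (a + b) \<beta> = e1 c a \<beta> + e1 c b \<beta>" "e1 c (smult H k a) \<beta> = k * e1 c a \<beta>" "e1 c 0 \<beta> = 0"
      using linear_on_zero[OF is_vspaceA, of ground "\<lambda>d. e1 c d \<beta>"] by (simp_all add: linear_on_def)
  qed
  have bl: "bl (\<lambda>x y. \<beta> (fst (\<Psi> x) c) y)" if "bl \<beta>" "linear_on (spc H) (base H) \<Psi>" for \<beta> \<Psi> c
    by (rule bilinear_comp[OF that(2) le_id base_form[OF that(1)]])
  show "0 \<in> vcar (hom_space H)"
  proof -
    have "linear_on (spc H) (base H) 0" using B(2) by (simp add: linear_on_def)
    moreover have "t1 a b (\<lambda>x y. 0) = 0" for a b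
      using eval_times(1)[OF structure_in(3), of "\<lambda>_ _. 0" a b 0] by (simp add: lin)
    ultimately show ?thesis by (simp add: hom_space_def hom_iff_eval e1 add)
  qed
  fix \<Psi> \<Theta> assume P: "\<Psi> \<in> vcar (hom_space H)" and Q: "\<Theta> \<in> vcar (hom_space H)"
  have PQ: "linear_on (spc H) (base H) \<Psi>" "linear_on (spc H) (base H) \<Theta>"
    using P Q by (simp_all add: hom_space_def hom_iff)
  have "linear_on (spc H) (base H) (\<Psi> + \<Theta>)"
    using PQ B(3) unfolding linear_on_def by (simp add: M.scale_right_distrib algebra_simps)
  moreover have "e1 c (fst ((\<Psi> + \<Theta>) a) b) \<beta> = t1 a b (\<lambda>x y. \<beta> (fst ((\<Psi> + \<Theta>) x) c) y)" if b: "bl \<beta>" for a b c \<beta>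
    using P Q b eval_add[OF is_vspaceA structure_in(3) bl[OF b PQ(1)] bl[OF b PQ(2)], of a b c c]
    by (simp add: hom_space_def hom_iff_eval e1 add)
  ultimately show "\<Psi> + \<Theta> \<in> vcar (hom_space H)" by (simp add: hom_space_def hom_iff_eval)
next
  interpret M: vector_space "vscale (MA H)" by (rule is_vspaceD[OF is_vspace_MA])
  note B = is_vspaceD[OF is_vspace_base, unfolded base_simps]
  fix k \<Psi> assume P: "\<Psi> \<in> vcar (hom_space H)"
  have PL: "linear_on (spc H) (base H) \<Psi>" using P by (simp add: hom_space_def hom_iff)
  have "linear_on (spc H) (base H) (\<lambda>a. vscale (MA H) k (\<Psi> a))"
    using PL B(5) unfolding linear_on_def by (simp add: M.scale_right_distrib M.scale_left_commute)
  moreover have "e1 c (fst (vscale (MA H) k (\<Psi> a)) b) \<beta> = t1 a b (\<lambda>x y. \<beta> (fst (vscale (MA H) k (\<Psi> x)) c) y)"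
    if b: "bl \<beta>" for a b c \<beta>
  proof -
    have "lf (\<lambda>d. e1 c d \<beta>)" by (intro lin)
    then have "e1 c (smult H k d) \<beta> = k * e1 c d \<beta>" for d by (simp add: linear_on_def)
    moreover have "\<beta> (smult H k x) y = k * \<beta> x y" for x y using b by (simp add: bilinear_on_def linear_on_def)
    moreover have "bl (\<lambda>x y. \<beta> (fst (\<Psi> x) c) y)"
      by (rule bilinear_comp[OF PL le_id base_form[OF b]])
    ultimately show ?thesis
      using P b eval_times(1)[OF structure_in(3), of "\<lambda>x y. \<beta> (fst (\<Psi> x) c) y" a b k]
      by (simp add: hom_space_def hom_iff_eval MA_scale)
  qed
  ultimately show "vscale (hom_space H) k \<Psi> \<in> vcar (hom_space H)" by (simp add: hom_space_def hom_iff_eval)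
qed

lemma SL_linear:
  assumes \<phi>: "lf \<phi>"
  shows "lf \<psi> \<Longrightarrow> t \<in> AA \<Longrightarrow> SL (\<lambda>x. \<phi> x + \<psi> x) t = SL \<phi> t + SL \<psi> t"
    and "t \<in> AA \<Longrightarrow> SL (\<lambda>x. k * \<phi> x) t = smult H k (SL \<phi> t)"
proof -
  show "SL (\<lambda>x. \<phi> x + \<psi> x) t = SL \<phi> t + SL \<psi> t" if \<psi>: "lf \<psi>" and t: "t \<in> AA"
  proof (rule A_eqI)
    fix \<chi> assume c: "lf \<chi>"
    show "\<chi> (SL (\<lambda>x. \<phi> x + \<psi> x) t) = \<chi> (SL \<phi> t + SL \<psi> t)"
      using eval_add[OF is_vspaceA t product_bilinear[OF \<phi> c] product_bilinear[OF \<psi> c]] linear_onD(2)[OF c]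
      by (simp add: SL_eval[OF lf_add[OF \<phi> \<psi>] t c] SL_eval[OF \<phi> t c] SL_eval[OF \<psi> t c] distrib_right)
  qed
  show "SL (\<lambda>x. k * \<phi> x) t = smult H k (SL \<phi> t)" if t: "t \<in> AA"
  proof (rule A_eqI)
    fix \<chi> assume c: "lf \<chi>"
    show "\<chi> (SL (\<lambda>x. k * \<phi> x) t) = \<chi> (smult H k (SL \<phi> t))"
      using eval_scale[OF is_vspaceA t product_bilinear[OF \<phi> c], of k] linear_onD(3)[OF c]
      by (simp add: SL_eval[OF lf_mult_left[OF \<phi>] t c] SL_eval[OF \<phi> t c] mult.assoc)
  qed
qed

lemma is_vspace_integral_space: "is_vspace (integral_space H)"
proof (rule is_vspaceI)
  note B = is_vspaceD[OF is_vspace_base, unfolded base_simps]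
  show "vector_space (vscale (integral_space H))"
    by unfold_locales (auto simp: integral_space_def fun_eq_iff algebra_simps)
  have SL0: "SL (\<lambda>x. 0) t = 0" if "t \<in> AA" for t
    using SL_linear(2)[OF lf_0 that, of 0] by simp
  have "lf 0" using lf_0 by (simp add: zero_fun_def)
  moreover have "SL 0 (t1 a b) = 0" for a b using SL0[of "t1 a b"] by (simp add: zero_fun_def)
  moreover have "\<exists>r\<in>range (capR H). \<forall>b. fst r b = 0" by (rule bexI[OF _ B(2)]) simp
  ultimately show "0 \<in> vcar (integral_space H)" by (simp add: integral_space_def integral_iff)
  fix \<phi> \<psi> k assume p: "\<phi> \<in> vcar (integral_space H)" and q: "\<psi> \<in> vcar (integral_space H)"
  then have l: "lf \<phi>" "lf \<psi>" by (simp_all add: integral_space_def integral_iff)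
  have p': "\<And>a. \<exists>r\<in>range (capR H). \<forall>b. fst r b = SL \<phi> (t1 a b)"
    and q': "\<And>a. \<exists>r\<in>range (capR H). \<forall>b. fst r b = SL \<psi> (t1 a b)"
    using p q by (simp_all add: integral_space_def integral_iff)
  have pq: "\<phi> + \<psi> = (\<lambda>x. \<phi> x + \<psi> x)" by (simp add: fun_eq_iff)
  have "\<exists>r\<in>range (capR H). \<forall>b. fst r b = SL (\<phi> + \<psi>) (t1 a b)" for a
  proof -
    obtain r where r: "r \<in> range (capR H)" "\<forall>b. fst r b = SL \<phi> (t1 a b)" using p'[of a] by (elim bexE)
    obtain s where s: "s \<in> range (capR H)" "\<forall>b. fst s b = SL \<psi> (t1 a b)" using q'[of a] by (elim bexE)
    show ?thesis
      by (rule bexI[OF _ B(3)[OF r(1) s(1)]]) (simp add: r(2) s(2) pq SL_linear(1)[OF l structure_in(3)])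
  qed
  then show "\<phi> + \<psi> \<in> vcar (integral_space H)"
    using l by (simp add: integral_space_def integral_iff pq lf_add)
next
  note B = is_vspaceD[OF is_vspace_base, unfolded base_simps]
  fix k \<phi> assume p: "\<phi> \<in> vcar (integral_space H)"
  then have l: "lf \<phi>" by (simp add: integral_space_def integral_iff)
  have l': "lf (\<lambda>x. k * \<phi> x)" using l by (simp add: lin)
  have p': "\<And>a. \<exists>r\<in>range (capR H). \<forall>b. fst r b = SL \<phi> (t1 a b)"
    using p by (simp add: integral_space_def integral_iff)
  have "\<exists>r\<in>range (capR H). \<forall>b. fst r b = SL (\<lambda>x. k * \<phi> x) (t1 a b)" for a
  proof -
    obtain r where r: "r \<in> range (capR H)" "\<forall>b. fst r b = SL \<phi> (t1 a b)" using p'[of a] by (elim bexE)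
    show ?thesis
      by (intro bexI[OF _ B(5)[OF r(1), of k]]) (simp add: r(2) MA_scale SL_linear(2)[OF l structure_in(3)])
  qed
  then show "vscale (integral_space H) k \<phi> \<in> vcar (integral_space H)"
    using l' by (simp add: integral_space_def integral_iff)
qed

end

theorem theorem3p6:
  fixes H :: "('k::field, 'a::ab_group_add) wmb"
  assumes "regular_weak_multiplier_bialgebra H"
    and "right_full H"
  shows "inverse_isomorphisms (hom_space H) (integral_space H)
           (\<lambda>\<Psi>. base_counit H \<circ> \<Psi>)
           (\<lambda>\<psi> a. slice_left (spc H) (base H) \<psi> (aF H a))"
proof -
  interpret right_full_wmb H
    using assms by (simp add: right_full_wmb_def right_full_wmb_axioms_def)
  let ?g = "\<lambda>\<psi> a. slice_left (spc H) (base H) \<psi> (aF H a)"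
  have g: "?g \<psi> = base_slice \<psi>" for \<psi> by (simp add: base_slice_def fun_eq_iff)
  note B = is_vspaceD[OF is_vspace_base, unfolded base_simps]
  have hom_lin: "linear_on (spc H) (base H) \<Psi>" if "\<Psi> \<in> vcar (hom_space H)" for \<Psi>
    using that by (simp add: hom_space_def hom_iff)
  have int_lin: "lf \<psi>" if "\<psi> \<in> vcar (integral_space H)" for \<psi>
    using that by (simp add: integral_space_def integral_iff)
  have "linear_on (hom_space H) (integral_space H) (\<lambda>\<Psi>. base_counit H \<circ> \<Psi>)"
    unfolding linear_on_def
  proof (intro conjI ballI allI)
    fix \<Psi> assume P: "\<Psi> \<in> vcar (hom_space H)"
    have Pa: "\<Psi> a \<in> vcar (base H)" for a using linear_onD(1)[OF hom_lin[OF P]] by simp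
    show "base_counit H \<circ> \<Psi> \<in> vcar (integral_space H)"
      using hom_integral(2) P by (simp add: hom_space_def integral_space_def)
    show "base_counit H \<circ> vscale (hom_space H) c \<Psi> = vscale (integral_space H) c (base_counit H \<circ> \<Psi>)" for c
      using linear_onD(3)[OF base_counit_linear Pa] by (simp add: hom_space_def integral_space_def fun_eq_iff)
    fix \<Theta> assume Q: "\<Theta> \<in> vcar (hom_space H)"
    have Qa: "\<Theta> a \<in> vcar (base H)" for a using linear_onD(1)[OF hom_lin[OF Q]] by simp
    show "base_counit H \<circ> (\<Psi> + \<Theta>) = (base_counit H \<circ> \<Psi>) + (base_counit H \<circ> \<Theta>)"
      using linear_onD(2)[OF base_counit_linear Pa Qa] by (simp add: fun_eq_iff)
  qed
  moreover have "linear_on (integral_space H) (hom_space H) ?g"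
    unfolding g linear_on_def
  proof (intro conjI ballI allI)
    fix \<psi> assume p: "\<psi> \<in> vcar (integral_space H)"
    note l = int_lin[OF p]
    show "base_slice \<psi> \<in> vcar (hom_space H)"
      using integral_hom p by (simp add: hom_space_def integral_space_def)
    show "base_slice (vscale (integral_space H) c \<psi>) = vscale (hom_space H) c (base_slice \<psi>)" for c
    proof
      fix a
      have l': "lf (\<lambda>x. c * \<psi> x)" using l by (simp add: lin)
      have "base_slice (\<lambda>x. c * \<psi> x) a = vscale (MA H) c (base_slice \<psi> a)"
        by (rule base_eqI[OF base_slice(1)[OF l'] B(5)[OF base_slice(1)[OF l]]])
          (use linear_onD(3)[OF lf_eps[OF le_id]] in \<open>simp add: base_slice(2) l l' MA_scale\<close>)
      then show "base_slice (vscale (integral_space H) c \<psi>) a = vscale (hom_space H) c (base_slice \<psi>) a"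
        by (simp add: integral_space_def hom_space_def)
    qed
    fix \<phi> assume q: "\<phi> \<in> vcar (integral_space H)"
    note l2 = int_lin[OF q]
    show "base_slice (\<psi> + \<phi>) = base_slice \<psi> + base_slice \<phi>"
    proof
      fix a
      have l': "lf (\<psi> + \<phi>)" using lf_add[OF l l2] by (simp add: plus_fun_def)
      have "base_slice (\<psi> + \<phi>) a = base_slice \<psi> a + base_slice \<phi> a"
        by (rule base_eqI[OF base_slice(1)[OF l'] B(3)[OF base_slice(1)[OF l] base_slice(1)[OF l2]]])
          (use linear_onD(2)[OF lf_eps[OF le_id]] in \<open>simp add: base_slice(2) l l2 l'\<close>)
      then show "base_slice (\<psi> + \<phi>) a = (base_slice \<psi> + base_slice \<phi>) a" by simp
    qed
  qed
  moreover have "?g (base_counit H \<circ> \<Psi>) = \<Psi>" if P: "\<Psi> \<in> vcar (hom_space H)" for \<Psi>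
  proof
    fix a
    have h: "\<Psi> \<in> comodule_homs H (regular_comod H) (base_comod H)" using P by (simp add: hom_space_def)
    have "lf (base_counit H \<circ> \<Psi>)" using hom_integral(2)[OF h] by (simp add: integral_iff)
    moreover have "\<Psi> a \<in> range (capR H)" using linear_onD(1)[OF hom_lin[OF P]] by simp
    ultimately have "base_slice (base_counit H \<circ> \<Psi>) a = \<Psi> a"
      by (rule base_slice_eqI) (rule hom_integral(1)[OF h])
    then show "?g (base_counit H \<circ> \<Psi>) a = \<Psi> a" by (simp add: base_slice_def)
  qed
  moreover have "base_counit H \<circ> ?g \<psi> = \<psi>" if "\<psi> \<in> vcar (integral_space H)" for \<psi>
    using base_counit_slice[OF int_lin[OF that]] by (simp add: g fun_eq_iff)
  ultimately show ?thesis
    unfolding inverse_isomorphisms_def using is_vspace_hom_space is_vspace_integral_space by blast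
qed

end
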